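(* Fix an aggregate signature $\Sigma$, a set $\Pi$ of defined predicate symbols and a $\Sigma(\Pi)$-aggregate program $P$. Let $\mathcal C$ be the class of two-valued structures for $\Sigma$ without its aggregate symbols in which every sort has a finite domain, and let $X$ be a function assigning to each $\mathcal D_o\in\mathcal C$ a three-valued $\Sigma$-structure $X(\mathcal D_o)$ extending $\mathcal D_o$ by interpreting each aggregate symbol by a three-valued aggregate relation. Assume that for every aggregate symbol $\mathsf R$ there are Turing machines that, given (encodings of) $\mathcal D_o\in\mathcal C$, a well-typed three-valued set $\tilde S$ and a domain element $d$, compute $(\mathsf R^{X(\mathcal D_o)})^1(\tilde S,d)$ and $(\mathsf R^{X(\mathcal D_o)})^2(\tilde S,d)$ in time polynomial in the size of the domain of $\mathcal D_o$ (the total number of elements of all its sort domains). Then, with $P,\Sigma,\Pi,X$ fixed and $\mathcal D_o$ ranging over $\mathcal C$: (i) deciding whether an atom is true in the Kripke–Kleene fixpoint of $\Phi_{P,X(\mathcal D_o)}$ is in P; (ii) deciding whether an atom is true in the well-founded fixpoint of $\Phi_{P,X(\mathcal D_o)}$ is in P; (iii) deciding whether $\Phi_{P,X(\mathcal D_o)}$ has an exact stable fixpoint is in NP.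
   Context: An aggregate signature $\Sigma$ has sorts, sorted function symbols, predicate symbols and aggregate symbols $\mathsf R:\{s_1\times\dots\times s_n\}\times w$. Set expressions $\{(x_1,\dots,x_n)\mid\varphi\}$, aggregate atoms $\mathsf R(s,t)$ and aggregate formulas (atoms, aggregate atoms, closed under $\neg,\wedge,\vee,\forall,\exists$) are defined simultaneously. Programs: $\Pi$ is a set of predicate symbols not in $\Sigma$; a rule is $A\leftarrow\varphi$ with $A$ a $\Pi$-atom and $\varphi$ a $\Sigma(\Pi)$-aggregate formula; a program is a set of rules. For a structure $\mathcal D_o$, $base(\Pi)$ is the set of ground $\Pi$-atoms over its domain elements, interpretations are subsets of it, and $inst(P)$ is the set of ground instances of the rules (domain elements for free variables, head terms evaluated). Three-valued notions: $\mathbf{THREE}=\{(\mathbf f,\mathbf f),(\mathbf f,\mathbf t),(\mathbf t,\mathbf t)\}$ (false, unknown, true), truth order componentwise with meet $\wedge$ and join $\vee$, $\neg(x,y)=(\neg y,\neg x)$, precision order $(x,y)\le_p(x',y')$ iff $x\le x'$, $y'\le y$. A three-valued set over $D$ is $(S_1,S_2)$ with $S_1\subseteq S_2\subseteq D$, ordered by $(S_1,S_2)\le_p(S_1',S_2')$ iff $S_1\subseteq S_1'$, $S_2'\subseteq S_2$. A three-valued aggregate relation is $\mathcal R:\mathcal P(D_1)^c\times D_2\to\mathbf{THREE}$, $\le_p$-monotone in the set argument and two-valued on exact sets $(S,S)$; $\mathcal R^1,\mathcal R^2$ are its two components. A three-valued interpretation is $(I_1,I_2)$ with $I_1\subseteq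 I_2$ (atom $A$ gets value $(A\in I_1,A\in I_2)$). Formula values are computed inductively: predicates of $\Sigma$ two-valued as in $\mathcal D_o$, defined atoms from $(I_1,I_2)$, connectives in $\mathbf{THREE}$, quantifiers as join/meet over the domain, a set expression $\{\bar x\mid\psi\}$ evaluates to $(S_1,S_2)$ with $S_1$ the tuples where $\psi(\bar d)$ is true and $S_2$ those where it is not false, and $\mathsf R(s,t)$ to $\mathsf R^{X(\mathcal D_o)}$ of the values. $\Phi_{P,X(\mathcal D_o)}(I_1,I_2)$ gives each ground atom $A$ the join of the values of the bodies of ground rules with head $A$ (false if none). Kripke–Kleene fixpoint: the $\le_p$-least fixpoint (with $(I_1,I_2)\le_p(J_1,J_2)$ iff $I_1\subseteq J_1$, $J_2\subseteq I_2$). For an operator $A$ with components $A^1,A^2$: $A^\downarrow(b)=\mathrm{glb}\{x\subseteq b\mid A^1(x,b)\subseteq x\}$, $A^\uparrow(a)=\mathrm{glb}\{x\supseteq a\mid A^2(a,x)\subseteq x\}$, $\mathcal S_A(a,b)=(A^\downarrow(b),A^\uparrow(a))$; the well-founded fixpoint is the $\le_p$-least fixpoint of $\mathcal S_A$ on pairs $(a,b)$ with $(a,b)\le_p A(a,b)$ and $a\subseteq A^\downarrow(b)$; an exact stable fixpoint is an $I$ with $\mathcal S_A(I,I)=(I,I)$.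
   Formalization: The signature Σ, the set Π and the program P are taken to be finite; for an infinite fixed program the claim fails (e.g. rules testing the size of the domain against a non-recursive set), and for an infinite signature structures have no finite encoding. *)

theory Defs
  imports
    "HOL-Library.Product_Order"
    "HOL-Computational_Algebra.Polynomial"
begin

section \<open>Turing machines and the classes P and NP\<close>

text \<open>
  Deterministic multi-tape machines. States and tape symbols are initial segments of the naturals.
  State 0 is initial, states 1 and 2 are the halting states accept and reject.
  Symbol 0 is the blank, symbols 1 and 2 represent the input bits.
\<close>

datatype move = MoveLeft | Stay | MoveRight

record tm =
  tm_tapes :: nat
  tm_states :: nat
  tm_symbols :: nat
  tm_delta :: "nat \<Rightarrow> nat list \<Rightarrow> nat \<times> (nat \<times> move) list"

definition wf_tm :: "tm \<Rightarrow> bool" where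
  "wf_tm M \<longleftrightarrow> tm_tapes M \<ge> 1 \<and> tm_states M \<ge> 3 \<and> tm_symbols M \<ge> 3 \<and>
    (\<forall>q ss. q < tm_states M \<and> length ss = tm_tapes M \<and> set ss \<subseteq> {..<tm_symbols M} \<longrightarrow>
       (case tm_delta M q ss of (q', acts) \<Rightarrow>
          q' < tm_states M \<and> length acts = tm_tapes M \<and>
          (\<forall>(a, m) \<in> set acts. a < tm_symbols M)))"

text \<open>A two-way infinite tape, indexed relative to the head, which is always at position 0.\<close>

type_synonym tape = "int \<Rightarrow> nat"

type_synonym config = "nat \<times> tape list"

fun offset :: "move \<Rightarrow> int" where
  "offset MoveLeft = -1"
| "offset Stay = 0"
| "offset MoveRight = 1"

fun act :: "nat \<times> move \<Rightarrow> tape \<Rightarrow> tape" where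
  "act (a, m) t = (\<lambda>i. (t(0 := a)) (i + offset m))"

fun tm_step :: "tm \<Rightarrow> config \<Rightarrow> config" where
  "tm_step M (q, ts) =
     (if q = 1 \<or> q = 2 then (q, ts)
      else (case tm_delta M q (map (\<lambda>t. t 0) ts) of (q', acts) \<Rightarrow> (q', map2 act acts ts)))"

definition input_tape :: "bool list \<Rightarrow> tape" where
  "input_tape w = (\<lambda>i. if 0 \<le> i \<and> i < int (length w) then (if w ! nat i then 2 else 1) else 0)"

definition tm_init :: "tm \<Rightarrow> bool list \<Rightarrow> config" where
  "tm_init M w = (0, input_tape w # replicate (tm_tapes M - 1) (\<lambda>_. 0))"

definition tm_answers :: "tm \<Rightarrow> bool list \<Rightarrow> nat \<Rightarrow> bool \<Rightarrow> bool" where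
  "tm_answers M w T b \<longleftrightarrow>
     (\<exists>t \<le> T. fst ((tm_step M ^^ t) (tm_init M w)) = (if b then 1 else 2))"

definition PTIME :: "bool list set set" where
  "PTIME = {L. \<exists>M (p :: nat poly). wf_tm M \<and>
              (\<forall>w. tm_answers M w (poly p (length w)) (w \<in> L))}"

definition pair_code :: "bool list \<Rightarrow> bool list \<Rightarrow> bool list" where
  "pair_code w u = concat (map (\<lambda>b. [True, b]) w) @ [False] @ u"

text \<open>NP by polynomial-time verifiers with certificates of polynomial length.\<close>

definition NPTIME :: "bool list set set" where
  "NPTIME = {L. \<exists>V \<in> PTIME. \<exists>p :: nat poly.
               \<forall>w. w \<in> L \<longleftrightarrow> (\<exists>u. length u \<le> poly p (length w) \<and> pair_code w u \<in> V)}"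


section \<open>Three-valued notions\<close>

text \<open>
  Truth values, three-valued sets and three-valued interpretations are pairs (certain, possible).
  The truth order with its meets and joins is the componentwise order of
  \<^theory>\<open>HOL-Library.Product_Order\<close>.
\<close>

definition THREE :: "(bool \<times> bool) set" where
  "THREE = {(False, False), (False, True), (True, True)}"

fun neg3 :: "bool \<times> bool \<Rightarrow> bool \<times> bool" where
  "neg3 (x, y) = (\<not> y, \<not> x)"

definition le_p :: "'b::ord \<times> 'b \<Rightarrow> 'b \<times> 'b \<Rightarrow> bool" (infix \<open>\<le>\<^sub>p\<close> 50) where
  "v \<le>\<^sub>p w \<longleftrightarrow> fst v \<le> fst w \<and> snd w \<le> snd v"

definition tv_sets :: "'b set \<Rightarrow> ('b set \<times> 'b set) set" where
  "tv_sets D = {(S1, S2). S1 \<subseteq> S2 \<and> S2 \<subseteq> D}"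

definition tv_aggregate_relation ::
  "'b set \<Rightarrow> 'c set \<Rightarrow> ('b set \<times> 'b set \<Rightarrow> 'c \<Rightarrow> bool \<times> bool) \<Rightarrow> bool" where
  "tv_aggregate_relation D1 D2 R \<longleftrightarrow>
     (\<forall>S \<in> tv_sets D1. \<forall>d \<in> D2. R S d \<in> THREE) \<and>
     (\<forall>S \<in> tv_sets D1. \<forall>S' \<in> tv_sets D1. \<forall>d \<in> D2. S \<le>\<^sub>p S' \<longrightarrow> R S d \<le>\<^sub>p R S' d) \<and>
     (\<forall>S \<subseteq> D1. \<forall>d \<in> D2. fst (R (S, S) d) = snd (R (S, S) d))"


section \<open>Aggregate signatures, formulas and programs\<close>

text \<open>
  The symbols of a signature are listed, which fixes the order in which their interpretations
  occur in the encoding of a structure. The sorts of the arguments of a predicate symbol are also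
  given for symbols outside the signature, as these may serve as defined predicates.
\<close>

record ('s, 'f, 'p, 'r) signature =
  sorts :: "'s list"
  funs :: "'f list"
  preds :: "'p list"
  aggs :: "'r list"
  fun_args :: "'f \<Rightarrow> 's list"
  fun_res :: "'f \<Rightarrow> 's"
  pred_args :: "'p \<Rightarrow> 's list"
  agg_args :: "'r \<Rightarrow> 's list"
  agg_res :: "'r \<Rightarrow> 's"

definition wf_signature :: "('s, 'f, 'p, 'r) signature \<Rightarrow> bool" where
  "wf_signature sg \<longleftrightarrow>
     distinct (sorts sg) \<and> distinct (funs sg) \<and> distinct (preds sg) \<and> distinct (aggs sg) \<and>
     (\<forall>f \<in> set (funs sg). set (fun_args sg f) \<subseteq> set (sorts sg) \<and> fun_res sg f \<in> set (sorts sg)) \<and>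
     (\<forall>p \<in> set (preds sg). set (pred_args sg p) \<subseteq> set (sorts sg)) \<and>
     (\<forall>r \<in> set (aggs sg). set (agg_args sg r) \<subseteq> set (sorts sg) \<and> agg_res sg r \<in> set (sorts sg))"

definition wf_defined :: "('s, 'f, 'p, 'r) signature \<Rightarrow> 'p list \<Rightarrow> bool" where
  "wf_defined sg Pd \<longleftrightarrow>
     distinct Pd \<and> set Pd \<inter> set (preds sg) = {} \<and>
     (\<forall>p \<in> set Pd. set (pred_args sg p) \<subseteq> set (sorts sg))"

definition sig_with :: "('s, 'f, 'p, 'r) signature \<Rightarrow> 'p list \<Rightarrow> ('s, 'f, 'p, 'r) signature" where
  "sig_with sg Pd = sg\<lparr>preds := preds sg @ Pd\<rparr>"

text \<open>A variable consists of a name and its sort.\<close>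

type_synonym 's var = "nat \<times> 's"

datatype ('s, 'f) trm = Var "'s var" | Fn 'f "('s, 'f) trm list"

datatype ('s, 'f, 'p, 'r) fm =
    Atom 'p "('s, 'f) trm list"
  | AggAtom 'r "('s, 'f, 'p, 'r) setexp" "('s, 'f) trm"
  | Neg "('s, 'f, 'p, 'r) fm"
  | Conj "('s, 'f, 'p, 'r) fm" "('s, 'f, 'p, 'r) fm"
  | Disj "('s, 'f, 'p, 'r) fm" "('s, 'f, 'p, 'r) fm"
  | Forall "'s var" "('s, 'f, 'p, 'r) fm"
  | Exists "'s var" "('s, 'f, 'p, 'r) fm"
and ('s, 'f, 'p, 'r) setexp = SetExp "'s var list" "('s, 'f, 'p, 'r) fm"

fun sort_of :: "('s, 'f, 'p, 'r) signature \<Rightarrow> ('s, 'f) trm \<Rightarrow> 's" where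
  "sort_of sg (Var x) = snd x"
| "sort_of sg (Fn f ts) = fun_res sg f"

fun wf_trm :: "('s, 'f, 'p, 'r) signature \<Rightarrow> ('s, 'f) trm \<Rightarrow> bool" where
  "wf_trm sg (Var x) \<longleftrightarrow> snd x \<in> set (sorts sg)"
| "wf_trm sg (Fn f ts) \<longleftrightarrow>
     f \<in> set (funs sg) \<and> (\<forall>t \<in> set ts. wf_trm sg t) \<and> map (sort_of sg) ts = fun_args sg f"

primrec wf_fm :: "('s, 'f, 'p, 'r) signature \<Rightarrow> ('s, 'f, 'p, 'r) fm \<Rightarrow> bool"
  and wf_setexp :: "('s, 'f, 'p, 'r) signature \<Rightarrow> ('s, 'f, 'p, 'r) setexp \<Rightarrow> 's list \<Rightarrow> bool" where
  "wf_fm sg (Atom p ts) \<longleftrightarrow>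
     p \<in> set (preds sg) \<and> (\<forall>t \<in> set ts. wf_trm sg t) \<and> map (sort_of sg) ts = pred_args sg p"
| "wf_fm sg (AggAtom r e t) \<longleftrightarrow>
     r \<in> set (aggs sg) \<and> wf_setexp sg e (agg_args sg r) \<and> wf_trm sg t \<and> sort_of sg t = agg_res sg r"
| "wf_fm sg (Neg \<phi>) \<longleftrightarrow> wf_fm sg \<phi>"
| "wf_fm sg (Conj \<phi> \<psi>) \<longleftrightarrow> wf_fm sg \<phi> \<and> wf_fm sg \<psi>"
| "wf_fm sg (Disj \<phi> \<psi>) \<longleftrightarrow> wf_fm sg \<phi> \<and> wf_fm sg \<psi>"
| "wf_fm sg (Forall x \<phi>) \<longleftrightarrow> snd x \<in> set (sorts sg) \<and> wf_fm sg \<phi>"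
| "wf_fm sg (Exists x \<phi>) \<longleftrightarrow> snd x \<in> set (sorts sg) \<and> wf_fm sg \<phi>"
| "wf_setexp sg (SetExp xs \<phi>) ss \<longleftrightarrow> distinct xs \<and> map snd xs = ss \<and> wf_fm sg \<phi>"

fun fv_trm :: "('s, 'f) trm \<Rightarrow> 's var set" where
  "fv_trm (Var x) = {x}"
| "fv_trm (Fn f ts) = (\<Union>t \<in> set ts. fv_trm t)"

primrec fv_fm :: "('s, 'f, 'p, 'r) fm \<Rightarrow> 's var set"
  and fv_setexp :: "('s, 'f, 'p, 'r) setexp \<Rightarrow> 's var set" where
  "fv_fm (Atom p ts) = (\<Union>t \<in> set ts. fv_trm t)"
| "fv_fm (AggAtom r e t) = fv_setexp e \<union> fv_trm t"
| "fv_fm (Neg \<phi>) = fv_fm \<phi>"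
| "fv_fm (Conj \<phi> \<psi>) = fv_fm \<phi> \<union> fv_fm \<psi>"
| "fv_fm (Disj \<phi> \<psi>) = fv_fm \<phi> \<union> fv_fm \<psi>"
| "fv_fm (Forall x \<phi>) = fv_fm \<phi> - {x}"
| "fv_fm (Exists x \<phi>) = fv_fm \<phi> - {x}"
| "fv_setexp (SetExp xs \<phi>) = fv_fm \<phi> - set xs"

record ('s, 'f, 'p, 'r) rl =
  head_pred :: 'p
  head_args :: "('s, 'f) trm list"
  body :: "('s, 'f, 'p, 'r) fm"

definition wf_rule :: "('s, 'f, 'p, 'r) signature \<Rightarrow> 'p list \<Rightarrow> ('s, 'f, 'p, 'r) rl \<Rightarrow> bool" where
  "wf_rule sg Pd \<rho> \<longleftrightarrow>
     head_pred \<rho> \<in> set Pd \<and> wf_fm (sig_with sg Pd) (Atom (head_pred \<rho>) (head_args \<rho>)) \<and>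
     wf_fm (sig_with sg Pd) (body \<rho>)"

definition fv_rule :: "('s, 'f, 'p, 'r) rl \<Rightarrow> 's var set" where
  "fv_rule \<rho> = (\<Union>t \<in> set (head_args \<rho>). fv_trm t) \<union> fv_fm (body \<rho>)"


section \<open>Structures\<close>

record ('s, 'f, 'p, 'e) struct =
  sdom :: "'s \<Rightarrow> 'e set"
  fun_int :: "'f \<Rightarrow> 'e list \<Rightarrow> 'e"
  pred_int :: "'p \<Rightarrow> 'e list \<Rightarrow> bool"

record ('s, 'f, 'p, 'e, 'r) struct3 = "('s, 'f, 'p, 'e) struct" +
  agg_int :: "'r \<Rightarrow> 'e list set \<times> 'e list set \<Rightarrow> 'e \<Rightarrow> bool \<times> bool"

definition tuples :: "('s, 'f, 'p, 'e, 'z) struct_scheme \<Rightarrow> 's list \<Rightarrow> 'e list set" where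
  "tuples D ss = listset (map (sdom D) ss)"

definition finite_structures ::
  "('s, 'f, 'p, 'r) signature \<Rightarrow> ('s, 'f, 'p, 'e) struct set" where
  "finite_structures sg =
     {D. (\<forall>s \<in> set (sorts sg). finite (sdom D s)) \<and>
         (\<forall>f \<in> set (funs sg). \<forall>ds \<in> tuples D (fun_args sg f). fun_int D f ds \<in> sdom D (fun_res sg f))}"

definition tv_extension ::
  "('s, 'f, 'p, 'r) signature \<Rightarrow> ('s, 'f, 'p, 'e) struct \<Rightarrow> ('s, 'f, 'p, 'e, 'r) struct3 \<Rightarrow> bool" where
  "tv_extension sg D E \<longleftrightarrow>
     struct.truncate E = D \<and>
     (\<forall>r \<in> set (aggs sg).
        tv_aggregate_relation (tuples E (agg_args sg r)) (sdom E (agg_res sg r)) (agg_int E r))"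

definition dom_size :: "('s, 'f, 'p, 'r) signature \<Rightarrow> ('s, 'f, 'p, 'e) struct \<Rightarrow> nat" where
  "dom_size sg D = (\<Sum>s \<in> set (sorts sg). card (sdom D s))"


section \<open>Three-valued semantics\<close>

type_synonym ('p, 'e) gatom = "'p \<times> 'e list"

type_synonym ('p, 'e) interp3 = "('p, 'e) gatom set \<times> ('p, 'e) gatom set"

fun eval_trm :: "('s, 'f, 'p, 'e, 'z) struct_scheme \<Rightarrow> ('s var \<Rightarrow> 'e) \<Rightarrow> ('s, 'f) trm \<Rightarrow> 'e" where
  "eval_trm D \<sigma> (Var x) = \<sigma> x"
| "eval_trm D \<sigma> (Fn f ts) = fun_int D f (map (eval_trm D \<sigma>) ts)"

definition assign :: "('s var \<Rightarrow> 'e) \<Rightarrow> 's var list \<Rightarrow> 'e list \<Rightarrow> 's var \<Rightarrow> 'e" where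
  "assign \<sigma> xs ds = (\<lambda>x. case map_of (zip xs ds) x of None \<Rightarrow> \<sigma> x | Some d \<Rightarrow> d)"

primrec val_fm :: "('s, 'f, 'p, 'e, 'r) struct3 \<Rightarrow> 'p list \<Rightarrow> ('p, 'e) interp3 \<Rightarrow>
    ('s, 'f, 'p, 'r) fm \<Rightarrow> ('s var \<Rightarrow> 'e) \<Rightarrow> bool \<times> bool"
  and val_setexp :: "('s, 'f, 'p, 'e, 'r) struct3 \<Rightarrow> 'p list \<Rightarrow> ('p, 'e) interp3 \<Rightarrow>
    ('s, 'f, 'p, 'r) setexp \<Rightarrow> ('s var \<Rightarrow> 'e) \<Rightarrow> 'e list set \<times> 'e list set" where
  "val_fm E Pd I (Atom p ts) = (\<lambda>\<sigma>. let ds = map (eval_trm E \<sigma>) ts in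
     if p \<in> set Pd then ((p, ds) \<in> fst I, (p, ds) \<in> snd I) else (pred_int E p ds, pred_int E p ds))"
| "val_fm E Pd I (AggAtom r e t) =
     (\<lambda>\<sigma>. agg_int E r (val_setexp E Pd I e \<sigma>) (eval_trm E \<sigma> t))"
| "val_fm E Pd I (Neg \<phi>) = (\<lambda>\<sigma>. neg3 (val_fm E Pd I \<phi> \<sigma>))"
| "val_fm E Pd I (Conj \<phi> \<psi>) = (\<lambda>\<sigma>. inf (val_fm E Pd I \<phi> \<sigma>) (val_fm E Pd I \<psi> \<sigma>))"
| "val_fm E Pd I (Disj \<phi> \<psi>) = (\<lambda>\<sigma>. sup (val_fm E Pd I \<phi> \<sigma>) (val_fm E Pd I \<psi> \<sigma>))"
| "val_fm E Pd I (Forall x \<phi>) = (\<lambda>\<sigma>. INF d \<in> sdom E (snd x). val_fm E Pd I \<phi> (\<sigma>(x := d)))"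
| "val_fm E Pd I (Exists x \<phi>) = (\<lambda>\<sigma>. SUP d \<in> sdom E (snd x). val_fm E Pd I \<phi> (\<sigma>(x := d)))"
| "val_setexp E Pd I (SetExp xs \<phi>) = (\<lambda>\<sigma>.
     ({ds \<in> tuples E (map snd xs). val_fm E Pd I \<phi> (assign \<sigma> xs ds) = (True, True)},
      {ds \<in> tuples E (map snd xs). val_fm E Pd I \<phi> (assign \<sigma> xs ds) \<noteq> (False, False)}))"

definition base :: "('s, 'f, 'p, 'r) signature \<Rightarrow> 'p list \<Rightarrow> ('s, 'f, 'p, 'e, 'z) struct_scheme \<Rightarrow>
    ('p, 'e) gatom set" where
  "base sg Pd D = {(p, ds). p \<in> set Pd \<and> ds \<in> tuples D (pred_args sg p)}"

text \<open>
  A ground instance is represented by its head, an atom over domain elements, and its body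
  together with the assignment of domain elements to the free variables.
\<close>

definition inst :: "('s, 'f, 'p, 'r) rl set \<Rightarrow> ('s, 'f, 'p, 'e, 'z) struct_scheme \<Rightarrow>
    (('p, 'e) gatom \<times> ('s, 'f, 'p, 'r) fm \<times> ('s var \<Rightarrow> 'e)) set" where
  "inst P D = {((head_pred \<rho>, map (eval_trm D \<sigma>) (head_args \<rho>)), body \<rho>, \<sigma>) | \<rho> \<sigma>.
                 \<rho> \<in> P \<and> (\<forall>x \<in> fv_rule \<rho>. \<sigma> x \<in> sdom D (snd x))}"

definition consequence_op :: "('s, 'f, 'p, 'r) signature \<Rightarrow> 'p list \<Rightarrow> ('s, 'f, 'p, 'r) rl set \<Rightarrow>
    ('s, 'f, 'p, 'e, 'r) struct3 \<Rightarrow> ('p, 'e) interp3 \<Rightarrow> ('p, 'e) interp3" where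
  "consequence_op sg Pd P E I =
     (let v = (\<lambda>A. Sup {val_fm E Pd I \<phi> \<sigma> | \<phi> \<sigma>. (A, \<phi>, \<sigma>) \<in> inst P E})
      in ({A \<in> base sg Pd E. fst (v A)}, {A \<in> base sg Pd E. snd (v A)}))"


section \<open>Fixpoints of operators on three-valued interpretations\<close>

text \<open>Throughout, \<open>B\<close> is the set of all ground atoms, so the underlying lattice is \<open>Pow B\<close>.\<close>

definition least_p :: "('b::ord \<times> 'b) set \<Rightarrow> 'b \<times> 'b" where
  "least_p Q = (THE v. v \<in> Q \<and> (\<forall>w \<in> Q. v \<le>\<^sub>p w))"

definition glb :: "'a set \<Rightarrow> 'a set set \<Rightarrow> 'a set" where
  "glb B Q = B \<inter> \<Inter>Q"

definition kripke_kleene :: "'a set \<Rightarrow> ('a set \<times> 'a set \<Rightarrow> 'a set \<times> 'a set) \<Rightarrow> 'a set \<times> 'a set" where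
  "kripke_kleene B A = least_p {v \<in> tv_sets B. A v = v}"

definition op_down :: "'a set \<Rightarrow> ('a set \<times> 'a set \<Rightarrow> 'a set \<times> 'a set) \<Rightarrow> 'a set \<Rightarrow> 'a set" where
  "op_down B A b = glb B {x. x \<subseteq> b \<and> fst (A (x, b)) \<subseteq> x}"

definition op_up :: "'a set \<Rightarrow> ('a set \<times> 'a set \<Rightarrow> 'a set \<times> 'a set) \<Rightarrow> 'a set \<Rightarrow> 'a set" where
  "op_up B A a = glb B {x. a \<subseteq> x \<and> x \<subseteq> B \<and> snd (A (a, x)) \<subseteq> x}"

definition stable_op ::
  "'a set \<Rightarrow> ('a set \<times> 'a set \<Rightarrow> 'a set \<times> 'a set) \<Rightarrow> 'a set \<times> 'a set \<Rightarrow> 'a set \<times> 'a set" where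
  "stable_op B A v = (op_down B A (snd v), op_up B A (fst v))"

definition well_founded :: "'a set \<Rightarrow> ('a set \<times> 'a set \<Rightarrow> 'a set \<times> 'a set) \<Rightarrow> 'a set \<times> 'a set" where
  "well_founded B A =
     least_p {v \<in> tv_sets B. v \<le>\<^sub>p A v \<and> fst v \<subseteq> op_down B A (snd v) \<and> stable_op B A v = v}"

definition exact_stable :: "'a set \<Rightarrow> ('a set \<times> 'a set \<Rightarrow> 'a set \<times> 'a set) \<Rightarrow> 'a set \<Rightarrow> bool" where
  "exact_stable B A I \<longleftrightarrow> I \<subseteq> B \<and> stable_op B A (I, I) = (I, I)"


section \<open>Encodings\<close>

text \<open>
  Every object is first flattened to a list of naturals, which are then written in unary.
  A domain element is represented by its rank in the domain of its sort. The structure is given by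
  the cardinalities of its domains and the value tables of its functions and predicates, with
  tuples in lexicographic order; the length of the code is thus at least the size of the domain
  and, for a fixed signature, polynomial in it.
\<close>

definition unary_code :: "nat list \<Rightarrow> bool list" where
  "unary_code ns = concat (map (\<lambda>n. replicate n True @ [False]) ns)"

definition rank :: "('s, 'f, 'p, 'e::linorder) struct \<Rightarrow> 's \<Rightarrow> 'e \<Rightarrow> nat" where
  "rank D s d = card {x \<in> sdom D s. x < d}"

definition tuple_list :: "('s, 'f, 'p, 'e::linorder) struct \<Rightarrow> 's list \<Rightarrow> 'e list list" where
  "tuple_list D ss = product_lists (map (\<lambda>s. sorted_list_of_set (sdom D s)) ss)"

definition struct_nats ::
  "('s, 'f, 'p, 'r) signature \<Rightarrow> ('s, 'f, 'p, 'e::linorder) struct \<Rightarrow> nat list" where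
  "struct_nats sg D =
     map (\<lambda>s. card (sdom D s)) (sorts sg) @
     concat (map (\<lambda>f. map (\<lambda>ds. rank D (fun_res sg f) (fun_int D f ds)) (tuple_list D (fun_args sg f)))
       (funs sg)) @
     concat (map (\<lambda>p. map (\<lambda>ds. of_bool (pred_int D p ds)) (tuple_list D (pred_args sg p)))
       (preds sg))"

text \<open>The entries 0, 1, 2 mean that a tuple is outside the set, undetermined, inside the set.\<close>

definition tv_set_nats ::
  "('s, 'f, 'p, 'e::linorder) struct \<Rightarrow> 's list \<Rightarrow> 'e list set \<times> 'e list set \<Rightarrow> nat list" where
  "tv_set_nats D ss S =
     map (\<lambda>ds. of_bool (ds \<in> fst S) + of_bool (ds \<in> snd S)) (tuple_list D ss)"

definition gatom_nats :: "('s, 'f, 'p, 'r) signature \<Rightarrow> 'p list \<Rightarrow>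
    ('s, 'f, 'p, 'e::linorder) struct \<Rightarrow> ('p, 'e) gatom \<Rightarrow> nat list" where
  "gatom_nats sg Pd D A =
     length (takeWhile (\<lambda>p. p \<noteq> fst A) Pd) # map2 (rank D) (pred_args sg (fst A)) (snd A)"

definition struct_code ::
  "('s, 'f, 'p, 'r) signature \<Rightarrow> ('s, 'f, 'p, 'e::linorder) struct \<Rightarrow> bool list" where
  "struct_code sg D = unary_code (struct_nats sg D)"

definition query_code :: "('s, 'f, 'p, 'r) signature \<Rightarrow> 'p list \<Rightarrow>
    ('s, 'f, 'p, 'e::linorder) struct \<Rightarrow> ('p, 'e) gatom \<Rightarrow> bool list" where
  "query_code sg Pd D A = unary_code (struct_nats sg D @ gatom_nats sg Pd D A)"

definition agg_code :: "('s, 'f, 'p, 'r) signature \<Rightarrow> 'r \<Rightarrow>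
    ('s, 'f, 'p, 'e::linorder) struct \<Rightarrow> 'e list set \<times> 'e list set \<Rightarrow> 'e \<Rightarrow> bool list" where
  "agg_code sg r D S d =
     unary_code (struct_nats sg D @ tv_set_nats D (agg_args sg r) S @ [rank D (agg_res sg r) d])"

text \<open>
  The running time is measured in the size of the domain, and nothing is required of the
  machine on words that do not encode an argument of the aggregate relation.
\<close>

definition agg_polytime :: "('s, 'f, 'p, 'r) signature \<Rightarrow>
    (('s, 'f, 'p, 'e::linorder) struct \<Rightarrow> ('s, 'f, 'p, 'e, 'r) struct3) \<Rightarrow>
    (bool \<times> bool \<Rightarrow> bool) \<Rightarrow> 'r \<Rightarrow> bool" where
  "agg_polytime sg X component r \<longleftrightarrow>
     (\<exists>M (p :: nat poly). wf_tm M \<and>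
        (\<forall>D \<in> finite_structures sg. \<forall>S \<in> tv_sets (tuples D (agg_args sg r)).
           \<forall>d \<in> sdom D (agg_res sg r).
             tm_answers M (agg_code sg r D S d) (poly p (dom_size sg D))
               (component (agg_int (X D) r S d))))"

end

theory Submission
  imports Defs
begin

text \<open>
  Functions computed in polynomial time by structured programs over stacks are closed under
  composition and bounded iteration. A program becomes a multi-tape machine by keeping each stack on
  a tape and taking the lists of commands still to be executed as states. The machines given for the
  aggregates are run as subroutines on two stacks per tape, which can be emptied afterwards.

  Over a finite structure, the Kripke--Kleene fixpoint is the limit of the iteration of the
  consequence operator from the least precise interpretation, and the well-founded fixpoint that of
  the stable operator, whose two components are limits of inner iterations; all of them become
  stationary after at most twice as many steps as there are ground atoms. A certificate for an exact
  stable fixpoint is the fixpoint itself. One step of the operator is computed from tables of the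
  truth values of the ground atoms, by induction on the formulas in the rules.
\<close>

section \<open>Stack programs and their compilation to Turing machines\<close>

text \<open>A machine sees only codes, whereas the claims speak of structures over an arbitrary
  ordered type, and the aggregate machines promise nothing on words that code no argument.
  Computability is therefore defined for functions on any set of objects of which certain words are
  visible. Restricting the set expresses a promise, and a function computed in this way agrees on
  objects with equal words. The latter makes the problems well posed as languages: a code fixes a
  structure only up to isomorphism, and \<open>X\<close> is not assumed to respect isomorphism. The
  input is recognized as a code by reading it as a structure over the naturals. Iteration preserves
  polynomial time only if intermediate results stay small; here they are tables with one bit per
  ground atom. For the well-founded fixpoint the obstacle is monotonicity of the stable operator: a
  more precise pair has a larger lower bound, above which its new upper bound is sought. Prudence,
  \<open>fst v \<subseteq> op_down B A (snd v)\<close>, supplies the missing inclusion.\<close>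

type_synonym store = "nat \<Rightarrow> nat list"

text \<open>An empty stack shows 0, the blank that the machine scans on its tape. As 0 cannot be
  pushed, the top alone tells whether a stack is empty.\<close>

definition tops :: "store \<Rightarrow> nat \<Rightarrow> nat" where
  "tops s i = (case s i of [] \<Rightarrow> 0 | a # _ \<Rightarrow> a)"

text \<open>Primitives and tests are arbitrary functions of the top symbols. For each stack a
  primitive yields \<open>None\<close>, leaving it alone, or a word that replaces its top; repeating
  the old top in this word makes it a push.\<close>

datatype com =
    Prim "(nat \<Rightarrow> nat) \<Rightarrow> nat \<Rightarrow> nat list option"
  | Seq com com
  | Cond "(nat \<Rightarrow> nat) \<Rightarrow> bool" com com
  | Loop "(nat \<Rightarrow> nat) \<Rightarrow> bool" com

text \<open>Symbol 0 is the blank, so it cannot be stored and is dropped from the pushed word.\<close>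

definition nz :: "nat list \<Rightarrow> nat list" where
  "nz w = filter (\<lambda>a. a \<noteq> 0) w"

definition prim :: "((nat \<Rightarrow> nat) \<Rightarrow> nat \<Rightarrow> nat list option) \<Rightarrow> store \<Rightarrow> store" where
  "prim F s = (\<lambda>i. case F (tops s) i of None \<Rightarrow> s i | Some w \<Rightarrow> nz w @ tl (s i))"

text \<open>The costs are those of the compiled machine: two steps for a primitive, which may have
  to write two symbols, and one step for each unfolding of a control command.\<close>

inductive exec :: "com \<Rightarrow> store \<Rightarrow> nat \<Rightarrow> store \<Rightarrow> bool" where
  Prim: "exec (Prim F) s 2 (prim F s)"
| Seq: "exec c1 s t1 s1 \<Longrightarrow> exec c2 s1 t2 s2 \<Longrightarrow> exec (Seq c1 c2) s (Suc (t1 + t2)) s2"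
| CondT: "P (tops s) \<Longrightarrow> exec c1 s t s' \<Longrightarrow> exec (Cond P c1 c2) s (Suc t) s'"
| CondF: "\<not> P (tops s) \<Longrightarrow> exec c2 s t s' \<Longrightarrow> exec (Cond P c1 c2) s (Suc t) s'"
| LoopF: "\<not> P (tops s) \<Longrightarrow> exec (Loop P c) s 1 s"
| LoopT: "P (tops s) \<Longrightarrow> exec c s t1 s1 \<Longrightarrow> exec (Loop P c) s1 t2 s2 \<Longrightarrow>
    exec (Loop P c) s (Suc (t1 + t2)) s2"

inductive_cases PrimE: "exec (Prim F) s t s'"
inductive_cases SeqE: "exec (Seq c1 c2) s t s'"
inductive_cases CondE: "exec (Cond P c1 c2) s t s'"
inductive_cases LoopE: "exec (Loop P c) s t s'"

text \<open>Determinism later makes the result of a computation a function of the visible words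
  alone, see \<open>PT_determines\<close>.\<close>

lemma exec_deterministic: "exec c s t s' \<Longrightarrow> exec c s t' s'' \<Longrightarrow> s'' = s'"
proof (induction arbitrary: t' s'' rule: exec.induct)
  case (Prim F s)
  then show ?case by (auto elim: PrimE)
next
  case (Seq c1 s t1 s1 c2 t2 s2)
  from Seq.prems show ?case by (rule SeqE) (use Seq in \<open>metis\<close>)+
next
  case (CondT P s c1 t s' c2)
  from CondT.prems show ?case by (rule CondE) (use CondT in \<open>metis\<close>)+
next
  case (CondF P s c2 t s' c1)
  from CondF.prems show ?case by (rule CondE) (use CondF in \<open>metis\<close>)+
next
  case (LoopF P s c)
  from LoopF.prems show ?case by (rule LoopE) (use LoopF in \<open>metis\<close>)+
next
  case (LoopT P s c t1 s1 t2 s2)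
  from LoopT.prems show ?case by (rule LoopE) (use LoopT in \<open>metis\<close>)+
qed

text \<open>The program fits on \<open>K\<close> tapes with symbols below \<open>N\<close>.
  Dependence on the first \<open>K\<close> tops only lets it be tabulated as a transition function,
  and two symbols are what a primitive can write in its two machine steps.\<close>

fun okc :: "nat \<Rightarrow> nat \<Rightarrow> com \<Rightarrow> bool" where
  "okc K N (Prim F) \<longleftrightarrow>
     (\<forall>\<tau> i w. F \<tau> i = Some w \<longrightarrow> i < K \<and> length w \<le> 2) \<and>
     (\<forall>\<tau> i w. (\<forall>j. \<tau> j < N) \<longrightarrow> F \<tau> i = Some w \<longrightarrow> set w \<subseteq> {..<N}) \<and>
     (\<forall>\<tau> \<tau>'. (\<forall>i<K. \<tau> i = \<tau>' i) \<longrightarrow> F \<tau> = F \<tau>')"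
| "okc K N (Seq c1 c2) \<longleftrightarrow> okc K N c1 \<and> okc K N c2"
| "okc K N (Cond P c1 c2) \<longleftrightarrow>
     (\<forall>\<tau> \<tau>'. (\<forall>i<K. \<tau> i = \<tau>' i) \<longrightarrow> P \<tau> = P \<tau>') \<and> okc K N c1 \<and> okc K N c2"
| "okc K N (Loop P c) \<longleftrightarrow> (\<forall>\<tau> \<tau>'. (\<forall>i<K. \<tau> i = \<tau>' i) \<longrightarrow> P \<tau> = P \<tau>') \<and> okc K N c"

text \<open>The bounds are required to work from some point on, instead of merely to exist:
  \<open>okc\<close> is not monotone in \<open>N\<close>, because a larger alphabet admits new tops,
  and the parts of a program are brought to common bounds by taking maxima.\<close>

definition ok :: "com \<Rightarrow> bool" where
  "ok c \<longleftrightarrow> (\<exists>K N. \<forall>K'\<ge>K. \<forall>N'\<ge>N. okc K' N' c)"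

lemma okI: "(\<And>K' N'. K' \<ge> K \<Longrightarrow> N' \<ge> N \<Longrightarrow> okc K' N' c) \<Longrightarrow> ok c"
  unfolding ok_def by blast

lemma ok_Seq:
  assumes "ok c1" "ok c2"
  shows "ok (Seq c1 c2)"
proof -
  from assms obtain K1 N1 K2 N2 where
    *: "\<forall>K'\<ge>K1. \<forall>N'\<ge>N1. okc K' N' c1" "\<forall>K'\<ge>K2. \<forall>N'\<ge>N2. okc K' N' c2"
    unfolding ok_def by blast
  show ?thesis
    by (rule okI[of "max K1 K2" "max N1 N2"]) (use * in auto)
qed

definition local_test :: "((nat \<Rightarrow> nat) \<Rightarrow> bool) \<Rightarrow> bool" where
  "local_test P \<longleftrightarrow> (\<exists>K. \<forall>\<tau> \<tau>'. (\<forall>i<K. \<tau> i = \<tau>' i) \<longrightarrow> P \<tau> = P \<tau>')"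

lemma local_test_top: "local_test (\<lambda>\<tau>. Q (\<tau> i))"
  unfolding local_test_def by (rule exI[of _ "Suc i"]) auto

lemma ok_Cond:
  assumes "local_test P" "ok c1" "ok c2"
  shows "ok (Cond P c1 c2)"
proof -
  from assms obtain K K1 N1 K2 N2 where
    *: "\<forall>\<tau> \<tau>'. (\<forall>i<K. \<tau> i = \<tau>' i) \<longrightarrow> P \<tau> = P \<tau>'"
       "\<forall>K'\<ge>K1. \<forall>N'\<ge>N1. okc K' N' c1" "\<forall>K'\<ge>K2. \<forall>N'\<ge>N2. okc K' N' c2"
    unfolding ok_def local_test_def by blast
  show ?thesis
    by (rule okI[of "max K (max K1 K2)" "max N1 N2"]) (use * in auto)
qed

lemma ok_Loop:
  assumes "local_test P" "ok c"
  shows "ok (Loop P c)"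
proof -
  from assms obtain K K1 N1 where
    *: "\<forall>\<tau> \<tau>'. (\<forall>i<K. \<tau> i = \<tau>' i) \<longrightarrow> P \<tau> = P \<tau>'"
       "\<forall>K'\<ge>K1. \<forall>N'\<ge>N1. okc K' N' c"
    unfolding ok_def local_test_def by blast
  show ?thesis
    by (rule okI[of "max K K1" "N1"]) (use * in auto)
qed

subsection \<open>Compilation\<close>

text \<open>
  A control state is a stack of commands still to be executed, together with the words that a
  \<open>Prim\<close> command is in the middle of writing: pushing a second symbol takes a second step.
\<close>

type_synonym ctl = "com list \<times> (nat \<Rightarrow> nat list option) option"

fun next_coms :: "com list \<Rightarrow> (nat \<Rightarrow> nat) \<Rightarrow> com list" where
  "next_coms [] \<tau> = []"
| "next_coms (Prim F # cs) \<tau> = cs"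
| "next_coms (Seq c1 c2 # cs) \<tau> = c1 # c2 # cs"
| "next_coms (Cond P c1 c2 # cs) \<tau> = (if P \<tau> then c1 else c2) # cs"
| "next_coms (Loop P c # cs) \<tau> = (if P \<tau> then c # Loop P c # cs else cs)"

text \<open>The words \<open>F \<tau>\<close> are determined once and kept in the control state,
  because the first of the two writing steps already changes the tops.\<close>

fun next_ctl :: "ctl \<Rightarrow> (nat \<Rightarrow> nat) \<Rightarrow> ctl" where
  "next_ctl (cs, Some W) \<tau> = (cs, None)"
| "next_ctl (Prim F # cs, None) \<tau> = (cs, Some (F \<tau>))"
| "next_ctl (cs, None) \<tau> = (next_coms cs \<tau>, None)"

text \<open>Popping erases the cell and moves right. To leave two symbols, the lower one replaces
  the top and the head moves left onto a blank cell, where \<open>write2\<close> puts the upper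
  one.\<close>

definition write1 :: "nat list option \<Rightarrow> nat \<Rightarrow> nat \<times> move" where
  "write1 w a = (case w of None \<Rightarrow> (a, Stay) | Some w \<Rightarrow>
     (case nz w of [] \<Rightarrow> (0, MoveRight) | [x] \<Rightarrow> (x, Stay) | x # y # _ \<Rightarrow> (y, MoveLeft)))"

definition write2 :: "nat list option \<Rightarrow> nat \<Rightarrow> nat \<times> move" where
  "write2 w a = (case w of None \<Rightarrow> (a, Stay) | Some w \<Rightarrow>
     (case nz w of x # y # _ \<Rightarrow> (x, Stay) | _ \<Rightarrow> (a, Stay)))"

fun ctl_act :: "ctl \<Rightarrow> (nat \<Rightarrow> nat) \<Rightarrow> nat \<Rightarrow> nat \<times> move" where
  "ctl_act (cs, Some W) \<tau> i = write2 (W i) (\<tau> i)"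
| "ctl_act (Prim F # cs, None) \<tau> i = write1 (F \<tau> i) (\<tau> i)"
| "ctl_act (cs, None) \<tau> i = (\<tau> i, Stay)"

text \<open>The lists of pending commands that can arise while \<open>c\<close> runs in front of
  \<open>cs\<close>. A loop is put back unchanged behind its body, so they are finitely many and can
  serve as states.\<close>

fun conts :: "com \<Rightarrow> com list \<Rightarrow> com list set" where
  "conts (Prim F) cs = {Prim F # cs}"
| "conts (Seq c1 c2) cs = insert (Seq c1 c2 # cs) (conts c1 (c2 # cs) \<union> conts c2 cs)"
| "conts (Cond P c1 c2) cs = insert (Cond P c1 c2 # cs) (conts c1 cs \<union> conts c2 cs)"
| "conts (Loop P c) cs = insert (Loop P c # cs) (conts c (Loop P c # cs))"

lemma finite_conts: "finite (conts c cs)"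
  by (induction c arbitrary: cs) auto

lemma Cons_in_conts: "c # cs \<in> conts c cs"
  by (cases c) auto

lemma next_coms_conts: "ds \<in> conts c cs \<Longrightarrow> next_coms ds \<tau> \<in> insert cs (conts c cs)"
proof (induction c arbitrary: cs ds)
  case (Seq c1 c2)
  from Seq.prems consider "ds = Seq c1 c2 # cs" | "ds \<in> conts c1 (c2 # cs)" | "ds \<in> conts c2 cs"
    by auto
  then show ?case
  proof cases
    case 2
    from Seq.IH(1)[OF this] show ?thesis using Cons_in_conts[of c2 cs] by auto
  next
    case 3
    from Seq.IH(2)[OF this] show ?thesis by auto
  qed (simp add: Cons_in_conts)
next
  case (Cond P c1 c2)
  from Cond.prems consider "ds = Cond P c1 c2 # cs" | "ds \<in> conts c1 cs" | "ds \<in> conts c2 cs"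
    by auto
  then show ?case
  proof cases
    case 2
    from Cond.IH(1)[OF this] show ?thesis by auto
  next
    case 3
    from Cond.IH(2)[OF this] show ?thesis by auto
  qed (simp add: Cons_in_conts)
next
  case (Loop P c)
  from Loop.prems consider "ds = Loop P c # cs" | "ds \<in> conts c (Loop P c # cs)"
    by auto
  then show ?case
  proof cases
    case 2
    from Loop.IH[OF this] show ?thesis by auto
  qed (simp add: Cons_in_conts)
qed auto

lemma okc_conts: "okc K N c \<Longrightarrow> \<forall>d\<in>set cs. okc K N d \<Longrightarrow> ds \<in> conts c cs \<Longrightarrow> d \<in> set ds \<Longrightarrow> okc K N d"
proof (induction c arbitrary: cs ds)
  case (Seq c1 c2)
  from Seq.prems(3) consider "ds = Seq c1 c2 # cs" | "ds \<in> conts c1 (c2 # cs)" | "ds \<in> conts c2 cs"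
    by auto
  then show ?case
  proof cases
    case 1
    then show ?thesis using Seq.prems(1,2,4) by (auto simp del: okc.simps(1))
  next
    case 2
    show ?thesis by (rule Seq.IH(1)[OF _ _ 2 Seq.prems(4)]) (use Seq.prems(1,2) in simp_all)
  next
    case 3
    show ?thesis by (rule Seq.IH(2)[OF _ _ 3 Seq.prems(4)]) (use Seq.prems(1,2) in simp_all)
  qed
next
  case (Cond P c1 c2)
  from Cond.prems(3) consider "ds = Cond P c1 c2 # cs" | "ds \<in> conts c1 cs" | "ds \<in> conts c2 cs"
    by auto
  then show ?case
  proof cases
    case 1
    then consider "d = Cond P c1 c2" | "d \<in> set cs" using Cond.prems(4) by auto
    then show ?thesis using Cond.prems(1,2) by cases simp_all
  next
    case 2
    show ?thesis by (rule Cond.IH(1)[OF _ _ 2 Cond.prems(4)]) (use Cond.prems(1,2) in simp_all)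
  next
    case 3
    show ?thesis by (rule Cond.IH(2)[OF _ _ 3 Cond.prems(4)]) (use Cond.prems(1,2) in simp_all)
  qed
next
  case (Loop P c)
  from Loop.prems(3) consider "ds = Loop P c # cs" | "ds \<in> conts c (Loop P c # cs)"
    by auto
  then show ?case
  proof cases
    case 1
    then consider "d = Loop P c" | "d \<in> set cs" using Loop.prems(4) by auto
    then show ?thesis using Loop.prems(1,2) by cases simp_all
  next
    case 2
    show ?thesis by (rule Loop.IH[OF _ _ 2 Loop.prems(4)]) (use Loop.prems(1,2) in simp_all)
  qed
next
  case (Prim F)
  then consider "d = Prim F" | "d \<in> set cs" by auto
  then show ?case using Prim.prems(1,2) by cases simp_all
qed

definition list_tops :: "nat list \<Rightarrow> nat \<Rightarrow> nat" where
  "list_tops ss i = (if i < length ss then ss ! i else 0)"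

text \<open>The top of the stack is the scanned cell and the rest extends to the right. All cells to
  the left of the head are blank, so there is room for pushing.\<close>

definition stack_tape :: "nat list \<Rightarrow> tape" where
  "stack_tape st = (\<lambda>i. if 0 \<le> i \<and> i < int (length st) then st ! nat i else 0)"

lemma stack_tape_0: "stack_tape (s i) 0 = tops s i"
  by (auto simp: stack_tape_def tops_def split: list.split)

lemma act_keep: "act (stack_tape st 0, Stay) (stack_tape st) = stack_tape st"
  by (auto simp: stack_tape_def fun_eq_iff)

lemma act_pop: "act (0, MoveRight) (stack_tape st) = stack_tape (tl st)"
  by (cases st) (auto simp: stack_tape_def fun_eq_iff nth_Cons' nat_diff_distrib nat_add_distrib)

lemma act_replace: "act (x, Stay) (stack_tape st) = stack_tape (x # tl st)"
  by (cases st) (auto simp: stack_tape_def fun_eq_iff nth_Cons')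

lemma act_push: "act (x, Stay) (act (y, MoveLeft) (stack_tape st)) = stack_tape (x # y # tl st)"
  by (cases st) (auto simp: stack_tape_def fun_eq_iff nth_Cons' nat_diff_distrib)

lemma act_write:
  fixes st :: "nat list"
  assumes "length w \<le> 2"
  defines "t \<equiv> act (write1 (Some w) (stack_tape st 0)) (stack_tape st)"
  shows "act (write2 (Some w) (t 0)) t = stack_tape (nz w @ tl st)"
proof -
  have "length (nz w) \<le> 2"
    unfolding nz_def by (rule order.trans[OF length_filter_le assms(1)])
  then consider "nz w = []" | x where "nz w = [x]" | x y where "nz w = [x, y]"
    by (cases "nz w"; cases "tl (nz w)"; cases "tl (tl (nz w))") auto
  then show ?thesis
  proof cases
    case 1
    then show ?thesis
      unfolding t_def write1_def write2_def using act_keep[of "tl st"] act_pop[of st]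
      by (simp del: act.simps)
  next
    case (2 x)
    then show ?thesis
      unfolding t_def write1_def write2_def using act_keep[of "x # tl st"] act_replace[of x st]
      by (simp del: act.simps)
  next
    case (3 x y)
    then show ?thesis
      unfolding t_def write1_def write2_def using act_push[of x y st] by (simp del: act.simps)
  qed
qed


text \<open>The second component of a control state ranges over an infinite type of functions. Only
  the values of primitives at \<open>K\<close> symbols below \<open>N\<close> occur, which leaves
  finitely many.\<close>

definition ctls :: "com \<Rightarrow> nat \<Rightarrow> nat \<Rightarrow> ctl set" where
  "ctls c K N = insert [] (conts c []) \<times> {None} \<union>
     {(cs, Some (F (list_tops ss))) | F cs ss.
        Prim F # cs \<in> conts c [] \<and> set ss \<subseteq> {..<N} \<and> length ss = K}"

lemma finite_ctls: "finite (ctls c K N)"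
proof -
  have fin: "finite {ss :: nat list. set ss \<subseteq> {..<N} \<and> length ss = K}"
    by (rule finite_lists_length_eq) simp
  have "{(cs, Some (F (list_tops ss))) | F cs ss.
          Prim F # cs \<in> conts c [] \<and> set ss \<subseteq> {..<N} \<and> length ss = K} \<subseteq>
        (\<lambda>(ds, ss). case ds of Prim F # cs \<Rightarrow> (cs, Some (F (list_tops ss)))) `
          (conts c [] \<times> {ss. set ss \<subseteq> {..<N} \<and> length ss = K})"
    by (auto simp: image_iff) force
  then have "finite {(cs, Some (F (list_tops ss))) | F cs ss.
          Prim F # cs \<in> conts c [] \<and> set ss \<subseteq> {..<N} \<and> length ss = K}"
    by (rule finite_subset) (simp add: finite_conts fin)
  then show ?thesis
    by (simp add: ctls_def finite_conts)
qed

lemma next_ctl_in_ctls: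
  assumes "q \<in> ctls c K N" "length ss = K" "set ss \<subseteq> {..<N}"
  shows "next_ctl q (list_tops ss) \<in> ctls c K N"
proof -
  have nx: "next_coms ds \<tau> \<in> insert [] (conts c [])" if "ds \<in> insert [] (conts c [])" for ds \<tau>
    using that next_coms_conts[of ds c "[]" \<tau>] by auto
  show ?thesis
  proof (cases q)
    case (Pair cs W)
    show ?thesis
    proof (cases W)
      case None
      then have cs: "cs \<in> insert [] (conts c [])"
        using assms(1) Pair by (auto simp: ctls_def)
      show ?thesis
      proof (cases "\<exists>F ds. cs = Prim F # ds")
        case True
        then obtain F ds where F: "cs = Prim F # ds" by blast
        then have "Prim F # ds \<in> conts c []" using cs by simp
        then have "(ds, Some (F (list_tops ss))) \<in> ctls c K N"
          unfolding ctls_def using assms(2,3) by blast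
        then show ?thesis using F Pair None by simp
      next
        case False
        then have "next_ctl q (list_tops ss) = (next_coms cs (list_tops ss), None)"
          using Pair None by (cases cs; cases "hd cs") auto
        then show ?thesis
          using nx[OF cs] by (simp add: ctls_def)
      qed
    next
      case (Some a)
      then obtain F where "Prim F # cs \<in> conts c []"
        using assms(1) Pair by (auto simp: ctls_def)
      then show ?thesis
        using Some Pair nx[of "Prim F # cs" "\<lambda>_. 0"] by (auto simp: ctls_def)
    qed
  qed
qed

locale compilation =
  fixes c :: com and K N out :: nat and e :: "ctl \<Rightarrow> nat"
  assumes okc: "okc K N c" and out: "out < K" and N: "N \<ge> 3"
    and e: "bij_betw e (ctls c K N) {..<card (ctls c K N)}"
begin

text \<open>The numbers 0, 1 and 2 are reserved by the machine model. State 0 stands for the start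
  of \<open>c\<close>, and a control state \<open>q\<close> is otherwise numbered
  \<open>3 + e q\<close>.\<close>

definition dec :: "nat \<Rightarrow> ctl" where
  "dec n = (if n < 3 then ([c], None) else inv_into (ctls c K N) e (n - 3))"

text \<open>When no command is left, one further step reads the top of stack \<open>out\<close> and
  accepts exactly if it is 2, the symbol of the bit \<open>True\<close>.\<close>

definition machine :: tm where
  "machine = \<lparr>tm_tapes = K, tm_states = 3 + card (ctls c K N), tm_symbols = N,
     tm_delta = (\<lambda>n ss.
       if n = 1 \<or> n = 2 then (2, map (\<lambda>a. (a, Stay)) ss)
       else if dec n = ([], None) then (if list_tops ss out = 2 then 1 else 2, map (\<lambda>a. (a, Stay)) ss)
       else (3 + e (next_ctl (dec n) (list_tops ss)), map (ctl_act (dec n) (list_tops ss)) [0..<K]))\<rparr>"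

lemma dec_in: "n < 3 + card (ctls c K N) \<Longrightarrow> dec n \<in> ctls c K N"
proof (cases "n < 3")
  case True
  then show ?thesis by (simp add: dec_def ctls_def Cons_in_conts)
next
  case False
  assume "n < 3 + card (ctls c K N)"
  then have "n - 3 \<in> e ` ctls c K N" using e False by (auto simp: bij_betw_def)
  then show ?thesis using False by (simp add: dec_def inv_into_into)
qed

lemma dec_e: "q \<in> ctls c K N \<Longrightarrow> dec (3 + e q) = q"
  using e by (simp add: dec_def bij_betw_def)

lemma e_less: "q \<in> ctls c K N \<Longrightarrow> e q < card (ctls c K N)"
  using e by (auto simp: bij_betw_def)

lemma okc_Prim: "Prim F # cs \<in> conts c [] \<Longrightarrow> okc K N (Prim F)"
  by (rule okc_conts[OF okc, of "[]" "Prim F # cs"]) simp_all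

lemma Prim_word:
  assumes "Prim F # cs \<in> conts c []" "set ss \<subseteq> {..<N}" "length ss = K" "F (list_tops ss) i = Some w"
  shows "set w \<subseteq> {..<N}"
proof -
  have "list_tops ss j < N" for j
    using assms(2,3) N nth_mem[of j ss] by (auto simp: list_tops_def subset_iff)
  moreover have "(\<forall>j. \<tau> j < N) \<longrightarrow> F \<tau> i = Some w \<longrightarrow> set w \<subseteq> {..<N}" for \<tau> i w
    using okc_Prim[OF assms(1)] by simp
  ultimately show ?thesis using assms(4) by blast
qed

lemma ctl_act_less:
  assumes q: "q \<in> ctls c K N" and ss: "length ss = K" "set ss \<subseteq> {..<N}" and i: "i < K"
  shows "fst (ctl_act q (list_tops ss) i) < N"
proof -
  have t: "list_tops ss i < N"
    using ss i nth_mem[of i ss] by (auto simp: list_tops_def subset_iff)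
  have w: "fst (write1 w (list_tops ss i)) < N \<and> fst (write2 w (list_tops ss i)) < N"
    if "\<And>v. w = Some v \<Longrightarrow> set v \<subseteq> {..<N}" for w
  proof (cases w)
    case (Some v)
    then have "set (nz v) \<subseteq> {..<N}" using that by (auto simp: nz_def)
    then show ?thesis
      using t Some N by (auto simp: write1_def write2_def split: list.split)
  qed (use t in \<open>auto simp: write1_def write2_def\<close>)
  show ?thesis
  proof (cases q)
    case (Pair cs W)
    show ?thesis
    proof (cases W)
      case None
      show ?thesis
      proof (cases "\<exists>F ds. cs = Prim F # ds")
        case True
        then obtain F ds where F: "cs = Prim F # ds" by blast
        then have "Prim F # ds \<in> conts c []" using q Pair None by (auto simp: ctls_def)
        then show ?thesis
          using F Pair None w Prim_word[OF _ ss(2,1)] by simp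
      next
        case False
        then have "ctl_act q (list_tops ss) i = (list_tops ss i, Stay)"
          using Pair None by (cases cs; cases "hd cs") auto
        then show ?thesis using t by simp
      qed
    next
      case (Some W')
      then obtain F ss' where "Prim F # cs \<in> conts c []" "W' = F (list_tops ss')"
        "set ss' \<subseteq> {..<N}" "length ss' = K"
        using q Pair by (auto simp: ctls_def)
      then show ?thesis
        using Some Pair w Prim_word by simp
    qed
  qed
qed

lemma wf_machine: "wf_tm machine"
  unfolding wf_tm_def
proof (intro conjI allI impI, goal_cases)
  case (4 n ss)
  then have ss: "length ss = K" "set ss \<subseteq> {..<N}" and n: "n < 3 + card (ctls c K N)"
    by (auto simp: machine_def)
  have "next_ctl (dec n) (list_tops ss) \<in> ctls c K N"
    by (rule next_ctl_in_ctls[OF dec_in[OF n] ss])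
  then have "e (next_ctl (dec n) (list_tops ss)) < card (ctls c K N)" by (rule e_less)
  moreover have "a < N" if am: "(a, m) \<in> set (map (ctl_act (dec n) (list_tops ss)) [0..<K])" for a m
  proof -
    obtain i where "i < K" "(a, m) = ctl_act (dec n) (list_tops ss) i" using am by auto
    then show ?thesis using ctl_act_less[OF dec_in[OF n] ss, of i] by (metis fst_conv)
  qed
  moreover have "a < N" if "(a, m) \<in> set (map (\<lambda>a. (a, Stay)) ss)" for a m
    using that ss by auto
  ultimately show ?case
    using ss by (auto simp add: machine_def simp del: set_map)
qed (use out N in \<open>auto simp: machine_def\<close>)

definition tapes :: "store \<Rightarrow> tape list" where
  "tapes s = map (\<lambda>i. stack_tape (s i)) [0..<K]"

definition bounded :: "store \<Rightarrow> bool" where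
  "bounded s \<longleftrightarrow> (\<forall>i<K. set (s i) \<subseteq> {..<N})"

abbreviation heads :: "store \<Rightarrow> nat list" where
  "heads s \<equiv> map (tops s) [0..<K]"

lemma heads: "bounded s \<Longrightarrow> set (heads s) \<subseteq> {..<N}" "bounded s \<Longrightarrow> length (heads s) = K"
  using N by (force simp: bounded_def tops_def split: list.split)+

lemma list_tops_heads: "i < K \<Longrightarrow> list_tops (heads s) i = tops s i"
  by (simp add: list_tops_def)

lemma tm_step_ctl:
  assumes "n \<noteq> 1" "n \<noteq> 2" "dec n = q" "q \<noteq> ([], None)" "ts = map t [0..<K]" "length ss = K"
    "\<And>i. i < K \<Longrightarrow> ss ! i = t i 0"
  shows "tm_step machine (n, ts) = (3 + e (next_ctl q (list_tops ss)),
           map (\<lambda>i. act (ctl_act q (list_tops ss) i) (t i)) [0..<K])"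
proof -
  have "map (\<lambda>t. t 0) ts = ss"
    using assms(5-7) by (auto intro: nth_equalityI)
  then show ?thesis
    using assms(1-5) by (auto simp: machine_def zip_map1 zip_map2 zip_same_conv_map)
qed

lemma step_control:
  assumes "n \<noteq> 1" "n \<noteq> 2" "dec n = (d # cs, None)" "\<not> (\<exists>F. d = Prim F)" "d # cs \<in> conts c []"
    "bounded s"
  shows "\<exists>n'. tm_step machine (n, tapes s) = (n', tapes s) \<and> n' \<noteq> 1 \<and> n' \<noteq> 2 \<and>
    dec n' = (next_coms (d # cs) (list_tops (heads s)), None) \<and>
    next_coms (d # cs) (list_tops (heads s)) \<in> insert [] (conts c [])"
proof -
  let ?q = "(d # cs, None) :: ctl" and ?\<tau> = "list_tops (heads s)"
  have q: "?q \<in> ctls c K N" using assms(5) by (simp add: ctls_def)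
  have nx: "next_ctl ?q ?\<tau> = (next_coms (d # cs) ?\<tau>, None)"
    using assms(4) by (cases d) auto
  have act: "ctl_act ?q ?\<tau> i = (?\<tau> i, Stay)" for i
    using assms(4) by (cases d) auto
  have in_ctls: "next_ctl ?q ?\<tau> \<in> ctls c K N"
    by (rule next_ctl_in_ctls[OF q]) (use heads[OF assms(6)] in auto)
  have "tm_step machine (n, tapes s) = (3 + e (next_ctl ?q ?\<tau>),
      map (\<lambda>i. act (ctl_act ?q ?\<tau> i) (stack_tape (s i))) [0..<K])"
    by (rule tm_step_ctl[OF assms(1,2,3)]) (auto simp: tapes_def stack_tape_0)
  also have "map (\<lambda>i. act (ctl_act ?q ?\<tau> i) (stack_tape (s i))) [0..<K] = tapes s"
    unfolding tapes_def act by (intro map_cong refl)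
      (simp add: list_tops_heads flip: stack_tape_0 del: act.simps, simp add: act_keep del: act.simps)
  finally show ?thesis
    using in_ctls dec_e nx next_coms_conts[OF assms(5)] by (intro exI) auto
qed

lemma step_Prim:
  assumes "n \<noteq> 1" "n \<noteq> 2" "dec n = (Prim F # cs, None)" "Prim F # cs \<in> conts c []" "bounded s"
  shows "\<exists>n'. tm_step machine (tm_step machine (n, tapes s)) = (n', tapes (prim F s)) \<and>
    n' \<noteq> 1 \<and> n' \<noteq> 2 \<and> dec n' = (cs, None) \<and> bounded (prim F s) \<and> cs \<in> insert [] (conts c [])"
proof -
  let ?q = "(Prim F # cs, None) :: ctl" and ?\<tau> = "list_tops (heads s)"
  let ?W = "F ?\<tau>"
  let ?q' = "(cs, Some ?W) :: ctl"
  let ?t = "\<lambda>i. act (write1 (?W i) (?\<tau> i)) (stack_tape (s i))"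
  let ?ss = "map (\<lambda>i. ?t i 0) [0..<K]"
  have okF: "okc K N (Prim F)" by (rule okc_Prim[OF assms(4)])
  \<comment> \<open>The tapes show only the tops below \<open>K\<close>; by locality of
    \<open>F\<close> these determine its value.\<close>
  then have W: "?W = F (tops s)" by (auto simp: list_tops_heads)
  have q': "?q' \<in> ctls c K N"
    using assms(4) heads[OF assms(5)] unfolding ctls_def by blast
  have cs: "cs \<in> insert [] (conts c [])"
    using next_coms_conts[OF assms(4), of "\<lambda>_. 0"] by simp
  then have q'': "(cs, None) \<in> ctls c K N" by (simp add: ctls_def)
  have 1: "tm_step machine (n, tapes s) = (3 + e ?q', map ?t [0..<K])"
    using tm_step_ctl[OF assms(1,2,3), of "tapes s" "\<lambda>i. stack_tape (s i)" "heads s"]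
    by (simp add: tapes_def stack_tape_0 del: act.simps)
  have "tm_step machine (3 + e ?q', map ?t [0..<K]) = (3 + e (next_ctl ?q' (list_tops ?ss)),
      map (\<lambda>i. act (ctl_act ?q' (list_tops ?ss) i) (?t i)) [0..<K])"
    by (rule tm_step_ctl) (use dec_e[OF q'] in auto)
  also have "map (\<lambda>i. act (ctl_act ?q' (list_tops ?ss) i) (?t i)) [0..<K] = tapes (prim F s)"
    unfolding tapes_def
  proof (intro map_cong refl)
    fix i assume "i \<in> set [0..<K]"
    then have i: "i < K" by simp
    have lt: "list_tops ?ss i = ?t i 0" using i by (simp add: list_tops_def)
    show "act (ctl_act ?q' (list_tops ?ss) i) (?t i) = stack_tape (prim F s i)"
    proof (cases "?W i")
      case None
      then show ?thesis
        using lt i W by (simp add: write1_def write2_def list_tops_heads prim_def act_keep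
            flip: stack_tape_0 del: act.simps)
    next
      case (Some w)
      then have "length w \<le> 2" using okF by auto
      from act_write[OF this, of "s i"] show ?thesis
        using lt i W Some by (simp add: list_tops_heads prim_def stack_tape_0 del: act.simps)
    qed
  qed
  finally have 2: "tm_step machine (3 + e ?q', map ?t [0..<K]) = (3 + e (cs, None), tapes (prim F s))"
    by simp
  have "set (prim F s i) \<subseteq> {..<N}" if "i < K" for i
  proof (cases "?W i")
    case None
    then show ?thesis using that assms(5) W by (auto simp: prim_def bounded_def)
  next
    case (Some w)
    then have "set w \<subseteq> {..<N}" using Prim_word[OF assms(4) heads[OF assms(5)]] by blast
    moreover have "set (tl (s i)) \<subseteq> {..<N}"
      using that assms(5) by (cases "s i") (fastforce simp: bounded_def)+
    ultimately show ?thesis using Some W by (auto simp: prim_def nz_def)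
  qed
  then have "bounded (prim F s)" by (simp add: bounded_def)
  then show ?thesis
    using 1 2 cs dec_e[OF q''] by (intro exI[of _ "3 + e (cs, None)"]) simp
qed

text \<open>Induction on the execution, for an arbitrary continuation \<open>cs\<close>. The time of
  \<open>exec\<close> is exactly the number of machine steps, so compilation causes no
  overhead.\<close>

lemma simulation:
  "exec d s t s' \<Longrightarrow> n \<noteq> 1 \<Longrightarrow> n \<noteq> 2 \<Longrightarrow> dec n = (d # cs, None) \<Longrightarrow> d # cs \<in> conts c [] \<Longrightarrow>
   bounded s \<Longrightarrow> \<exists>n'. (tm_step machine ^^ t) (n, tapes s) = (n', tapes s') \<and> n' \<noteq> 1 \<and> n' \<noteq> 2 \<and>
     dec n' = (cs, None) \<and> bounded s' \<and> cs \<in> insert [] (conts c [])"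
proof (induction arbitrary: n cs rule: exec.induct)
  case (Prim F s)
  from step_Prim[OF Prim(1-5)] show ?case by (simp add: numeral_2_eq_2)
next
  case (Seq c1 s t1 s1 c2 t2 s2)
  from step_control[OF Seq.prems(1-3) _ Seq.prems(4,5)] obtain n1 where
    1: "tm_step machine (n, tapes s) = (n1, tapes s)" "n1 \<noteq> 1" "n1 \<noteq> 2"
       "dec n1 = (c1 # c2 # cs, None)" "c1 # c2 # cs \<in> conts c []" by auto
  from Seq.IH(1)[OF 1(2-5) Seq.prems(5)] obtain n2 where
    2: "(tm_step machine ^^ t1) (n1, tapes s) = (n2, tapes s1)" "n2 \<noteq> 1" "n2 \<noteq> 2"
       "dec n2 = (c2 # cs, None)" "bounded s1" "c2 # cs \<in> conts c []" by auto
  from Seq.IH(2)[OF 2(2-4,6,5)] obtain n3 where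
    3: "(tm_step machine ^^ t2) (n2, tapes s1) = (n3, tapes s2)" "n3 \<noteq> 1" "n3 \<noteq> 2"
       "dec n3 = (cs, None)" "bounded s2" "cs \<in> insert [] (conts c [])" by auto
  have "(tm_step machine ^^ Suc (t1 + t2)) (n, tapes s) = (n3, tapes s2)"
    using 1(1) 2(1) 3(1) by (simp add: funpow_Suc_right add.commute[of t1] funpow_add
        del: funpow.simps tm_step.simps)
  then show ?case using 3 by blast
next
  case (CondT P s c1 t s' c2)
  have "okc K N (Cond P c1 c2)"
    by (rule okc_conts[OF okc _ CondT.prems(4)]) simp_all
  then have "P (list_tops (heads s))" using CondT.hyps(1) list_tops_heads[of _ s] by auto
  with step_control[OF CondT.prems(1-3) _ CondT.prems(4,5)] obtain n1 where
    1: "tm_step machine (n, tapes s) = (n1, tapes s)" "n1 \<noteq> 1" "n1 \<noteq> 2"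
       "dec n1 = (c1 # cs, None)" "c1 # cs \<in> conts c []" by auto
  from CondT.IH[OF 1(2-5) CondT.prems(5)] show ?case
    using 1(1) by (simp add: funpow_Suc_right del: funpow.simps tm_step.simps)
next
  case (CondF P s c2 t s' c1)
  have "okc K N (Cond P c1 c2)"
    by (rule okc_conts[OF okc _ CondF.prems(4)]) simp_all
  then have "\<not> P (list_tops (heads s))" using CondF.hyps(1) list_tops_heads[of _ s] by auto
  with step_control[OF CondF.prems(1-3) _ CondF.prems(4,5)] obtain n1 where
    1: "tm_step machine (n, tapes s) = (n1, tapes s)" "n1 \<noteq> 1" "n1 \<noteq> 2"
       "dec n1 = (c2 # cs, None)" "c2 # cs \<in> conts c []" by auto
  from CondF.IH[OF 1(2-5) CondF.prems(5)] show ?case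
    using 1(1) by (simp add: funpow_Suc_right del: funpow.simps tm_step.simps)
next
  case (LoopF P s d)
  have "okc K N (Loop P d)"
    by (rule okc_conts[OF okc _ LoopF.prems(4)]) simp_all
  then have "\<not> P (list_tops (heads s))" using LoopF.hyps(1) list_tops_heads[of _ s] by auto
  with step_control[OF LoopF.prems(1-3) _ LoopF.prems(4,5)] show ?case
    using LoopF.prems(5) by auto
next
  case (LoopT P s d t1 s1 t2 s2)
  have "okc K N (Loop P d)"
    by (rule okc_conts[OF okc _ LoopT.prems(4)]) simp_all
  then have "P (list_tops (heads s))" using LoopT.hyps(1) list_tops_heads[of _ s] by auto
  with step_control[OF LoopT.prems(1-3) _ LoopT.prems(4,5)] obtain n1 where
    1: "tm_step machine (n, tapes s) = (n1, tapes s)" "n1 \<noteq> 1" "n1 \<noteq> 2"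
       "dec n1 = (d # Loop P d # cs, None)" "d # Loop P d # cs \<in> conts c []" by auto
  from LoopT.IH(1)[OF 1(2-5) LoopT.prems(5)] obtain n2 where
    2: "(tm_step machine ^^ t1) (n1, tapes s) = (n2, tapes s1)" "n2 \<noteq> 1" "n2 \<noteq> 2"
       "dec n2 = (Loop P d # cs, None)" "bounded s1" "Loop P d # cs \<in> conts c []" by auto
  from LoopT.IH(2)[OF 2(2-4,6,5)] obtain n3 where
    3: "(tm_step machine ^^ t2) (n2, tapes s1) = (n3, tapes s2)" "n3 \<noteq> 1" "n3 \<noteq> 2"
       "dec n3 = (cs, None)" "bounded s2" "cs \<in> insert [] (conts c [])" by auto
  have "(tm_step machine ^^ Suc (t1 + t2)) (n, tapes s) = (n3, tapes s2)"
    using 1(1) 2(1) 3(1) by (simp add: funpow_Suc_right add.commute[of t1] funpow_add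
        del: funpow.simps tm_step.simps)
  then show ?case using 3 by blast
qed

text \<open>The strict inequality leaves one step for turning the final store into an
  answer.\<close>

lemma machine_answers:
  assumes ex: "exec c s t s'" and s: "s = (\<lambda>_. [])(0 := map (\<lambda>b. if b then 2 else 1) w)"
    and t: "t < T"
  shows "tm_answers machine w T (tops s' out = 2)"
proof -
  have b: "bounded s" using N by (auto simp: bounded_def s)
  have init: "tm_init machine w = (0, tapes s)"
  proof -
    have K: "[0..<K] = 0 # [1..<K]" using out by (simp add: upt_rec)
    have "map (\<lambda>i. stack_tape (s i)) [1..<K] = replicate (K - 1) (\<lambda>_. 0)"
      by (rule nth_equalityI) (auto simp: s stack_tape_def)
    moreover have "stack_tape (s 0) = input_tape w"
      by (auto simp: s stack_tape_def input_tape_def fun_eq_iff)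
    ultimately show ?thesis
      by (simp add: tm_init_def machine_def tapes_def K)
  qed
  have "dec 0 = ([c], None)" by (simp add: dec_def)
  from simulation[OF ex _ _ this Cons_in_conts b] obtain n' where
    n': "(tm_step machine ^^ t) (0, tapes s) = (n', tapes s')" "n' \<noteq> 1" "n' \<noteq> 2"
      "dec n' = ([], None)" by auto
  have "map (\<lambda>t. t 0) (tapes s') = heads s'"
    by (auto simp: tapes_def stack_tape_0)
  then have "fst (tm_step machine (n', tapes s')) = (if tops s' out = 2 then 1 else 2)"
    using n'(2-4) by (auto simp: machine_def list_tops_heads[OF out])
  then have "fst ((tm_step machine ^^ Suc t) (tm_init machine w)) = (if tops s' out = 2 then 1 else 2)"
    using n'(1) init by simp
  then show ?thesis
    unfolding tm_answers_def using t by (intro exI[of _ "Suc t"]) simp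
qed

end

lemma PTIME_I:
  assumes "ok c"
    and run: "\<And>w. \<exists>t s'. exec c ((\<lambda>_. [])(0 := map (\<lambda>b. if b then 2 else 1) w)) t s' \<and>
      t \<le> poly p (length w) \<and> (tops s' out = 2 \<longleftrightarrow> w \<in> L)"
  shows "L \<in> PTIME"
proof -
  from assms(1) obtain K0 N0 where "\<forall>K'\<ge>K0. \<forall>N'\<ge>N0. okc K' N' c"
    unfolding ok_def by blast
  \<comment> \<open>There must be a tape for \<open>out\<close>, and at least three symbols, for the
    blank and the two bits.\<close>
  then have "okc (max K0 (Suc out)) (max N0 3) c" by simp
  moreover obtain e where "bij_betw e (ctls c (max K0 (Suc out)) (max N0 3))
      {..<card (ctls c (max K0 (Suc out)) (max N0 3))}"
    using ex_bij_betw_finite_nat[OF finite_ctls] unfolding atLeast0LessThan by blast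
  ultimately interpret compilation c "max K0 (Suc out)" "max N0 3" out e
    by unfold_locales auto
  have "tm_answers machine w (poly (p + 1) (length w)) (w \<in> L)" for w
  proof -
    obtain t s' where "exec c ((\<lambda>_. [])(0 := map (\<lambda>b. if b then 2 else 1) w)) t s'"
      "t \<le> poly p (length w)" "tops s' out = 2 \<longleftrightarrow> w \<in> L"
      using run by blast
    from machine_answers[OF this(1) refl, of "poly (p + 1) (length w)"] this(2,3) show ?thesis
      by simp
  qed
  then show ?thesis
    unfolding PTIME_def using wf_machine by blast
qed

section \<open>Functions computable in polynomial time\<close>

definition runs :: "com \<Rightarrow> store \<Rightarrow> nat \<Rightarrow> store \<Rightarrow> bool" where
  "runs c s T s' \<longleftrightarrow> (\<exists>t\<le>T. exec c s t s')"

lemma runs_mono: "runs c s T s' \<Longrightarrow> T \<le> T' \<Longrightarrow> runs c s T' s'"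
  unfolding runs_def using order.trans by blast

lemma runs_Prim: "s' = prim F s \<Longrightarrow> T \<ge> 2 \<Longrightarrow> runs (Prim F) s T s'"
  unfolding runs_def using exec.Prim by blast

lemma runs_Seq: "runs c1 s T1 s1 \<Longrightarrow> runs c2 s1 T2 s2 \<Longrightarrow> runs (Seq c1 c2) s (Suc (T1 + T2)) s2"
  unfolding runs_def using exec.Seq by (meson Suc_le_mono add_mono)

lemma runs_CondT: "P (tops s) \<Longrightarrow> runs c1 s T s' \<Longrightarrow> runs (Cond P c1 c2) s (Suc T) s'"
  unfolding runs_def by (meson Suc_le_mono exec.CondT)

lemma runs_CondF: "\<not> P (tops s) \<Longrightarrow> runs c2 s T s' \<Longrightarrow> runs (Cond P c1 c2) s (Suc T) s'"
  unfolding runs_def by (meson Suc_le_mono exec.CondF)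

text \<open>A loop is verified by exhibiting its trace: \<open>\<sigma> i\<close> is the store
  before round \<open>i\<close>, and \<open>n\<close> is the number of rounds.\<close>

lemma runs_Loop:
  assumes "\<And>i. i < n \<Longrightarrow> P (tops (\<sigma> i))" "\<And>i. i < n \<Longrightarrow> runs c (\<sigma> i) T (\<sigma> (Suc i))"
    "\<not> P (tops (\<sigma> n))"
  shows "runs (Loop P c) (\<sigma> 0) (Suc (n * Suc T)) (\<sigma> n)"
  using assms
proof (induction n arbitrary: \<sigma>)
  case 0
  then have "exec (Loop P c) (\<sigma> 0) 1 (\<sigma> 0)" by (intro exec.LoopF)
  then show ?case unfolding runs_def by (intro exI[of _ 1]) simp
next
  case (Suc n)
  have "runs (Loop P c) (\<sigma> (Suc 0)) (Suc (n * Suc T)) (\<sigma> (Suc n))"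
    by (rule Suc.IH[of "\<lambda>i. \<sigma> (Suc i)"]) (rule Suc.prems; simp)+
  then obtain t2 where t2: "t2 \<le> Suc (n * Suc T)" "exec (Loop P c) (\<sigma> (Suc 0)) t2 (\<sigma> (Suc n))"
    unfolding runs_def by blast
  obtain t1 where t1: "t1 \<le> T" "exec c (\<sigma> 0) t1 (\<sigma> (Suc 0))"
    using Suc.prems(2)[of 0] unfolding runs_def by blast
  have "exec (Loop P c) (\<sigma> 0) (Suc (t1 + t2)) (\<sigma> (Suc n))"
    using exec.LoopT t1 t2 Suc.prems(1)[of 0] by blast
  moreover have "Suc (t1 + t2) \<le> Suc (Suc n * Suc T)" using t1 t2 by simp
  ultimately show ?case unfolding runs_def by blast
qed

text \<open>A primitive costs two units and makes a stack longer by at most two symbols. Hence time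
  bounds are also bounds on the size of results.\<close>

lemma exec_length: "exec c s t s' \<Longrightarrow> okc K N c \<Longrightarrow> length (s' i) \<le> length (s i) + t"
proof (induction rule: exec.induct)
  case (Prim F s)
  have "length (nz w) \<le> 2" if "F (tops s) i = Some w" for w
    unfolding nz_def using Prim that by (auto intro!: order.trans[OF length_filter_le])
  then show ?case by (fastforce simp: prim_def split: option.split)
qed fastforce+

lemma runs_length: "runs c s T s' \<Longrightarrow> ok c \<Longrightarrow> length (s' i) \<le> length (s i) + T"
  unfolding runs_def ok_def using exec_length by (meson add_left_mono order.refl order.trans)

text \<open>Empties \<open>a\<close> and pushes its symbols, mapped by \<open>f\<close>, on all
  stacks in \<open>ds\<close>, in reverse order. The old top \<open>\<tau> i\<close> is repeated
  below the new symbol; on an empty stack it is 0 and gets dropped.\<close>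

definition gmove :: "(nat \<Rightarrow> nat) \<Rightarrow> nat \<Rightarrow> nat list \<Rightarrow> com" where
  "gmove f a ds = Loop (\<lambda>\<tau>. \<tau> a \<noteq> 0)
     (Prim (\<lambda>\<tau> i. if i = a then Some [] else if i \<in> set ds then Some [f (\<tau> a), \<tau> i] else None))"

lemma ok_gmove:
  assumes "\<And>N a. N \<ge> N0 \<Longrightarrow> a < N \<Longrightarrow> f a < N"
  shows "ok (gmove f a ds)"
  unfolding gmove_def
proof (rule ok_Loop[OF local_test_top])
  let ?K = "Suc (Max (set (a # ds)))"
  have K: "i < K" if "i \<in> set (a # ds)" "K \<ge> ?K" for i K
    using Max_ge[of "set (a # ds)" i] that by (meson List.finite_set Suc_le_lessD le_imp_less_Suc order_less_le_trans)
  show "ok (Prim (\<lambda>\<tau> i. if i = a then Some [] else if i \<in> set ds then Some [f (\<tau> a), \<tau> i] else None))"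
    by (rule okI[of ?K N0]) (use K assms in \<open>auto simp: fun_eq_iff\<close>)
qed

lemma prim_gmove:
  assumes "s a = x # xs" "x \<noteq> 0" "f x \<noteq> 0" "\<forall>d\<in>set ds. 0 \<notin> set (s d)" "a \<notin> set ds"
  shows "prim (\<lambda>\<tau> i. if i = a then Some [] else if i \<in> set ds then Some [f (\<tau> a), \<tau> i] else None) s
    = (\<lambda>i. if i = a then xs else if i \<in> set ds then f x # s i else s i)"
proof
  fix i
  show "prim (\<lambda>\<tau> i. if i = a then Some [] else if i \<in> set ds then Some [f (\<tau> a), \<tau> i] else None) s i
    = (if i = a then xs else if i \<in> set ds then f x # s i else s i)"
    using assms by (cases "s i") (auto simp: prim_def nz_def tops_def dest: bspec[of _ _ i])
qed

lemma runs_gmove: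
  assumes "0 \<notin> set (s a)" "\<forall>x. x \<noteq> 0 \<longrightarrow> f x \<noteq> 0" "\<forall>d\<in>set ds. 0 \<notin> set (s d)" "a \<notin> set ds"
    "T \<ge> 3 * length (s a) + 1"
    "s' = (\<lambda>i. if i = a then [] else if i \<in> set ds then rev (map f (s a)) @ s i else s i)"
  shows "runs (gmove f a ds) s T s'"
proof -
  define \<sigma> where "\<sigma> = (\<lambda>k i. if i = a then drop k (s a)
    else if i \<in> set ds then rev (map f (take k (s a))) @ s i else s i)"
  have "runs (gmove f a ds) (\<sigma> 0) (Suc (length (s a) * Suc 2)) (\<sigma> (length (s a)))"
    unfolding gmove_def
  proof (rule runs_Loop)
    fix k assume k: "k < length (s a)"
    then have nz: "s a ! k \<noteq> 0" using assms(1) nth_mem[OF k] by metis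
    have d: "\<sigma> k a = s a ! k # drop (Suc k) (s a)"
      using k by (simp add: \<sigma>_def Cons_nth_drop_Suc)
    then show "tops (\<sigma> k) a \<noteq> 0" using nz by (simp add: tops_def)
    have "f x \<noteq> 0" if "x \<in> set (take k (s a))" for x
      using assms(1,2) in_set_takeD[OF that] by metis
    then have "0 \<notin> f ` set (take k (s a))" by (metis imageE)
    then have "\<forall>d\<in>set ds. 0 \<notin> set (\<sigma> k d)"
      using assms(3,4) by (auto simp: \<sigma>_def)
    then have "prim (\<lambda>\<tau> i. if i = a then Some [] else if i \<in> set ds then Some [f (\<tau> a), \<tau> i] else None) (\<sigma> k)
      = (\<lambda>i. if i = a then drop (Suc k) (s a) else if i \<in> set ds then f (s a ! k) # \<sigma> k i else \<sigma> k i)"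
      using prim_gmove[of "\<sigma> k", OF d] nz assms(2,4) by blast
    also have "\<dots> = \<sigma> (Suc k)"
      using k by (auto simp: \<sigma>_def take_Suc_conv_app_nth fun_eq_iff)
    finally show "runs (Prim (\<lambda>\<tau> i. if i = a then Some [] else if i \<in> set ds then Some [f (\<tau> a), \<tau> i] else None))
      (\<sigma> k) 2 (\<sigma> (Suc k))" by (intro runs_Prim) auto
  next
    show "\<not> tops (\<sigma> (length (s a))) a \<noteq> 0" by (simp add: \<sigma>_def tops_def)
  qed
  moreover have "\<sigma> 0 = s" "\<sigma> (length (s a)) = s'" by (auto simp: \<sigma>_def assms(6) fun_eq_iff)
  ultimately show ?thesis using runs_mono[of "gmove f a ds" s _ s' T] assms(5) by simp
qed

abbreviation move :: "nat \<Rightarrow> nat list \<Rightarrow> com" where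
  "move \<equiv> gmove (\<lambda>x. x)"

lemma ok_move: "ok (move a ds)"
  by (rule ok_gmove[of 0]) simp

lemma runs_clear: "0 \<notin> set (s a) \<Longrightarrow> runs (move a []) s (3 * length (s a) + 1) (s(a := []))"
  by (rule runs_gmove) auto

lemma runs_move:
  "0 \<notin> set (s a) \<Longrightarrow> 0 \<notin> set (s b) \<Longrightarrow> a \<noteq> b \<Longrightarrow>
   runs (move a [b]) s (3 * length (s a) + 1) (s(a := [], b := rev (s a) @ s b))"
  by (rule runs_gmove) auto

fun clear_all :: "nat list \<Rightarrow> com" where
  "clear_all [] = Prim (\<lambda>_ _. None)"
| "clear_all (a # as) = Seq (move a []) (clear_all as)"

lemma ok_None: "ok (Prim (\<lambda>_ _. None))"
  by (rule okI) simp

lemma ok_clear_all: "ok (clear_all as)"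
  by (induction as) (auto intro: ok_Seq ok_move ok_None)

lemma runs_clear_all:
  "\<forall>a\<in>set as. 0 \<notin> set (s a) \<and> length (s a) \<le> n \<Longrightarrow>
   runs (clear_all as) s (length as * (3 * n + 2) + 2) (\<lambda>i. if i \<in> set as then [] else s i)"
proof (induction as arbitrary: s)
  case Nil
  then show ?case by (auto intro!: runs_Prim simp: prim_def)
next
  case (Cons a as)
  have "runs (clear_all as) (s(a := [])) (length as * (3 * n + 2) + 2)
      (\<lambda>i. if i \<in> set as then [] else (s(a := [])) i)"
    by (rule Cons.IH) (use Cons.prems in auto)
  moreover have "runs (move a []) s (3 * n + 1) (s(a := []))"
    by (rule runs_mono[OF runs_clear]) (use Cons.prems in auto)
  ultimately have "runs (clear_all (a # as)) s (Suc ((3 * n + 1) + (length as * (3 * n + 2) + 2)))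
      (\<lambda>i. if i \<in> set as then [] else (s(a := [])) i)"
    by (simp only: clear_all.simps) (rule runs_Seq)
  moreover have "(\<lambda>i. if i \<in> set as then [] else (s(a := [])) i) = (\<lambda>i. if i \<in> set (a # as) then [] else s i)"
    by auto
  ultimately show ?case using runs_mono by simp
qed

section \<open>Polynomial bounds and functions on promise domains\<close>

definition pbd :: "'x set \<Rightarrow> ('x \<Rightarrow> nat) \<Rightarrow> ('x \<Rightarrow> nat) \<Rightarrow> bool" where
  "pbd X m T \<longleftrightarrow> (\<exists>p :: nat poly. \<forall>x\<in>X. T x \<le> poly p (m x))"

lemma poly_nat_mono: "m \<le> n \<Longrightarrow> poly p m \<le> poly p n" for p :: "nat poly"
  by (induction p) (auto intro!: add_mono mult_le_mono)

lemma pbd_le: "pbd X m T \<Longrightarrow> (\<And>x. x \<in> X \<Longrightarrow> T' x \<le> T x) \<Longrightarrow> pbd X m T'"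
  unfolding pbd_def by (meson order.trans)

lemma pbd_const: "pbd X m (\<lambda>_. k)"
  unfolding pbd_def by (rule exI[of _ "[:k:]"]) simp

lemma pbd_id: "pbd X m m"
  unfolding pbd_def by (rule exI[of _ "[:0, 1:]"]) simp

lemma pbd_add:
  assumes "pbd X m T" "pbd X m T'"
  shows "pbd X m (\<lambda>x. T x + T' x)"
proof -
  obtain p q where "\<forall>x\<in>X. T x \<le> poly p (m x)" "\<forall>x\<in>X. T' x \<le> poly q (m x)"
    using assms unfolding pbd_def by blast
  then show ?thesis unfolding pbd_def by (intro exI[of _ "p + q"]) (simp add: add_mono)
qed

lemma pbd_Suc: "pbd X m T \<Longrightarrow> pbd X m (\<lambda>x. Suc (T x))"
  using pbd_add[OF pbd_const[of X m 1], of T] by simp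

lemma pbd_mult:
  assumes "pbd X m T" "pbd X m T'"
  shows "pbd X m (\<lambda>x. T x * T' x)"
proof -
  obtain p q where "\<forall>x\<in>X. T x \<le> poly p (m x)" "\<forall>x\<in>X. T' x \<le> poly q (m x)"
    using assms unfolding pbd_def by blast
  then show ?thesis unfolding pbd_def by (intro exI[of _ "p * q"]) (simp add: mult_le_mono)
qed

lemma pbd_poly:
  assumes "pbd X m T"
  shows "pbd X m (\<lambda>x. poly p (T x))"
proof -
  obtain q where "\<forall>x\<in>X. T x \<le> poly q (m x)" using assms unfolding pbd_def by blast
  then show ?thesis
    unfolding pbd_def by (intro exI[of _ "pcompose p q"]) (simp add: poly_pcompose poly_nat_mono)
qed

lemma pbd_comp:
  assumes "pbd X' m' T" "\<And>x. x \<in> X \<Longrightarrow> h x \<in> X'" "pbd X m (\<lambda>x. m' (h x))"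
  shows "pbd X m (\<lambda>x. T (h x))"
proof -
  from assms(1) obtain p where "\<forall>x\<in>X'. T x \<le> poly p (m' x)" unfolding pbd_def by blast
  then show ?thesis
    by (intro pbd_le[OF pbd_poly[OF assms(3), of p]]) (use assms(2) in blast)
qed

lemma pbd_sum_list: "(\<And>g. g \<in> set gs \<Longrightarrow> pbd X m g) \<Longrightarrow> pbd X m (\<lambda>x. \<Sum>g\<leftarrow>gs. g x)"
  by (induction gs) (auto intro: pbd_const pbd_add)

lemmas pbd_intros = pbd_const pbd_Suc pbd_add pbd_mult pbd_poly

definition enc :: "bool list \<Rightarrow> nat list" where
  "enc w = map (\<lambda>b. if b then 2 else 1) w"

lemma enc_simps [simp]: "enc [] = []" "enc (b # w) = (if b then 2 else 1) # enc w"
  "enc (v @ w) = enc v @ enc w" "length (enc w) = length w" "0 \<notin> set (enc w)"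
  "enc (replicate n b) = replicate n (if b then 2 else 1)"
  "enc (tl w) = tl (enc w)" "enc (drop n w) = drop n (enc w)" "enc w = [] \<longleftrightarrow> w = []"
  by (auto simp: enc_def map_tl drop_map)

lemma enc_inj: "enc v = enc w \<Longrightarrow> v = w"
  unfolding enc_def by (subst (asm) inj_map_eq_map) (auto simp: inj_def split: if_splits)

definition sz :: "('x \<Rightarrow> bool list) list \<Rightarrow> 'x \<Rightarrow> nat" where
  "sz G x = (\<Sum>g\<leftarrow>G. length (g x))"

definition computes :: "'x set \<Rightarrow> ('x \<Rightarrow> bool list) list \<Rightarrow> ('x \<Rightarrow> bool list) \<Rightarrow>
    nat list \<Rightarrow> nat \<Rightarrow> nat \<Rightarrow> com \<Rightarrow> ('x \<Rightarrow> nat) \<Rightarrow> bool" where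
  "computes X G f ins out L c T \<longleftrightarrow> ok c \<and> pbd X (sz G) T \<and>
     (\<forall>x\<in>X. \<forall>s. map s ins = map (\<lambda>g. enc (g x)) G \<longrightarrow> s out = [] \<longrightarrow> (\<forall>i\<ge>L. s i = []) \<longrightarrow>
        runs c s (T x) (s(out := enc (f x))))"

text \<open>
  The arguments \<open>G x\<close> are found in registers \<open>ins\<close>, the registers from \<open>L\<close> on are scratch space, and
  nothing but \<open>out\<close> is changed. Quantifying over the registers spares relocating programs. As the
  domain \<open>X\<close> may consist of arbitrary objects, of which only the words \<open>G x\<close> are accessible, promise
  problems and invariance under isomorphism are both covered.
\<close>

definition PT :: "'x set \<Rightarrow> ('x \<Rightarrow> bool list) list \<Rightarrow> ('x \<Rightarrow> bool list) \<Rightarrow> bool" where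
  "PT X G f \<longleftrightarrow> (\<forall>ins out L. length ins = length G \<longrightarrow> set ins \<subseteq> {..<L} \<longrightarrow> out < L \<longrightarrow>
     out \<notin> set ins \<longrightarrow> (\<exists>c T. computes X G f ins out L c T))"

lemma PTE:
  assumes "PT X G f" "length ins = length G" "set ins \<subseteq> {..<L}" "out < L" "out \<notin> set ins"
  obtains c T where "ok c" "pbd X (sz G) T"
    "\<And>x s. x \<in> X \<Longrightarrow> map s ins = map (\<lambda>g. enc (g x)) G \<Longrightarrow> s out = [] \<Longrightarrow> (\<And>i. i \<ge> L \<Longrightarrow> s i = []) \<Longrightarrow>
        runs c s (T x) (s(out := enc (f x)))"
  using assms unfolding PT_def computes_def by meson

lemma map_upd_notin: "a \<notin> set ins \<Longrightarrow> map (s(a := v)) ins = map s ins"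
  by simp

definition canonical_store :: "('x \<Rightarrow> bool list) list \<Rightarrow> 'x \<Rightarrow> store" where
  "canonical_store G x = (\<lambda>i. if i < length G then enc ((G ! i) x) else [])"

lemma PT_run_canonical:
  assumes "PT X G f"
  shows "\<exists>c T. ok c \<and> pbd X (sz G) T \<and>
    (\<forall>x\<in>X. runs c (canonical_store G x) (T x) ((canonical_store G x)(length G := enc (f x))))"
proof -
  let ?n = "length G"
  obtain c T where c: "ok c" "pbd X (sz G) T" and
    r: "\<And>x s. x \<in> X \<Longrightarrow> map s [0..<?n] = map (\<lambda>g. enc (g x)) G \<Longrightarrow> s ?n = [] \<Longrightarrow>
       (\<And>i. i \<ge> Suc ?n \<Longrightarrow> s i = []) \<Longrightarrow> runs c s (T x) (s(?n := enc (f x)))"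
    by (rule PTE[OF assms, of "[0..<?n]" "Suc ?n" ?n]) auto
  have "runs c (canonical_store G x) (T x) ((canonical_store G x)(?n := enc (f x)))" if "x \<in> X" for x
    by (rule r[OF that]) (auto simp: canonical_store_def intro!: nth_equalityI)
  then show ?thesis using c by blast
qed

text \<open>The output has to be written within the time bound, so its length is polynomial too.
  Compositions obtain the size of intermediate results from this without extra hypotheses.\<close>

lemma PT_length:
  assumes "PT X G f"
  shows "pbd X (sz G) (\<lambda>x. length (f x))"
proof -
  from PT_run_canonical[OF assms] obtain c T where c: "ok c" "pbd X (sz G) T"
    "\<forall>x\<in>X. runs c (canonical_store G x) (T x) ((canonical_store G x)(length G := enc (f x)))"
    by blast
  have "length (f x) \<le> T x" if "x \<in> X" for x
    using runs_length[OF bspec[OF c(3) that] c(1), of "length G"] by (simp add: canonical_store_def)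
  then show ?thesis by (rule pbd_le[OF c(2)])
qed

text \<open>Objects with the same visible words give the same initial store, and execution is
  deterministic. This is how independence of the chosen structure with a given code is
  obtained.\<close>

lemma PT_determines:
  assumes "PT X G f" "x \<in> X" "y \<in> X" "\<And>g. g \<in> set G \<Longrightarrow> g x = g y"
  shows "f x = f y"
proof -
  from PT_run_canonical[OF assms(1)] obtain c T where
    c: "\<forall>x\<in>X. runs c (canonical_store G x) (T x) ((canonical_store G x)(length G := enc (f x)))"
    by blast
  have s: "canonical_store G x = canonical_store G y"
    using assms(4)[OF nth_mem] by (simp add: canonical_store_def fun_eq_iff)
  have "(canonical_store G x)(length G := enc (f x)) = (canonical_store G y)(length G := enc (f y))"
    using bspec[OF c assms(2)] bspec[OF c assms(3)] unfolding s runs_def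
    by (blast intro: exec_deterministic)
  then have "enc (f x) = enc (f y)" by (metis fun_upd_same)
  then show ?thesis by (rule enc_inj)
qed

lemma PTIME_if_PT:
  assumes "PT UNIV [\<lambda>w. w] (\<lambda>w. [w \<in> L])"
  shows "L \<in> PTIME"
proof -
  let ?G = "[\<lambda>w. w] :: (bool list \<Rightarrow> bool list) list"
  from PT_run_canonical[OF assms] obtain c T where c: "ok c" "pbd UNIV (sz ?G) T"
    "\<forall>w. runs c (canonical_store ?G w) (T w) ((canonical_store ?G w)(1 := enc [w \<in> L]))"
    by auto
  obtain p where p: "\<And>w. T w \<le> poly p (length w)"
    using c(2) by (auto simp: pbd_def sz_def)
  show ?thesis
  proof (rule PTIME_I[OF c(1)])
    fix w
    let ?s = "canonical_store ?G w"
    have s0: "(\<lambda>_. [])(0 := map (\<lambda>b. if b then 2 else 1) w) = ?s"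
      by (auto simp: enc_def canonical_store_def)
    from c(3) obtain t where "exec c ?s t (?s(1 := enc [w \<in> L]))" "t \<le> T w"
      unfolding runs_def by blast
    with p[of w] show "\<exists>t s'. exec c ((\<lambda>_. [])(0 := map (\<lambda>b. if b then 2 else 1) w)) t s' \<and>
      t \<le> poly p (length w) \<and> (tops s' 1 = 2 \<longleftrightarrow> w \<in> L)"
      unfolding s0
      by (intro exI[of _ t] exI[of _ "?s(1 := enc [w \<in> L])"]) (auto simp: tops_def)
  qed
qed

lemma PTI:
  assumes "\<And>ins out L. length ins = length G \<Longrightarrow> set ins \<subseteq> {..<L} \<Longrightarrow> out < L \<Longrightarrow> out \<notin> set ins \<Longrightarrow>
    \<exists>c T. ok c \<and> pbd X (sz G) T \<and>
     (\<forall>x\<in>X. \<forall>s. map s ins = map (\<lambda>g. enc (g x)) G \<longrightarrow> s out = [] \<longrightarrow> (\<forall>i\<ge>L. s i = []) \<longrightarrow>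
        runs c s (T x) (s(out := enc (f x))))"
  shows "PT X G f"
  unfolding PT_def computes_def using assms by blast

lemma PT_mono_cong:
  assumes "PT X G f" "Y \<subseteq> X" "\<And>x. x \<in> Y \<Longrightarrow> f x = f' x"
  shows "PT Y G f'"
proof (rule PTI)
  fix ins :: "nat list" and out L :: nat
  assume "length ins = length G" "set ins \<subseteq> {..<L}" "out < L" "out \<notin> set ins"
  with assms(1) obtain c T where c: "ok c" "pbd X (sz G) T" and
    r: "\<And>x s. x \<in> X \<Longrightarrow> map s ins = map (\<lambda>g. enc (g x)) G \<Longrightarrow> s out = [] \<Longrightarrow>
      (\<And>i. i \<ge> L \<Longrightarrow> s i = []) \<Longrightarrow> runs c s (T x) (s(out := enc (f x)))"
    by (rule PTE) blast
  have "pbd Y (sz G) T" using c(2) assms(2) unfolding pbd_def by blast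
  moreover have "runs c s (T x) (s(out := enc (f' x)))"
    if "x \<in> Y" "map s ins = map (\<lambda>g. enc (g x)) G" "s out = []" "\<forall>i\<ge>L. s i = []" for x s
    using r[of x s] assms(2,3) that by auto
  ultimately show "\<exists>c T. ok c \<and> pbd Y (sz G) T \<and>
     (\<forall>x\<in>Y. \<forall>s. map s ins = map (\<lambda>g. enc (g x)) G \<longrightarrow> s out = [] \<longrightarrow> (\<forall>i\<ge>L. s i = []) \<longrightarrow>
        runs c s (T x) (s(out := enc (f' x))))"
    using c(1) by (intro exI[of _ c] exI[of _ T]) simp
qed

lemma PT_mono: "PT X G f \<Longrightarrow> Y \<subseteq> X \<Longrightarrow> PT Y G f"
  by (rule PT_mono_cong) simp_all

lemma PT_cong: "PT X G f \<Longrightarrow> (\<And>x. x \<in> X \<Longrightarrow> f x = f' x) \<Longrightarrow> PT X G f'"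
  by (rule PT_mono_cong[OF _ subset_refl])

section \<open>Closure properties of polynomial-time functions\<close>

lemma sz_ge: "g \<in> set G \<Longrightarrow> length (g x) \<le> sz G x"
  unfolding sz_def by (rule member_le_sum_list) auto

text \<open>Copying must not destroy the source: the word is moved to a scratch register and then
  back onto both its own register and \<open>out\<close>. The two reversals cancel.\<close>

lemma PT_proj:
  assumes "g \<in> set G"
  shows "PT X G g"
proof (rule PTI, goal_cases)
  case (1 ins out L)
  note ins = 1(1,2) and out = 1(3,4)
  from assms obtain k where k: "k < length G" "G ! k = g" by (auto simp: in_set_conv_nth)
  define a where "a = ins ! k"
  have a: "a \<in> set ins" "a < L" "a \<noteq> out" "a \<noteq> L" "out \<noteq> L"
    using ins out k nth_mem[of k ins] subsetD[OF ins(2), of "ins ! k"] by (auto simp: a_def)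
  show ?case
  proof (intro exI conjI ballI allI impI)
    show "ok (Seq (move a [L]) (move L [a, out]))" by (intro ok_Seq ok_move)
    show "pbd X (sz G) (\<lambda>x. Suc ((3 * sz G x + 1) + (3 * sz G x + 1)))"
      by (intro pbd_intros pbd_id)
    fix x s
    assume s: "map s ins = map (\<lambda>g. enc (g x)) G" "s out = []" "\<forall>i\<ge>L. s i = []"
    have sa: "s a = enc (g x)"
      using arg_cong[OF s(1), of "\<lambda>xs. xs ! k"] k ins(1) by (simp add: a_def)
    have le: "length (g x) \<le> sz G x" by (rule sz_ge[OF assms])
    show "runs (Seq (move a [L]) (move L [a, out])) s (Suc ((3 * sz G x + 1) + (3 * sz G x + 1)))
      (s(out := enc (g x)))"
    proof (rule runs_Seq)
      show "runs (move a [L]) s (3 * sz G x + 1) (s(a := [], L := rev (s a) @ s L))"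
        by (rule runs_mono[OF runs_move]) (use sa s(3) a le in auto)
      show "runs (move L [a, out]) (s(a := [], L := rev (s a) @ s L)) (3 * sz G x + 1)
        (s(out := enc (g x)))"
        by (rule runs_gmove) (use sa s a le in \<open>auto simp: fun_eq_iff\<close>)
    qed
  qed
qed

text \<open>The arguments of \<open>f\<close> are computed one after the other into registers from
  \<open>L\<close> on, \<open>f\<close> is run with its scratch space moved behind them, and they
  are cleared again. Their sizes are polynomial by \<open>PT_length\<close>, which bounds the time
  of \<open>f\<close>.\<close>

lemma PT_comp:
  assumes f: "PT X' G' f" and h: "\<And>x. x \<in> X \<Longrightarrow> h x \<in> X'"
    and G': "\<And>g. g \<in> set G' \<Longrightarrow> PT X G (\<lambda>x. g (h x))"
  shows "PT X G (\<lambda>x. f (h x))"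
proof (rule PTI, goal_cases)
  case (1 ins out L)
  note ins = 1(1,2) and out = 1(3,4)
  let ?n = "length G'"
  \<comment> \<open>The store after the first \<open>m\<close> arguments have been computed.\<close>
  define upd where "upd = (\<lambda>m s x i. if L \<le> i \<and> i < L + m then enc ((G' ! (i - L)) (h x)) else s i :: nat list)"
  have "\<exists>c T. ok c \<and> pbd X (sz G) T \<and>
     (\<forall>x\<in>X. \<forall>s. map s ins = map (\<lambda>g. enc (g x)) G \<longrightarrow> (\<forall>i\<ge>L. s i = []) \<longrightarrow>
        runs c s (T x) (upd m s x))" if "m \<le> ?n" for m
    using that
  proof (induction m)
    case 0
    have "runs (Prim (\<lambda>_ _. None)) s 2 (upd 0 s x)" for s x
      by (rule runs_Prim) (auto simp: prim_def upd_def fun_eq_iff)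
    then show ?case
      using ok_None pbd_const[of X "sz G" 2] by (intro exI[of _ "Prim (\<lambda>_ _. None)"] exI[of _ "\<lambda>_. 2"]) blast
  next
    case (Suc m)
    then obtain c1 T1 where c1: "ok c1" "pbd X (sz G) T1"
      "\<forall>x\<in>X. \<forall>s. map s ins = map (\<lambda>g. enc (g x)) G \<longrightarrow> (\<forall>i\<ge>L. s i = []) \<longrightarrow> runs c1 s (T1 x) (upd m s x)"
      by auto
    have "PT X G (\<lambda>x. (G' ! m) (h x))" using Suc.prems by (intro G') simp
    then obtain c2 T2 where c2: "ok c2" "pbd X (sz G) T2" and
      r2: "\<And>x s. x \<in> X \<Longrightarrow> map s ins = map (\<lambda>g. enc (g x)) G \<Longrightarrow> s (L + m) = [] \<Longrightarrow>
        (\<And>i. i \<ge> L + ?n \<Longrightarrow> s i = []) \<Longrightarrow> runs c2 s (T2 x) (s(L + m := enc ((G' ! m) (h x))))"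
      by (rule PTE[of _ _ _ ins "L + ?n" "L + m"]) (use ins Suc.prems in auto)
    show ?case
    proof (intro exI conjI ballI allI impI)
      show "ok (Seq c1 c2)" by (intro ok_Seq c1 c2)
      show "pbd X (sz G) (\<lambda>x. Suc (T1 x + T2 x))" by (intro pbd_intros c1 c2)
      fix x s assume x: "x \<in> X" and s: "map s ins = map (\<lambda>g. enc (g x)) G" "\<forall>i\<ge>L. s i = []"
      show "runs (Seq c1 c2) s (Suc (T1 x + T2 x)) (upd (Suc m) s x)"
      proof (rule runs_Seq)
        show "runs c1 s (T1 x) (upd m s x)" using c1(3) x s by blast
        have "map (upd m s x) ins = map s ins" using ins by (auto simp: upd_def)
        then have "runs c2 (upd m s x) (T2 x) ((upd m s x)(L + m := enc ((G' ! m) (h x))))"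
          by (intro r2[OF x]) (use s Suc.prems in \<open>auto simp: upd_def\<close>)
        also have "(upd m s x)(L + m := enc ((G' ! m) (h x))) = upd (Suc m) s x"
          by (auto simp: upd_def fun_eq_iff)
        finally show "runs c2 (upd m s x) (T2 x) (upd (Suc m) s x)" .
      qed
    qed
  qed
  from this[OF order.refl] obtain c1 T1 where c1: "ok c1" "pbd X (sz G) T1"
    "\<forall>x\<in>X. \<forall>s. map s ins = map (\<lambda>g. enc (g x)) G \<longrightarrow> (\<forall>i\<ge>L. s i = []) \<longrightarrow> runs c1 s (T1 x) (upd ?n s x)"
    by blast
  obtain c2 T2 where c2: "ok c2" "pbd X' (sz G') T2" and
    r2: "\<And>x s. x \<in> X' \<Longrightarrow> map s [L..<L + ?n] = map (\<lambda>g. enc (g x)) G' \<Longrightarrow> s out = [] \<Longrightarrow>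
      (\<And>i. i \<ge> L + ?n \<Longrightarrow> s i = []) \<Longrightarrow> runs c2 s (T2 x) (s(out := enc (f x)))"
    by (rule PTE[OF f, of "[L..<L + ?n]" "L + ?n" out]) (use out in auto)
  let ?c3 = "clear_all [L..<L + ?n]"
  have szh: "pbd X (sz G) (\<lambda>x. sz G' (h x))"
  proof -
    have "pbd X (sz G) (\<lambda>x. \<Sum>k\<leftarrow>map (\<lambda>g x. length (g (h x))) G'. k x)"
      by (rule pbd_sum_list) (use PT_length[OF G'] in auto)
    then show ?thesis by (simp add: sz_def comp_def)
  qed
  show ?case
  proof (intro exI conjI ballI allI impI)
    show "ok (Seq c1 (Seq c2 ?c3))" by (intro ok_Seq c1 c2 ok_clear_all)
    show "pbd X (sz G) (\<lambda>x. Suc (T1 x + Suc (T2 (h x) + (?n * (3 * sz G' (h x) + 2) + 2))))"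
      by (intro pbd_intros c1 szh pbd_comp[OF c2(2) h szh])
    fix x s assume x: "x \<in> X" and s: "map s ins = map (\<lambda>g. enc (g x)) G" "s out = []" "\<forall>i\<ge>L. s i = []"
    show "runs (Seq c1 (Seq c2 ?c3)) s (Suc (T1 x + Suc (T2 (h x) + (?n * (3 * sz G' (h x) + 2) + 2))))
      (s(out := enc (f (h x))))"
    proof (intro runs_Seq)
      show "runs c1 s (T1 x) (upd ?n s x)" using c1(3) x s by blast
      show "runs c2 (upd ?n s x) (T2 (h x)) ((upd ?n s x)(out := enc (f (h x))))"
        by (rule r2[OF h[OF x]]) (use s out in \<open>auto simp: upd_def intro!: nth_equalityI\<close>)
      have "runs ?c3 ((upd ?n s x)(out := enc (f (h x)))) (length [L..<L + ?n] * (3 * sz G' (h x) + 2) + 2)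
        (\<lambda>i. if i \<in> set [L..<L + ?n] then [] else ((upd ?n s x)(out := enc (f (h x)))) i)"
        by (rule runs_clear_all) (use out in \<open>auto simp: upd_def intro!: sz_ge\<close>)
      also have "(\<lambda>i. if i \<in> set [L..<L + ?n] then [] else ((upd ?n s x)(out := enc (f (h x)))) i) =
        s(out := enc (f (h x)))"
        using s(3) out by (auto simp: upd_def fun_eq_iff)
      finally show "runs ?c3 ((upd ?n s x)(out := enc (f (h x)))) (?n * (3 * sz G' (h x) + 2) + 2)
        (s(out := enc (f (h x))))" by (simp only: length_upt diff_add_inverse)
    qed
  qed
qed

definition put :: "nat \<Rightarrow> nat \<Rightarrow> com" where
  "put a v = Prim (\<lambda>\<tau> i. if i = a then Some [v] else None)"

lemma ok_put: "ok (put a v)"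
  unfolding put_def by (rule okI[of "Suc a" "Suc v"]) auto

lemma runs_put: "s a = [] \<Longrightarrow> v \<noteq> 0 \<Longrightarrow> runs (put a v) s 2 (s(a := [v]))"
  unfolding put_def by (rule runs_Prim) (auto simp: prim_def nz_def)

lemma PT_Nil: "PT X G (\<lambda>_. [])"
proof (rule PTI)
  fix ins :: "nat list" and out L :: nat
  have "runs (Prim (\<lambda>_ _. None)) s 2 (s(out := enc []))" if "s out = []" for s
    by (rule runs_Prim) (use that in \<open>auto simp: prim_def\<close>)
  then show "\<exists>c T. ok c \<and> pbd X (sz G) T \<and>
     (\<forall>x\<in>X. \<forall>s. map s ins = map (\<lambda>g. enc (g x)) G \<longrightarrow> s out = [] \<longrightarrow> (\<forall>i\<ge>L. s i = []) \<longrightarrow>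
        runs c s (T x) (s(out := enc [])))"
    using ok_None pbd_const[of X "sz G" 2] by (intro exI[of _ "Prim (\<lambda>_ _. None)"] exI[of _ "\<lambda>_. 2"]) blast
qed

lemma PT_single: "PT X G (\<lambda>_. [b])"
proof (rule PTI)
  fix ins :: "nat list" and out L :: nat
  have "runs (put out (if b then 2 else 1)) s 2 (s(out := enc [b]))" if "s out = []" for s
    using runs_put[of s out "if b then 2 else 1"] that by simp
  then show "\<exists>c T. ok c \<and> pbd X (sz G) T \<and>
     (\<forall>x\<in>X. \<forall>s. map s ins = map (\<lambda>g. enc (g x)) G \<longrightarrow> s out = [] \<longrightarrow> (\<forall>i\<ge>L. s i = []) \<longrightarrow>
        runs c s (T x) (s(out := enc [b])))"
    using ok_put pbd_const[of X "sz G" 2]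
    by (intro exI[of _ "put out (if b then 2 else 1)"] exI[of _ "\<lambda>_. 2"]) blast
qed

text \<open>The second word is computed first, since the first one must end up on top of it. The
  detour through another register restores the order of the symbols.\<close>

lemma PT_append:
  assumes f: "PT X G f" and g: "PT X G g"
  shows "PT X G (\<lambda>x. f x @ g x)"
proof (rule PTI, goal_cases)
  case (1 ins out L)
  note ins = 1(1,2) and out = 1(3,4)
  obtain c1 T1 where c1: "ok c1" "pbd X (sz G) T1" and
    r1: "\<And>x s. x \<in> X \<Longrightarrow> map s ins = map (\<lambda>g. enc (g x)) G \<Longrightarrow> s out = [] \<Longrightarrow>
      (\<And>i. i \<ge> L \<Longrightarrow> s i = []) \<Longrightarrow> runs c1 s (T1 x) (s(out := enc (g x)))"
    by (rule PTE[OF g ins out]) blast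
  obtain c2 T2 where c2: "ok c2" "pbd X (sz G) T2" and
    r2: "\<And>x s. x \<in> X \<Longrightarrow> map s ins = map (\<lambda>g. enc (g x)) G \<Longrightarrow> s L = [] \<Longrightarrow>
      (\<And>i. i \<ge> Suc L \<Longrightarrow> s i = []) \<Longrightarrow> runs c2 s (T2 x) (s(L := enc (f x)))"
    by (rule PTE[OF f ins(1), of "Suc L" L]) (use ins in auto)
  note pf = PT_length[OF f]
  show ?case
  proof (intro exI conjI ballI allI impI)
    show "ok (Seq c1 (Seq c2 (Seq (move L [Suc L]) (move (Suc L) [out]))))"
      by (intro ok_Seq ok_move c1 c2)
    show "pbd X (sz G) (\<lambda>x. Suc (T1 x + Suc (T2 x + Suc ((3 * length (f x) + 1) + (3 * length (f x) + 1)))))"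
      by (intro pbd_intros c1 c2 pf)
    fix x s assume x: "x \<in> X" and s: "map s ins = map (\<lambda>g. enc (g x)) G" "s out = []" "\<forall>i\<ge>L. s i = []"
    let ?s1 = "s(out := enc (g x))"
    let ?s2 = "?s1(L := enc (f x))"
    let ?s3 = "?s1(Suc L := rev (enc (f x)))"
    show "runs (Seq c1 (Seq c2 (Seq (move L [Suc L]) (move (Suc L) [out])))) s
      (Suc (T1 x + Suc (T2 x + Suc ((3 * length (f x) + 1) + (3 * length (f x) + 1)))))
      (s(out := enc (f x @ g x)))"
    proof (intro runs_Seq)
      show "runs c1 s (T1 x) ?s1" by (rule r1[OF x]) (use s in auto)
      have "map ?s1 ins = map s ins" by (rule map_upd_notin[OF out(2)])
      then show "runs c2 ?s1 (T2 x) ?s2" by (intro r2[OF x]) (use s out in auto)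
      show "runs (move L [Suc L]) ?s2 (3 * length (f x) + 1) ?s3"
        by (rule runs_gmove) (use s out in \<open>auto simp: fun_eq_iff\<close>)
      show "runs (move (Suc L) [out]) ?s3 (3 * length (f x) + 1) (s(out := enc (f x @ g x)))"
        by (rule runs_gmove) (use s out in \<open>auto simp: fun_eq_iff\<close>)
    qed
  qed
qed

lemma PT_tl:
  assumes f: "PT X G f"
  shows "PT X G (\<lambda>x. tl (f x))"
proof (rule PTI, goal_cases)
  case (1 ins out L)
  note ins = 1(1,2) and out = 1(3,4)
  obtain c1 T1 where c1: "ok c1" "pbd X (sz G) T1" and
    r1: "\<And>x s. x \<in> X \<Longrightarrow> map s ins = map (\<lambda>g. enc (g x)) G \<Longrightarrow> s out = [] \<Longrightarrow>
      (\<And>i. i \<ge> L \<Longrightarrow> s i = []) \<Longrightarrow> runs c1 s (T1 x) (s(out := enc (f x)))"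
    by (rule PTE[OF f ins out]) blast
  let ?c2 = "Prim (\<lambda>\<tau> i. if i = out then Some [] else None)"
  show ?case
  proof (intro exI conjI ballI allI impI)
    have "ok ?c2" by (rule okI[of "Suc out" 0]) auto
    then show "ok (Seq c1 ?c2)" by (intro ok_Seq c1)
    show "pbd X (sz G) (\<lambda>x. Suc (T1 x + 2))" by (intro pbd_intros c1)
    fix x s assume x: "x \<in> X" and s: "map s ins = map (\<lambda>g. enc (g x)) G" "s out = []" "\<forall>i\<ge>L. s i = []"
    show "runs (Seq c1 ?c2) s (Suc (T1 x + 2)) (s(out := enc (tl (f x))))"
    proof (rule runs_Seq)
      show "runs c1 s (T1 x) (s(out := enc (f x)))" by (rule r1[OF x]) (use s in auto)
      show "runs ?c2 (s(out := enc (f x))) 2 (s(out := enc (tl (f x))))"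
        by (rule runs_Prim) (auto simp: prim_def nz_def)
    qed
  qed
qed

definition head_sym :: "bool list \<Rightarrow> nat" where
  "head_sym w = (case w of [] \<Rightarrow> 0 | b # _ \<Rightarrow> if b then 2 else 1)"

text \<open>Each branch has to be computable only on its part of the domain. Thus a test can guard a
  computation that is meaningful only if the test succeeds.\<close>

lemma PT_case:
  assumes b: "PT X G b" and f: "PT {x \<in> X. Q (head_sym (b x))} G f"
    and g: "PT {x \<in> X. \<not> Q (head_sym (b x))} G g"
  shows "PT X G (\<lambda>x. if Q (head_sym (b x)) then f x else g x)"
proof (rule PTI, goal_cases)
  case (1 ins out L)
  note ins = 1(1,2) and out = 1(3,4)
  let ?Y = "{x \<in> X. Q (head_sym (b x))}" and ?Z = "{x \<in> X. \<not> Q (head_sym (b x))}"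
  obtain c1 T1 where c1: "ok c1" "pbd ?Y (sz G) T1" and
    r1: "\<And>x s. x \<in> ?Y \<Longrightarrow> map s ins = map (\<lambda>g. enc (g x)) G \<Longrightarrow> s out = [] \<Longrightarrow>
      (\<And>i. i \<ge> L \<Longrightarrow> s i = []) \<Longrightarrow> runs c1 s (T1 x) (s(out := enc (f x)))"
    by (rule PTE[OF f ins out]) blast
  obtain c2 T2 where c2: "ok c2" "pbd ?Z (sz G) T2" and
    r2: "\<And>x s. x \<in> ?Z \<Longrightarrow> map s ins = map (\<lambda>g. enc (g x)) G \<Longrightarrow> s out = [] \<Longrightarrow>
      (\<And>i. i \<ge> L \<Longrightarrow> s i = []) \<Longrightarrow> runs c2 s (T2 x) (s(out := enc (g x)))"
    by (rule PTE[OF g ins out]) blast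
  obtain c0 T0 where c0: "ok c0" "pbd X (sz G) T0" and
    r0: "\<And>x s. x \<in> X \<Longrightarrow> map s ins = map (\<lambda>g. enc (g x)) G \<Longrightarrow> s L = [] \<Longrightarrow>
      (\<And>i. i \<ge> Suc L \<Longrightarrow> s i = []) \<Longrightarrow> runs c0 s (T0 x) (s(L := enc (b x)))"
    by (rule PTE[OF b ins(1), of "Suc L" L]) (use ins in auto)
  \<comment> \<open>The bounds \<open>T1\<close> and \<open>T2\<close> are known only on the two
    parts of the domain. They are replaced by polynomials of the size, which can be added on all of
    \<open>X\<close>.\<close>
  obtain p1 where p1: "\<And>x. x \<in> ?Y \<Longrightarrow> T1 x \<le> poly p1 (sz G x)" using c1(2) unfolding pbd_def by blast
  obtain p2 where p2: "\<And>x. x \<in> ?Z \<Longrightarrow> T2 x \<le> poly p2 (sz G x)" using c2(2) unfolding pbd_def by blast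
  note pb = PT_length[OF b]
  let ?c = "Seq c0 (Cond (\<lambda>\<tau>. Q (\<tau> L)) (Seq (move L []) c1) (Seq (move L []) c2))"
  let ?T = "\<lambda>x. Suc ((3 * length (b x) + 1) + (poly p1 (sz G x) + poly p2 (sz G x)))"
  show ?case
  proof (intro exI conjI ballI allI impI)
    show "ok ?c" by (intro ok_Seq ok_Cond ok_move local_test_top c0 c1 c2)
    show "pbd X (sz G) (\<lambda>x. Suc (T0 x + Suc (?T x)))" by (intro pbd_intros pbd_id c0 pb)
    fix x s assume x: "x \<in> X" and s: "map s ins = map (\<lambda>g. enc (g x)) G" "s out = []" "\<forall>i\<ge>L. s i = []"
    let ?s0 = "s(L := enc (b x))"
    have t: "tops ?s0 L = head_sym (b x)"
      by (auto simp: tops_def head_sym_def split: list.split)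
    show "runs ?c s (Suc (T0 x + Suc (?T x))) (s(out := enc (if Q (head_sym (b x)) then f x else g x)))"
    proof (rule runs_Seq)
      show "runs c0 s (T0 x) ?s0" by (rule r0[OF x]) (use s in auto)
      have clr: "runs (move L []) ?s0 (3 * length (b x) + 1) s"
        by (rule runs_gmove) (use s in \<open>auto simp: fun_eq_iff\<close>)
      show "runs (Cond (\<lambda>\<tau>. Q (\<tau> L)) (Seq (move L []) c1) (Seq (move L []) c2)) ?s0 (Suc (?T x))
        (s(out := enc (if Q (head_sym (b x)) then f x else g x)))"
      proof (cases "Q (head_sym (b x))")
        case True
        have "runs c1 s (T1 x) (s(out := enc (f x)))" by (rule r1) (use x True s in auto)
        then have "runs c1 s (poly p1 (sz G x) + poly p2 (sz G x)) (s(out := enc (f x)))"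
          by (rule runs_mono) (use p1[of x] x True in auto)
        from runs_Seq[OF clr this] show ?thesis
          by (intro runs_CondT) (use t True in auto)
      next
        case False
        have "runs c2 s (T2 x) (s(out := enc (g x)))" by (rule r2) (use x False s in auto)
        then have "runs c2 s (poly p1 (sz G x) + poly p2 (sz G x)) (s(out := enc (g x)))"
          by (rule runs_mono) (use p2[of x] x False in auto)
        from runs_Seq[OF clr this] show ?thesis
          by (intro runs_CondF) (use t False in auto)
      qed
    qed
  qed
qed

text \<open>The body sees the original arguments, the round number in unary and the current value.
  The bound \<open>q\<close> on all intermediate values is what keeps the total time polynomial: a
  polynomial-time body could double the length in each round.\<close>

lemma PT_iterate:
  fixes y :: "'x \<Rightarrow> nat \<Rightarrow> bool list"
  assumes cnt: "PT X G cnt" and y0: "PT X G (\<lambda>x. y x 0)"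
    and body: "PT {(x, i). x \<in> X \<and> i < length (cnt x)}
      (map (\<lambda>g (x, i). g x) G @ [\<lambda>(x, i). replicate i True, \<lambda>(x, i). y x i]) (\<lambda>(x, i). y x (Suc i))"
    and bd: "pbd X (sz G) q" "\<And>x i. x \<in> X \<Longrightarrow> i \<le> length (cnt x) \<Longrightarrow> length (y x i) \<le> q x"
  shows "PT X G (\<lambda>x. y x (length (cnt x)))"
proof (rule PTI, goal_cases)
  case (1 ins out L)
  note ins = 1(1,2) and out = 1(3,4)
  let ?X = "{(x, i). x \<in> X \<and> i < length (cnt x)}"
  let ?G = "map (\<lambda>g (x, i). g x) G @ [\<lambda>(x, i). replicate i True, \<lambda>(x, i). y x i]"
  obtain c0 T0 where c0: "ok c0" "pbd X (sz G) T0" and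
    r0: "\<And>x s. x \<in> X \<Longrightarrow> map s ins = map (\<lambda>g. enc (g x)) G \<Longrightarrow> s L = [] \<Longrightarrow>
      (\<And>i. i \<ge> Suc L \<Longrightarrow> s i = []) \<Longrightarrow> runs c0 s (T0 x) (s(L := enc (cnt x)))"
    by (rule PTE[OF cnt ins(1), of "Suc L" L]) (use ins in auto)
  obtain c1 T1 where c1: "ok c1" "pbd X (sz G) T1" and
    r1: "\<And>x s. x \<in> X \<Longrightarrow> map s ins = map (\<lambda>g. enc (g x)) G \<Longrightarrow> s (L + 2) = [] \<Longrightarrow>
      (\<And>i. i \<ge> L + 3 \<Longrightarrow> s i = []) \<Longrightarrow> runs c1 s (T1 x) (s(L + 2 := enc (y x 0)))"
    by (rule PTE[OF y0 ins(1), of "L + 3" "L + 2"]) (use ins in auto)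
  obtain c2 T2 where c2: "ok c2" "pbd ?X (sz ?G) T2" and
    r2: "\<And>x s. x \<in> ?X \<Longrightarrow> map s (ins @ [L + 1, L + 2]) = map (\<lambda>g. enc (g x)) ?G \<Longrightarrow> s (L + 3) = [] \<Longrightarrow>
      (\<And>i. i \<ge> L + 4 \<Longrightarrow> s i = []) \<Longrightarrow> runs c2 s (T2 x) (s(L + 3 := enc ((\<lambda>(x, i). y x (Suc i)) x)))"
    by (rule PTE[OF body, of "ins @ [L + 1, L + 2]" "L + 4" "L + 3"]) (use ins in auto)
  obtain p2 where p2: "\<And>x. x \<in> ?X \<Longrightarrow> T2 x \<le> poly p2 (sz ?G x)" using c2(2) unfolding pbd_def by blast
  have szG: "sz ?G (x, i) = sz G x + i + length (y x i)" for x i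
    by (simp add: sz_def comp_def)
  let ?step = "Prim (\<lambda>\<tau> i. if i = L then Some [] else if i = L + 1 then Some [2, \<tau> i] else None)"
  let ?b = "Seq c2 (Seq (move (L + 2) []) (Seq (move (L + 3) [L + 4]) (Seq (move (L + 4) [L + 2]) ?step)))"
  let ?loop = "Loop (\<lambda>\<tau>. \<tau> L \<noteq> 0) ?b"
  let ?fin = "Seq (move (L + 1) []) (Seq (move (L + 2) [L + 4]) (move (L + 4) [out]))"
  let ?c = "Seq c0 (Seq c1 (Seq ?loop ?fin))"
  let ?m = "\<lambda>x. 3 * q x + 1"
  let ?Tb = "\<lambda>x. Suc (poly p2 (sz G x + length (cnt x) + q x) + Suc (?m x + Suc (?m x + Suc (?m x + 2))))"
  let ?T = "\<lambda>x. Suc (T0 x + Suc (T1 x + Suc (Suc (length (cnt x) * Suc (?Tb x)) +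
      Suc ((3 * length (cnt x) + 1) + Suc (?m x + ?m x)))))"
  show ?case
  proof (intro exI conjI ballI allI impI)
    have "ok ?step" by (rule okI[of "L + 2" 3]) (auto simp: fun_eq_iff)
    then show "ok ?c" by (intro ok_Seq ok_Loop local_test_top ok_move c0 c1 c2)
    show "pbd X (sz G) ?T" by (intro pbd_intros pbd_id c0 c1 bd(1) PT_length[OF cnt])
    fix x s assume x: "x \<in> X" and s: "map s ins = map (\<lambda>g. enc (g x)) G" "s out = []" "\<forall>i\<ge>L. s i = []"
    \<comment> \<open>Before round \<open>i\<close>, register \<open>L\<close> holds the rest of the
      counter, \<open>L + 1\<close> the round number in unary and \<open>L + 2\<close> the current
      value. \<open>L + 3\<close> receives the next value, which reaches \<open>L + 2\<close>
      through \<open>L + 4\<close>, so that its order is kept.\<close>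
    define \<sigma> where "\<sigma> = (\<lambda>i. s(L := enc (drop i (cnt x)), L + 1 := replicate i (2::nat), L + 2 := enc (y x i)))"
    let ?n = "length (cnt x)"
    have ins_\<sigma>: "map (\<sigma> i) ins = map s ins" for i
      using ins(2) by (auto simp: \<sigma>_def)
    show "runs ?c s (?T x) (s(out := enc (y x ?n)))"
    proof (intro runs_Seq)
      show "runs c0 s (T0 x) (s(L := enc (cnt x)))" by (rule r0[OF x]) (use s in auto)
      have "map (s(L := enc (cnt x))) ins = map s ins" using ins(2) by (intro map_upd_notin) auto
      then have "runs c1 (s(L := enc (cnt x))) (T1 x) ((s(L := enc (cnt x)))(L + 2 := enc (y x 0)))"
        by (intro r1[OF x]) (use s in auto)
      also have "(s(L := enc (cnt x)))(L + 2 := enc (y x 0)) = \<sigma> 0"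
        using s(3) by (auto simp: \<sigma>_def fun_eq_iff)
      finally show "runs c1 (s(L := enc (cnt x))) (T1 x) (\<sigma> 0)" .
      show "runs ?loop (\<sigma> 0) (Suc (?n * Suc (?Tb x))) (\<sigma> ?n)"
      proof (rule runs_Loop)
        fix i assume i: "i < ?n"
        then have dr: "drop i (cnt x) = cnt x ! i # drop (Suc i) (cnt x)" by (simp add: Cons_nth_drop_Suc)
        then show "tops (\<sigma> i) L \<noteq> 0" by (simp add: \<sigma>_def tops_def del: enc_simps(8))
        have q: "length (y x i) \<le> q x" "length (y x (Suc i)) \<le> q x"
          using i by (auto intro!: bd(2)[OF x])
        let ?s1 = "(\<sigma> i)(L + 3 := enc (y x (Suc i)))"
        let ?s2 = "?s1(L + 2 := [])"
        let ?s3 = "?s2(L + 3 := [], L + 4 := rev (enc (y x (Suc i))))"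
        let ?s4 = "(\<sigma> i)(L + 2 := enc (y x (Suc i)))"
        show "runs ?b (\<sigma> i) (?Tb x) (\<sigma> (Suc i))"
        proof (intro runs_Seq)
          have "T2 (x, i) \<le> poly p2 (sz ?G (x, i))" using p2[of "(x, i)"] x i by simp
          also have "\<dots> \<le> poly p2 (sz G x + ?n + q x)"
            unfolding szG by (rule poly_nat_mono) (use q i in simp)
          finally have T2: "T2 (x, i) \<le> poly p2 (sz G x + ?n + q x)" .
          have "runs c2 (\<sigma> i) (T2 (x, i)) ((\<sigma> i)(L + 3 := enc ((\<lambda>(x, i). y x (Suc i)) (x, i))))"
          proof (rule r2)
            show "map (\<sigma> i) (ins @ [L + 1, L + 2]) = map (\<lambda>g. enc (g (x, i))) ?G"
              using s(1) ins_\<sigma>[of i] by (simp add: \<sigma>_def)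
          qed (use x i s in \<open>auto simp: \<sigma>_def\<close>)
          from runs_mono[OF this T2] show "runs c2 (\<sigma> i) (poly p2 (sz G x + ?n + q x)) ?s1" by simp
          show "runs (move (L + 2) []) ?s1 (?m x) ?s2"
            by (rule runs_gmove) (use s q in \<open>auto simp: fun_eq_iff \<sigma>_def\<close>)
          show "runs (move (L + 3) [L + 4]) ?s2 (?m x) ?s3"
            by (rule runs_gmove) (use s q in \<open>auto simp: fun_eq_iff \<sigma>_def\<close>)
          show "runs (move (L + 4) [L + 2]) ?s3 (?m x) ?s4"
            by (rule runs_gmove) (use s q in \<open>auto simp: fun_eq_iff \<sigma>_def\<close>)
          \<comment> \<open>In round 0 the register \<open>L + 1\<close> is still empty: the old top
            repeated by the push is then 0 and gets dropped.\<close>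
          show "runs ?step ?s4 2 (\<sigma> (Suc i))"
            by (rule runs_Prim, cases i) (auto simp: prim_def nz_def \<sigma>_def tops_def fun_eq_iff tl_drop drop_Suc
                split: list.split)
        qed
      next
        show "\<not> tops (\<sigma> ?n) L \<noteq> 0" by (simp add: \<sigma>_def tops_def)
      qed
      have q: "length (y x ?n) \<le> q x" by (intro bd(2)[OF x]) simp
      let ?s1 = "s(L + 2 := enc (y x ?n))"
      let ?s2 = "s(L + 4 := rev (enc (y x ?n)))"
      show "runs (move (L + 1) []) (\<sigma> ?n) (3 * ?n + 1) ?s1"
        by (rule runs_gmove) (use s in \<open>auto simp: fun_eq_iff \<sigma>_def\<close>)
      show "runs (move (L + 2) [L + 4]) ?s1 (?m x) ?s2"
        by (rule runs_gmove) (use s q in \<open>auto simp: fun_eq_iff\<close>)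
      show "runs (move (L + 4) [out]) ?s2 (?m x) (s(out := enc (y x ?n)))"
        by (rule runs_gmove) (use s q out in \<open>auto simp: fun_eq_iff\<close>)
    qed
  qed
qed

subsection \<open>Running Turing machines as subroutines\<close>

text \<open>
  A tape is represented by two stacks, with the scanned cell on top of the right one. Symbols are
  shifted by one, so that visited blank cells can be stored.
\<close>

definition cell :: "nat list \<Rightarrow> nat \<Rightarrow> nat" where
  "cell xs n = (if n < length xs then xs ! n - 1 else 0)"

definition two_stack_tape :: "nat list \<Rightarrow> nat list \<Rightarrow> tape" where
  "two_stack_tape l r = (\<lambda>i. if 0 \<le> i then cell r (nat i) else cell l (nat (- i - 1)))"

lemma cell_simps: "cell (x # xs) 0 = x - 1" "cell (x # xs) (Suc n) = cell xs n" "cell [] n = 0"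
  "cell (tl xs) n = cell xs (Suc n)"
  by (auto simp: cell_def nth_tl)

lemma cell_Cons: "cell (x # xs) n = (if n = 0 then x - 1 else cell xs (n - 1))"
  by (cases n) (auto simp: cell_simps)

lemma two_stack_Stay: "act (a, Stay) (two_stack_tape l r) = two_stack_tape l (Suc a # tl r)"
  by (auto simp: two_stack_tape_def fun_eq_iff cell_Cons cell_simps)

lemma two_stack_Right: "act (a, MoveRight) (two_stack_tape l r) = two_stack_tape (Suc a # l) (tl r)"
proof
  fix i :: int
  consider "i \<ge> 0" | "i = -1" | "i < -1" by linarith
  then show "act (a, MoveRight) (two_stack_tape l r) i = two_stack_tape (Suc a # l) (tl r) i"
  proof cases
    case 3
    then have "nat (- i - 1) - 1 = nat (- (i + 1) - 1)" "nat (- i - 1) \<noteq> 0" by linarith+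
    then show ?thesis using 3 by (simp add: two_stack_tape_def cell_Cons)
  qed (auto simp: two_stack_tape_def cell_Cons cell_simps nat_add_distrib)
qed

text \<open>If the left stack is empty, the head enters a blank cell not visited before. It is
  stored as 1, the shifted blank.\<close>

lemma two_stack_Left:
  "act (a, MoveLeft) (two_stack_tape l r) =
   two_stack_tape (tl l) ((case l of [] \<Rightarrow> 1 | x # _ \<Rightarrow> x) # Suc a # tl r)"
proof
  fix i :: int
  consider "i < 0" | "i = 0" | "i = 1" | "i > 1" by linarith
  then show "act (a, MoveLeft) (two_stack_tape l r) i =
   two_stack_tape (tl l) ((case l of [] \<Rightarrow> 1 | x # _ \<Rightarrow> x) # Suc a # tl r) i"
  proof cases
    case 1
    then have "nat (- (i - 1) - 1) = Suc (nat (- i - 1))" by linarith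
    then show ?thesis using 1 by (simp add: two_stack_tape_def cell_simps)
  next
    case 4
    then have "nat (i - 1) = Suc (nat i - 1 - 1)" "\<not> nat i \<le> 1" by linarith+
    then show ?thesis using 4 by (simp add: two_stack_tape_def cell_Cons cell_simps)
  qed (auto simp: two_stack_tape_def cell_Cons cell_def split: list.split)
qed

locale subroutine =
  fixes M :: tm and L :: nat
  assumes wf: "wf_tm M"
begin

abbreviation k where "k \<equiv> tm_tapes M"
text \<open>Register \<open>L\<close> holds the state plus one and \<open>L + 1\<close> the input
  word. Each tape has the two registers \<open>lft j\<close> and \<open>rgt j\<close> after
  these.\<close>

definition lft where "lft j = L + 2 + 2 * j"
definition rgt where "rgt j = L + 3 + 2 * j"

definition rd :: "(nat \<Rightarrow> nat) \<Rightarrow> nat list" where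
  "rd \<tau> = map (\<lambda>j. \<tau> (rgt j) - 1) [0..<k]"

text \<open>Well-formedness of \<open>M\<close> says nothing about transitions outside its states
  and symbols, but a primitive must stay within the alphabet for all tops. On other tops it does
  nothing.\<close>

definition legal :: "(nat \<Rightarrow> nat) \<Rightarrow> bool" where
  "legal \<tau> \<longleftrightarrow> \<tau> L - 1 < tm_states M \<and> set (rd \<tau>) \<subseteq> {..<tm_symbols M}"

definition acts :: "(nat \<Rightarrow> nat) \<Rightarrow> nat \<Rightarrow> nat \<times> move" where
  "acts \<tau> j = snd (tm_delta M (\<tau> L - 1) (rd \<tau>)) ! j"

definition left_word :: "(nat \<Rightarrow> nat) \<Rightarrow> nat \<Rightarrow> nat list option" where
  "left_word \<tau> j = (case acts \<tau> j of (a, MoveLeft) \<Rightarrow> Some [] | (a, Stay) \<Rightarrow> None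
     | (a, MoveRight) \<Rightarrow> Some [Suc a, \<tau> (lft j)])"

definition right_word :: "(nat \<Rightarrow> nat) \<Rightarrow> nat \<Rightarrow> nat list option" where
  "right_word \<tau> j = (case acts \<tau> j of
       (a, MoveLeft) \<Rightarrow> Some [if \<tau> (lft j) = 0 then 1 else \<tau> (lft j), Suc a]
     | (a, Stay) \<Rightarrow> Some [Suc a] | (a, MoveRight) \<Rightarrow> Some [])"

text \<open>A step of \<open>M\<close> affects only the ends of the two stacks of each tape, by at
  most two symbols, so it is one primitive.\<close>

definition step_words :: "(nat \<Rightarrow> nat) \<Rightarrow> nat \<Rightarrow> nat list option" where
  "step_words \<tau> i = (if \<not> legal \<tau> then None
     else if i = L then Some [Suc (fst (tm_delta M (\<tau> L - 1) (rd \<tau>)))]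
     else if L + 2 \<le> i \<and> i < L + 2 + 2 * k then
       (if even (i - L) then left_word \<tau> ((i - L - 2) div 2) else right_word \<tau> ((i - L - 2) div 2))
     else None)"

lemma step_words_simps:
  assumes "legal \<tau>"
  shows "step_words \<tau> L = Some [Suc (fst (tm_delta M (\<tau> L - 1) (rd \<tau>)))]"
    "j < k \<Longrightarrow> step_words \<tau> (lft j) = left_word \<tau> j"
    "j < k \<Longrightarrow> step_words \<tau> (rgt j) = right_word \<tau> j"
proof -
  show "step_words \<tau> L = Some [Suc (fst (tm_delta M (\<tau> L - 1) (rd \<tau>)))]"
    using assms by (simp add: step_words_def)
  assume j: "j < k"
  have "(Suc (2 + 2 * j) - 2) div 2 = j" by simp
  then show "step_words \<tau> (rgt j) = right_word \<tau> j"
    using assms j by (simp add: step_words_def rgt_def)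
  show "step_words \<tau> (lft j) = left_word \<tau> j"
    using assms j by (simp add: step_words_def lft_def)
qed

lemma delta:
  assumes "legal \<tau>"
  shows "fst (tm_delta M (\<tau> L - 1) (rd \<tau>)) < tm_states M"
    "length (snd (tm_delta M (\<tau> L - 1) (rd \<tau>))) = k" "j < k \<Longrightarrow> fst (acts \<tau> j) < tm_symbols M"
proof -
  obtain q' as where d: "tm_delta M (\<tau> L - 1) (rd \<tau>) = (q', as)" by force
  have "case tm_delta M (\<tau> L - 1) (rd \<tau>) of (q', as) \<Rightarrow>
          q' < tm_states M \<and> length as = tm_tapes M \<and> (\<forall>(a, m) \<in> set as. a < tm_symbols M)"
    using wf assms unfolding wf_tm_def legal_def by (simp add: rd_def)
  then have as: "q' < tm_states M" "length as = k" "\<And>a. a \<in> set as \<Longrightarrow> fst a < tm_symbols M"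
    unfolding d by (auto simp: case_prod_beta)
  then show "fst (tm_delta M (\<tau> L - 1) (rd \<tau>)) < tm_states M"
    "length (snd (tm_delta M (\<tau> L - 1) (rd \<tau>))) = k"
    unfolding d by simp_all
  show "j < k \<Longrightarrow> fst (acts \<tau> j) < tm_symbols M"
    unfolding acts_def d using as(2,3) by simp
qed

lemma ok_step: "ok (Prim step_words)"
proof (rule okI)
  fix K N assume K: "K \<ge> L + 3 + 2 * k" and N: "N \<ge> Suc (tm_states M + tm_symbols M)"
  have w: "length w \<le> 2 \<and> ((\<forall>j. \<tau> j < N) \<longrightarrow> set w \<subseteq> {..<N})"
    if "legal \<tau>" "j < k" "left_word \<tau> j = Some w \<or> right_word \<tau> j = Some w" for \<tau> j w
    using that delta(3)[of \<tau> j] N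
    by (auto simp: left_word_def right_word_def split: prod.splits move.splits if_splits)
  have 1: "i < K \<and> length w \<le> 2 \<and> ((\<forall>j. \<tau> j < N) \<longrightarrow> set w \<subseteq> {..<N})" if "step_words \<tau> i = Some w" for \<tau> i w
  proof -
    have l: "legal \<tau>" using that by (auto simp: step_words_def split: if_splits)
    show ?thesis
    proof (cases "i = L")
      case True
      then show ?thesis using that l delta(1)[OF l] K N by (auto simp: step_words_def)
    next
      case False
      then have i: "L + 2 \<le> i" "i < L + 2 + 2 * k"
        and "left_word \<tau> ((i - L - 2) div 2) = Some w \<or> right_word \<tau> ((i - L - 2) div 2) = Some w"
        using that by (auto simp: step_words_def split: if_splits)
      moreover have "(i - L - 2) div 2 < k" using i by linarith
      ultimately show ?thesis using w[OF l] K by fastforce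
    qed
  qed
  have 2: "step_words \<tau> = step_words \<tau>'" if "\<forall>i<K. \<tau> i = \<tau>' i" for \<tau> \<tau>'
  proof -
    have lr: "\<tau> (lft j) = \<tau>' (lft j)" "\<tau> (rgt j) = \<tau>' (rgt j)" if "j < k" for j
      using that \<open>\<forall>i<K. \<tau> i = \<tau>' i\<close> K by (auto simp: lft_def rgt_def)
    have L: "\<tau> L = \<tau>' L" using that K by auto
    have rd: "rd \<tau> = rd \<tau>'" using lr by (simp add: rd_def)
    have acts: "acts \<tau> j = acts \<tau>' j" for j by (simp add: acts_def L rd)
    have "left_word \<tau> j = left_word \<tau>' j" "right_word \<tau> j = right_word \<tau>' j" if "j < k" for j
      unfolding left_word_def right_word_def acts lr[OF that] by (rule refl)+
    moreover have "(i - L - 2) div 2 < k" if "L + 2 \<le> i" "i < L + 2 + 2 * k" for i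
      using that by linarith
    ultimately show ?thesis
      by (auto simp: step_words_def fun_eq_iff legal_def rd L)
  qed
  show "okc K N (Prim step_words)" using 1 2 by (simp only: okc.simps) blast
qed

text \<open>The stacks contain no 0, so that they can be emptied afterwards by popping until a blank
  shows.\<close>

definition represents :: "store \<Rightarrow> config \<Rightarrow> bool" where
  "represents s C \<longleftrightarrow> s L = [Suc (fst C)] \<and> fst C < tm_states M \<and> length (snd C) = k \<and>
     (\<forall>j<k. snd C ! j = two_stack_tape (s (lft j)) (s (rgt j)) \<and>
        0 \<notin> set (s (lft j)) \<and> 0 \<notin> set (s (rgt j)) \<and> (\<forall>i. (snd C ! j) i < tm_symbols M))"

lemma step_represents:
  assumes r: "represents s (q, ts)" and q: "q \<noteq> 1" "q \<noteq> 2"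
  shows "represents (prim step_words s) (tm_step M (q, ts))"
proof -
  let ?\<tau> = "tops s"
  have len: "length ts = k" and qs: "q < tm_states M" and \<tau>L: "?\<tau> L - 1 = q"
    using r by (auto simp: represents_def tops_def)
  have ts: "ts ! j = two_stack_tape (s (lft j)) (s (rgt j))" "0 \<notin> set (s (lft j))"
    "0 \<notin> set (s (rgt j))" "\<And>i. (ts ! j) i < tm_symbols M" if "j < k" for j
    using r that by (auto simp: represents_def)
  have "(ts ! j) 0 = ?\<tau> (rgt j) - 1" if "j < k" for j
    using ts(1)[OF that] by (auto simp: two_stack_tape_def cell_def tops_def split: list.split)
  then have rd: "map (\<lambda>t. t 0) ts = rd ?\<tau>"
    unfolding rd_def using len by (auto intro: nth_equalityI)
  have legal: "legal ?\<tau>"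
    unfolding legal_def \<tau>L rd[symmetric] using qs ts(4) len by (auto simp: in_set_conv_nth)
  note delta = delta[OF legal]
  let ?s' = "prim step_words s" and ?\<delta> = "tm_delta M q (rd ?\<tau>)"
  have step: "tm_step M (q, ts) = (fst ?\<delta>, map2 act (snd ?\<delta>) ts)"
    using q rd by (auto split: prod.splits)
  have s'L: "?s' L = [Suc (fst ?\<delta>)]"
    using step_words_simps(1)[OF legal] r \<tau>L by (auto simp: prim_def nz_def represents_def)
  have "map2 act (snd ?\<delta>) ts ! j = two_stack_tape (?s' (lft j)) (?s' (rgt j)) \<and>
      0 \<notin> set (?s' (lft j)) \<and> 0 \<notin> set (?s' (rgt j)) \<and>
      (\<forall>i. (map2 act (snd ?\<delta>) ts ! j) i < tm_symbols M)" if j: "j < k" for j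
  proof -
    obtain a m where am: "acts ?\<tau> j = (a, m)" by force
    have a: "a < tm_symbols M" using delta(3)[OF j] am by simp
    have new: "map2 act (snd ?\<delta>) ts ! j = act (a, m) (ts ! j)"
      using delta(2) j len am unfolding acts_def \<tau>L by (simp del: act.simps)
    have tl0: "0 \<notin> set (tl xs)" if "0 \<notin> set xs" for xs :: "nat list"
      using that by (cases xs) auto
    have l': "?s' (lft j) = (case left_word ?\<tau> j of None \<Rightarrow> s (lft j) | Some w \<Rightarrow> nz w @ tl (s (lft j)))"
      by (simp add: prim_def step_words_simps(2)[OF legal j])
    have r': "?s' (rgt j) = (case right_word ?\<tau> j of None \<Rightarrow> s (rgt j) | Some w \<Rightarrow> nz w @ tl (s (rgt j)))"
      by (simp add: prim_def step_words_simps(3)[OF legal j])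
    have "(act (a, m) (ts ! j)) i < tm_symbols M" for i
      using ts(4)[OF j] a by simp
    moreover have "act (a, m) (ts ! j) = two_stack_tape (?s' (lft j)) (?s' (rgt j)) \<and>
      0 \<notin> set (?s' (lft j)) \<and> 0 \<notin> set (?s' (rgt j))"
    proof (cases m)
      case MoveLeft
      have "?s' (lft j) = tl (s (lft j))"
        "?s' (rgt j) = (case s (lft j) of [] \<Rightarrow> 1 | x # _ \<Rightarrow> x) # Suc a # tl (s (rgt j))"
        using l' r' am MoveLeft ts(2)[OF j]
        by (auto simp: left_word_def right_word_def nz_def tops_def split: list.splits)
      then show ?thesis
        using two_stack_Left[of a "s (lft j)" "s (rgt j)"] ts(1-3)[OF j] tl0 MoveLeft
        by (auto simp del: act.simps split: list.splits)
    next
      case Stay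
      have "?s' (lft j) = s (lft j)" "?s' (rgt j) = Suc a # tl (s (rgt j))"
        using l' r' am Stay by (auto simp: left_word_def right_word_def nz_def)
      then show ?thesis
        using two_stack_Stay[of a "s (lft j)" "s (rgt j)"] ts(1-3)[OF j] tl0 Stay
        by (simp del: act.simps)
    next
      case MoveRight
      have "?s' (lft j) = Suc a # s (lft j)" "?s' (rgt j) = tl (s (rgt j))"
        using l' r' am MoveRight ts(2)[OF j]
        by (auto simp: left_word_def right_word_def nz_def tops_def split: list.splits)
      then show ?thesis
        using two_stack_Right[of a "s (lft j)" "s (rgt j)"] ts(1-3)[OF j] tl0 MoveRight
        by (simp del: act.simps)
    qed
    ultimately show ?thesis unfolding new by blast
  qed
  moreover have "fst ?\<delta> < tm_states M" "length (map2 act (snd ?\<delta>) ts) = k"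
    using delta(1,2) len \<tau>L by simp_all
  ultimately show ?thesis
    unfolding represents_def step fst_conv snd_conv using s'L by blast
qed

lemma prim_step_length: "length (prim step_words s i) \<le> length (s i) + 2"
proof -
  obtain K N where "okc K N (Prim step_words)" using ok_step unfolding ok_def by blast
  from exec_length[OF exec.Prim this] show ?thesis .
qed

lemma funpow_step_length: "length ((prim step_words ^^ n) s i) \<le> length (s i) + 2 * n"
  by (induction n) (use prim_step_length order.trans in \<open>fastforce+\<close>)

lemma funpow_step_other:
  assumes "i < L \<or> i = L + 1 \<or> i \<ge> L + 2 + 2 * k"
  shows "(prim step_words ^^ n) s i = s i"
  by (induction n) (use assms in \<open>auto simp: prim_def step_words_def\<close>)

lemma funpow_represents:
  assumes "represents s C" "\<And>i. i < n \<Longrightarrow> fst ((tm_step M ^^ i) C) \<notin> {1, 2}"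
  shows "represents ((prim step_words ^^ n) s) ((tm_step M ^^ n) C)"
  using assms(2)
proof (induction n)
  case (Suc n)
  then show ?case using step_represents[of "(prim step_words ^^ n) s" "fst ((tm_step M ^^ n) C)" "snd ((tm_step M ^^ n) C)"]
    by (simp del: tm_step.simps)
qed (simp add: assms(1))

lemma halted: "fst C \<in> {1, 2} \<Longrightarrow> (tm_step M ^^ n) C = C"
  by (induction n) (cases C; auto)+

text \<open>The simulating loop stops at the first halting configuration. As configurations do not
  change after halting, this one already carries the answer.\<close>

lemma answers_least:
  assumes "tm_answers M w T b"
  shows "\<exists>t\<le>T. fst ((tm_step M ^^ t) (tm_init M w)) = (if b then 1 else 2) \<and>
    (\<forall>i<t. fst ((tm_step M ^^ i) (tm_init M w)) \<notin> {1, 2})"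
proof -
  let ?q = "\<lambda>t. fst ((tm_step M ^^ t) (tm_init M w))"
  obtain t where t: "t \<le> T" "?q t = (if b then 1 else 2)"
    using assms unfolding tm_answers_def by blast
  define t0 where "t0 = (LEAST t. ?q t \<in> {1, 2})"
  have t': "?q t \<in> {1, 2}" using t(2) by auto
  have le: "t0 \<le> t" unfolding t0_def using t' by (rule Least_le)
  have q0: "?q t0 \<in> {1, 2}" unfolding t0_def using t' by (rule LeastI)
  have "(tm_step M ^^ t) (tm_init M w) = (tm_step M ^^ (t - t0)) ((tm_step M ^^ t0) (tm_init M w))"
    using le by (metis comp_apply funpow_add le_add_diff_inverse2)
  then have "?q t0 = ?q t" using halted[OF q0, of "t - t0"] by simp
  moreover have "?q i \<notin> {1, 2}" if "i < t0" for i
    using that not_less_Least unfolding t0_def by blast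
  ultimately show ?thesis using le t by (intro exI[of _ t0]) auto
qed

end

text \<open>Nothing is known of \<open>M\<close> on words other than \<open>u x\<close>, which is
  harmless because the domain of a \<open>PT\<close> function is a promise. The halting states 1 and
  2 appear in register \<open>L\<close> as 2 and 3.\<close>

lemma PT_machine:
  assumes wf: "wf_tm M" and u: "PT X G u" and bd: "pbd X (sz G) T"
    and ans: "\<And>x. x \<in> X \<Longrightarrow> tm_answers M (u x) (T x) (b x)"
  shows "PT X G (\<lambda>x. [b x])"
proof (rule PTI, goal_cases)
  case (1 ins out L)
  note ins = 1(1,2) and out = 1(3,4)
  interpret subroutine M L by unfold_locales (rule wf)
  have k: "k \<ge> 1" and st: "tm_states M \<ge> 3" and sy: "tm_symbols M \<ge> 3"
    using wf by (auto simp: wf_tm_def)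
  obtain c0 T0 where c0: "ok c0" "pbd X (sz G) T0" and
    r0: "\<And>x s. x \<in> X \<Longrightarrow> map s ins = map (\<lambda>g. enc (g x)) G \<Longrightarrow> s (L + 1) = [] \<Longrightarrow>
      (\<And>i. i \<ge> L + 2 \<Longrightarrow> s i = []) \<Longrightarrow> runs c0 s (T0 x) (s(L + 1 := enc (u x)))"
    by (rule PTE[OF u ins(1), of "L + 2" "L + 1"]) (use ins in auto)
  \<comment> \<open>On the two bit symbols this is the successor. The successor itself would map the
    largest symbol of a bounded alphabet outside of it.\<close>
  define shift where "shift = (\<lambda>a::nat. if a = 1 then 2 else 3 :: nat)"
  let ?regs = "[L..<L + 2 + 2 * k]"
  let ?main = "Loop (\<lambda>\<tau>. \<tau> L \<notin> {2, 3}) (Prim step_words)"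
  let ?ans = "Cond (\<lambda>\<tau>. \<tau> L = 2) (put out 2) (put out 1)"
  let ?c = "Seq c0 (Seq (move (L + 1) [L + 2]) (Seq (gmove shift (L + 2) [L + 3])
     (Seq (put L 1) (Seq ?main (Seq ?ans (clear_all ?regs))))))"
  let ?m = "\<lambda>x. 3 * length (u x) + 1"
  \<comment> \<open>A bound on all registers to be cleared: the input, one symbol for the state, and
    two symbols for each simulated step.\<close>
  let ?n = "\<lambda>x. length (u x) + 1 + 2 * T x"
  let ?T = "\<lambda>x. Suc (T0 x + Suc (?m x + Suc (?m x + Suc (2 + Suc (Suc (T x * Suc 2) + Suc (Suc 2 +
     ((2 + 2 * k) * (3 * ?n x + 2) + 2)))))))"
  show ?case
  proof (intro exI conjI ballI allI impI)
    have "ok (gmove shift (L + 2) [L + 3])" by (rule ok_gmove[of 4]) (auto simp: shift_def)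
    moreover have "ok ?main" by (rule ok_Loop[OF local_test_top[of "\<lambda>a. a \<notin> {2, 3}"] ok_step])
    moreover have "ok ?ans" by (intro ok_Cond local_test_top ok_put)
    ultimately show "ok ?c" by (intro ok_Seq ok_put ok_move ok_clear_all c0)
    show "pbd X (sz G) ?T" by (intro pbd_intros pbd_id c0 bd PT_length[OF u])
    fix x s assume x: "x \<in> X" and s: "map s ins = map (\<lambda>g. enc (g x)) G" "s out = []" "\<forall>i\<ge>L. s i = []"
    let ?w = "u x"
    let ?s1 = "s(L + 1 := enc ?w)" and ?s2 = "s(L + 2 := rev (enc ?w))" and ?s3 = "s(L + 3 := map shift (enc ?w))"
    define s4 where "s4 = ?s3(L := [1])"
    from answers_least[OF ans[OF x]] obtain t where t: "t \<le> T x" "fst ((tm_step M ^^ t) (tm_init M ?w)) = (if b x then 1 else 2)"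
      "\<And>i. i < t \<Longrightarrow> fst ((tm_step M ^^ i) (tm_init M ?w)) \<notin> {1, 2}"
      by blast
    define \<sigma> where "\<sigma> = (\<lambda>i. (prim step_words ^^ i) s4)"
    have rep0: "represents s4 (tm_init M ?w)"
    proof -
      have "input_tape ?w = two_stack_tape [] (map shift (enc ?w))"
        by (auto simp: input_tape_def two_stack_tape_def fun_eq_iff cell_def enc_def shift_def nat_less_iff)
      moreover have "s4 (lft j) = []" for j using s(3) by (auto simp: s4_def lft_def)
      moreover have "s4 (rgt j) = (if j = 0 then map shift (enc ?w) else [])" for j
        using s(3) by (auto simp: s4_def rgt_def)
      moreover have "two_stack_tape [] [] = (\<lambda>_. 0)"
        by (auto simp: two_stack_tape_def cell_def fun_eq_iff)
      moreover have "input_tape ?w i < tm_symbols M" for i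
        using sy by (auto simp: input_tape_def)
      moreover have "0 \<notin> set (map shift (enc ?w))" by (auto simp: shift_def)
      ultimately show ?thesis
        using st sy k by (auto simp: represents_def tm_init_def nth_Cons' s4_def)
    qed
    have rep: "represents (\<sigma> i) ((tm_step M ^^ i) (tm_init M ?w))" if "i \<le> t" for i
      unfolding \<sigma>_def by (rule funpow_represents[OF rep0]) (use t(3) that in auto)
    have top: "tops (\<sigma> i) L = Suc (fst ((tm_step M ^^ i) (tm_init M ?w)))" if "i \<le> t" for i
      using rep[OF that] by (simp add: represents_def tops_def)
    have same: "\<sigma> t i = s i" if "i < L \<or> i = L + 1 \<or> i \<ge> L + 2 + 2 * k" for i
    proof -
      have "i \<noteq> L + 3" using k that by auto
      then show ?thesis
        unfolding \<sigma>_def funpow_step_other[OF that] using that by (auto simp: s4_def)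
    qed
    have len: "length (\<sigma> t i) \<le> ?n x" if "i \<ge> L" for i
    proof -
      have "length (s4 i) \<le> length ?w + 1" using s(3) that by (auto simp: s4_def)
      then show ?thesis
        unfolding \<sigma>_def using funpow_step_length[of t s4 i] t(1) by linarith
    qed
    have nz: "0 \<notin> set (\<sigma> t i)" if i: "L \<le> i" "i < L + 2 + 2 * k" for i
    proof -
      have r: "represents (\<sigma> t) ((tm_step M ^^ t) (tm_init M ?w))" by (rule rep) simp
      consider "i = L" | "i = L + 1" | j where "j < k" "i = lft j \<or> i = rgt j"
      proof -
        have "i = lft ((i - L - 2) div 2) \<or> i = rgt ((i - L - 2) div 2)" if "i \<ge> L + 2"
          using that unfolding lft_def rgt_def by presburger
        moreover have "(i - L - 2) div 2 < k" if "i \<ge> L + 2" using i(2) that by linarith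
        moreover have "i = L \<or> i = L + 1 \<or> i \<ge> L + 2" using i(1) by linarith
        ultimately show ?thesis using that by blast
      qed
      then show ?thesis
        using r same[of "L + 1"] s(3) by cases (auto simp: represents_def)
    qed
    show "runs ?c s (?T x) (s(out := enc [b x]))"
    proof (intro runs_Seq)
      show "runs c0 s (T0 x) ?s1" by (rule r0[OF x]) (use s in auto)
      show "runs (move (L + 1) [L + 2]) ?s1 (?m x) ?s2"
        by (rule runs_gmove) (use s in \<open>auto simp: fun_eq_iff\<close>)
      show "runs (gmove shift (L + 2) [L + 3]) ?s2 (?m x) ?s3"
        by (rule runs_gmove) (use s in \<open>auto simp: fun_eq_iff shift_def rev_map\<close>)
      show "runs (put L 1) ?s3 2 s4" unfolding s4_def by (rule runs_put) (use s in auto)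
      have "runs ?main (\<sigma> 0) (Suc (t * Suc 2)) (\<sigma> t)"
      proof (rule runs_Loop)
        fix i assume i: "i < t"
        then show "tops (\<sigma> i) L \<notin> {2, 3}" using top[of i] t(3)[OF i] by auto
        show "runs (Prim step_words) (\<sigma> i) 2 (\<sigma> (Suc i))" by (rule runs_Prim) (auto simp: \<sigma>_def)
      next
        show "\<not> tops (\<sigma> t) L \<notin> {2, 3}" using top[of t] t(2) by simp
      qed
      moreover have "\<sigma> 0 = s4" by (simp add: \<sigma>_def)
      ultimately have "runs ?main s4 (Suc (t * Suc 2)) (\<sigma> t)" by simp
      then show "runs ?main s4 (Suc (T x * Suc 2)) (\<sigma> t)"
        by (rule runs_mono) (use t(1) in simp)
      have so: "\<sigma> t out = []" using same[of out] out s(2) by simp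
      show "runs ?ans (\<sigma> t) (Suc 2) ((\<sigma> t)(out := enc [b x]))"
      proof (cases "b x")
        case True
        then show ?thesis using runs_put[of "\<sigma> t" out 2] so top[of t] t(2) by (intro runs_CondT) auto
      next
        case False
        then show ?thesis using runs_put[of "\<sigma> t" out 1] so top[of t] t(2) by (intro runs_CondF) auto
      qed
      have "runs (clear_all ?regs) ((\<sigma> t)(out := enc [b x])) (length ?regs * (3 * ?n x + 2) + 2)
        (\<lambda>i. if i \<in> set ?regs then [] else ((\<sigma> t)(out := enc [b x])) i)"
        by (rule runs_clear_all) (use nz len out in auto)
      also have "(\<lambda>i. if i \<in> set ?regs then [] else ((\<sigma> t)(out := enc [b x])) i) = s(out := enc [b x])"
        using same s(3) out by (auto simp: fun_eq_iff not_less)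
      also have "length ?regs = 2 + 2 * k" by simp
      finally show "runs (clear_all ?regs) ((\<sigma> t)(out := enc [b x])) ((2 + 2 * k) * (3 * ?n x + 2) + 2)
        (s(out := enc [b x]))" .
    qed
  qed
qed

subsection \<open>Arithmetic and bounded search\<close>

text \<open>Numbers are kept in unary, so that a computable number is polynomially bounded and may
  serve as the length of a loop.\<close>

definition PN :: "'x set \<Rightarrow> ('x \<Rightarrow> bool list) list \<Rightarrow> ('x \<Rightarrow> nat) \<Rightarrow> bool" where
  "PN X G n \<longleftrightarrow> PT X G (\<lambda>x. replicate (n x) True)"

definition PB :: "'x set \<Rightarrow> ('x \<Rightarrow> bool list) list \<Rightarrow> ('x \<Rightarrow> bool) \<Rightarrow> bool" where
  "PB X G b \<longleftrightarrow> PT X G (\<lambda>x. [b x])"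

definition below :: "'x set \<Rightarrow> ('x \<Rightarrow> nat) \<Rightarrow> ('x \<times> nat) set" where
  "below X N = {(x, i). x \<in> X \<and> i < N x}"

definition add_index :: "('x \<Rightarrow> bool list) list \<Rightarrow> ('x \<times> nat \<Rightarrow> bool list) list" where
  "add_index G = map (\<lambda>g (x, i). g x) G @ [\<lambda>(x, i). replicate i True]"

lemma PB_mono: "PB X G b \<Longrightarrow> Y \<subseteq> X \<Longrightarrow> PB Y G b"
  unfolding PB_def by (rule PT_mono)

lemma PN_cong: "PN X G n \<Longrightarrow> (\<And>x. x \<in> X \<Longrightarrow> n x = n' x) \<Longrightarrow> PN X G n'"
  unfolding PN_def by (erule PT_cong) simp

lemma PB_cong: "PB X G b \<Longrightarrow> (\<And>x. x \<in> X \<Longrightarrow> b x = b' x) \<Longrightarrow> PB X G b'"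
  unfolding PB_def by (erule PT_cong) simp

lemma PB_comp:
  "PB X' G' b \<Longrightarrow> (\<And>x. x \<in> X \<Longrightarrow> h x \<in> X') \<Longrightarrow> (\<And>g. g \<in> set G' \<Longrightarrow> PT X G (\<lambda>x. g (h x))) \<Longrightarrow>
   PB X G (\<lambda>x. b (h x))"
  unfolding PB_def by (rule PT_comp)

lemma PT_more: "PT X G f \<Longrightarrow> set G \<subseteq> set G' \<Longrightarrow> PT X G' f"
  using PT_comp[of X G f X "\<lambda>x. x" G'] PT_proj by blast

lemma PT_lift:
  assumes "PT X G f" "\<And>z. z \<in> Y \<Longrightarrow> fst z \<in> X" "set (map (\<lambda>g (x, i). g x) G) \<subseteq> set H"
  shows "PT Y H (\<lambda>(x, i). f x)"
proof -
  have "PT Y H (\<lambda>z. f (fst z))"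
  proof (rule PT_comp[OF assms(1,2)])
    fix g assume "g \<in> set G"
    then have "(\<lambda>(x, i). g x) \<in> set H" using assms(3) by auto
    then have "PT Y H (\<lambda>(x, i). g x)" by (rule PT_proj)
    then show "PT Y H (\<lambda>z. g (fst z))" by (simp add: case_prod_beta')
  qed
  then show ?thesis by (simp add: case_prod_beta')
qed

lemma PT_index: "PT X G f \<Longrightarrow> PT (below X N) (add_index G) (\<lambda>(x, i). f x)"
  by (rule PT_lift) (auto simp: below_def add_index_def)

lemma PN_the_index: "PN (below X N) (add_index G) (\<lambda>(x, i). i)"
proof -
  have "PT (below X N) (add_index G) (\<lambda>(x, i). replicate i True)"
    by (rule PT_proj) (simp add: add_index_def)
  then show ?thesis by (simp add: PN_def case_prod_beta')
qed

lemma head_sym_simps [simp]: "head_sym [b] = 2 \<longleftrightarrow> b" "head_sym w = 2 \<longleftrightarrow> w \<noteq> [] \<and> hd w"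
  "head_sym w = 0 \<longleftrightarrow> w = []"
  by (auto simp: head_sym_def split: list.split)

lemma PT_if:
  assumes "PB X G b" "PT {x \<in> X. b x} G f" "PT {x \<in> X. \<not> b x} G g"
  shows "PT X G (\<lambda>x. if b x then f x else g x)"
  using PT_case[of X G "\<lambda>x. [b x]" "\<lambda>a. a = 2" f g] assms by (simp add: PB_def)

lemma PT_if': "PB X G b \<Longrightarrow> PT X G f \<Longrightarrow> PT X G g \<Longrightarrow> PT X G (\<lambda>x. if b x then f x else g x)"
  by (rule PT_if) (auto elim: PT_mono)

lemma PB_hd: "PT X G f \<Longrightarrow> PB X G (\<lambda>x. f x \<noteq> [] \<and> hd (f x))"
  unfolding PB_def
  by (rule PT_cong[OF PT_case[of X G f "\<lambda>a. a = 2" "\<lambda>_. [True]" "\<lambda>_. [False]"]])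
    (auto intro: PT_single)

lemma PB_Nil: "PT X G f \<Longrightarrow> PB X G (\<lambda>x. f x = [])"
  unfolding PB_def
  by (rule PT_cong[OF PT_case[of X G f "\<lambda>a. a = 0" "\<lambda>_. [True]" "\<lambda>_. [False]"]])
    (auto intro: PT_single)

lemma PB_const: "PB X G (\<lambda>_. b)"
  unfolding PB_def by (rule PT_single)

lemma PB_If:
  assumes "PB X G b" "PB {x \<in> X. b x} G c" "PB {x \<in> X. \<not> b x} G d"
  shows "PB X G (\<lambda>x. if b x then c x else d x)"
  unfolding PB_def
  by (rule PT_cong[OF PT_if[OF assms[unfolded PB_def[of _ _ c] PB_def[of _ _ d]]]]) auto

lemma PB_not: "PB X G b \<Longrightarrow> PB X G (\<lambda>x. \<not> b x)"
  by (rule PB_cong[OF PB_If[of X G b "\<lambda>_. False" "\<lambda>_. True"]]) (auto intro: PB_const)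

text \<open>The second conjunct has to be decidable only where the first one holds. In this way a
  check of the input precedes the solution of a promise problem.\<close>

lemma PB_conj_dep: "PB X G b \<Longrightarrow> PB {x \<in> X. b x} G c \<Longrightarrow> PB X G (\<lambda>x. b x \<and> c x)"
  by (rule PB_cong[OF PB_If[of X G b c "\<lambda>_. False"]]) (auto intro: PB_const)

lemma PB_conj: "PB X G b \<Longrightarrow> PB X G c \<Longrightarrow> PB X G (\<lambda>x. b x \<and> c x)"
  by (rule PB_conj_dep) (auto elim: PB_mono)

lemma PB_disj: "PB X G b \<Longrightarrow> PB X G c \<Longrightarrow> PB X G (\<lambda>x. b x \<or> c x)"
  using PB_not[OF PB_conj[OF PB_not[of X G b] PB_not[of X G c]]] by simp

text \<open>Quantifiers over a fixed finite set, such as the rules or the predicate symbols, are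
  unrolled into the program. Quantifiers whose range depends on the input are treated in
  \<open>PB_ex\<close>.\<close>

lemma PB_bex: "finite A \<Longrightarrow> (\<And>a. a \<in> A \<Longrightarrow> PB X G (\<lambda>x. b a x)) \<Longrightarrow> PB X G (\<lambda>x. \<exists>a\<in>A. b a x)"
  by (induction A rule: finite_induct) (auto intro: PB_const PB_disj)

lemma PB_ball: "finite A \<Longrightarrow> (\<And>a. a \<in> A \<Longrightarrow> PB X G (\<lambda>x. b a x)) \<Longrightarrow> PB X G (\<lambda>x. \<forall>a\<in>A. b a x)"
  by (induction A rule: finite_induct) (auto intro: PB_const PB_conj)

lemma PT_const: "PT X G (\<lambda>_. w)"
proof (induction w)
  case (Cons b w)
  from PT_append[OF PT_single[of X G b] this] show ?case by simp
qed (rule PT_Nil)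

lemma PT_concat_static:
  "(\<And>a. a \<in> set as \<Longrightarrow> PT X G (\<lambda>x. f a x)) \<Longrightarrow> PT X G (\<lambda>x. concat (map (\<lambda>a. f a x) as))"
  by (induction as) (auto intro: PT_append PT_Nil)

lemma PN_const: "PN X G (\<lambda>_. n)"
  unfolding PN_def by (rule PT_const)

lemma PN_add: "PN X G m \<Longrightarrow> PN X G n \<Longrightarrow> PN X G (\<lambda>x. m x + n x)"
  unfolding PN_def by (simp add: replicate_add PT_append)

lemma PN_sum_list: "(\<And>a. a \<in> set as \<Longrightarrow> PN X G (\<lambda>x. n a x)) \<Longrightarrow> PN X G (\<lambda>x. \<Sum>a\<leftarrow>as. n a x)"
  by (induction as) (auto intro: PN_add PN_const)

lemma PN_length:
  assumes "PT X G f"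
  shows "PN X G (\<lambda>x. length (f x))"
  unfolding PN_def
proof (rule PT_iterate[of X G f "\<lambda>x i. replicate i True", OF assms])
  let ?X = "{(x, i). x \<in> X \<and> i < length (f x)}"
  let ?G = "map (\<lambda>g (x, i). g x) G @ [\<lambda>(x, i). replicate i True, \<lambda>(x, i). replicate i True]"
  have "PT ?X ?G (\<lambda>(x, i). replicate i True)" by (rule PT_proj) simp
  from PT_append[OF PT_single[of _ _ True] this]
  show "PT ?X ?G (\<lambda>(x, i). replicate (Suc i) True)" by (simp add: case_prod_beta')
qed (auto intro: PT_Nil PT_length[OF assms])

lemma PT_drop:
  assumes f: "PT X G f" and n: "PN X G n"
  shows "PT X G (\<lambda>x. drop (n x) (f x))"
proof -
  have "PT X G (\<lambda>x. drop (length (replicate (n x) True)) (f x))"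
  proof (rule PT_iterate[of X G _ "\<lambda>x i. drop i (f x)", OF n[unfolded PN_def]])
    let ?X = "{(x, i). x \<in> X \<and> i < length (replicate (n x) True)}"
    let ?G = "map (\<lambda>g (x, i). g x) G @ [\<lambda>(x, i). replicate i True, \<lambda>(x, i). drop i (f x)]"
    have "PT ?X ?G (\<lambda>(x, i). drop i (f x))" by (rule PT_proj) simp
    from PT_tl[OF this]
    show "PT ?X ?G (\<lambda>(x, i). drop (Suc i) (f x))" by (simp add: case_prod_beta' drop_Suc tl_drop)
    show "PT X G (\<lambda>x. drop 0 (f x))" using f by simp
  qed (auto intro: PT_length[OF f])
  then show ?thesis by simp
qed

lemma sz_add_index: "sz (add_index G) (x, i) = sz G x + i"
  by (simp add: sz_def add_index_def comp_def)

text \<open>The general form of a loop that collects output: bounded quantifiers, products and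
  tables are instances. Every piece is polynomially bounded in \<open>sz G x + N x\<close>, hence so
  is the accumulated word.\<close>

lemma PT_concat:
  assumes N: "PN X G N" and f: "PT (below X N) (add_index G) (\<lambda>(x, i). f x i)"
  shows "PT X G (\<lambda>x. concat (map (f x) [0..<N x]))"
proof -
  let ?y = "\<lambda>x i. concat (map (f x) [0..<i])"
  obtain p where p: "\<And>x i. x \<in> X \<Longrightarrow> i < N x \<Longrightarrow> length (f x i) \<le> poly p (sz G x + i)"
    using PT_length[OF f] unfolding pbd_def by (auto simp: below_def sz_add_index)
  let ?q = "\<lambda>x. N x * poly p (sz G x + N x)"
  have pN: "pbd X (sz G) N" using PT_length[OF N[unfolded PN_def]] by simp
  have "PT X G (\<lambda>x. ?y x (length (replicate (N x) True)))"
  proof (rule PT_iterate[of X G _ ?y ?q, OF N[unfolded PN_def]])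
    show "PT X G (\<lambda>x. ?y x 0)" by (simp add: PT_Nil)
    show "pbd X (sz G) ?q" by (intro pbd_intros pbd_id pN)
    fix x i assume x: "x \<in> X" and "i \<le> length (replicate (N x) True)"
    then have i: "i \<le> N x" by simp
    then have "length (?y x i) \<le> i * poly p (sz G x + N x)"
    proof (induction i)
      case (Suc i)
      have "length (f x i) \<le> poly p (sz G x + i)" using p[OF x, of i] Suc.prems by simp
      also have "\<dots> \<le> poly p (sz G x + N x)" by (rule poly_nat_mono) (use Suc.prems in simp)
      finally show ?case using Suc by simp
    qed simp
    also have "\<dots> \<le> ?q x" by (rule mult_le_mono1[OF i])
    finally show "length (?y x i) \<le> ?q x" .
  next
    let ?X = "{(x, i). x \<in> X \<and> i < length (replicate (N x) True)}"
    let ?G = "map (\<lambda>g (x, i). g x) G @ [\<lambda>(x, i). replicate i True, \<lambda>(x, i). ?y x i]"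
    have "PT ?X ?G (\<lambda>(x, i). ?y x i)" by (rule PT_proj) simp
    moreover have "PT ?X ?G (\<lambda>(x, i). f x i)"
      using PT_more[OF f, of ?G] by (auto simp: add_index_def below_def)
    ultimately have "PT ?X ?G (\<lambda>z. (\<lambda>(x, i). ?y x i) z @ (\<lambda>(x, i). f x i) z)"
      by (rule PT_append)
    then show "PT ?X ?G (\<lambda>(x, i). ?y x (Suc i))" by (simp add: case_prod_beta')
  qed
  then show ?thesis by simp
qed

text \<open>One bit is output for every witness, and the collected word is tested for
  emptiness.\<close>

lemma PB_ex:
  assumes N: "PN X G N" and b: "PB (below X N) (add_index G) (\<lambda>(x, i). b x i)"
  shows "PB X G (\<lambda>x. \<exists>i<N x. b x i)"
proof -
  have "PT (below X N) (add_index G) (\<lambda>z. if (\<lambda>(x, i). b x i) z then [True] else [])"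
    by (rule PT_if'[OF b PT_const PT_const])
  then have "PT (below X N) (add_index G) (\<lambda>(x, i). if b x i then [True] else [])"
    by (simp add: case_prod_beta')
  from PB_not[OF PB_Nil[OF PT_concat[OF N this]]] show ?thesis
  proof (rule PB_cong)
    fix x
    have "concat (map (\<lambda>i. if b x i then [True] else []) [0..<k]) = [] \<longleftrightarrow> \<not> (\<exists>i<k. b x i)" for k
      by (induction k) (auto simp: less_Suc_eq)
    then show "(concat (map (\<lambda>i. if b x i then [True] else []) [0..<N x]) \<noteq> []) = (\<exists>i<N x. b x i)"
      by blast
  qed
qed

lemma PB_all:
  assumes N: "PN X G N" and b: "PB (below X N) (add_index G) (\<lambda>(x, i). b x i)"
  shows "PB X G (\<lambda>x. \<forall>i<N x. b x i)"
proof -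
  have "PB (below X N) (add_index G) (\<lambda>(x, i). \<not> b x i)"
    using PB_not[OF b] by (simp add: case_prod_beta')
  from PB_not[OF PB_ex[OF N this]] show ?thesis by simp
qed

lemma PN_mult:
  assumes "PN X G m" "PN X G n"
  shows "PN X G (\<lambda>x. m x * n x)"
proof -
  have "PT (below X m) (add_index G) (\<lambda>(x, i). replicate (n x) True)"
    using PT_index[OF assms(2)[unfolded PN_def]] .
  from PT_concat[OF assms(1) this] have "PT X G (\<lambda>x. concat (map (\<lambda>i. replicate (n x) True) [0..<m x]))" .
  moreover have "concat (map (\<lambda>i. replicate b True) [0..<a]) = replicate (a * b) True" for a b :: nat
    by (induction a) (auto simp: replicate_add[symmetric] add.commute)
  ultimately show ?thesis by (simp add: PN_def)
qed

lemma PN_prod_list: "(\<And>a. a \<in> set as \<Longrightarrow> PN X G (\<lambda>x. n a x)) \<Longrightarrow> PN X G (\<lambda>x. \<Prod>a\<leftarrow>as. n a x)"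
  by (induction as) (auto intro: PN_mult PN_const)

lemma PN_diff: "PN X G m \<Longrightarrow> PN X G n \<Longrightarrow> PN X G (\<lambda>x. m x - n x)"
  using PT_drop[of X G "\<lambda>x. replicate (m x) True" n] by (simp add: PN_def)

lemma PB_less:
  assumes "PN X G m" "PN X G n"
  shows "PB X G (\<lambda>x. m x < n x)"
  by (rule PB_cong[OF PB_not[OF PB_Nil[OF PN_diff[OF assms(2,1), unfolded PN_def]]]]) auto

lemma PB_le: "PN X G m \<Longrightarrow> PN X G n \<Longrightarrow> PB X G (\<lambda>x. m x \<le> n x)"
  using PB_not[OF PB_less[of X G n m]] by (simp add: not_less)

lemma PB_eq: "PN X G m \<Longrightarrow> PN X G n \<Longrightarrow> PB X G (\<lambda>x. m x = n x)"
  using PB_conj[OF PB_le[of X G m n] PB_le[of X G n m]] by (simp add: eq_iff)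

lemma PB_nth:
  assumes "PT X G f" "PN X G n"
  shows "PB X G (\<lambda>x. n x < length (f x) \<and> f x ! n x)"
  by (rule PB_cong[OF PB_hd[OF PT_drop[OF assms]]]) (auto simp: hd_drop_conv_nth)

lemma PT_take:
  assumes f: "PT X G f" and n: "PN X G n"
  shows "PT X G (\<lambda>x. take (n x) (f x))"
proof -
  let ?Y = "below X n" and ?H = "add_index G"
  let ?f = "\<lambda>(x, i::nat). f x"
  have i: "PN ?Y ?H snd" using PN_the_index[of X n G] by (simp add: case_prod_beta')
  have fi: "PT ?Y ?H (\<lambda>z. f (fst z))" using PT_index[OF f, of n] by (simp add: case_prod_beta')
  have "PT ?Y ?H (\<lambda>z. if snd z < length (f (fst z)) then
      [snd z < length (f (fst z)) \<and> f (fst z) ! snd z] else [])"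
    by (intro PT_if' PB_less PN_length fi i PB_nth[unfolded PB_def] PT_Nil)
  then have "PT ?Y ?H (\<lambda>(x, i). if i < length (f x) then [i < length (f x) \<and> f x ! i] else [])"
    by (simp add: case_prod_beta')
  from PT_concat[OF n this] show ?thesis
  proof (rule PT_cong)
    fix x
    have "concat (map (\<lambda>i. if i < length w then [i < length w \<and> w ! i] else []) [0..<k]) = take k w"
      for w :: "bool list" and k
      by (induction k) (auto simp: take_Suc_conv_app_nth)
    then show "concat (map (\<lambda>i. if i < length (f x) then [i < length (f x) \<and> f x ! i] else []) [0..<n x]) =
      take (n x) (f x)" .
  qed
qed

lemma PB_eq_words:
  assumes f: "PT X G f" and g: "PT X G g"
  shows "PB X G (\<lambda>x. f x = g x)"
proof -
  let ?N = "\<lambda>x. length (f x)"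
  let ?Y = "below X ?N" and ?H = "add_index G"
  have i: "PN ?Y ?H snd" using PN_the_index[of X ?N G] by (simp add: case_prod_beta')
  have fi: "PT ?Y ?H (\<lambda>z. f (fst z))" using PT_index[OF f, of ?N] by (simp add: case_prod_beta')
  have gi: "PT ?Y ?H (\<lambda>z. g (fst z))" using PT_index[OF g, of ?N] by (simp add: case_prod_beta')
  let ?a = "\<lambda>h z. snd z < length (h (fst z)) \<and> h (fst z) ! snd z"
  have "PB ?Y ?H (\<lambda>z. (?a f z \<and> ?a g z) \<or> (\<not> ?a f z \<and> \<not> ?a g z))"
    by (intro PB_disj PB_conj PB_not PB_nth[OF fi i] PB_nth[OF gi i])
  then have "PB ?Y ?H (\<lambda>(x, i). (i < length (f x) \<and> f x ! i) = (i < length (g x) \<and> g x ! i))"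
    by (rule PB_cong) auto
  from PB_conj[OF PB_eq[OF PN_length[OF f] PN_length[OF g]] PB_all[OF PN_length[OF f] this]]
  show ?thesis by (rule PB_cong) (auto intro: nth_equalityI)
qed

section \<open>Reading numbers from unary codes\<close>

definition strip :: "bool list \<Rightarrow> bool list" where
  "strip v = (if v \<noteq> [] \<and> hd v then tl v else v)"

lemma length_strip: "length ((strip ^^ i) v) \<le> length v"
  by (induction i) (auto simp: strip_def)

text \<open>The number of rounds of an iteration is fixed in advance. A round that finds no leading
  \<open>True\<close> changes nothing, so the length of the word is a sufficient number.\<close>

lemma strip_dropWhile: "length v \<le> i \<Longrightarrow> (strip ^^ i) v = dropWhile (\<lambda>b. b) v"
proof (induction i arbitrary: v)
  case (Suc i)
  have fix_nil: "(strip ^^ n) [] = []" for n by (induction n) (auto simp: strip_def)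
  have fix_False: "(strip ^^ n) (False # w) = False # w" for n w by (induction n) (auto simp: strip_def)
  show ?case
  proof (cases v)
    case Nil
    then show ?thesis using fix_nil[of "Suc i"] by simp
  next
    case (Cons b w)
    show ?thesis
    proof (cases b)
      case True
      then have "strip v = w" using Cons by (simp add: strip_def)
      then show ?thesis using Suc Cons True by (simp add: funpow_Suc_right del: funpow.simps)
    next
      case False
      then show ?thesis using Cons fix_False[of "Suc i" w] by simp
    qed
  qed
qed simp

lemma PT_dropWhile:
  assumes f: "PT X G f"
  shows "PT X G (\<lambda>x. dropWhile (\<lambda>b. b) (f x))"
proof -
  have "PT X G (\<lambda>x. (strip ^^ length (f x)) (f x))"
  proof (rule PT_iterate[of X G f "\<lambda>x i. (strip ^^ i) (f x)", OF f _ _ PT_length[OF f]])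
    let ?X = "{(x, i). x \<in> X \<and> i < length (f x)}"
    let ?y = "\<lambda>(x, i). (strip ^^ i) (f x)"
    let ?G = "map (\<lambda>g (x, i). g x) G @ [\<lambda>(x, i). replicate i True, ?y]"
    have y: "PT ?X ?G ?y" by (rule PT_proj) simp
    have "PT ?X ?G (\<lambda>z. if ?y z \<noteq> [] \<and> hd (?y z) then tl (?y z) else ?y z)"
      by (intro PT_if' PB_hd PT_tl y)
    then show "PT ?X ?G (\<lambda>(x, i). (strip ^^ Suc i) (f x))"
      by (rule PT_cong) (auto simp: strip_def[of "(strip ^^ _) _"])
    show "PT X G (\<lambda>x. (strip ^^ 0) (f x))" using f by simp
  qed (rule length_strip)
  then show ?thesis by (simp add: strip_dropWhile)
qed

definition drop_block :: "bool list \<Rightarrow> bool list" where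
  "drop_block v = tl (dropWhile (\<lambda>b. b) v)"

text \<open>Entry \<open>j\<close> of a list coded in unary. It is defined for all words and
  indices, which allows arbitrary words to be decoded as structures.\<close>

definition block :: "bool list \<Rightarrow> nat \<Rightarrow> nat" where
  "block w j = length (takeWhile (\<lambda>b. b) ((drop_block ^^ j) w))"

lemma PN_block:
  assumes f: "PT X G f" and j: "PN X G j"
  shows "PN X G (\<lambda>x. block (f x) (j x))"
proof -
  have le: "length ((drop_block ^^ i) v) \<le> length v" for i v
  proof (induction i)
    case (Suc i)
    then show ?case
      using length_dropWhile_le[of "\<lambda>b. b" "(drop_block ^^ i) v"]
      by (simp add: drop_block_def[of "(drop_block ^^ i) v"])
  qed simp
  have "PT X G (\<lambda>x. (drop_block ^^ length (replicate (j x) True)) (f x))"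
  proof (rule PT_iterate[of X G _ "\<lambda>x i. (drop_block ^^ i) (f x)", OF j[unfolded PN_def] _ _ PT_length[OF f]])
    let ?X = "{(x, i). x \<in> X \<and> i < length (replicate (j x) True)}"
    let ?y = "\<lambda>(x, i). (drop_block ^^ i) (f x)"
    let ?G = "map (\<lambda>g (x, i). g x) G @ [\<lambda>(x, i). replicate i True, ?y]"
    have y: "PT ?X ?G ?y" by (rule PT_proj) simp
    have "PT ?X ?G (\<lambda>z. tl (dropWhile (\<lambda>b. b) (?y z)))"
      by (intro PT_tl PT_dropWhile y)
    then show "PT ?X ?G (\<lambda>(x, i). (drop_block ^^ Suc i) (f x))"
      by (rule PT_cong) (auto simp: drop_block_def[of "(drop_block ^^ _) _"])
    show "PT X G (\<lambda>x. (drop_block ^^ 0) (f x))" using f by simp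
  qed (rule le)
  then have d: "PT X G (\<lambda>x. (drop_block ^^ j x) (f x))" by simp
  have eq: "length v - length (dropWhile (\<lambda>b. b) v) = length (takeWhile (\<lambda>b. b) v)" for v
    by (metis takeWhile_dropWhile_id length_append add_diff_cancel_right')
  from PN_diff[OF PN_length[OF d] PN_length[OF PT_dropWhile[OF d]]] show ?thesis
    by (simp add: eq block_def)
qed

lemma unary_code_simps: "unary_code [] = []" "unary_code (n # ns) = replicate n True @ False # unary_code ns"
  "unary_code (ms @ ns) = unary_code ms @ unary_code ns"
  by (auto simp: unary_code_def)

lemma block_unary_code: "j < length ns \<Longrightarrow> block (unary_code ns) j = ns ! j"
proof (induction ns arbitrary: j)
  case (Cons n ns)
  have "drop_block (unary_code (n # ns)) = unary_code ns"
    by (simp add: drop_block_def unary_code_simps dropWhile_append3 takeWhile_replicate)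
  then show ?case
    using Cons by (cases j) (auto simp: block_def unary_code_simps takeWhile_append
        funpow_Suc_right simp del: funpow.simps)
qed simp

lemma PT_unary_code:
  "(\<And>n. n \<in> set ns \<Longrightarrow> PN X G n) \<Longrightarrow> PT X G (\<lambda>x. unary_code (map (\<lambda>n. n x) ns))"
proof (induction ns)
  case (Cons n ns)
  then have "PT X G (\<lambda>x. replicate (n x) True)" by (simp add: PN_def)
  from PT_append[OF this PT_append[OF PT_single[of _ _ False] Cons.IH]] Cons.prems
  show ?case by (simp add: unary_code_simps)
qed (simp add: unary_code_simps PT_Nil)

section \<open>Fixpoints of approximating operators as finite iterations\<close>

lemma le_p_refl: "v \<le>\<^sub>p (v :: 'b::preorder \<times> 'b)"
  by (simp add: le_p_def)

lemma le_p_antisym: "v \<le>\<^sub>p w \<Longrightarrow> w \<le>\<^sub>p v \<Longrightarrow> v = (w :: 'b::order \<times> 'b)"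
  by (auto simp: le_p_def prod_eq_iff)

lemma least_p_eqI: "v \<in> Q \<Longrightarrow> (\<And>w. w \<in> Q \<Longrightarrow> v \<le>\<^sub>p w) \<Longrightarrow> least_p Q = (v :: 'b::order \<times> 'b)"
  unfolding least_p_def by (rule the_equality) (auto intro: le_p_antisym)

lemma funpow_invariant: "Q x \<Longrightarrow> (\<And>x. Q x \<Longrightarrow> Q (f x)) \<Longrightarrow> Q ((f ^^ n) x)"
  by (induction n) auto

text \<open>While the iteration moves, the measure grows by at least one in each step. If step
  \<open>N\<close> still moved, then so did all earlier ones, and the measure would exceed its bound
  after \<open>N + 1\<close> steps.\<close>

lemma funpow_stationary:
  fixes \<mu> :: "'b \<Rightarrow> nat"
  assumes "Q x" "\<And>x. Q x \<Longrightarrow> Q (f x)" "\<And>x. Q x \<Longrightarrow> f x \<noteq> x \<Longrightarrow> \<mu> x < \<mu> (f x)" "\<And>x. Q x \<Longrightarrow> \<mu> x \<le> N"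
  shows "f ((f ^^ N) x) = (f ^^ N) x"
proof (rule ccontr)
  assume ne: "f ((f ^^ N) x) \<noteq> (f ^^ N) x"
  have Q: "Q ((f ^^ i) x)" for i by (rule funpow_invariant) (use assms in auto)
  have "f ((f ^^ i) x) \<noteq> (f ^^ i) x" if "i \<le> N" for i
  proof
    assume fp: "f ((f ^^ i) x) = (f ^^ i) x"
    have "(f ^^ (i + j)) x = (f ^^ i) x" for j by (induction j) (use fp in auto)
    from this[of "N - i"] fp ne that show False by simp
  qed
  then have "i \<le> Suc N \<Longrightarrow> i \<le> \<mu> ((f ^^ i) x)" for i
  proof (induction i)
    case (Suc i)
    then show ?case using assms(3)[OF Q[of i]] by fastforce
  qed simp
  from this[of "Suc N"] assms(4)[OF Q[of "Suc N"]] show False by simp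
qed

locale approximation_op =
  fixes B :: "'a set" and A :: "'a set \<times> 'a set \<Rightarrow> 'a set \<times> 'a set"
  assumes fin: "finite B"
    and maps: "v \<in> tv_sets B \<Longrightarrow> A v \<in> tv_sets B"
    and mono: "v \<in> tv_sets B \<Longrightarrow> w \<in> tv_sets B \<Longrightarrow> v \<le>\<^sub>p w \<Longrightarrow> A v \<le>\<^sub>p A w"
    and exact: "I \<subseteq> B \<Longrightarrow> fst (A (I, I)) = snd (A (I, I))"
begin

lemma tv_iff: "(a, b) \<in> tv_sets B \<longleftrightarrow> a \<subseteq> b \<and> b \<subseteq> B"
  by (auto simp: tv_sets_def)

lemma fst_le_snd: "a \<subseteq> b \<Longrightarrow> b \<subseteq> B \<Longrightarrow> fst (A (a, b)) \<subseteq> snd (A (a, b))"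
  and snd_le: "a \<subseteq> b \<Longrightarrow> b \<subseteq> B \<Longrightarrow> snd (A (a, b)) \<subseteq> B"
  using maps[of "(a, b)"] by (auto simp: tv_sets_def)

lemma fst_mono: "a \<subseteq> a' \<Longrightarrow> a' \<subseteq> b' \<Longrightarrow> b' \<subseteq> b \<Longrightarrow> b \<subseteq> B \<Longrightarrow> fst (A (a, b)) \<subseteq> fst (A (a', b'))"
  and snd_mono: "a \<subseteq> a' \<Longrightarrow> a' \<subseteq> b' \<Longrightarrow> b' \<subseteq> b \<Longrightarrow> b \<subseteq> B \<Longrightarrow> snd (A (a', b')) \<subseteq> snd (A (a, b))"
  using mono[of "(a, b)" "(a', b')"] unfolding tv_iff le_p_def by auto

text \<open>The number of decided atoms. It grows strictly with precision and is at most
  \<open>2 * card B\<close>, whence the number of iterations of both fixpoint constructions.\<close>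

definition precision :: "'a set \<times> 'a set \<Rightarrow> nat" where
  "precision v = card (fst v) + card (B - snd v)"

lemma precision_le: "v \<in> tv_sets B \<Longrightarrow> precision v \<le> 2 * card B"
  unfolding precision_def using fin card_mono[of B "fst v"] card_mono[of B "B - snd v"]
  by (force simp: tv_sets_def)

lemma precision_less:
  assumes "v \<in> tv_sets B" "w \<in> tv_sets B" "v \<le>\<^sub>p w" "w \<noteq> v"
  shows "precision v < precision w"
proof -
  obtain a b where v: "v = (a, b)" by force
  obtain c d where w: "w = (c, d)" by force
  have s: "a \<subseteq> c" "d \<subseteq> b" "c \<subseteq> B" "b \<subseteq> B" using assms(1-3) v w by (auto simp: tv_sets_def le_p_def)
  have le: "card a \<le> card c" "card (B - b) \<le> card (B - d)"
    using s fin by (auto intro!: card_mono intro: finite_subset)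
  from assms(4) v w consider "a \<noteq> c" | "b \<noteq> d" by auto
  then show ?thesis
  proof cases
    case 1
    then have "card a < card c" using s fin by (intro psubset_card_mono) (auto intro: finite_subset)
    then show ?thesis using le v w by (simp add: precision_def)
  next
    case 2
    then have "card (B - b) < card (B - d)" using s fin by (intro psubset_card_mono) auto
    then show ?thesis using le v w by (simp add: precision_def)
  qed
qed

text \<open>The invariant \<open>v \<le>\<^sub>p A v\<close> makes the iterates a chain, and by
  monotonicity they stay below every fixpoint.\<close>

lemma kripke_kleene_iterate: "kripke_kleene B A = (A ^^ (2 * card B)) ({}, B)"
  unfolding kripke_kleene_def
proof (rule least_p_eqI)
  let ?Q = "\<lambda>v. v \<in> tv_sets B \<and> v \<le>\<^sub>p A v"
  have 0: "?Q ({}, B)" using maps[of "({}, B)"] by (auto simp: tv_sets_def le_p_def)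
  have step: "?Q v \<Longrightarrow> ?Q (A v)" for v using maps mono by blast
  have "A ((A ^^ (2 * card B)) ({}, B)) = (A ^^ (2 * card B)) ({}, B)"
    by (rule funpow_stationary[of ?Q _ _ precision, OF 0 step])
      (use precision_less precision_le maps in blast)+
  moreover have "?Q ((A ^^ (2 * card B)) ({}, B))"
    by (rule funpow_invariant[of ?Q, OF 0 step])
  ultimately show "(A ^^ (2 * card B)) ({}, B) \<in> {v \<in> tv_sets B. A v = v}" by blast
  fix w assume w: "w \<in> {v \<in> tv_sets B. A v = v}"
  have "?Q ((A ^^ n) ({}, B)) \<and> (A ^^ n) ({}, B) \<le>\<^sub>p w" for n
  proof (induction n)
    case 0
    show ?case using \<open>?Q ({}, B)\<close> w by (auto simp: le_p_def tv_sets_def)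
  next
    case (Suc n)
    then show ?case using step[of "(A ^^ n) ({}, B)"] mono[of "(A ^^ n) ({}, B)" w] w by auto
  qed
  then show "(A ^^ (2 * card B)) ({}, B) \<le>\<^sub>p w" by blast
qed

text \<open>The intersection keeps \<open>(x, b)\<close> a consistent pair throughout, as
  monotonicity of \<open>A\<close> is available only for those. In \<open>up\<close> the union with
  \<open>a\<close> serves the same purpose.\<close>

definition down :: "'a set \<Rightarrow> 'a set" where
  "down b = ((\<lambda>x. fst (A (x, b)) \<inter> b) ^^ card B) {}"

definition up :: "'a set \<Rightarrow> 'a set" where
  "up a = ((\<lambda>x. a \<union> snd (A (a, x))) ^^ card B) a"

lemma down_fixpoint:
  assumes b: "b \<subseteq> B"
  shows "fst (A (down b, b)) \<inter> b = down b" "down b \<subseteq> b"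
proof -
  let ?f = "\<lambda>x. fst (A (x, b)) \<inter> b"
  let ?Q = "\<lambda>x. x \<subseteq> b \<and> x \<subseteq> ?f x"
  have 0: "?Q {}" by simp
  have step: "?Q x \<Longrightarrow> ?Q (?f x)" for x using fst_mono[of x "?f x" b b] b by blast
  have finb: "finite b" using b fin by (rule finite_subset)
  show "?f (down b) = down b" unfolding down_def
  proof (rule funpow_stationary[of ?Q _ ?f card, OF 0 step])
    fix x assume "?Q x" "?f x \<noteq> x"
    then show "card x < card (?f x)" using finb by (intro psubset_card_mono) auto
  next
    fix x assume "?Q x"
    then show "card x \<le> card B" using b fin by (intro card_mono) auto
  qed
  show "down b \<subseteq> b" unfolding down_def using funpow_invariant[of ?Q "{}" ?f, OF 0 step] by blast
qed

lemma down_least: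
  assumes b: "b \<subseteq> B" and x: "x \<subseteq> b" "fst (A (x, b)) \<subseteq> x"
  shows "down b \<subseteq> x"
  unfolding down_def
proof (rule funpow_invariant[of "\<lambda>y. y \<subseteq> x"])
  fix y assume "y \<subseteq> x"
  then show "fst (A (y, b)) \<inter> b \<subseteq> x" using fst_mono[of y x b b] x b by blast
qed simp

text \<open>By the second hypothesis the intersection in \<open>down\<close> has no effect at the
  limit. Without it there may be no closed set below \<open>b\<close> at all, and the greatest lower
  bound of the empty family is \<open>B\<close>.\<close>

lemma op_down_eq:
  assumes b: "b \<subseteq> B" and "fst (A (b, b)) \<subseteq> b"
  shows "op_down B A b = down b"
proof -
  have "fst (A (down b, b)) \<subseteq> fst (A (b, b))"
    using fst_mono[of "down b" b b b] down_fixpoint[OF b] b by blast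
  then have "fst (A (down b, b)) = down b" using down_fixpoint[OF b] assms(2) by blast
  then show ?thesis
    unfolding op_down_def glb_def using down_fixpoint(2)[OF b] down_least[OF b] b by auto
qed

lemma up_props:
  assumes a: "a \<subseteq> B"
  shows "a \<subseteq> up a" "up a \<subseteq> B" "snd (A (a, up a)) \<subseteq> up a"
proof -
  let ?f = "\<lambda>x. a \<union> snd (A (a, x))"
  let ?Q = "\<lambda>x. a \<subseteq> x \<and> x \<subseteq> B \<and> x \<subseteq> ?f x"
  have 0: "?Q a" using a by auto
  have step: "?Q (?f x)" if Q: "?Q x" for x
  proof -
    have "?f x \<subseteq> B" using Q a snd_le[of a x] by blast
    moreover from this have "snd (A (a, x)) \<subseteq> snd (A (a, ?f x))"
      using snd_mono[of a a x "?f x"] Q by blast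
    ultimately show ?thesis by blast
  qed
  have "?f (up a) = up a" unfolding up_def
  proof (rule funpow_stationary[of ?Q _ ?f card, OF 0 step])
    fix x assume "?Q x" "?f x \<noteq> x"
    moreover from step[OF this(1)] have "finite (?f x)" using fin finite_subset by blast
    ultimately show "card x < card (?f x)" by (intro psubset_card_mono) blast+
  next
    fix x assume "?Q x"
    then show "card x \<le> card B" using fin by (intro card_mono) auto
  qed
  moreover have "?Q (up a)" unfolding up_def by (rule funpow_invariant[of ?Q, OF 0 step])
  ultimately show "a \<subseteq> up a" "up a \<subseteq> B" "snd (A (a, up a)) \<subseteq> up a" by blast+
qed

lemma up_least:
  assumes x: "a \<subseteq> x" "x \<subseteq> B" "snd (A (a, x)) \<subseteq> x"
  shows "up a \<subseteq> x"
proof -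
  have "a \<subseteq> up a \<and> up a \<subseteq> x" unfolding up_def
  proof (rule funpow_invariant[of "\<lambda>y. a \<subseteq> y \<and> y \<subseteq> x"])
    fix y assume "a \<subseteq> y \<and> y \<subseteq> x"
    then show "a \<subseteq> a \<union> snd (A (a, y)) \<and> a \<union> snd (A (a, y)) \<subseteq> x"
      using snd_mono[of a a y x] x by blast
  qed (use x in auto)
  then show ?thesis by blast
qed

lemma op_up_eq:
  assumes "a \<subseteq> B"
  shows "op_up B A a = up a"
proof -
  have "up a \<in> {x. a \<subseteq> x \<and> x \<subseteq> B \<and> snd (A (a, x)) \<subseteq> x}" using up_props[OF assms] by blast
  moreover have "up a \<subseteq> x" if "x \<in> {x. a \<subseteq> x \<and> x \<subseteq> B \<and> snd (A (a, x)) \<subseteq> x}" for x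
    using up_least that by blast
  ultimately show ?thesis
    unfolding op_up_def glb_def using up_props(2)[OF assms] by blast
qed

section \<open>The stable operator on prudent pairs\<close>

definition prudent :: "'a set \<times> 'a set \<Rightarrow> bool" where
  "prudent v \<longleftrightarrow> v \<in> tv_sets B \<and> v \<le>\<^sub>p A v \<and> fst v \<subseteq> op_down B A (snd v)"

definition stable :: "'a set \<times> 'a set \<Rightarrow> 'a set \<times> 'a set" where
  "stable v = (down (snd v), up (fst v))"

lemma prudentD:
  assumes "prudent (a, b)"
  shows "a \<subseteq> b" "b \<subseteq> B" "a \<subseteq> fst (A (a, b))" "snd (A (a, b)) \<subseteq> b" "fst (A (b, b)) \<subseteq> b"
    "op_down B A b = down b" "a \<subseteq> down b" "op_up B A a = up a"
proof -
  show ab: "a \<subseteq> b" "b \<subseteq> B" "a \<subseteq> fst (A (a, b))" "snd (A (a, b)) \<subseteq> b"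
    using assms by (auto simp: prudent_def tv_sets_def le_p_def)
  \<comment> \<open>That \<open>b\<close> is closed, as required for \<open>op_down_eq\<close>, is
    seen through the second component:
    \<open>snd (A (b, b)) \<subseteq> snd (A (a, b)) \<subseteq> b\<close>.\<close>
  have "fst (A (b, b)) \<subseteq> snd (A (b, b))" "snd (A (b, b)) \<subseteq> snd (A (a, b))"
    using fst_le_snd[of b b] snd_mono[of a b b b] ab by auto
  then show "fst (A (b, b)) \<subseteq> b" using ab by blast
  then show "op_down B A b = down b" using op_down_eq ab by blast
  then show "a \<subseteq> down b" using assms by (simp add: prudent_def)
  show "op_up B A a = up a" using op_up_eq ab by blast
qed

lemma stable_op_eq: "prudent v \<Longrightarrow> stable_op B A v = stable v"
  using prudentD(6,8)[of "fst v" "snd v"] by (simp add: stable_op_def stable_def)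

text \<open>A smaller upper bound is more precise and lets more be derived. So
  \<open>down b'\<close>, being closed with respect to \<open>b'\<close>, is also closed with
  respect to \<open>b\<close>, and \<open>down b\<close> is the least such set.\<close>

lemma down_antimono:
  assumes "b' \<subseteq> b" "b \<subseteq> B" "fst (A (b', b')) \<subseteq> b'"
  shows "down b \<subseteq> down b'"
proof -
  have b': "b' \<subseteq> B" using assms by simp
  let ?x = "down b'"
  have x: "?x \<subseteq> b'" by (rule down_fixpoint(2)[OF b'])
  have "fst (A (?x, b')) \<subseteq> fst (A (b', b'))" by (rule fst_mono) (use x b' in simp_all)
  then have "fst (A (?x, b')) \<subseteq> b'" using assms(3) by (rule order.trans)
  then have "fst (A (?x, b')) \<subseteq> ?x" using down_fixpoint(1)[OF b'] by (simp add: Int_absorb2)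
  moreover have "fst (A (?x, b)) \<subseteq> fst (A (?x, b'))" by (rule fst_mono) (use x assms in simp_all)
  ultimately have "fst (A (?x, b)) \<subseteq> ?x" by simp
  then show ?thesis by (rule down_least[OF assms(2) order.trans[OF x assms(1)]])
qed

text \<open>The main point is consistency, \<open>down b \<subseteq> up a\<close>. It holds because
  \<open>up a\<close> is closed for the upper bound \<open>b\<close>: \<open>fst (A (up a, b))
  \<subseteq> fst (A (up a, up a)) \<subseteq> snd (A (up a, up a)) \<subseteq> snd (A (a, up a))
  \<subseteq> up a\<close>.\<close>

lemma prudent_stable:
  assumes "prudent v"
  shows "prudent (stable v)" "v \<le>\<^sub>p stable v"
proof -
  obtain a b where v: "v = (a, b)" by force
  note p = prudentD[OF assms[unfolded v]]
  let ?a = "down b" and ?b = "up a"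
  have aB: "a \<subseteq> B" using p(1,2) by simp
  note u = up_props[OF aB]
  have ub: "?b \<subseteq> b" by (rule up_least) (use p in auto)
  have "fst (A (?b, ?b)) \<subseteq> snd (A (?b, ?b))" by (rule fst_le_snd) (use u in simp_all)
  also have "\<dots> \<subseteq> snd (A (a, ?b))" by (rule snd_mono) (use u in simp_all)
  also have "\<dots> \<subseteq> ?b" by (rule u(3))
  finally have fb: "fst (A (?b, ?b)) \<subseteq> ?b" .
  have "fst (A (?b, b)) \<subseteq> fst (A (?b, ?b))" by (rule fst_mono) (use ub p in simp_all)
  then have ab: "?a \<subseteq> ?b" by (intro down_least[OF p(2) ub] order.trans[OF _ fb])
  have "fst (A (?a, b)) \<subseteq> fst (A (b, b))"
    by (rule fst_mono) (use down_fixpoint(2)[OF p(2)] p(2) in simp_all)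
  then have "fst (A (?a, b)) \<subseteq> b" using p(5) by simp
  then have fix_a: "fst (A (?a, b)) = ?a" using down_fixpoint(1)[OF p(2)] by (simp add: Int_absorb2)
  have "fst (A (?a, b)) \<subseteq> fst (A (?a, ?b))" by (rule fst_mono) (use ab ub p(2) in simp_all)
  then have 1: "?a \<subseteq> fst (A (?a, ?b))" unfolding fix_a .
  have "snd (A (?a, ?b)) \<subseteq> snd (A (a, ?b))" by (rule snd_mono) (use u p(7) ab in simp_all)
  then have 2: "snd (A (?a, ?b)) \<subseteq> ?b" using u(3) by simp
  have "op_down B A ?b = down ?b" by (rule op_down_eq[OF u(2) fb])
  then have 3: "?a \<subseteq> op_down B A ?b" using down_antimono[OF ub p(2) fb] by simp
  show "prudent (stable v)" unfolding prudent_def v stable_def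
    using ab u(2) 1 2 3 by (simp add: tv_sets_def le_p_def)
  show "v \<le>\<^sub>p stable v" unfolding v stable_def using p(7) ub by (simp add: le_p_def)
qed

text \<open>To compare \<open>up c\<close> with \<open>up a\<close> one needs
  \<open>c \<subseteq> up a\<close>, which does not follow from \<open>a \<subseteq> c\<close>. The
  set \<open>x = up a \<inter> d\<close> is closed under \<open>fst (A (_, d))\<close>, hence
  contains \<open>down d\<close>, and thus \<open>c\<close> by prudence of \<open>w\<close>. It is
  then also closed under \<open>snd (A (c, _))\<close>, so that
  \<open>up c \<subseteq> x\<close>.\<close>

lemma stable_mono:
  assumes "prudent v" "prudent w" "v \<le>\<^sub>p w"
  shows "stable v \<le>\<^sub>p stable w"
proof -
  obtain a b where v: "v = (a, b)" by force
  obtain c d where w: "w = (c, d)" by force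
  note p = prudentD[OF assms(1)[unfolded v]] and q = prudentD[OF assms(2)[unfolded w]]
  have le: "a \<subseteq> c" "d \<subseteq> b" using assms(3) v w by (auto simp: le_p_def)
  have aB: "a \<subseteq> B" using p(1,2) by simp
  note u = up_props[OF aB]
  define x where "x = up a \<inter> d"
  have x: "x \<subseteq> up a" "x \<subseteq> d" by (auto simp: x_def)
  have ax: "a \<subseteq> x" using u(1) order.trans[OF le(1) q(1)] by (simp add: x_def)
  have xB: "x \<subseteq> B" using x(2) q(2) by simp
  have "snd (A (a, x)) \<subseteq> snd (A (a, up a))" by (rule snd_mono) (use ax x u in simp_all)
  then have up_x: "snd (A (a, x)) \<subseteq> up a" using u(3) by simp
  have "fst (A (x, d)) \<subseteq> fst (A (x, x))" by (rule fst_mono) (use x q in simp_all)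
  also have "\<dots> \<subseteq> snd (A (x, x))" by (rule fst_le_snd) (use xB in simp_all)
  also have "\<dots> \<subseteq> snd (A (a, x))" by (rule snd_mono) (use ax xB in simp_all)
  also note up_x
  finally have "fst (A (x, d)) \<subseteq> up a" .
  moreover have "fst (A (x, d)) \<subseteq> fst (A (d, d))" by (rule fst_mono) (use x q in simp_all)
  then have "fst (A (x, d)) \<subseteq> d" using q(5) by simp
  ultimately have "fst (A (x, d)) \<subseteq> x" by (simp add: x_def)
  then have "down d \<subseteq> x" by (rule down_least[OF q(2) x(2)])
  then have cx: "c \<subseteq> x" using q(7) by simp
  have "snd (A (c, x)) \<subseteq> snd (A (a, x))" by (rule snd_mono) (use le cx xB in simp_all)
  then have "snd (A (c, x)) \<subseteq> up a" using up_x by simp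
  moreover have "snd (A (c, x)) \<subseteq> snd (A (c, d))" by (rule snd_mono) (use cx x q in simp_all)
  then have "snd (A (c, x)) \<subseteq> d" using q(4) by simp
  ultimately have "snd (A (c, x)) \<subseteq> x" by (simp add: x_def)
  then have "up c \<subseteq> x" by (rule up_least[OF cx xB])
  then show ?thesis
    unfolding v w stable_def using down_antimono[OF le(2) p(2) q(5)] x(1) by (simp add: le_p_def)
qed

lemma well_founded_iterate: "well_founded B A = (stable ^^ (2 * card B)) ({}, B)"
proof -
  have set_eq: "{v \<in> tv_sets B. v \<le>\<^sub>p A v \<and> fst v \<subseteq> op_down B A (snd v) \<and> stable_op B A v = v} =
    {v. prudent v \<and> stable v = v}"
    using stable_op_eq by (auto simp: prudent_def)
  have 0: "prudent ({}, B)"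
    using maps[of "({}, B)"] by (auto simp: prudent_def tv_sets_def le_p_def)
  note step = prudent_stable(1)
  show ?thesis
    unfolding well_founded_def set_eq
  proof (rule least_p_eqI)
    have "stable ((stable ^^ (2 * card B)) ({}, B)) = (stable ^^ (2 * card B)) ({}, B)"
    proof (rule funpow_stationary[of prudent _ _ precision, OF 0 step])
      fix v assume "prudent v" "stable v \<noteq> v"
      then show "precision v < precision (stable v)"
        using precision_less prudent_stable by (auto simp: prudent_def)
    qed (auto simp: prudent_def intro: precision_le)
    moreover have "prudent ((stable ^^ (2 * card B)) ({}, B))"
      by (rule funpow_invariant[of prudent, OF 0 step])
    ultimately show "(stable ^^ (2 * card B)) ({}, B) \<in> {v. prudent v \<and> stable v = v}" by blast
    fix w assume w: "w \<in> {v. prudent v \<and> stable v = v}"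
    have "prudent ((stable ^^ n) ({}, B)) \<and> (stable ^^ n) ({}, B) \<le>\<^sub>p w" for n
    proof (induction n)
      case 0
      show ?case using \<open>prudent ({}, B)\<close> w by (auto simp: le_p_def prudent_def tv_sets_def)
    next
      case (Suc n)
      then show ?case using step[of "(stable ^^ n) ({}, B)"] stable_mono[of "(stable ^^ n) ({}, B)" w] w by auto
    qed
    then show "(stable ^^ (2 * card B)) ({}, B) \<le>\<^sub>p w" by blast
  qed
qed

text \<open>On exact pairs both components of \<open>A\<close> agree, so \<open>up I = I\<close>
  follows from the fixpoint equation. The equation is stated besides \<open>down I = I\<close>
  because the latter, through the intersection in \<open>down\<close>, gives only
  \<open>I \<subseteq> fst (A (I, I))\<close>.\<close>

lemma exact_stable_iff: "exact_stable B A I \<longleftrightarrow> I \<subseteq> B \<and> down I = I \<and> fst (A (I, I)) = I"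
proof
  assume es: "exact_stable B A I"
  then have I: "I \<subseteq> B" and dn: "op_down B A I = I"
    by (auto simp: exact_stable_def stable_op_def)
  let ?Z = "{x. x \<subseteq> I \<and> fst (A (x, I)) \<subseteq> x}"
  \<comment> \<open>If \<open>?Z\<close> were empty, its greatest lower bound \<open>B\<close> would
    equal \<open>I\<close>. But \<open>B\<close> is closed, so it would then be an element of
    \<open>?Z\<close>.\<close>
  have "fst (A (B, B)) \<subseteq> B" using fst_le_snd[of B B] snd_le[of B B] by blast
  then have "?Z \<noteq> {}" using dn unfolding op_down_def glb_def by (cases "?Z = {}") auto
  then obtain x where x: "x \<in> ?Z" by blast
  have "I \<subseteq> x" using dn x unfolding op_down_def glb_def by blast
  then have "fst (A (I, I)) \<subseteq> I" using x by auto
  moreover from op_down_eq[OF I this] dn have "down I = I" by simp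
  ultimately show "I \<subseteq> B \<and> down I = I \<and> fst (A (I, I)) = I"
    using down_fixpoint(1)[OF I] I by auto
next
  assume I: "I \<subseteq> B \<and> down I = I \<and> fst (A (I, I)) = I"
  then have "op_down B A I = I" using op_down_eq[of I] by simp
  moreover have "up I = I"
    using up_props(1)[of I] up_least[of I I] I exact[of I] by auto
  then have "op_up B A I = I" using op_up_eq[of I] I by simp
  ultimately show "exact_stable B A I"
    using I by (simp add: exact_stable_def stable_op_def)
qed

end

section \<open>Access to encoded structures\<close>

definition elems :: "('s, 'f, 'p, 'e::linorder, 'z) struct_scheme \<Rightarrow> 's \<Rightarrow> 'e list" where
  "elems D s = sorted_list_of_set (sdom D s)"

lemma elems:
  assumes "finite (sdom D s)"
  shows "set (elems D s) = sdom D s" "distinct (elems D s)" "length (elems D s) = card (sdom D s)"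
  using assms by (auto simp: elems_def)

lemma rank_nth:
  assumes "finite (sdom D s)" "i < card (sdom D s)"
  shows "rank D s (elems D s ! i) = i"
proof -
  let ?xs = "elems D s"
  have len: "length ?xs = card (sdom D s)" by (rule elems(3)[OF assms(1)])
  have sorted: "sorted_wrt (<) ?xs" by (simp add: elems_def)
  have less: "?xs ! j < ?xs ! i \<longleftrightarrow> j < i" if "j < length ?xs" for j
  proof (cases j i rule: linorder_cases)
    case less
    then show ?thesis using sorted_wrt_nth_less[OF sorted less] assms(2) len by simp
  next
    case greater
    then show ?thesis using sorted_wrt_nth_less[OF sorted greater] that by simp
  qed simp
  have "{x \<in> sdom D s. x < ?xs ! i} = (!) ?xs ` {..<i}"
  proof -
    have "x \<in> (!) ?xs ` {..<i}" if x: "x \<in> sdom D s" "x < ?xs ! i" for x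
    proof -
      obtain j where "j < length ?xs" "x = ?xs ! j"
        using x(1) unfolding elems(1)[OF assms(1), symmetric] in_set_conv_nth by blast
      then show ?thesis using less x(2) by blast
    qed
    moreover have "?xs ! j \<in> sdom D s \<and> ?xs ! j < ?xs ! i" if "j < i" for j
      using less[of j] that assms(2) len nth_mem[of j ?xs] elems(1)[OF assms(1)] by simp
    ultimately show ?thesis by auto
  qed
  moreover have "inj_on ((!) ?xs) {..<i}"
    using elems(2)[OF assms(1)] assms(2) len by (auto simp: inj_on_def nth_eq_iff_index_eq)
  ultimately show ?thesis unfolding rank_def by (simp add: card_image)
qed

lemma nth_rank:
  assumes "finite (sdom D s)" "d \<in> sdom D s"
  shows "elems D s ! rank D s d = d" "rank D s d < card (sdom D s)"
proof -
  obtain i where "i < length (elems D s)" "elems D s ! i = d"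
    using assms(2) unfolding elems(1)[OF assms(1), symmetric] in_set_conv_nth by blast
  then show "elems D s ! rank D s d = d" "rank D s d < card (sdom D s)"
    using rank_nth[OF assms(1), of i] elems(3)[OF assms(1)] by auto
qed

lemma rank_inj:
  "finite (sdom D s) \<Longrightarrow> d \<in> sdom D s \<Longrightarrow> d' \<in> sdom D s \<Longrightarrow> rank D s d = rank D s d' \<longleftrightarrow> d = d'"
  using nth_rank(1) by metis

definition prod_card :: "('s, 'f, 'p, 'e, 'z) struct_scheme \<Rightarrow> 's list \<Rightarrow> nat" where
  "prod_card D ss = (\<Prod>s\<leftarrow>ss. card (sdom D s))"

text \<open>The position of a tuple in \<open>tuple_list\<close>, computed from the ranks in mixed
  radix with the domain sizes as bases. The default 0 is the index of the empty tuple.\<close>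

fun tuple_index :: "('s, 'f, 'p, 'e::linorder) struct \<Rightarrow> 's list \<Rightarrow> 'e list \<Rightarrow> nat" where
  "tuple_index D (s # ss) (d # ds) = rank D s d * prod_card D ss + tuple_index D ss ds"
| "tuple_index D _ _ = 0"

lemma tuples_Nil: "tuples D [] = {[]}"
  by (simp add: tuples_def)

lemma tuples_Cons: "ds \<in> tuples D (s # ss) \<longleftrightarrow> (\<exists>d ds'. ds = d # ds' \<and> d \<in> sdom D s \<and> ds' \<in> tuples D ss)"
  by (auto simp: tuples_def set_Cons_def)

lemma tuples_length: "ds \<in> tuples D ss \<Longrightarrow> length ds = length ss"
  by (induction ss arbitrary: ds) (auto simp: tuples_Nil tuples_Cons)

lemma tuples_map:
  "map f xs \<in> tuples D (map g xs) \<longleftrightarrow> (\<forall>x\<in>set xs. f x \<in> sdom D (g x))"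
  by (induction xs) (auto simp: tuples_Nil tuples_Cons)

lemma tuple_list_Nil: "tuple_list D [] = [[]]"
  by (simp add: tuple_list_def)

lemma tuple_list_Cons: "tuple_list D (s # ss) = concat (map (\<lambda>d. map ((#) d) (tuple_list D ss)) (elems D s))"
  by (simp add: tuple_list_def elems_def)

lemma set_tuple_list: "\<forall>s\<in>set ss. finite (sdom D s) \<Longrightarrow> set (tuple_list D ss) = tuples D ss"
proof (induction ss)
  case (Cons s ss)
  then show ?case by (auto simp: tuple_list_Cons tuples_Cons elems(1) image_iff)
qed (simp add: tuple_list_Nil tuples_Nil)

lemma length_tuple_list: "\<forall>s\<in>set ss. finite (sdom D s) \<Longrightarrow> length (tuple_list D ss) = prod_card D ss"
proof (induction ss)
  case (Cons s ss)
  then show ?case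
    by (simp add: tuple_list_Cons prod_card_def length_concat comp_def elems(3) sum_list_triv)
qed (simp add: tuple_list_Nil prod_card_def)

lemma distinct_tuple_list: "\<forall>s\<in>set ss. finite (sdom D s) \<Longrightarrow> distinct (tuple_list D ss)"
proof (induction ss)
  case (Cons s ss)
  then have d: "distinct (elems D s)" "distinct (tuple_list D ss)" using elems(2) by auto
  have "distinct (concat (map (\<lambda>d. map ((#) d) (tuple_list D ss)) xs))" if "distinct xs" for xs
    using that d(2) by (induction xs) (auto simp: distinct_map)
  then show ?case using d(1) by (simp add: tuple_list_Cons)
qed (simp add: tuple_list_Nil)

lemma nth_concat_uniform:
  "\<forall>x\<in>set xs. length (f x) = m \<Longrightarrow> i < length xs \<Longrightarrow> j < m \<Longrightarrow>
   concat (map f xs) ! (i * m + j) = f (xs ! i) ! j"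
proof (induction xs arbitrary: i)
  case (Cons x xs)
  then show ?case by (cases i) (auto simp: nth_append)
qed simp

lemma nth_tuple_index:
  "\<forall>s\<in>set ss. finite (sdom D s) \<Longrightarrow> ds \<in> tuples D ss \<Longrightarrow>
   tuple_index D ss ds < prod_card D ss \<and> tuple_list D ss ! tuple_index D ss ds = ds"
proof (induction ss arbitrary: ds)
  case (Cons s ss)
  then obtain d ds' where ds: "ds = d # ds'" "d \<in> sdom D s" "ds' \<in> tuples D ss"
    by (auto simp: tuples_Cons)
  have fin: "finite (sdom D s)" using Cons.prems by simp
  from Cons ds have IH: "tuple_index D ss ds' < prod_card D ss" "tuple_list D ss ! tuple_index D ss ds' = ds'"
    by auto
  note r = nth_rank[OF fin ds(2)]
  let ?m = "prod_card D ss"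
  have len: "length (tuple_list D ss) = ?m" using length_tuple_list Cons.prems by auto
  have "rank D s d * ?m + tuple_index D ss ds' < Suc (rank D s d) * ?m" using IH by simp
  also have "\<dots> \<le> card (sdom D s) * ?m" using r(2) by (intro mult_le_mono1) simp
  finally have 1: "tuple_index D (s # ss) ds < prod_card D (s # ss)"
    using ds by (simp add: prod_card_def)
  have "tuple_list D (s # ss) ! (rank D s d * ?m + tuple_index D ss ds') =
      map ((#) (elems D s ! rank D s d)) (tuple_list D ss) ! tuple_index D ss ds'"
    unfolding tuple_list_Cons
    by (rule nth_concat_uniform) (use len r elems(3)[OF fin] IH in auto)
  then show ?case using 1 ds r IH len by simp
qed (simp add: tuples_Nil tuple_list_Nil prod_card_def)

definition pos :: "'b list \<Rightarrow> 'b \<Rightarrow> nat" where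
  "pos xs a = length (takeWhile (\<lambda>b. b \<noteq> a) xs)"

lemma pos: "a \<in> set xs \<Longrightarrow> pos xs a < length xs \<and> xs ! pos xs a = a"
  by (induction xs) (auto simp: pos_def)

lemma nth_concat_offset:
  "a \<in> set as \<Longrightarrow> j < length (f a) \<Longrightarrow>
   (\<Sum>b\<leftarrow>takeWhile (\<lambda>b. b \<noteq> a) as. length (f b)) + j < length (concat (map f as)) \<and>
   concat (map f as) ! ((\<Sum>b\<leftarrow>takeWhile (\<lambda>b. b \<noteq> a) as. length (f b)) + j) = f a ! j"
  by (induction as) (auto simp: nth_append add.assoc)

text \<open>The place in \<open>struct_nats\<close> where the table of \<open>f\<close> begins;
  \<open>tuple_index\<close> counts on from there.\<close>

definition fun_offset :: "('s, 'f, 'p, 'r) signature \<Rightarrow> ('s, 'f, 'p, 'e) struct \<Rightarrow> 'f \<Rightarrow> nat" where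
  "fun_offset sg D f = length (sorts sg) +
     (\<Sum>g\<leftarrow>takeWhile (\<lambda>g. g \<noteq> f) (funs sg). prod_card D (fun_args sg g))"

definition pred_offset :: "('s, 'f, 'p, 'r) signature \<Rightarrow> ('s, 'f, 'p, 'e) struct \<Rightarrow> 'p \<Rightarrow> nat" where
  "pred_offset sg D p = length (sorts sg) + (\<Sum>g\<leftarrow>funs sg. prod_card D (fun_args sg g)) +
     (\<Sum>q\<leftarrow>takeWhile (\<lambda>q. q \<noteq> p) (preds sg). prod_card D (pred_args sg q))"

locale wf_sig =
  fixes sg :: "('s, 'f, 'p, 'r) signature"
  assumes wf_sg: "wf_signature sg"
begin

lemma fun_sorts: "f \<in> set (funs sg) \<Longrightarrow> set (fun_args sg f) \<subseteq> set (sorts sg)"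
  "f \<in> set (funs sg) \<Longrightarrow> fun_res sg f \<in> set (sorts sg)"
  and pred_sorts: "p \<in> set (preds sg) \<Longrightarrow> set (pred_args sg p) \<subseteq> set (sorts sg)"
  and agg_sorts: "r \<in> set (aggs sg) \<Longrightarrow> set (agg_args sg r) \<subseteq> set (sorts sg)"
  "r \<in> set (aggs sg) \<Longrightarrow> agg_res sg r \<in> set (sorts sg)"
  using wf_sg unfolding wf_signature_def by auto

lemma finite_sdom: "D \<in> finite_structures sg \<Longrightarrow> s \<in> set (sorts sg) \<Longrightarrow> finite (sdom D s)"
  by (auto simp: finite_structures_def)

lemma finite_sdoms: "D \<in> finite_structures sg \<Longrightarrow> set ss \<subseteq> set (sorts sg) \<Longrightarrow> \<forall>s\<in>set ss. finite (sdom D s)"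
  using finite_sdom by blast

context
  fixes D :: "('s, 'f, 'p, 'e::linorder) struct"
  assumes D: "D \<in> finite_structures sg"
begin

text \<open>The list \<open>ns\<close> stands for whatever follows the structure in a code, such as
  a queried atom.\<close>

lemma block_card:
  assumes "s \<in> set (sorts sg)"
  shows "block (unary_code (struct_nats sg D @ ns)) (pos (sorts sg) s) = card (sdom D s)"
  using pos[OF assms] by (simp add: block_unary_code struct_nats_def nth_append)

lemma sum_length_fun_tables:
  "set fs \<subseteq> set (funs sg) \<Longrightarrow>
   (\<Sum>g\<leftarrow>fs. length (map (\<lambda>ds. h g ds) (tuple_list D (fun_args sg g)))) =
   (\<Sum>g\<leftarrow>fs. prod_card D (fun_args sg g))"
  by (induction fs) (auto simp: length_tuple_list finite_sdoms[OF D fun_sorts(1)])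

lemma sum_length_pred_tables:
  "set ps \<subseteq> set (preds sg) \<Longrightarrow>
   (\<Sum>q\<leftarrow>ps. length (map (\<lambda>ds. h q ds) (tuple_list D (pred_args sg q)))) =
   (\<Sum>q\<leftarrow>ps. prod_card D (pred_args sg q))"
  by (induction ps) (auto simp: length_tuple_list finite_sdoms[OF D pred_sorts])

lemma block_fun:
  assumes f: "f \<in> set (funs sg)" and ds: "ds \<in> tuples D (fun_args sg f)"
  shows "block (unary_code (struct_nats sg D @ ns)) (fun_offset sg D f + tuple_index D (fun_args sg f) ds) =
    rank D (fun_res sg f) (fun_int D f ds)"
proof -
  let ?t = "\<lambda>f. map (\<lambda>ds. rank D (fun_res sg f) (fun_int D f ds)) (tuple_list D (fun_args sg f))"
  let ?j = "tuple_index D (fun_args sg f) ds"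
  have fin: "\<forall>s\<in>set (fun_args sg f). finite (sdom D s)" by (rule finite_sdoms[OF D fun_sorts(1)[OF f]])
  have j: "?j < length (tuple_list D (fun_args sg f))" "tuple_list D (fun_args sg f) ! ?j = ds"
    using nth_tuple_index[OF fin ds] length_tuple_list[OF fin] by auto
  let ?pre = "takeWhile (\<lambda>g. g \<noteq> f) (funs sg)"
  have "(\<Sum>g\<leftarrow>?pre. length (?t g)) = (\<Sum>g\<leftarrow>?pre. prod_card D (fun_args sg g))"
    by (rule sum_length_fun_tables) (auto dest: set_takeWhileD)
  then have "(\<Sum>g\<leftarrow>?pre. prod_card D (fun_args sg g)) + ?j < length (concat (map ?t (funs sg)))"
    "concat (map ?t (funs sg)) ! ((\<Sum>g\<leftarrow>?pre. prod_card D (fun_args sg g)) + ?j) = ?t f ! ?j"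
    using nth_concat_offset[OF f, of ?j ?t] j by auto
  then show ?thesis
    using j by (simp add: block_unary_code struct_nats_def nth_append fun_offset_def add.assoc)
qed

lemma block_pred:
  assumes p: "p \<in> set (preds sg)" and ds: "ds \<in> tuples D (pred_args sg p)"
  shows "block (unary_code (struct_nats sg D @ ns)) (pred_offset sg D p + tuple_index D (pred_args sg p) ds) =
    of_bool (pred_int D p ds)"
proof -
  let ?u = "\<lambda>f. map (\<lambda>ds. rank D (fun_res sg f) (fun_int D f ds)) (tuple_list D (fun_args sg f))"
  let ?t = "\<lambda>p. map (\<lambda>ds. of_bool (pred_int D p ds) :: nat) (tuple_list D (pred_args sg p))"
  let ?j = "tuple_index D (pred_args sg p) ds"
  have fin: "\<forall>s\<in>set (pred_args sg p). finite (sdom D s)" by (rule finite_sdoms[OF D pred_sorts[OF p]])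
  have j: "?j < length (tuple_list D (pred_args sg p))" "tuple_list D (pred_args sg p) ! ?j = ds"
    using nth_tuple_index[OF fin ds] length_tuple_list[OF fin] by auto
  let ?pre = "takeWhile (\<lambda>g. g \<noteq> p) (preds sg)"
  have "(\<Sum>g\<leftarrow>?pre. length (?t g)) = (\<Sum>g\<leftarrow>?pre. prod_card D (pred_args sg g))"
    by (rule sum_length_pred_tables) (auto dest: set_takeWhileD)
  then have 1: "(\<Sum>g\<leftarrow>?pre. prod_card D (pred_args sg g)) + ?j < length (concat (map ?t (preds sg)))"
    "concat (map ?t (preds sg)) ! ((\<Sum>g\<leftarrow>?pre. prod_card D (pred_args sg g)) + ?j) = ?t p ! ?j"
    using nth_concat_offset[OF p, of ?j ?t] j by auto
  have "length (concat (map ?u (funs sg))) = (\<Sum>g\<leftarrow>funs sg. prod_card D (fun_args sg g))"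
    using sum_length_fun_tables[OF subset_refl, of "\<lambda>f ds. rank D (fun_res sg f) (fun_int D f ds)"]
    by (simp add: length_concat comp_def)
  then show ?thesis
    using j 1 by (simp add: block_unary_code struct_nats_def nth_append pred_offset_def add.assoc)
qed

lemma eval_trm_in:
  "wf_trm sg t \<Longrightarrow> \<forall>x\<in>fv_trm t. \<sigma> x \<in> sdom D (snd x) \<Longrightarrow> eval_trm D \<sigma> t \<in> sdom D (sort_of sg t)"
proof (induction t)
  case (Fn f ts)
  then have "map (eval_trm D \<sigma>) ts \<in> tuples D (map (sort_of sg) ts)"
    unfolding tuples_map by auto
  then show ?case using Fn.prems D by (auto simp: finite_structures_def)
qed simp

lemma eval_trms_in:
  "\<forall>t\<in>set ts. wf_trm sg t \<Longrightarrow> \<forall>t\<in>set ts. \<forall>x\<in>fv_trm t. \<sigma> x \<in> sdom D (snd x) \<Longrightarrow>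
   map (eval_trm D \<sigma>) ts \<in> tuples D (map (sort_of sg) ts)"
  unfolding tuples_map using eval_trm_in by blast

end

end

text \<open>Only finite domains with computable cardinalities are required. The loops derived here
  thus also apply to decoded words, which need not describe a structure.\<close>

locale domain_context = wf_sig sg
  for sg :: "('s, 'f, 'p, 'r) signature" +
  fixes K :: "'k set" and dm :: "'k \<Rightarrow> ('s, 'f, 'p, 'e::linorder) struct" and G0 :: "('k \<Rightarrow> bool list) list"
  assumes finite_dm: "k \<in> K \<Longrightarrow> s \<in> set (sorts sg) \<Longrightarrow> finite (sdom (dm k) s)"
    and PN_card: "s \<in> set (sorts sg) \<Longrightarrow> PN K G0 (\<lambda>k. card (sdom (dm k) s))"
begin

text \<open>Assignments \<open>\<sigma>\<close> are accessible only through the ranks of the values of the variables \<open>vs\<close>.\<close>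

definition cX :: "'s var list \<Rightarrow> ('k \<times> ('s var \<Rightarrow> 'e)) set" where
  "cX vs = {(k, \<sigma>). k \<in> K \<and> (\<forall>v\<in>set vs. \<sigma> v \<in> sdom (dm k) (snd v))}"

definition cG :: "'s var list \<Rightarrow> ('k \<times> ('s var \<Rightarrow> 'e) \<Rightarrow> bool list) list" where
  "cG vs = map (\<lambda>g (k, \<sigma>). g k) G0 @
     map (\<lambda>v (k, \<sigma>). replicate (rank (dm k) (snd v) (\<sigma> v)) True) vs"

lemma cX_val: "z \<in> cX vs \<Longrightarrow> v \<in> set vs \<Longrightarrow> snd z v \<in> sdom (dm (fst z)) (snd v)"
  by (cases z) (simp add: cX_def)

lemma ctx_base: "PT K G0 f \<Longrightarrow> PT (cX vs) (cG vs) (\<lambda>z. f (fst z))"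
  using PT_lift[of K G0 f "cX vs" "cG vs"] by (auto simp: cX_def cG_def case_prod_beta')

lemma ctx_base_PN: "PN K G0 n \<Longrightarrow> PN (cX vs) (cG vs) (\<lambda>z. n (fst z))"
  unfolding PN_def by (rule ctx_base)

lemma ctx_var: "v \<in> set vs \<Longrightarrow> PN (cX vs) (cG vs) (\<lambda>z. rank (dm (fst z)) (snd v) (snd z v))"
  unfolding PN_def by (rule PT_proj) (auto simp: cG_def case_prod_beta')

lemma ctx_more:
  assumes "PT (cX vs) (cG vs) f" "set vs \<subseteq> set vs'"
  shows "PT (cX vs') (cG vs') f"
  by (rule PT_mono[OF PT_more[OF assms(1)]]) (use assms(2) in \<open>auto simp: cG_def cX_def\<close>)

lemma PN_prod_card:
  assumes "set ss \<subseteq> set (sorts sg)"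
  shows "PN K G0 (\<lambda>k. prod_card (dm k) ss)"
  unfolding prod_card_def by (rule PN_prod_list) (use assms PN_card in blast)

text \<open>The loop index is the rank of the element assigned to \<open>v\<close>, so the updated
  assignment is visible through words that are already at hand. If \<open>v\<close> occurs in
  \<open>vs\<close>, its former rank is shadowed.\<close>

lemma ctx_loop:
  assumes v: "snd v \<in> set (sorts sg)" and f: "PT (cX (v # vs)) (cG (v # vs)) (\<lambda>z. f (fst z) (snd z))"
  shows "PT (cX vs) (cG vs)
    (\<lambda>z. concat (map (\<lambda>d. f (fst z) ((snd z)(v := d))) (elems (dm (fst z)) (snd v))))"
proof -
  let ?N = "\<lambda>z :: 'k \<times> ('s var \<Rightarrow> 'e). card (sdom (dm (fst z)) (snd v))"
  let ?h = "\<lambda>((k, \<sigma>), i). (k, \<sigma>(v := elems (dm k) (snd v) ! i))"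
  let ?Y = "below (cX vs) ?N" and ?H = "add_index (cG vs)"
  have N: "PN (cX vs) (cG vs) ?N" by (rule ctx_base_PN[OF PN_card[OF v]])
  have fin: "finite (sdom (dm k) (snd v))" if "k \<in> K" for k by (rule finite_dm[OF that v])
  have "PT ?Y ?H (\<lambda>y. (\<lambda>z. f (fst z) (snd z)) (?h y))"
  proof (rule PT_comp[OF f])
    fix y assume "y \<in> ?Y"
    then obtain k \<sigma> i where y: "y = ((k, \<sigma>), i)" "k \<in> K" "i < card (sdom (dm k) (snd v))"
      "\<forall>u\<in>set vs. \<sigma> u \<in> sdom (dm k) (snd u)"
      by (auto simp: below_def cX_def)
    have "elems (dm k) (snd v) ! i \<in> sdom (dm k) (snd v)"
      using elems(1,3)[OF fin[OF y(2)]] y(3) nth_mem[of i "elems (dm k) (snd v)"] by simp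
    then show "?h y \<in> cX (v # vs)" using y by (auto simp: cX_def)
  next
    fix g assume "g \<in> set (cG (v # vs))"
    then consider g0 where "g0 \<in> set G0" "g = (\<lambda>(k, \<sigma>). g0 k)" |
      u where "u \<in> set (v # vs)" "g = (\<lambda>(k, \<sigma>). replicate (rank (dm k) (snd u) (\<sigma> u)) True)"
      unfolding cG_def set_append set_map Un_iff image_iff by blast
    then show "PT ?Y ?H (\<lambda>y. g (?h y))"
    proof cases
      case 1
      have "PT (cX vs) (cG vs) (\<lambda>(k, \<sigma>). g0 k)" by (rule PT_proj) (use 1 in \<open>auto simp: cG_def\<close>)
      from PT_index[OF this, of ?N] show ?thesis by (simp add: 1(2) case_prod_beta')
    next
      case 2
      show ?thesis
      proof (cases "u = v")
        case True
        have "PT ?Y ?H (\<lambda>(z, i). replicate i True)"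
          using PN_the_index[of "cX vs" ?N "cG vs"] by (simp add: PN_def case_prod_beta')
        then show ?thesis
        proof (rule PT_cong)
          fix y assume "y \<in> ?Y"
          then obtain k \<sigma> i where y: "y = ((k, \<sigma>), i)" "k \<in> K" "i < card (sdom (dm k) (snd v))"
            by (auto simp: below_def cX_def)
          then show "(\<lambda>(z, i). replicate i True) y = g (?h y)"
            using rank_nth[OF fin[OF y(2)] y(3)] 2(2) True by simp
        qed
      next
        case False
        then have "u \<in> set vs" using 2 by simp
        from PT_index[OF ctx_var[OF this, unfolded PN_def], of ?N] show ?thesis
          using False by (simp add: 2(2) case_prod_beta')
      qed
    qed
  qed
  then have "PT ?Y ?H (\<lambda>(z, i). f (fst z) ((snd z)(v := elems (dm (fst z)) (snd v) ! i)))"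
    by (simp add: case_prod_beta')
  from PT_concat[OF N this] show ?thesis
  proof (rule PT_cong)
    fix z assume "z \<in> cX vs"
    then have "length (elems (dm (fst z)) (snd v)) = ?N z"
      using elems(3)[OF fin] by (auto simp: cX_def)
    then have "map (\<lambda>i. g (elems (dm (fst z)) (snd v) ! i)) [0..<?N z] = map g (elems (dm (fst z)) (snd v))" for g :: "'e \<Rightarrow> bool list"
      by (intro nth_equalityI) simp_all
    then show "concat (map (\<lambda>i. f (fst z) ((snd z)(v := elems (dm (fst z)) (snd v) ! i))) [0..<?N z]) =
      concat (map (\<lambda>d. f (fst z) ((snd z)(v := d))) (elems (dm (fst z)) (snd v)))"
      by (rule arg_cong)
  qed
qed

lemma ctx_ex:
  assumes v: "snd v \<in> set (sorts sg)" and b: "PB (cX (v # vs)) (cG (v # vs)) (\<lambda>z. b (fst z) (snd z))"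
  shows "PB (cX vs) (cG vs) (\<lambda>z. \<exists>d\<in>sdom (dm (fst z)) (snd v). b (fst z) ((snd z)(v := d)))"
proof -
  have "PT (cX (v # vs)) (cG (v # vs)) (\<lambda>z. if b (fst z) (snd z) then [True] else [])"
    by (rule PT_if'[OF b PT_const PT_const])
  from PB_not[OF PB_Nil[OF ctx_loop[OF v this]]] show ?thesis
  proof (rule PB_cong)
    fix z assume "z \<in> cX vs"
    then have set_eq: "set (elems (dm (fst z)) (snd v)) = sdom (dm (fst z)) (snd v)"
      using elems(1)[OF finite_dm[OF _ v]] by (auto simp: cX_def)
    have c: "concat (map (\<lambda>d. if P d then [True] else []) xs) = [] \<longleftrightarrow> \<not> (\<exists>d\<in>set xs. P d)"
      for P and xs :: "'e list" by (induction xs) auto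
    show "(concat (map (\<lambda>d. if b (fst z) ((snd z)(v := d)) then [True] else [])
        (elems (dm (fst z)) (snd v))) \<noteq> []) = (\<exists>d\<in>sdom (dm (fst z)) (snd v). b (fst z) ((snd z)(v := d)))"
      unfolding c set_eq by blast
  qed
qed

lemma ctx_all:
  assumes v: "snd v \<in> set (sorts sg)" and b: "PB (cX (v # vs)) (cG (v # vs)) (\<lambda>z. b (fst z) (snd z))"
  shows "PB (cX vs) (cG vs) (\<lambda>z. \<forall>d\<in>sdom (dm (fst z)) (snd v). b (fst z) ((snd z)(v := d)))"
  by (rule PB_cong[OF PB_not[OF ctx_ex[OF v, of _ "\<lambda>k \<sigma>. \<not> b k \<sigma>", OF PB_not[OF b]]]]) blast

lemma ctx_ex_many:
  "\<forall>u\<in>set us. snd u \<in> set (sorts sg) \<Longrightarrow>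
   PB (cX (us @ vs)) (cG (us @ vs)) (\<lambda>z. b (fst z) (snd z)) \<Longrightarrow>
   PB (cX vs) (cG vs) (\<lambda>z. \<exists>\<sigma>. (\<forall>u\<in>set us. \<sigma> u \<in> sdom (dm (fst z)) (snd u)) \<and>
     (\<forall>u. u \<notin> set us \<longrightarrow> \<sigma> u = snd z u) \<and> b (fst z) \<sigma>)"
proof (induction us arbitrary: b)
  case Nil
  have "(\<forall>u. \<sigma> u = \<sigma>' u) \<longleftrightarrow> \<sigma> = \<sigma>'" for \<sigma> \<sigma>' :: "'s var \<Rightarrow> 'e" by (auto simp: fun_eq_iff)
  then show ?case using Nil by simp
next
  case (Cons v us)
  have "PB (cX (us @ vs)) (cG (us @ vs))
      (\<lambda>z. \<exists>d\<in>sdom (dm (fst z)) (snd v). b (fst z) ((snd z)(v := d)))"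
    by (rule ctx_ex) (use Cons.prems in auto)
  moreover have "\<forall>u\<in>set us. snd u \<in> set (sorts sg)" using Cons.prems(1) by simp
  ultimately have "PB (cX vs) (cG vs) (\<lambda>z. \<exists>\<sigma>. (\<forall>u\<in>set us. \<sigma> u \<in> sdom (dm (fst z)) (snd u)) \<and>
     (\<forall>u. u \<notin> set us \<longrightarrow> \<sigma> u = snd z u) \<and> (\<exists>d\<in>sdom (dm (fst z)) (snd v). b (fst z) (\<sigma>(v := d))))"
    by (intro Cons.IH[of "\<lambda>k \<sigma>. \<exists>d\<in>sdom (dm k) (snd v). b k (\<sigma>(v := d))"])
  then show ?case
  proof (rule PB_cong, intro iffI; elim exE conjE bexE)
    fix z \<sigma> d
    assume "\<forall>u\<in>set us. \<sigma> u \<in> sdom (dm (fst z)) (snd u)" "\<forall>u. u \<notin> set us \<longrightarrow> \<sigma> u = snd z u"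
      "d \<in> sdom (dm (fst z)) (snd v)" "b (fst z) (\<sigma>(v := d))"
    then show "\<exists>\<sigma>. (\<forall>u\<in>set (v # us). \<sigma> u \<in> sdom (dm (fst z)) (snd u)) \<and>
        (\<forall>u. u \<notin> set (v # us) \<longrightarrow> \<sigma> u = snd z u) \<and> b (fst z) \<sigma>"
      by (intro exI[of _ "\<sigma>(v := d)"]) auto
  next
    fix z \<sigma>
    assume *: "\<forall>u\<in>set (v # us). \<sigma> u \<in> sdom (dm (fst z)) (snd u)"
      "\<forall>u. u \<notin> set (v # us) \<longrightarrow> \<sigma> u = snd z u" "b (fst z) \<sigma>"
    \<comment> \<open>Before the choice for \<open>v\<close> the assignment must agree with
      \<open>z\<close> at \<open>v\<close>, unless \<open>v\<close> is among the other chosen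
      variables, where it is free anyway.\<close>
    let ?\<sigma> = "if v \<in> set us then \<sigma> else \<sigma>(v := snd z v)"
    have "?\<sigma>(v := \<sigma> v) = \<sigma>" by auto
    then show "\<exists>\<sigma>. (\<forall>u\<in>set us. \<sigma> u \<in> sdom (dm (fst z)) (snd u)) \<and>
      (\<forall>u. u \<notin> set us \<longrightarrow> \<sigma> u = snd z u) \<and> (\<exists>d\<in>sdom (dm (fst z)) (snd v). b (fst z) (\<sigma>(v := d)))"
      using * by (intro exI[of _ ?\<sigma>] conjI bexI[of _ "\<sigma> v"]) auto
  qed
qed

lemma assign_Nil: "assign \<sigma> [] [] = \<sigma>"
  by (simp add: assign_def)

lemma assign_Cons: "x \<notin> set xs \<Longrightarrow> assign \<sigma> (x # xs) (d # ds) = assign (\<sigma>(x := d)) xs ds"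
proof
  fix u
  assume x: "x \<notin> set xs"
  have "map_of (zip xs ds) x = None" using x by (auto simp: map_of_eq_None_iff dest: set_zip_leftD)
  then show "assign \<sigma> (x # xs) (d # ds) u = assign (\<sigma>(x := d)) xs ds u"
    by (cases "u = x") (auto simp: assign_def split: option.split)
qed

lemma map_assign: "distinct xs \<Longrightarrow> length ds = length xs \<Longrightarrow> map (assign \<sigma> xs ds) xs = ds"
  by (rule nth_equalityI) (auto simp: assign_def map_of_zip_nth)

lemma ctx_tuples:
  "distinct xs \<Longrightarrow> \<forall>x\<in>set xs. snd x \<in> set (sorts sg) \<Longrightarrow>
   PT (cX (xs @ vs)) (cG (xs @ vs)) (\<lambda>z. f (fst z) (snd z)) \<Longrightarrow>
   PT (cX vs) (cG vs) (\<lambda>z. concat (map (\<lambda>ds. f (fst z) (assign (snd z) xs ds))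
     (tuple_list (dm (fst z)) (map snd xs))))"
proof (induction xs arbitrary: vs)
  case Nil
  then show ?case by (simp add: tuple_list_Nil assign_Nil)
next
  case (Cons x xs)
  have "PT (cX (xs @ x # vs)) (cG (xs @ x # vs)) (\<lambda>z. f (fst z) (snd z))"
    by (rule ctx_more[OF Cons.prems(3)]) auto
  then have "PT (cX (x # vs)) (cG (x # vs)) (\<lambda>z. concat (map (\<lambda>ds. f (fst z) (assign (snd z) xs ds))
     (tuple_list (dm (fst z)) (map snd xs))))"
    using Cons.IH Cons.prems by simp
  then have "PT (cX vs) (cG vs) (\<lambda>z. concat (map (\<lambda>d. concat (map (\<lambda>ds. f (fst z) (assign ((snd z)(x := d)) xs ds))
     (tuple_list (dm (fst z)) (map snd xs)))) (elems (dm (fst z)) (snd x))))"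
    by (intro ctx_loop[of x vs "\<lambda>k \<sigma>. concat (map (\<lambda>ds. f k (assign \<sigma> xs ds)) (tuple_list (dm k) (map snd xs)))"])
      (use Cons.prems(2) in simp)
  then show ?case
  proof (rule PT_cong)
    fix z :: "'k \<times> ('s var \<Rightarrow> 'e)"
    have "assign (snd z) (x # xs) (d # ds) = assign ((snd z)(x := d)) xs ds" for d ds
      using Cons.prems(1) by (intro assign_Cons) simp
    moreover have "concat (map g (concat (map (\<lambda>d. map ((#) d) L) es))) =
      concat (map (\<lambda>d. concat (map (\<lambda>ds. g (d # ds)) L)) es)" for g :: "'e list \<Rightarrow> bool list" and es L
      by (induction es) (auto simp: comp_def)
    ultimately show "concat (map (\<lambda>d. concat (map (\<lambda>ds. f (fst z) (assign ((snd z)(x := d)) xs ds))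
       (tuple_list (dm (fst z)) (map snd xs)))) (elems (dm (fst z)) (snd x))) =
      concat (map (\<lambda>ds. f (fst z) (assign (snd z) (x # xs) ds)) (tuple_list (dm (fst z)) (map snd (x # xs))))"
      by (simp add: tuple_list_Cons)
  qed
qed

text \<open>The variables \<open>zs\<close> only name the components of the tuple. As no other
  variable is visible, any initial assignment will do, here \<open>undefined\<close>.\<close>

lemma PT_tuples:
  assumes zs: "distinct zs" "map snd zs = ss" and ss: "set ss \<subseteq> set (sorts sg)"
    and f: "PT (cX zs) (cG zs) (\<lambda>z. f (fst z) (map (snd z) zs))"
  shows "PT K G0 (\<lambda>k. concat (map (f k) (tuple_list (dm k) ss)))"
proof -
  have "\<forall>x\<in>set zs. snd x \<in> set (sorts sg)"
    using ss unfolding zs(2)[symmetric] set_map image_subset_iff .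
  moreover have "PT (cX (zs @ [])) (cG (zs @ [])) (\<lambda>z. f (fst z) (map (snd z) zs))" using f by simp
  ultimately have "PT (cX []) (cG []) (\<lambda>z. concat (map (\<lambda>ds. f (fst z) (map (assign (snd z) zs ds) zs))
      (tuple_list (dm (fst z)) (map snd zs))))"
    by (rule ctx_tuples[OF zs(1), of _ "\<lambda>k \<sigma>. f k (map \<sigma> zs)"])
  then have "PT K G0 (\<lambda>k. (\<lambda>z. concat (map (\<lambda>ds. f (fst z) (map (assign (snd z) zs ds) zs))
      (tuple_list (dm (fst z)) (map snd zs)))) (k, undefined))"
  proof (rule PT_comp)
    fix g assume "g \<in> set (cG [])"
    then obtain g0 where "g0 \<in> set G0" "g = (\<lambda>(k, \<sigma>). g0 k)" by (auto simp: cG_def)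
    then show "PT K G0 (\<lambda>k. g (k, undefined))" using PT_proj[of g0 G0 K] by simp
  qed (simp add: cX_def)
  then show ?thesis
  proof (rule PT_cong)
    fix k assume k: "k \<in> K"
    have fin: "\<forall>s\<in>set ss. finite (sdom (dm k) s)" using finite_dm[OF k] ss by blast
    have "map (assign \<sigma> zs ds) zs = ds" if "ds \<in> set (tuple_list (dm k) ss)" for ds \<sigma>
    proof (rule map_assign[OF zs(1)])
      have "ds \<in> tuples (dm k) (map snd zs)" using that set_tuple_list[OF fin] zs(2) by simp
      from tuples_length[OF this] show "length ds = length zs" by simp
    qed
    then show "(\<lambda>z. concat (map (\<lambda>ds. f (fst z) (map (assign (snd z) zs ds) zs))
      (tuple_list (dm (fst z)) (map snd zs)))) (k, undefined) = concat (map (f k) (tuple_list (dm k) ss))"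
      by (simp add: zs(2) cong: map_cong)
  qed
qed

lemma PB_tuples_ex:
  assumes zs: "distinct zs" "map snd zs = ss" and ss: "set ss \<subseteq> set (sorts sg)"
    and b: "PB (cX zs) (cG zs) (\<lambda>z. b (fst z) (map (snd z) zs))"
  shows "PB K G0 (\<lambda>k. \<exists>ds\<in>tuples (dm k) ss. b k ds)"
proof -
  have "PT (cX zs) (cG zs) (\<lambda>z. if b (fst z) (map (snd z) zs) then [True] else [])"
    by (rule PT_if'[OF b PT_const PT_const])
  from PB_not[OF PB_Nil[OF PT_tuples[OF zs ss, of "\<lambda>k ds. if b k ds then [True] else []", OF this]]]
  show ?thesis
  proof (rule PB_cong)
    fix k assume k: "k \<in> K"
    have fin: "\<forall>s\<in>set ss. finite (sdom (dm k) s)" using finite_dm[OF k] ss by blast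
    have c: "concat (map (\<lambda>d. if Q d then [True] else []) xs) = [] \<longleftrightarrow> \<not> (\<exists>d\<in>set xs. Q d)"
      for Q and xs :: "'e list list" by (induction xs) auto
    show "(concat (map (\<lambda>ds. if b k ds then [True] else []) (tuple_list (dm k) ss)) \<noteq> []) =
      (\<exists>ds\<in>tuples (dm k) ss. b k ds)"
      unfolding c set_tuple_list[OF fin] by blast
  qed
qed

lemma PN_fun_offset: "f \<in> set (funs sg) \<Longrightarrow> PN K G0 (\<lambda>k. fun_offset sg (dm k) f)"
  unfolding fun_offset_def
  by (intro PN_add PN_const PN_sum_list PN_prod_card fun_sorts) (auto dest: set_takeWhileD)

lemma PN_pred_offset: "p \<in> set (preds sg) \<Longrightarrow> PN K G0 (\<lambda>k. pred_offset sg (dm k) p)"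
  unfolding pred_offset_def
  by (intro PN_add PN_const PN_sum_list PN_prod_card fun_sorts pred_sorts) (auto dest: set_takeWhileD)

lemma ctx_tuple_index:
  assumes "\<And>t. t \<in> set ts \<Longrightarrow> PN (cX vs) (cG vs) (\<lambda>z. rank (dm (fst z)) (srt t) (ev t z))"
    "srt ` set ts \<subseteq> set (sorts sg)"
  shows "PN (cX vs) (cG vs) (\<lambda>z. tuple_index (dm (fst z)) (map srt ts) (map (\<lambda>t. ev t z) ts))"
  using assms
proof (induction ts)
  case (Cons t ts)
  then have "PN (cX vs) (cG vs) (\<lambda>z. tuple_index (dm (fst z)) (map srt ts) (map (\<lambda>t. ev t z) ts))"
    "PN (cX vs) (cG vs) (\<lambda>z. rank (dm (fst z)) (srt t) (ev t z))"
    "PN (cX vs) (cG vs) (\<lambda>z. prod_card (dm (fst z)) (map srt ts))"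
    using ctx_base_PN[OF PN_prod_card[of "map srt ts"]] by auto
  from PN_add[OF PN_mult[OF this(2,3)] this(1)] show ?case by simp
qed (simp add: PN_const)

end

locale structure_context = wf_sig sg
  for sg :: "('s, 'f, 'p, 'r) signature" +
  fixes K :: "'k set" and dm :: "'k \<Rightarrow> ('s, 'f, 'p, 'e::linorder) struct"
    and G0 :: "('k \<Rightarrow> bool list) list"
  assumes dm: "k \<in> K \<Longrightarrow> dm k \<in> finite_structures sg"
    and code: "PT K G0 (\<lambda>k. struct_code sg (dm k))"
begin

sublocale domain_context sg K dm G0
proof
  fix s assume s: "s \<in> set (sorts sg)"
  show "finite (sdom (dm k) s)" if "k \<in> K" for k by (rule finite_sdom[OF dm[OF that] s])
  show "PN K G0 (\<lambda>k. card (sdom (dm k) s))"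
    by (rule PN_cong[OF PN_block[OF code PN_const[of _ _ "pos (sorts sg) s"]]])
      (use block_card[OF dm s, of _ "[]"] in \<open>auto simp: struct_code_def\<close>)
qed

text \<open>Terms are evaluated on ranks: the ranks of the arguments give a position in the table of
  the function, where the rank of the value is found.\<close>

lemma ctx_trm:
  "wf_trm sg t \<Longrightarrow> fv_trm t \<subseteq> set vs \<Longrightarrow>
   PN (cX vs) (cG vs) (\<lambda>z. rank (dm (fst z)) (sort_of sg t) (eval_trm (dm (fst z)) (snd z) t))"
proof (induction t)
  case (Var x)
  then show ?case using ctx_var[of x vs] by simp
next
  case (Fn f ts)
  have f: "f \<in> set (funs sg)" and ts: "\<forall>t\<in>set ts. wf_trm sg t" "map (sort_of sg) ts = fun_args sg f"
    using Fn.prems by auto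
  have ss: "sort_of sg ` set ts \<subseteq> set (sorts sg)"
    using fun_sorts(1)[OF f] arg_cong[OF ts(2), of set] by simp
  have "PN (cX vs) (cG vs) (\<lambda>z. rank (dm (fst z)) (sort_of sg t) (eval_trm (dm (fst z)) (snd z) t))"
    if "t \<in> set ts" for t
    by (rule Fn.IH[OF that]) (use that ts Fn.prems(2) in auto)
  then have "PN (cX vs) (cG vs) (\<lambda>z. tuple_index (dm (fst z)) (map (sort_of sg) ts)
      (map (\<lambda>t. eval_trm (dm (fst z)) (snd z) t) ts))"
    by (rule ctx_tuple_index[OF _ ss])
  then have "PN (cX vs) (cG vs) (\<lambda>z. block (struct_code sg (dm (fst z))) (fun_offset sg (dm (fst z)) f +
      tuple_index (dm (fst z)) (fun_args sg f) (map (eval_trm (dm (fst z)) (snd z)) ts)))"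
    unfolding ts(2) by (intro PN_block PN_add ctx_base[OF code] ctx_base_PN[OF PN_fun_offset[OF f]])
  then show ?case
  proof (rule PN_cong)
    fix z assume z: "z \<in> cX vs"
    then have D: "dm (fst z) \<in> finite_structures sg" using dm by (auto simp: cX_def)
    have "map (eval_trm (dm (fst z)) (snd z)) ts \<in> tuples (dm (fst z)) (map (sort_of sg) ts)"
      by (rule eval_trms_in[OF D ts(1)], intro ballI cX_val[OF z]) (use Fn.prems(2) in auto)
    then show "block (struct_code sg (dm (fst z))) (fun_offset sg (dm (fst z)) f +
        tuple_index (dm (fst z)) (fun_args sg f) (map (eval_trm (dm (fst z)) (snd z)) ts)) =
      rank (dm (fst z)) (sort_of sg (Fn f ts)) (eval_trm (dm (fst z)) (snd z) (Fn f ts))"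
      using block_fun[OF D f, of _ "[]"] ts(2) by (simp add: struct_code_def)
  qed
qed

lemma ctx_trms_index:
  assumes "\<forall>t\<in>set ts. wf_trm sg t" "(\<Union>t\<in>set ts. fv_trm t) \<subseteq> set vs" "set (map (sort_of sg) ts) \<subseteq> set (sorts sg)"
  shows "PN (cX vs) (cG vs) (\<lambda>z. tuple_index (dm (fst z)) (map (sort_of sg) ts)
      (map (eval_trm (dm (fst z)) (snd z)) ts))"
  by (rule ctx_tuple_index[where ev = "\<lambda>t z. eval_trm (dm (fst z)) (snd z) t"])
    (use assms in \<open>auto intro!: ctx_trm\<close>)

end

section \<open>Evaluation of formulas and the consequence operator\<close>

lemma sig_with_simps [simp]:
  "sorts (sig_with sg Pd) = sorts sg" "funs (sig_with sg Pd) = funs sg" "aggs (sig_with sg Pd) = aggs sg"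
  "preds (sig_with sg Pd) = preds sg @ Pd" "fun_args (sig_with sg Pd) = fun_args sg"
  "fun_res (sig_with sg Pd) = fun_res sg" "pred_args (sig_with sg Pd) = pred_args sg"
  "agg_args (sig_with sg Pd) = agg_args sg" "agg_res (sig_with sg Pd) = agg_res sg"
  by (simp_all add: sig_with_def)

lemma sort_of_sig_with [simp]: "sort_of (sig_with sg Pd) = sort_of sg"
proof
  show "sort_of (sig_with sg Pd) t = sort_of sg t" for t :: "('a, 'b) trm" by (cases t) auto
qed

lemma wf_trm_sig_with [simp]: "wf_trm (sig_with sg Pd) t = wf_trm sg t"
  by (induction t) auto

lemma truncate_simps:
  assumes "struct.truncate E = D"
  shows "sdom E = sdom D" "fun_int E = fun_int D" "pred_int E = pred_int D" "tuples E = tuples D"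
    "eval_trm E \<sigma> t = eval_trm D \<sigma> t"
proof -
  show 1: "sdom E = sdom D" "fun_int E = fun_int D" "pred_int E = pred_int D"
    using assms by (auto simp: struct.truncate_def)
  show "tuples E = tuples D" by (simp add: tuples_def 1 fun_eq_iff)
  show "eval_trm E \<sigma> t = eval_trm D \<sigma> t"
  proof (induction t)
    case (Fn f ts)
    then have "map (eval_trm E \<sigma>) ts = map (eval_trm D \<sigma>) ts" by simp
    then show ?case by (simp only: eval_trm.simps 1)
  qed simp
qed

lemma eval_trm_cong: "\<forall>x\<in>fv_trm t. \<sigma> x = \<sigma>' x \<Longrightarrow> eval_trm D \<sigma> t = eval_trm D \<sigma>' t"
proof (induction t)
  case (Fn f ts)
  then have "map (eval_trm D \<sigma>) ts = map (eval_trm D \<sigma>') ts" by simp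
  then show ?case by (simp only: eval_trm.simps)
qed simp

lemma assign_cong:
  assumes "\<forall>x\<in>V - set xs. \<sigma> x = \<sigma>' x" "length ds = length xs" "x \<in> V"
  shows "assign \<sigma> xs ds x = assign \<sigma>' xs ds x"
proof (cases "x \<in> set xs")
  case True
  then have "map_of (zip xs ds) x \<noteq> None" using assms(2) by (simp add: map_of_zip_is_None)
  then show ?thesis by (auto simp: assign_def)
next
  case False
  then have "map_of (zip xs ds) x = None" using assms(2) by (simp add: map_of_zip_is_None)
  moreover have "\<sigma> x = \<sigma>' x" using assms False by blast
  ultimately show ?thesis unfolding assign_def by simp
qed

lemma val_fm_cong:
  fixes E :: "('s, 'f, 'p, 'e, 'r) struct3"
  shows "\<forall>x\<in>fv_fm \<phi>. \<sigma> x = \<sigma>' x \<Longrightarrow> val_fm E Pd I \<phi> \<sigma> = val_fm E Pd I \<phi> \<sigma>'"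
    and "\<forall>x\<in>fv_setexp e. \<sigma> x = \<sigma>' x \<Longrightarrow> val_setexp E Pd I e \<sigma> = val_setexp E Pd I e \<sigma>'"
proof (induction \<phi> and e arbitrary: \<sigma> \<sigma>' and \<sigma> \<sigma>')
  case (Atom p ts)
  then have "map (eval_trm E \<sigma>) ts = map (eval_trm E \<sigma>') ts" by (auto intro!: eval_trm_cong)
  then show ?case by (simp only: val_fm.simps)
next
  case (AggAtom r e t)
  have "val_setexp E Pd I e \<sigma> = val_setexp E Pd I e \<sigma>'" by (rule AggAtom.IH) (use AggAtom.prems in simp)
  moreover have "eval_trm E \<sigma> t = eval_trm E \<sigma>' t" by (rule eval_trm_cong) (use AggAtom.prems in simp)
  ultimately show ?case by simp
next
  case (Neg \<phi>)
  have "val_fm E Pd I \<phi> \<sigma> = val_fm E Pd I \<phi> \<sigma>'" by (rule Neg.IH) (use Neg.prems in simp)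
  then show ?case by simp
next
  case (Conj \<phi> \<psi>)
  have "val_fm E Pd I \<phi> \<sigma> = val_fm E Pd I \<phi> \<sigma>'" "val_fm E Pd I \<psi> \<sigma> = val_fm E Pd I \<psi> \<sigma>'"
    by (rule Conj.IH; use Conj.prems in simp)+
  then show ?case by simp
next
  case (Disj \<phi> \<psi>)
  have "val_fm E Pd I \<phi> \<sigma> = val_fm E Pd I \<phi> \<sigma>'" "val_fm E Pd I \<psi> \<sigma> = val_fm E Pd I \<psi> \<sigma>'"
    by (rule Disj.IH; use Disj.prems in simp)+
  then show ?case by simp
next
  case (Forall x \<phi>)
  have "val_fm E Pd I \<phi> (\<sigma>(x := d)) = val_fm E Pd I \<phi> (\<sigma>'(x := d))" for d
    by (rule Forall.IH) (use Forall.prems in simp)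
  then show ?case by simp
next
  case (Exists x \<phi>)
  have "val_fm E Pd I \<phi> (\<sigma>(x := d)) = val_fm E Pd I \<phi> (\<sigma>'(x := d))" for d
    by (rule Exists.IH) (use Exists.prems in simp)
  then show ?case by simp
next
  case (SetExp xs \<phi>)
  have "val_fm E Pd I \<phi> (assign \<sigma> xs ds) = val_fm E Pd I \<phi> (assign \<sigma>' xs ds)"
    if "ds \<in> tuples E (map snd xs)" for ds
  proof (rule SetExp.IH, rule ballI)
    fix x assume "x \<in> fv_fm \<phi>"
    then show "assign \<sigma> xs ds x = assign \<sigma>' xs ds x"
      by (intro assign_cong[of "fv_fm \<phi>"]) (use SetExp.prems tuples_length[OF that] in simp_all)
  qed
  then show ?case by (simp only: val_setexp.simps prod.inject) (intro conjI Collect_cong, auto)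
qed

lemma finite_fv_trm: "finite (fv_trm t)"
  by (induction t) auto

lemma finite_fv: fixes \<phi> :: "('s, 'f, 'p, 'r) fm" and e :: "('s, 'f, 'p, 'r) setexp"
  shows "finite (fv_fm \<phi>)" and "finite (fv_setexp e)"
  by (induction \<phi> and e) (auto simp: finite_fv_trm)

lemma fv_trm_sorts: "wf_trm sg t \<Longrightarrow> x \<in> fv_trm t \<Longrightarrow> snd x \<in> set (sorts sg)"
  by (induction t) auto

lemma fv_fm_sorts:
  fixes sg :: "('s, 'f, 'p, 'r) signature"
  shows "wf_fm sg \<phi> \<Longrightarrow> x \<in> fv_fm \<phi> \<Longrightarrow> snd x \<in> set (sorts sg)"
    and "wf_setexp sg e ss \<Longrightarrow> x \<in> fv_setexp e \<Longrightarrow> snd x \<in> set (sorts sg)"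
  by (induction \<phi> and e arbitrary: and ss) (auto dest: fv_trm_sorts)

lemma neg3_eq: "neg3 v = (\<not> snd v, \<not> fst v)"
  by (cases v) simp

lemma unary_code_map: "unary_code (map h xs) = concat (map (\<lambda>x. unary_code [h x]) xs)"
  by (simp add: unary_code_def comp_def)

lemma length_unary_code: "length (unary_code ns) = sum_list ns + length ns"
  by (induction ns) (auto simp: unary_code_simps)

section \<open>Programs and interpretations as tables of bits\<close>

locale aggregate_program = wf_sig sg
  for sg :: "('s, 'f, 'p, 'r) signature" +
  fixes Pd :: "'p list" and P :: "('s, 'f, 'p, 'r) rl set"
    and X :: "('s, 'f, 'p, 'e::linorder) struct \<Rightarrow> ('s, 'f, 'p, 'e, 'r) struct3"
  assumes wf_Pd: "wf_defined sg Pd" and fin_P: "finite P"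
    and wf_P: "\<rho> \<in> P \<Longrightarrow> wf_rule sg Pd \<rho>"
    and ext: "D \<in> finite_structures sg \<Longrightarrow> tv_extension sg D (X D)"
    and poly: "r \<in> set (aggs sg) \<Longrightarrow> agg_polytime sg X fst r \<and> agg_polytime sg X snd r"
begin

lemma Pd_sorts: "p \<in> set Pd \<Longrightarrow> set (pred_args sg p) \<subseteq> set (sorts sg)"
  and Pd_distinct: "distinct Pd" and Pd_disjoint: "p \<in> set Pd \<Longrightarrow> p \<notin> set (preds sg)"
  using wf_Pd unfolding wf_defined_def by auto

lemma truncate_X: "D \<in> finite_structures sg \<Longrightarrow> struct.truncate (X D) = D"
  using ext by (auto simp: tv_extension_def)

lemmas X_simps = truncate_simps[OF truncate_X]

definition atom_list :: "('s, 'f, 'p, 'e) struct \<Rightarrow> ('p, 'e) gatom list" where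
  "atom_list D = concat (map (\<lambda>p. map (Pair p) (tuple_list D (pred_args sg p))) Pd)"

text \<open>All these words have length \<open>card (bs D)\<close>, so iterating on them cannot
  exceed a polynomial size.\<close>

definition tab :: "('s, 'f, 'p, 'e) struct \<Rightarrow> ('p, 'e) gatom set \<Rightarrow> bool list" where
  "tab D J = map (\<lambda>A. A \<in> J) (atom_list D)"

definition atom_offset :: "('s, 'f, 'p, 'e) struct \<Rightarrow> 'p \<Rightarrow> nat" where
  "atom_offset D p = (\<Sum>q\<leftarrow>takeWhile (\<lambda>q. q \<noteq> p) Pd. prod_card D (pred_args sg q))"

abbreviation bs :: "('s, 'f, 'p, 'e) struct \<Rightarrow> ('p, 'e) gatom set" where
  "bs \<equiv> base sg Pd"

abbreviation \<Phi> :: "('s, 'f, 'p, 'e) struct \<Rightarrow> ('p, 'e) interp3 \<Rightarrow> ('p, 'e) interp3" where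
  "\<Phi> D \<equiv> consequence_op sg Pd P (X D)"

context
  fixes D :: "('s, 'f, 'p, 'e) struct"
  assumes D: "D \<in> finite_structures sg"
begin

lemma Pd_finite: "p \<in> set Pd \<Longrightarrow> \<forall>s\<in>set (pred_args sg p). finite (sdom D s)"
  by (rule finite_sdoms[OF D Pd_sorts])

lemma set_atom_list: "set (atom_list D) = bs D"
  using set_tuple_list[OF Pd_finite] by (auto simp: atom_list_def base_def)

lemma distinct_atom_list: "distinct (atom_list D)"
proof -
  have "distinct (concat (map (\<lambda>p. map (Pair p) (tuple_list D (pred_args sg p))) ps))"
    if "distinct ps" "set ps \<subseteq> set Pd" for ps
    using that distinct_tuple_list[OF Pd_finite]
    by (induction ps) (auto simp: distinct_map inj_on_def)
  then show ?thesis using Pd_distinct by (simp add: atom_list_def)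
qed

lemma finite_base: "finite (bs D)"
  using set_atom_list by (metis List.finite_set)

lemma length_tab: "length (tab D J) = card (bs D)"
  using distinct_card[OF distinct_atom_list] by (simp add: tab_def set_atom_list)

lemma tab_inj: "J \<subseteq> bs D \<Longrightarrow> J' \<subseteq> bs D \<Longrightarrow> tab D J = tab D J' \<longleftrightarrow> J = J'"
  using set_atom_list by (auto simp: tab_def)

text \<open>Every word of the right length is a table, so the length is the only thing to check
  about the form of a certificate.\<close>

lemma tab_surj: "length u = card (bs D) \<Longrightarrow> \<exists>J\<subseteq>bs D. tab D J = u"
proof (intro exI conjI)
  assume len: "length u = card (bs D)"
  let ?L = "atom_list D"
  let ?J = "{?L ! i | i. i < length ?L \<and> u ! i}"
  have l: "length ?L = length u" using len distinct_card[OF distinct_atom_list] set_atom_list by simp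
  show "?J \<subseteq> bs D" using set_atom_list nth_mem by blast
  have "(?L ! i \<in> ?J) = u ! i" if i: "i < length ?L" for i
  proof
    assume "?L ! i \<in> ?J"
    then obtain j where "j < length ?L" "u ! j" "?L ! i = ?L ! j" by blast
    then show "u ! i" using i distinct_atom_list nth_eq_iff_index_eq by metis
  qed (use i in blast)
  then show "tab D ?J = u" unfolding tab_def by (intro nth_equalityI) (simp_all add: l)
qed

lemma nth_tab:
  assumes p: "p \<in> set Pd" and ds: "ds \<in> tuples D (pred_args sg p)"
  defines "i \<equiv> atom_offset D p + tuple_index D (pred_args sg p) ds"
  shows "i < length (tab D J) \<and> tab D J ! i = ((p, ds) \<in> J)"
proof -
  let ?f = "\<lambda>p. map (\<lambda>ds. (p, ds) \<in> J) (tuple_list D (pred_args sg p))"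
  let ?j = "tuple_index D (pred_args sg p) ds"
  have tab: "tab D J = concat (map ?f Pd)"
    by (simp add: tab_def atom_list_def map_concat comp_def)
  have j: "?j < length (tuple_list D (pred_args sg p))" "tuple_list D (pred_args sg p) ! ?j = ds"
    using nth_tuple_index[OF Pd_finite[OF p] ds] length_tuple_list[OF Pd_finite[OF p]] by auto
  have "(\<Sum>q\<leftarrow>qs. length (?f q)) = (\<Sum>q\<leftarrow>qs. prod_card D (pred_args sg q))" if "set qs \<subseteq> set Pd" for qs
    using that by (induction qs) (auto simp: length_tuple_list[OF Pd_finite])
  then have "(\<Sum>q\<leftarrow>takeWhile (\<lambda>q. q \<noteq> p) Pd. length (?f q)) = atom_offset D p"
    unfolding atom_offset_def by (auto dest: set_takeWhileD)
  then show ?thesis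
    using nth_concat_offset[OF p, of ?j ?f] j unfolding i_def tab by simp
qed

end

end

locale program_context = aggregate_program sg Pd P X + structure_context sg K dm G0
  for sg :: "('s, 'f, 'p, 'r) signature" and Pd :: "'p list" and P :: "('s, 'f, 'p, 'r) rl set"
    and X :: "('s, 'f, 'p, 'e::linorder) struct \<Rightarrow> ('s, 'f, 'p, 'e, 'r) struct3"
    and K :: "'k set" and dm :: "'k \<Rightarrow> ('s, 'f, 'p, 'e) struct" and G0 :: "('k \<Rightarrow> bool list) list"
begin

lemma cX_D: "z \<in> cX vs \<Longrightarrow> dm (fst z) \<in> finite_structures sg"
  using dm by (auto simp: cX_def)

lemma PN_atom_offset: "p \<in> set Pd \<Longrightarrow> PN K G0 (\<lambda>k. atom_offset (dm k) p)"
  unfolding atom_offset_def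
  by (intro PN_sum_list PN_prod_card Pd_sorts) (auto dest: set_takeWhileD)

lemma ctx_defined_atom:
  assumes p: "p \<in> set Pd" and ts: "\<forall>t\<in>set ts. wf_trm sg t" "map (sort_of sg) ts = pred_args sg p"
    "(\<Union>t\<in>set ts. fv_trm t) \<subseteq> set vs" and J: "PT K G0 (\<lambda>k. tab (dm k) (J k))"
  shows "PB (cX vs) (cG vs) (\<lambda>z. (p, map (eval_trm (dm (fst z)) (snd z)) ts) \<in> J (fst z))"
proof -
  have "PN (cX vs) (cG vs) (\<lambda>z. tuple_index (dm (fst z)) (map (sort_of sg) ts)
      (map (eval_trm (dm (fst z)) (snd z)) ts))"
    by (rule ctx_trms_index) (use ts Pd_sorts[OF p] in auto)
  from PB_nth[OF ctx_base[OF J] PN_add[OF ctx_base_PN[OF PN_atom_offset[OF p]] this]]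
  show ?thesis
  proof (rule PB_cong)
    fix z assume z: "z \<in> cX vs"
    have "map (eval_trm (dm (fst z)) (snd z)) ts \<in> tuples (dm (fst z)) (map (sort_of sg) ts)"
      by (rule eval_trms_in[OF cX_D[OF z] ts(1)], intro ballI cX_val[OF z]) (use ts(3) in auto)
    from nth_tab[OF cX_D[OF z] p this[unfolded ts(2)], of "J (fst z)"]
    show "(atom_offset (dm (fst z)) p + tuple_index (dm (fst z)) (map (sort_of sg) ts)
          (map (eval_trm (dm (fst z)) (snd z)) ts) < length (tab (dm (fst z)) (J (fst z))) \<and>
        tab (dm (fst z)) (J (fst z)) ! (atom_offset (dm (fst z)) p +
          tuple_index (dm (fst z)) (map (sort_of sg) ts) (map (eval_trm (dm (fst z)) (snd z)) ts))) =
        ((p, map (eval_trm (dm (fst z)) (snd z)) ts) \<in> J (fst z))"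
      unfolding ts(2) by blast
  qed
qed

lemma ctx_pred_atom:
  assumes p: "p \<in> set (preds sg)" and ts: "\<forall>t\<in>set ts. wf_trm sg t" "map (sort_of sg) ts = pred_args sg p"
    "(\<Union>t\<in>set ts. fv_trm t) \<subseteq> set vs"
  shows "PB (cX vs) (cG vs) (\<lambda>z. pred_int (dm (fst z)) p (map (eval_trm (dm (fst z)) (snd z)) ts))"
proof -
  have "PN (cX vs) (cG vs) (\<lambda>z. tuple_index (dm (fst z)) (map (sort_of sg) ts)
      (map (eval_trm (dm (fst z)) (snd z)) ts))"
    by (rule ctx_trms_index) (use ts pred_sorts[OF p] in auto)
  from PB_eq[OF PN_block[OF ctx_base[OF code] PN_add[OF ctx_base_PN[OF PN_pred_offset[OF p]] this]] PN_const[of _ _ 1]]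
  show ?thesis
  proof (rule PB_cong)
    fix z assume z: "z \<in> cX vs"
    have "map (eval_trm (dm (fst z)) (snd z)) ts \<in> tuples (dm (fst z)) (map (sort_of sg) ts)"
      by (rule eval_trms_in[OF cX_D[OF z] ts(1)], intro ballI cX_val[OF z]) (use ts(3) in auto)
    from block_pred[OF cX_D[OF z] p this[unfolded ts(2)], of "[]"]
    show "(block (struct_code sg (dm (fst z))) (pred_offset sg (dm (fst z)) p +
          tuple_index (dm (fst z)) (map (sort_of sg) ts) (map (eval_trm (dm (fst z)) (snd z)) ts)) = 1) =
        pred_int (dm (fst z)) p (map (eval_trm (dm (fst z)) (snd z)) ts)"
      unfolding ts(2) by (simp add: struct_code_def)
  qed
qed

text \<open>The cardinalities occur in unary in the code. A bound polynomial in the domain size is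
  therefore polynomial in the length of the input.\<close>

lemma dom_size_le: "dom_size sg D \<le> length (struct_code sg D)"
proof -
  have "dom_size sg D = sum_list (map (\<lambda>s. card (sdom D s)) (sorts sg))"
    using wf_sg by (simp add: dom_size_def wf_signature_def sum_list_distinct_conv_sum_set)
  then show ?thesis by (simp add: struct_code_def length_unary_code struct_nats_def)
qed

text \<open>The word expected by the given machine is assembled and the machine run on it. That
  \<open>S z\<close> and \<open>d z\<close> are well typed is the promise under which it
  answers.\<close>

lemma ctx_agg_component:
  assumes pt: "agg_polytime sg X cmp r"
    and S: "PT (cX vs) (cG vs) (\<lambda>z. unary_code (tv_set_nats (dm (fst z)) (agg_args sg r) (S z)))"
      "\<And>z. z \<in> cX vs \<Longrightarrow> S z \<in> tv_sets (tuples (dm (fst z)) (agg_args sg r))"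
    and d: "PN (cX vs) (cG vs) (\<lambda>z. rank (dm (fst z)) (agg_res sg r) (d z))"
      "\<And>z. z \<in> cX vs \<Longrightarrow> d z \<in> sdom (dm (fst z)) (agg_res sg r)"
  shows "PB (cX vs) (cG vs) (\<lambda>z. cmp (agg_int (X (dm (fst z))) r (S z) (d z)))"
proof -
  from pt obtain M p where M: "wf_tm M" and ans: "\<And>D S d. D \<in> finite_structures sg \<Longrightarrow>
      S \<in> tv_sets (tuples D (agg_args sg r)) \<Longrightarrow> d \<in> sdom D (agg_res sg r) \<Longrightarrow>
      tm_answers M (agg_code sg r D S d) (Polynomial.poly p (dom_size sg D)) (cmp (agg_int (X D) r S d))"
    unfolding agg_polytime_def by blast
  have "PT (cX vs) (cG vs) (\<lambda>z. unary_code (map (\<lambda>n. n z) [\<lambda>z. rank (dm (fst z)) (agg_res sg r) (d z)]))"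
    by (rule PT_unary_code) (use d(1) in simp)
  from PT_append[OF ctx_base[OF code] PT_append[OF S(1) this]]
  have u: "PT (cX vs) (cG vs) (\<lambda>z. agg_code sg r (dm (fst z)) (S z) (d z))"
    by (simp add: agg_code_def struct_code_def unary_code_simps)
  have T: "pbd (cX vs) (sz (cG vs)) (\<lambda>z. Polynomial.poly p (dom_size sg (dm (fst z))))"
    by (rule pbd_poly, rule pbd_le[OF PT_length[OF ctx_base[OF code]]]) (rule dom_size_le)
  show ?thesis unfolding PB_def
    by (rule PT_machine[OF M u T]) (rule ans[OF cX_D S(2) d(2)])
qed

end

locale evaluation = program_context sg Pd P X K dm G0
  for sg :: "('s, 'f, 'p, 'r) signature" and Pd :: "'p list" and P :: "('s, 'f, 'p, 'r) rl set"
    and X :: "('s, 'f, 'p, 'e::linorder) struct \<Rightarrow> ('s, 'f, 'p, 'e, 'r) struct3"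
    and K :: "'k set" and dm :: "'k \<Rightarrow> ('s, 'f, 'p, 'e) struct" and G0 :: "('k \<Rightarrow> bool list) list" +
  fixes int :: "'k \<Rightarrow> ('p, 'e) interp3"
  assumes int1: "PT K G0 (\<lambda>k. tab (dm k) (fst (int k)))"
    and int2: "PT K G0 (\<lambda>k. tab (dm k) (snd (int k)))"
begin

abbreviation val where "val z \<phi> \<equiv> val_fm (X (dm (fst z))) Pd (int (fst z)) \<phi> (snd z)"

lemma val_setexp_tv: "val_setexp E Pd' I (SetExp xs \<phi>) \<sigma> \<in> tv_sets (tuples E (map snd xs))"
  by (auto simp: tv_sets_def)

text \<open>Both components are treated in one induction because negation exchanges them. For set
  expressions the statement concerns the code of the resulting three-valued set, as it is handed to
  the machine of the aggregate.\<close>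

lemma ctx_val:
  shows "wf_fm (sig_with sg Pd) \<phi> \<Longrightarrow> fv_fm \<phi> \<subseteq> set vs \<Longrightarrow>
      PB (cX vs) (cG vs) (\<lambda>z. fst (val z \<phi>)) \<and> PB (cX vs) (cG vs) (\<lambda>z. snd (val z \<phi>))"
    and "wf_setexp (sig_with sg Pd) e ss \<Longrightarrow> fv_setexp e \<subseteq> set vs \<Longrightarrow> set ss \<subseteq> set (sorts sg) \<Longrightarrow>
      PT (cX vs) (cG vs) (\<lambda>z. unary_code (tv_set_nats (dm (fst z)) ss
        (val_setexp (X (dm (fst z))) Pd (int (fst z)) e (snd z))))"
proof (induction \<phi> and e arbitrary: vs and vs ss)
  case (Atom p ts)
  have ts: "\<forall>t\<in>set ts. wf_trm sg t" "map (sort_of sg) ts = pred_args sg p"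
    "(\<Union>t\<in>set ts. fv_trm t) \<subseteq> set vs" "p \<in> set (preds sg) \<or> p \<in> set Pd"
    using Atom.prems by auto
  have ev: "map (eval_trm (X (dm (fst z))) (snd z)) ts = map (eval_trm (dm (fst z)) (snd z)) ts"
    if "z \<in> cX vs" for z using X_simps(5)[OF cX_D[OF that]] by simp
  show ?case
  proof (cases "p \<in> set Pd")
    case True
    have "PB (cX vs) (cG vs) (\<lambda>z. fst (val z (Atom p ts)))"
      by (rule PB_cong[OF ctx_defined_atom[OF True ts(1-3) int1]]) (simp add: ev True Let_def)
    moreover have "PB (cX vs) (cG vs) (\<lambda>z. snd (val z (Atom p ts)))"
      by (rule PB_cong[OF ctx_defined_atom[OF True ts(1-3) int2]]) (simp add: ev True Let_def)
    ultimately show ?thesis by blast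
  next
    case False
    then have "p \<in> set (preds sg)" using ts(4) by simp
    note pr = ctx_pred_atom[OF this ts(1-3)]
    show ?thesis
      by (intro conjI; rule PB_cong[OF pr]) (simp_all add: ev False Let_def X_simps(3)[OF cX_D])
  qed
next
  case (AggAtom r e t)
  have r: "r \<in> set (aggs sg)" and e: "wf_setexp (sig_with sg Pd) e (agg_args sg r)"
    and t: "wf_trm sg t" "sort_of sg t = agg_res sg r" and fv: "fv_setexp e \<subseteq> set vs" "fv_trm t \<subseteq> set vs"
    using AggAtom.prems by auto
  obtain xs \<psi> where xs: "e = SetExp xs \<psi>" by (cases e)
  have ss: "map snd xs = agg_args sg r" using e xs by simp
  let ?S = "\<lambda>z. val_setexp (X (dm (fst z))) Pd (int (fst z)) e (snd z)"
  let ?d = "\<lambda>z. eval_trm (dm (fst z)) (snd z) t"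
  note S = AggAtom.IH[OF e fv(1) agg_sorts(1)[OF r]]
  have S': "?S z \<in> tv_sets (tuples (dm (fst z)) (agg_args sg r))" if "z \<in> cX vs" for z
    using val_setexp_tv[of "X (dm (fst z))" Pd "int (fst z)" xs \<psi> "snd z"]
    unfolding xs ss X_simps(4)[OF cX_D[OF that]] .
  note d = ctx_trm[OF t(1) fv(2), unfolded t(2)]
  have d': "?d z \<in> sdom (dm (fst z)) (agg_res sg r)" if "z \<in> cX vs" for z
    unfolding t(2)[symmetric]
    by (rule eval_trm_in[OF cX_D[OF that] t(1)], intro ballI cX_val[OF that]) (use fv(2) in auto)
  have "PB (cX vs) (cG vs) (\<lambda>z. cmp (agg_int (X (dm (fst z))) r (?S z) (?d z)))"
    if "agg_polytime sg X cmp r" for cmp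
    by (rule ctx_agg_component[OF that S S' d d'])
  then have "PB (cX vs) (cG vs) (\<lambda>z. fst (agg_int (X (dm (fst z))) r (?S z) (?d z)))"
    "PB (cX vs) (cG vs) (\<lambda>z. snd (agg_int (X (dm (fst z))) r (?S z) (?d z)))"
    using poly[OF r] by blast+
  then show ?case by (intro conjI; elim PB_cong) (simp_all add: X_simps(5)[OF cX_D])
next
  case (Neg \<phi>)
  then show ?case using Neg.IH[of vs] by (simp add: neg3_eq PB_not)
next
  case (Conj \<phi> \<psi>)
  then show ?case by (simp add: PB_conj)
next
  case (Disj \<phi> \<psi>)
  then show ?case by (simp add: PB_disj)
next
  case (Forall x \<phi>)
  have x: "snd x \<in> set (sorts sg)" using Forall.prems by simp
  have IH: "PB (cX (x # vs)) (cG (x # vs)) (\<lambda>z. fst (val z \<phi>)) \<and> PB (cX (x # vs)) (cG (x # vs)) (\<lambda>z. snd (val z \<phi>))"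
    by (rule Forall.IH) (use Forall.prems in auto)
  show ?case
    using PB_cong[OF ctx_all[OF x, of vs "\<lambda>k \<sigma>. fst (val (k, \<sigma>) \<phi>)"]]
      PB_cong[OF ctx_all[OF x, of vs "\<lambda>k \<sigma>. snd (val (k, \<sigma>) \<phi>)"]] IH
    by (simp add: fst_INF snd_INF X_simps(1)[OF cX_D])
next
  case (Exists x \<phi>)
  have x: "snd x \<in> set (sorts sg)" using Exists.prems by simp
  have IH: "PB (cX (x # vs)) (cG (x # vs)) (\<lambda>z. fst (val z \<phi>)) \<and> PB (cX (x # vs)) (cG (x # vs)) (\<lambda>z. snd (val z \<phi>))"
    by (rule Exists.IH) (use Exists.prems in auto)
  show ?case
    using PB_cong[OF ctx_ex[OF x, of vs "\<lambda>k \<sigma>. fst (val (k, \<sigma>) \<phi>)"]]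
      PB_cong[OF ctx_ex[OF x, of vs "\<lambda>k \<sigma>. snd (val (k, \<sigma>) \<phi>)"]] IH
    by (simp add: fst_SUP snd_SUP X_simps(1)[OF cX_D])
next
  case (SetExp xs \<phi>)
  have xs: "distinct xs" "map snd xs = ss" "wf_fm (sig_with sg Pd) \<phi>" using SetExp.prems by auto
  have srt: "\<forall>x\<in>set xs. snd x \<in> set (sorts sg)"
    using SetExp.prems(3) unfolding xs(2)[symmetric] set_map image_subset_iff .
  let ?a = "\<lambda>z. fst (val z \<phi>)" and ?b = "\<lambda>z. snd (val z \<phi>)"
  have IH: "PB (cX (xs @ vs)) (cG (xs @ vs)) ?a \<and> PB (cX (xs @ vs)) (cG (xs @ vs)) ?b"
    by (rule SetExp.IH[OF xs(3)]) (use SetExp.prems in auto)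
  \<comment> \<open>An entry of the code is the sum of the two membership bits. Both mixed values
    yield 1, in agreement with \<open>val_setexp\<close>.\<close>
  have "PT (cX (xs @ vs)) (cG (xs @ vs)) (\<lambda>z. if ?a z \<and> ?b z then unary_code [2]
      else if ?a z \<or> ?b z then unary_code [1] else unary_code [0])"
    by (intro PT_if' PB_conj PB_disj PT_const conjunct1[OF IH] conjunct2[OF IH])
  then have "PT (cX (xs @ vs)) (cG (xs @ vs)) (\<lambda>z. (\<lambda>k \<sigma>.
      unary_code [of_bool (val (k, \<sigma>) \<phi> = (True, True)) + of_bool (val (k, \<sigma>) \<phi> \<noteq> (False, False))]) (fst z) (snd z))"
    by (rule PT_cong) (auto simp: prod_eq_iff numeral_2_eq_2)
  then have "PT (cX vs) (cG vs) (\<lambda>z. concat (map (\<lambda>ds. (\<lambda>k \<sigma>.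
      unary_code [of_bool (val (k, \<sigma>) \<phi> = (True, True)) + of_bool (val (k, \<sigma>) \<phi> \<noteq> (False, False))])
      (fst z) (assign (snd z) xs ds)) (tuple_list (dm (fst z)) (map snd xs))))"
    by (rule ctx_tuples[OF xs(1) srt])
  then show ?case
  proof (rule PT_cong)
    fix z assume z: "z \<in> cX vs"
    have set_t: "set (tuple_list (dm (fst z)) ss) = tuples (dm (fst z)) ss"
      by (rule set_tuple_list[OF finite_sdoms[OF cX_D[OF z] SetExp.prems(3)]])
    show "concat (map (\<lambda>ds. (\<lambda>k \<sigma>.
      unary_code [of_bool (val (k, \<sigma>) \<phi> = (True, True)) + of_bool (val (k, \<sigma>) \<phi> \<noteq> (False, False))])
      (fst z) (assign (snd z) xs ds)) (tuple_list (dm (fst z)) (map snd xs))) =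
      unary_code (tv_set_nats (dm (fst z)) ss (val_setexp (X (dm (fst z))) Pd (int (fst z)) (SetExp xs \<phi>) (snd z)))"
      unfolding tv_set_nats_def unary_code_map xs(2)
      by (intro arg_cong[of _ _ concat] map_cong refl)
        (simp add: set_t X_simps(4)[OF cX_D[OF z]] xs(2))
  qed
qed

end

lemma tuples_nth: "ds \<in> tuples D ss \<Longrightarrow> i < length ss \<Longrightarrow> ds ! i \<in> sdom D (ss ! i)"
  by (induction ss arbitrary: ds i) (auto simp: tuples_Cons nth_Cons split: nat.split)

lemma assign_in:
  assumes "ds \<in> tuples D (map snd xs)" "x \<in> set xs"
  shows "assign \<sigma> xs ds x \<in> sdom D (snd x)"
proof -
  have len: "length ds = length xs" using tuples_length[OF assms(1)] by simp
  then have "map_of (zip xs ds) x \<noteq> None" using assms(2) by (simp add: map_of_zip_is_None)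
  then obtain d where d: "map_of (zip xs ds) x = Some d" by blast
  then have "(x, d) \<in> set (zip xs ds)" by (rule map_of_SomeD)
  then obtain i where "i < length xs" "xs ! i = x" "ds ! i = d" by (auto simp: in_set_zip)
  then have "d \<in> sdom D (snd x)" using tuples_nth[OF assms(1), of i] by simp
  then show ?thesis using d by (simp add: assign_def)
qed

lemma zip_all_eq_iff:
  "length as = length bs \<Longrightarrow> (\<forall>q\<in>set (zip as bs). f (snd q) = g (fst q)) \<longleftrightarrow> map f bs = map g as"
  by (induction as bs rule: list_induct2) auto

lemma fst_Sup_bool: "fst (Sup S) \<longleftrightarrow> (\<exists>v\<in>S. fst v)" for S :: "(bool \<times> bool) set"
  by (auto simp: fst_Sup)

lemma snd_Sup_bool: "snd (Sup S) \<longleftrightarrow> (\<exists>v\<in>S. snd v)" for S :: "(bool \<times> bool) set"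
  by (auto simp: snd_Sup)

text \<open>Preservation of consistency, precision and exactness, the last under hypothesis \<open>ex\<close>.\<close>

definition refines :: "bool \<Rightarrow> bool \<times> bool \<Rightarrow> bool \<times> bool \<Rightarrow> bool" where
  "refines ex v w \<longleftrightarrow> (fst v \<longrightarrow> snd v) \<and> (fst w \<longrightarrow> snd w) \<and> (fst v \<longrightarrow> fst w) \<and> (snd w \<longrightarrow> snd v) \<and>
     (ex \<longrightarrow> fst v = snd v)"

lemma refines_neg: "refines ex v w \<Longrightarrow> refines ex (neg3 v) (neg3 w)"
  unfolding refines_def neg3_eq fst_conv snd_conv by blast

lemma refines_inf: "refines ex v w \<Longrightarrow> refines ex v' w' \<Longrightarrow> refines ex (inf v v') (inf w w')"
  unfolding refines_def fst_inf snd_inf inf_bool_def by blast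

lemma refines_sup: "refines ex v w \<Longrightarrow> refines ex v' w' \<Longrightarrow> refines ex (sup v v') (sup w w')"
  unfolding refines_def fst_sup snd_sup sup_bool_def by blast

lemma INF_bool: "(INF d\<in>S. Q d) \<longleftrightarrow> (\<forall>d\<in>S. Q d)" for Q :: "'b \<Rightarrow> bool"
  by auto

lemma SUP_bool: "(SUP d\<in>S. Q d) \<longleftrightarrow> (\<exists>d\<in>S. Q d)" for Q :: "'b \<Rightarrow> bool"
  by auto

lemma refines_INF:
  "(\<And>d. d \<in> S \<Longrightarrow> refines ex (f d) (g d)) \<Longrightarrow> refines ex (INF d\<in>S. f d) (INF d\<in>S. g d)"
  unfolding refines_def fst_INF snd_INF INF_bool by blast

lemma refines_SUP:
  "(\<And>d. d \<in> S \<Longrightarrow> refines ex (f d) (g d)) \<Longrightarrow> refines ex (SUP d\<in>S. f d) (SUP d\<in>S. g d)"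
  unfolding refines_def fst_SUP snd_SUP SUP_bool by blast

text \<open>For consistent values, being \<open>(True, True)\<close> is the first component and
  differing from \<open>(False, False)\<close> the second one, which turns statements on values into
  inclusions.\<close>

lemma refines_sets:
  assumes "\<And>d. d \<in> S \<Longrightarrow> refines ex (f d) (g d)"
  defines "F \<equiv> ({d \<in> S. f d = (True, True)}, {d \<in> S. f d \<noteq> (False, False)})"
    and "G \<equiv> ({d \<in> S. g d = (True, True)}, {d \<in> S. g d \<noteq> (False, False)})"
  shows "F \<in> tv_sets S \<and> G \<in> tv_sets S \<and> F \<le>\<^sub>p G \<and> (ex \<longrightarrow> fst F = snd F)"
proof -
  have "F = ({d \<in> S. fst (f d)}, {d \<in> S. snd (f d)})" "G = ({d \<in> S. fst (g d)}, {d \<in> S. snd (g d)})"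
    using assms(1) unfolding F_def G_def refines_def prod_eq_iff fst_conv snd_conv by blast+
  then show ?thesis
    using assms(1) unfolding refines_def tv_sets_def le_p_def by (simp add: subset_iff set_eq_iff) blast
qed

section \<open>The consequence operator as a search over rule instances\<close>

context aggregate_program
begin

text \<open>The components of the consequence operator without suprema of truth values, with
  \<open>cmp\<close> being \<open>fst\<close> or \<open>snd\<close>. In this form they are bounded
  searches.\<close>

definition derived :: "(bool \<times> bool \<Rightarrow> bool) \<Rightarrow> ('s, 'f, 'p, 'e) struct \<Rightarrow> ('p, 'e) interp3 \<Rightarrow> ('p, 'e) gatom set" where
  "derived cmp D I = {A \<in> bs D. \<exists>\<rho>\<in>P. \<exists>\<sigma>. (\<forall>x\<in>fv_rule \<rho>. \<sigma> x \<in> sdom D (snd x)) \<and>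
     A = (head_pred \<rho>, map (eval_trm D \<sigma>) (head_args \<rho>)) \<and> cmp (val_fm (X D) Pd I (body \<rho>) \<sigma>)}"

lemma consequence_derived:
  assumes D: "D \<in> finite_structures sg"
  shows "\<Phi> D I = (derived fst D I, derived snd D I)"
proof -
  have b: "bs D = base sg Pd (X D)" by (simp add: base_def X_simps[OF D])
  have ev: "eval_trm (X D) \<sigma> = eval_trm D \<sigma>" for \<sigma> by (simp add: fun_eq_iff X_simps[OF D])
  have i: "(A, \<phi>, \<sigma>) \<in> inst P (X D) \<longleftrightarrow> (\<exists>\<rho>\<in>P. (\<forall>x\<in>fv_rule \<rho>. \<sigma> x \<in> sdom D (snd x)) \<and>
     A = (head_pred \<rho>, map (eval_trm D \<sigma>) (head_args \<rho>)) \<and> \<phi> = body \<rho>)" for A \<phi> \<sigma>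
    unfolding inst_def ev X_simps(1)[OF D] by blast
  have e: "(\<exists>v\<in>{val_fm (X D) Pd I \<phi> \<sigma> | \<phi> \<sigma>. (A, \<phi>, \<sigma>) \<in> inst P (X D)}. cmp v) \<longleftrightarrow>
      (\<exists>\<rho>\<in>P. \<exists>\<sigma>. (\<forall>x\<in>fv_rule \<rho>. \<sigma> x \<in> sdom D (snd x)) \<and>
       A = (head_pred \<rho>, map (eval_trm D \<sigma>) (head_args \<rho>)) \<and> cmp (val_fm (X D) Pd I (body \<rho>) \<sigma>))"
    (is "?l \<longleftrightarrow> ?r") for A cmp
  proof
    assume ?l
    then obtain \<phi> \<sigma> where "(A, \<phi>, \<sigma>) \<in> inst P (X D)" "cmp (val_fm (X D) Pd I \<phi> \<sigma>)" by blast
    then show ?r unfolding i by blast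
  next
    assume ?r
    then obtain \<rho> \<sigma> where "\<rho> \<in> P" "\<forall>x\<in>fv_rule \<rho>. \<sigma> x \<in> sdom D (snd x)"
      "A = (head_pred \<rho>, map (eval_trm D \<sigma>) (head_args \<rho>))" and c: "cmp (val_fm (X D) Pd I (body \<rho>) \<sigma>)" by blast
    then have "(A, body \<rho>, \<sigma>) \<in> inst P (X D)" unfolding i by blast
    with c show ?l by blast
  qed
  show ?thesis
    unfolding consequence_op_def derived_def Let_def fst_Sup_bool snd_Sup_bool e b by (rule refl)
qed

lemma wf_P_D:
  assumes "\<rho> \<in> P"
  shows "head_pred \<rho> \<in> set Pd" "\<forall>t\<in>set (head_args \<rho>). wf_trm sg t"
    "map (sort_of sg) (head_args \<rho>) = pred_args sg (head_pred \<rho>)" "wf_fm (sig_with sg Pd) (body \<rho>)"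
  using wf_P[OF assms] by (auto simp: wf_rule_def)

lemma finite_fv_rule: "finite (fv_rule \<rho>)"
  by (simp add: fv_rule_def finite_fv_trm finite_fv)

lemma fv_rule_sorts:
  assumes "\<rho> \<in> P" "x \<in> fv_rule \<rho>"
  shows "snd x \<in> set (sorts sg)"
proof -
  from assms(2) consider t where "t \<in> set (head_args \<rho>)" "x \<in> fv_trm t" | "x \<in> fv_fm (body \<rho>)"
    by (auto simp: fv_rule_def)
  then show ?thesis
  proof cases
    case 1
    then show ?thesis using wf_P_D(2)[OF assms(1)] fv_trm_sorts by blast
  next
    case 2
    then show ?thesis using fv_fm_sorts(1)[OF wf_P_D(4)[OF assms(1)] 2] by simp
  qed
qed

text \<open>Fresh variables name the components of a ground atom while it is compared with the heads
  of the rules.\<close>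

lemma fresh_vars:
  "\<exists>zs :: 's var list. distinct zs \<and> map snd zs = ss \<and> (\<forall>\<rho>\<in>P. set zs \<inter> fv_rule \<rho> = {})"
proof -
  have "finite (fst ` (\<Union>\<rho>\<in>P. fv_rule \<rho>))" using fin_P finite_fv_rule by blast
  then obtain m where m: "\<forall>n \<in> fst ` (\<Union>\<rho>\<in>P. fv_rule \<rho>). n < m"
    using finite_nat_set_iff_bounded by blast
  let ?zs = "zip [m..<m + length ss] ss"
  have "z \<notin> fv_rule \<rho>" if "z \<in> set ?zs" "\<rho> \<in> P" for z \<rho>
  proof
    assume "z \<in> fv_rule \<rho>"
    then have "fst z < m" using m that(2) by blast
    moreover have "fst z \<in> set [m..<m + length ss]" using that(1) by (metis prod.collapse set_zip_leftD)
    ultimately show False by simp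
  qed
  then show ?thesis
    by (intro exI[of _ ?zs]) (auto simp: distinct_zipI1 map_snd_zip)
qed

end

context evaluation
begin

text \<open>All assignments to the variables of the rule are tried. The evaluated head is compared
  with the atom by ranks, which amounts to equality because corresponding components lie in the
  domain of the same sort.\<close>

lemma PB_rule_applies:
  assumes \<rho>: "\<rho> \<in> P" "head_pred \<rho> = p" and zs: "map snd zs = pred_args sg p"
    and cmp: "\<And>vs. fv_fm (body \<rho>) \<subseteq> set vs \<Longrightarrow> PB (cX vs) (cG vs) (\<lambda>z. cmp (val z (body \<rho>)))"
    and disj: "set zs \<inter> fv_rule \<rho> = {}"
  shows "PB (cX zs) (cG zs) (\<lambda>z. \<exists>\<sigma>. (\<forall>x\<in>fv_rule \<rho>. \<sigma> x \<in> sdom (dm (fst z)) (snd x)) \<and>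
     map (snd z) zs = map (eval_trm (dm (fst z)) \<sigma>) (head_args \<rho>) \<and>
     cmp (val_fm (X (dm (fst z))) Pd (int (fst z)) (body \<rho>) \<sigma>))"
proof -
  note wf = wf_P_D[OF \<rho>(1)]
  obtain us where us: "set us = fv_rule \<rho>" using finite_list[OF finite_fv_rule] by blast
  have sorts_eq: "map (sort_of sg) (head_args \<rho>) = map snd zs" using wf(3) \<rho>(2) zs by simp
  have len: "length (head_args \<rho>) = length zs" using arg_cong[OF sorts_eq, of length] by simp
  define b where "b = (\<lambda>k \<sigma>. (\<forall>q\<in>set (zip (head_args \<rho>) zs).
      rank (dm k) (sort_of sg (fst q)) (eval_trm (dm k) \<sigma> (fst q)) = rank (dm k) (snd (snd q)) (\<sigma> (snd q))) \<and>
      cmp (val_fm (X (dm k)) Pd (int k) (body \<rho>) \<sigma>))"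
  have q: "fst q \<in> set (head_args \<rho>)" "snd q \<in> set zs" if "q \<in> set (zip (head_args \<rho>) zs)" for q
    using that by (metis prod.collapse set_zip_leftD set_zip_rightD)+
  have "PB (cX (us @ zs)) (cG (us @ zs)) (\<lambda>z. b (fst z) (snd z))"
    unfolding b_def
  proof (intro PB_conj PB_ball PB_eq ctx_trm ctx_var)
    fix q assume "q \<in> set (zip (head_args \<rho>) zs)"
    note q = q[OF this]
    show "wf_trm sg (fst q)" using wf(2) q by blast
    show "fv_trm (fst q) \<subseteq> set (us @ zs)" using q us by (auto simp: fv_rule_def)
    show "snd q \<in> set (us @ zs)" using q by simp
  next
    show "PB (cX (us @ zs)) (cG (us @ zs)) (\<lambda>z. cmp (val z (body \<rho>)))"
      by (rule cmp) (use us in \<open>auto simp: fv_rule_def\<close>)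
  qed simp
  then have "PB (cX zs) (cG zs) (\<lambda>z. \<exists>\<sigma>. (\<forall>u\<in>set us. \<sigma> u \<in> sdom (dm (fst z)) (snd u)) \<and>
     (\<forall>u. u \<notin> set us \<longrightarrow> \<sigma> u = snd z u) \<and> b (fst z) \<sigma>)"
    by (rule ctx_ex_many[rotated]) (use fv_rule_sorts[OF \<rho>(1)] us in blast)
  then show ?thesis
  proof (rule PB_cong)
    fix z assume z: "z \<in> cX zs"
    let ?D = "dm (fst z)"
    have D: "?D \<in> finite_structures sg" by (rule cX_D[OF z])
    have heads: "(\<forall>q\<in>set (zip (head_args \<rho>) zs). rank ?D (sort_of sg (fst q)) (eval_trm ?D \<sigma> (fst q)) =
        rank ?D (snd (snd q)) (\<sigma> (snd q))) \<longleftrightarrow> map (snd z) zs = map (eval_trm ?D \<sigma>) (head_args \<rho>)"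
      if \<sigma>: "\<forall>u\<in>fv_rule \<rho>. \<sigma> u \<in> sdom ?D (snd u)" "\<forall>u. u \<notin> fv_rule \<rho> \<longrightarrow> \<sigma> u = snd z u" for \<sigma>
    proof -
      have "rank ?D (sort_of sg (fst q)) (eval_trm ?D \<sigma> (fst q)) = rank ?D (snd (snd q)) (\<sigma> (snd q)) \<longleftrightarrow>
          snd z (snd q) = eval_trm ?D \<sigma> (fst q)" if q': "q \<in> set (zip (head_args \<rho>) zs)" for q
      proof -
        note q = q[OF q']
        obtain i where "i < length zs" "fst q = head_args \<rho> ! i" "snd q = zs ! i"
          using q' by (auto simp: set_zip)
        then have s: "sort_of sg (fst q) = snd (snd q)"
          using arg_cong[OF sorts_eq, of "\<lambda>xs. xs ! i"] len by simp
        have wft: "wf_trm sg (fst q)" using wf(2) q by blast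
        have "eval_trm ?D \<sigma> (fst q) \<in> sdom ?D (sort_of sg (fst q))"
          by (rule eval_trm_in[OF D wft]) (use q \<sigma>(1) in \<open>auto simp: fv_rule_def\<close>)
        moreover have zq: "\<sigma> (snd q) = snd z (snd q)" using \<sigma>(2) disj q by blast
        moreover have "snd z (snd q) \<in> sdom ?D (snd (snd q))" by (rule cX_val[OF z q(2)])
        moreover have "snd (snd q) \<in> set (sorts sg)"
          using q(2) arg_cong[OF zs, of set] Pd_sorts[OF wf(1)] \<rho>(2) by auto
        ultimately show ?thesis using rank_inj[OF finite_sdom[OF D]] unfolding s zq by metis
      qed
      then have "(\<forall>q\<in>set (zip (head_args \<rho>) zs). rank ?D (sort_of sg (fst q)) (eval_trm ?D \<sigma> (fst q)) =
        rank ?D (snd (snd q)) (\<sigma> (snd q))) \<longleftrightarrow>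
        (\<forall>q\<in>set (zip (head_args \<rho>) zs). snd z (snd q) = eval_trm ?D \<sigma> (fst q))" by simp
      also have "\<dots> \<longleftrightarrow> map (snd z) zs = map (eval_trm ?D \<sigma>) (head_args \<rho>)"
        by (rule zip_all_eq_iff[OF len])
      finally show ?thesis .
    qed
    show "(\<exists>\<sigma>. (\<forall>u\<in>set us. \<sigma> u \<in> sdom ?D (snd u)) \<and> (\<forall>u. u \<notin> set us \<longrightarrow> \<sigma> u = snd z u) \<and> b (fst z) \<sigma>) =
      (\<exists>\<sigma>. (\<forall>x\<in>fv_rule \<rho>. \<sigma> x \<in> sdom ?D (snd x)) \<and>
       map (snd z) zs = map (eval_trm ?D \<sigma>) (head_args \<rho>) \<and>
       cmp (val_fm (X ?D) Pd (int (fst z)) (body \<rho>) \<sigma>))"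
    proof
      assume "\<exists>\<sigma>. (\<forall>u\<in>set us. \<sigma> u \<in> sdom ?D (snd u)) \<and> (\<forall>u. u \<notin> set us \<longrightarrow> \<sigma> u = snd z u) \<and> b (fst z) \<sigma>"
      then show "\<exists>\<sigma>. (\<forall>x\<in>fv_rule \<rho>. \<sigma> x \<in> sdom ?D (snd x)) \<and>
       map (snd z) zs = map (eval_trm ?D \<sigma>) (head_args \<rho>) \<and>
       cmp (val_fm (X ?D) Pd (int (fst z)) (body \<rho>) \<sigma>)"
        unfolding us b_def using heads by blast
    next
      assume "\<exists>\<sigma>. (\<forall>x\<in>fv_rule \<rho>. \<sigma> x \<in> sdom ?D (snd x)) \<and>
       map (snd z) zs = map (eval_trm ?D \<sigma>) (head_args \<rho>) \<and>
       cmp (val_fm (X ?D) Pd (int (fst z)) (body \<rho>) \<sigma>)"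
      then obtain \<sigma> where \<sigma>: "\<forall>x\<in>fv_rule \<rho>. \<sigma> x \<in> sdom ?D (snd x)"
       "map (snd z) zs = map (eval_trm ?D \<sigma>) (head_args \<rho>)"
       "cmp (val_fm (X ?D) Pd (int (fst z)) (body \<rho>) \<sigma>)" by blast
      \<comment> \<open>A ground instance leaves the assignment arbitrary outside the variables of
        the rule, whereas the search keeps the values of \<open>z\<close> there. Neither head nor
        body notices the difference.\<close>
      let ?\<sigma> = "\<lambda>u. if u \<in> fv_rule \<rho> then \<sigma> u else snd z u"
      have ev: "eval_trm ?D ?\<sigma> t = eval_trm ?D \<sigma> t" if "t \<in> set (head_args \<rho>)" for t
        by (rule eval_trm_cong) (use that in \<open>auto simp: fv_rule_def\<close>)
      have vl: "val_fm (X ?D) Pd (int (fst z)) (body \<rho>) ?\<sigma> = val_fm (X ?D) Pd (int (fst z)) (body \<rho>) \<sigma>"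
        by (rule val_fm_cong) (auto simp: fv_rule_def)
      have "map (snd z) zs = map (eval_trm ?D ?\<sigma>) (head_args \<rho>)" using \<sigma>(2) ev by simp
      then show "\<exists>\<sigma>. (\<forall>u\<in>set us. \<sigma> u \<in> sdom ?D (snd u)) \<and> (\<forall>u. u \<notin> set us \<longrightarrow> \<sigma> u = snd z u) \<and> b (fst z) \<sigma>"
        unfolding us b_def using \<sigma>(1,3) vl heads[of ?\<sigma>] by (intro exI[of _ ?\<sigma>]) auto
    qed
  qed
qed

lemma PT_derived:
  assumes cmp: "\<And>\<phi> vs. wf_fm (sig_with sg Pd) \<phi> \<Longrightarrow> fv_fm \<phi> \<subseteq> set vs \<Longrightarrow> PB (cX vs) (cG vs) (\<lambda>z. cmp (val z \<phi>))"
  shows "PT K G0 (\<lambda>k. tab (dm k) (derived cmp (dm k) (int k)))"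
proof -
  let ?J = "\<lambda>k. derived cmp (dm k) (int k)"
  have "PT K G0 (\<lambda>k. concat (map (\<lambda>ds. [(p, ds) \<in> ?J k]) (tuple_list (dm k) (pred_args sg p))))"
    if p: "p \<in> set Pd" for p
  proof -
    obtain zs :: "'s var list" where zs: "distinct zs" "map snd zs = pred_args sg p"
      "\<forall>\<rho>\<in>P. set zs \<inter> fv_rule \<rho> = {}" using fresh_vars by blast
    let ?R = "{\<rho> \<in> P. head_pred \<rho> = p}"
    have "PB (cX zs) (cG zs) (\<lambda>z. \<exists>\<rho>\<in>?R. \<exists>\<sigma>. (\<forall>x\<in>fv_rule \<rho>. \<sigma> x \<in> sdom (dm (fst z)) (snd x)) \<and>
     map (snd z) zs = map (eval_trm (dm (fst z)) \<sigma>) (head_args \<rho>) \<and>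
     cmp (val_fm (X (dm (fst z))) Pd (int (fst z)) (body \<rho>) \<sigma>))"
    proof (rule PB_bex)
      show "finite ?R" using fin_P by simp
      fix \<rho> assume "\<rho> \<in> ?R"
      then have \<rho>: "\<rho> \<in> P" "head_pred \<rho> = p" by auto
      have c: "PB (cX vs) (cG vs) (\<lambda>z. cmp (val z (body \<rho>)))" if "fv_fm (body \<rho>) \<subseteq> set vs" for vs
        by (rule cmp[OF wf_P_D(4)[OF \<rho>(1)] that])
      show "PB (cX zs) (cG zs) (\<lambda>z. \<exists>\<sigma>. (\<forall>x\<in>fv_rule \<rho>. \<sigma> x \<in> sdom (dm (fst z)) (snd x)) \<and>
         map (snd z) zs = map (eval_trm (dm (fst z)) \<sigma>) (head_args \<rho>) \<and>
         cmp (val_fm (X (dm (fst z))) Pd (int (fst z)) (body \<rho>) \<sigma>))"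
        by (rule PB_rule_applies[OF \<rho> zs(2) c]) (use zs(3) \<rho>(1) in auto)
    qed
    then have "PB (cX zs) (cG zs) (\<lambda>z. (p, map (snd z) zs) \<in> ?J (fst z))"
    proof (rule PB_cong)
      fix z assume z: "z \<in> cX zs"
      have "map (snd z) zs \<in> tuples (dm (fst z)) (map snd zs)"
        unfolding tuples_map using cX_val[OF z] by blast
      then have "(p, map (snd z) zs) \<in> bs (dm (fst z))" using p zs(2) by (simp add: base_def)
      then show "(\<exists>\<rho>\<in>?R. \<exists>\<sigma>. (\<forall>x\<in>fv_rule \<rho>. \<sigma> x \<in> sdom (dm (fst z)) (snd x)) \<and>
         map (snd z) zs = map (eval_trm (dm (fst z)) \<sigma>) (head_args \<rho>) \<and>
         cmp (val_fm (X (dm (fst z))) Pd (int (fst z)) (body \<rho>) \<sigma>)) = ((p, map (snd z) zs) \<in> ?J (fst z))"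
        unfolding derived_def by blast
    qed
    then have "PT (cX zs) (cG zs) (\<lambda>z. [(p, map (snd z) zs) \<in> ?J (fst z)])"
      by (simp add: PB_def)
    then show ?thesis by (rule PT_tuples[OF zs(1,2) Pd_sorts[OF p], of "\<lambda>k ds. [(p, ds) \<in> ?J k]"])
  qed
  then have "PT K G0 (\<lambda>k. concat (map (\<lambda>p. concat (map (\<lambda>ds. [(p, ds) \<in> ?J k]) (tuple_list (dm k) (pred_args sg p)))) Pd))"
    by (rule PT_concat_static)
  moreover have "concat (map (\<lambda>p. concat (map (\<lambda>ds. [(p, ds) \<in> ?J k]) (tuple_list (dm k) (pred_args sg p)))) Pd) =
      tab (dm k) (?J k)" for k
    by (simp add: tab_def atom_list_def map_concat comp_def)
  ultimately show ?thesis by simp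
qed

end

context aggregate_program
begin

lemma PT_consequence:
  assumes "\<And>k. k \<in> K \<Longrightarrow> dm k \<in> finite_structures sg" "PT K G0 (\<lambda>k. struct_code sg (dm k))"
    "PT K G0 (\<lambda>k. tab (dm k) (fst (J k)))" "PT K G0 (\<lambda>k. tab (dm k) (snd (J k)))"
  shows "PT K G0 (\<lambda>k. tab (dm k) (fst (\<Phi> (dm k) (J k))))"
    "PT K G0 (\<lambda>k. tab (dm k) (snd (\<Phi> (dm k) (J k))))"
proof -
  interpret evaluation sg Pd P X K dm G0 J by unfold_locales (use assms in auto)
  show "PT K G0 (\<lambda>k. tab (dm k) (fst (\<Phi> (dm k) (J k))))"
    by (rule PT_cong[OF PT_derived[of fst]]) (use ctx_val consequence_derived assms(1) in auto)
  show "PT K G0 (\<lambda>k. tab (dm k) (snd (\<Phi> (dm k) (J k))))"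
    by (rule PT_cong[OF PT_derived[of snd]]) (use ctx_val consequence_derived assms(1) in auto)
qed

text \<open>Consistency, monotonicity and exactness are proved in a single induction: an aggregate
  relation guarantees the last two only on well-typed three-valued sets, and a set expression yields
  such a set only if the formula in it has consistent values.\<close>

lemma val_props:
  assumes D: "D \<in> finite_structures sg" and IJ: "fst I \<subseteq> snd I" "fst J \<subseteq> snd J" "I \<le>\<^sub>p J"
  shows "wf_fm (sig_with sg Pd) \<phi> \<Longrightarrow> \<forall>x\<in>fv_fm \<phi>. \<sigma> x \<in> sdom D (snd x) \<Longrightarrow>
      refines (fst I = snd I) (val_fm (X D) Pd I \<phi> \<sigma>) (val_fm (X D) Pd J \<phi> \<sigma>)"
    and "wf_setexp (sig_with sg Pd) e ss \<Longrightarrow> \<forall>x\<in>fv_setexp e. \<sigma> x \<in> sdom D (snd x) \<Longrightarrow>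
      val_setexp (X D) Pd I e \<sigma> \<in> tv_sets (tuples D ss) \<and> val_setexp (X D) Pd J e \<sigma> \<in> tv_sets (tuples D ss) \<and>
      val_setexp (X D) Pd I e \<sigma> \<le>\<^sub>p val_setexp (X D) Pd J e \<sigma> \<and>
      (fst I = snd I \<longrightarrow> fst (val_setexp (X D) Pd I e \<sigma>) = snd (val_setexp (X D) Pd I e \<sigma>))"
proof (induction \<phi> and e arbitrary: \<sigma> and \<sigma> ss)
  case (Atom p ts)
  then show ?case using IJ by (auto simp: Let_def le_p_def refines_def)
next
  case (AggAtom r e t)
  have r: "r \<in> set (aggs sg)" and e: "wf_setexp (sig_with sg Pd) e (agg_args sg r)"
    and t: "wf_trm sg t" "sort_of sg t = agg_res sg r"
    and fv: "\<forall>x\<in>fv_setexp e. \<sigma> x \<in> sdom D (snd x)" "\<forall>x\<in>fv_trm t. \<sigma> x \<in> sdom D (snd x)"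
    using AggAtom.prems by auto
  note X = X_simps[OF D]
  let ?d = "eval_trm D \<sigma> t" and ?R = "agg_int (X D) r"
  let ?S = "val_setexp (X D) Pd I e \<sigma>" and ?S' = "val_setexp (X D) Pd J e \<sigma>"
  have d: "?d \<in> sdom D (agg_res sg r)" using eval_trm_in[OF D t(1) fv(2)] t(2) by simp
  have "tv_aggregate_relation (tuples D (agg_args sg r)) (sdom D (agg_res sg r)) ?R"
    using ext[OF D] r by (simp add: tv_extension_def X)
  then have R: "\<And>S. S \<in> tv_sets (tuples D (agg_args sg r)) \<Longrightarrow> ?R S ?d \<in> THREE"
    "\<And>S S'. S \<in> tv_sets (tuples D (agg_args sg r)) \<Longrightarrow> S' \<in> tv_sets (tuples D (agg_args sg r)) \<Longrightarrow>
      S \<le>\<^sub>p S' \<Longrightarrow> ?R S ?d \<le>\<^sub>p ?R S' ?d"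
    "\<And>S. S \<subseteq> tuples D (agg_args sg r) \<Longrightarrow> fst (?R (S, S) ?d) = snd (?R (S, S) ?d)"
    using d unfolding tv_aggregate_relation_def by blast+
  have three: "fst v \<longrightarrow> snd v" if "v \<in> THREE" for v using that by (auto simp: THREE_def)
  have IH: "?S \<in> tv_sets (tuples D (agg_args sg r))" "?S' \<in> tv_sets (tuples D (agg_args sg r))" "?S \<le>\<^sub>p ?S'"
    "fst I = snd I \<longrightarrow> fst ?S = snd ?S"
    using AggAtom.IH[OF e fv(1)] by blast+
  have "fst (?R ?S ?d) = snd (?R ?S ?d)" if "fst I = snd I"
  proof -
    have "?S = (fst ?S, fst ?S)" "fst ?S \<subseteq> tuples D (agg_args sg r)"
      using IH(1,4) that by (auto simp: prod_eq_iff tv_sets_def)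
    then show ?thesis using R(3)[of "fst ?S"] by simp
  qed
  then have "refines (fst I = snd I) (?R ?S ?d) (?R ?S' ?d)"
    using R(2)[OF IH(1-3)] three[OF R(1)[OF IH(1)]] three[OF R(1)[OF IH(2)]]
    unfolding refines_def le_p_def le_bool_def by blast
  then show ?case by (simp add: X)
next
  case (Neg \<phi>)
  then show ?case by (simp add: refines_neg)
next
  case (Conj \<phi> \<psi>)
  have "\<forall>x\<in>fv_fm \<phi>. \<sigma> x \<in> sdom D (snd x)" "\<forall>x\<in>fv_fm \<psi>. \<sigma> x \<in> sdom D (snd x)"
    "wf_fm (sig_with sg Pd) \<phi>" "wf_fm (sig_with sg Pd) \<psi>" using Conj.prems by auto
  then show ?case unfolding val_fm.simps by (intro refines_inf Conj.IH)
next
  case (Disj \<phi> \<psi>)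
  have "\<forall>x\<in>fv_fm \<phi>. \<sigma> x \<in> sdom D (snd x)" "\<forall>x\<in>fv_fm \<psi>. \<sigma> x \<in> sdom D (snd x)"
    "wf_fm (sig_with sg Pd) \<phi>" "wf_fm (sig_with sg Pd) \<psi>" using Disj.prems by auto
  then show ?case unfolding val_fm.simps by (intro refines_sup Disj.IH)
next
  case (Forall x \<phi>)
  have "wf_fm (sig_with sg Pd) \<phi>" using Forall.prems by simp
  then show ?case unfolding val_fm.simps X_simps(1)[OF D]
    by (intro refines_INF Forall.IH) (use Forall.prems(2) in auto)
next
  case (Exists x \<phi>)
  have "wf_fm (sig_with sg Pd) \<phi>" using Exists.prems by simp
  then show ?case unfolding val_fm.simps X_simps(1)[OF D]
    by (intro refines_SUP Exists.IH) (use Exists.prems(2) in auto)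
next
  case (SetExp xs \<phi>)
  have xs: "map snd xs = ss" "wf_fm (sig_with sg Pd) \<phi>" using SetExp.prems by auto
  have "\<forall>y\<in>fv_fm \<phi>. assign \<sigma> xs ds y \<in> sdom D (snd y)" if "ds \<in> tuples D ss" for ds
  proof
    fix y assume y: "y \<in> fv_fm \<phi>"
    show "assign \<sigma> xs ds y \<in> sdom D (snd y)"
    proof (cases "y \<in> set xs")
      case True
      then show ?thesis using assign_in that xs(1) by blast
    next
      case False
      have "length ds = length xs" using tuples_length[OF that] xs(1) by auto
      then have "map_of (zip xs ds) y = None" using False by (simp add: map_of_zip_is_None)
      then have "assign \<sigma> xs ds y = \<sigma> y" unfolding assign_def by simp
      then show ?thesis using SetExp.prems(2) y False by simp
    qed
  qed
  note IH = SetExp.IH[OF xs(2) this]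
  show ?case
    unfolding val_setexp.simps xs(1) X_simps(4)[OF D] by (rule refines_sets[OF IH])
qed

lemma derived_props:
  assumes D: "D \<in> finite_structures sg" and IJ: "fst I \<subseteq> snd I" "fst J \<subseteq> snd J" "I \<le>\<^sub>p J"
  shows "derived fst D I \<subseteq> derived snd D I" "derived fst D I \<subseteq> derived fst D J"
    "derived snd D J \<subseteq> derived snd D I" "fst I = snd I \<Longrightarrow> derived fst D I = derived snd D I"
proof -
  have *: "(fst (val_fm (X D) Pd I (body \<rho>) \<sigma>) \<longrightarrow> snd (val_fm (X D) Pd I (body \<rho>) \<sigma>)) \<and>
      (fst (val_fm (X D) Pd I (body \<rho>) \<sigma>) \<longrightarrow> fst (val_fm (X D) Pd J (body \<rho>) \<sigma>)) \<and>
      (snd (val_fm (X D) Pd J (body \<rho>) \<sigma>) \<longrightarrow> snd (val_fm (X D) Pd I (body \<rho>) \<sigma>)) \<and>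
      (fst I = snd I \<longrightarrow> fst (val_fm (X D) Pd I (body \<rho>) \<sigma>) = snd (val_fm (X D) Pd I (body \<rho>) \<sigma>))"
    if "\<rho> \<in> P" "\<forall>x\<in>fv_rule \<rho>. \<sigma> x \<in> sdom D (snd x)" for \<rho> \<sigma>
    using val_props(1)[OF D IJ wf_P_D(4)[OF that(1)], of \<sigma>] that(2)
    unfolding fv_rule_def refines_def by blast
  show "derived fst D I \<subseteq> derived snd D I" "derived fst D I \<subseteq> derived fst D J"
    "derived snd D J \<subseteq> derived snd D I" "fst I = snd I \<Longrightarrow> derived fst D I = derived snd D I"
    unfolding derived_def using * by blast+
qed

lemma approximation_op_consequence:
  assumes D: "D \<in> finite_structures sg"
  shows "approximation_op (bs D) (\<Phi> D)"
proof
  show "finite (bs D)" by (rule finite_base[OF D])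
  note eq = consequence_derived[OF D]
  have sub: "derived cmp D I \<subseteq> bs D" for cmp I by (auto simp: derived_def)
  fix v w assume "v \<in> tv_sets (bs D)"
  then have v: "fst v \<subseteq> snd v" by (auto simp: tv_sets_def)
  show "\<Phi> D v \<in> tv_sets (bs D)"
    unfolding eq using derived_props(1)[OF D v v le_p_refl] sub by (simp add: tv_sets_def)
  assume "w \<in> tv_sets (bs D)" and vw: "v \<le>\<^sub>p w"
  then have w: "fst w \<subseteq> snd w" by (auto simp: tv_sets_def)
  show "\<Phi> D v \<le>\<^sub>p \<Phi> D w"
    unfolding eq le_p_def using derived_props(2,3)[OF D v w vw] by simp
next
  fix I :: "('p, 'e) gatom set"
  show "fst (\<Phi> D (I, I)) = snd (\<Phi> D (I, I))"
    unfolding consequence_derived[OF D] using derived_props(4)[OF D _ _ le_p_refl, of "(I, I)"] by simp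
qed

end

section \<open>Computing the fixpoints\<close>

lemma PB_op:
  assumes "PB X G a" "PB X G b"
  shows "PB X G (\<lambda>x. bop (a x) (b x))"
proof -
  have "PB X G (\<lambda>x. (a x \<and> b x \<and> bop True True) \<or> (a x \<and> \<not> b x \<and> bop True False) \<or>
      (\<not> a x \<and> b x \<and> bop False True) \<or> (\<not> a x \<and> \<not> b x \<and> bop False False))"
    by (intro PB_disj PB_conj PB_not PB_const assms)
  then show ?thesis
  proof (rule PB_cong)
    fix x
    show "((a x \<and> b x \<and> bop True True) \<or> (a x \<and> \<not> b x \<and> bop True False) \<or>
      (\<not> a x \<and> b x \<and> bop False True) \<or> (\<not> a x \<and> \<not> b x \<and> bop False False)) = bop (a x) (b x)"
      by (cases "a x"; cases "b x") simp_all
  qed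
qed

lemma PT_map2:
  assumes f: "PT X G f" and g: "PT X G g" and len: "\<And>x. x \<in> X \<Longrightarrow> length (f x) = length (g x)"
  shows "PT X G (\<lambda>x. map2 bop (f x) (g x))"
proof -
  let ?N = "\<lambda>x. length (f x)"
  let ?Y = "below X ?N" and ?H = "add_index G"
  let ?a = "\<lambda>h z. snd z < length (h (fst z)) \<and> h (fst z) ! snd z"
  have i: "PN ?Y ?H snd" using PN_the_index[of X ?N G] by (simp add: case_prod_beta')
  have fi: "PT ?Y ?H (\<lambda>z. f (fst z))" using PT_index[OF f, of ?N] by (simp add: case_prod_beta')
  have gi: "PT ?Y ?H (\<lambda>z. g (fst z))" using PT_index[OF g, of ?N] by (simp add: case_prod_beta')
  have "PB ?Y ?H (\<lambda>z. bop (?a f z) (?a g z))"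
    by (rule PB_op[OF PB_nth[OF fi i] PB_nth[OF gi i]])
  then have "PT ?Y ?H (\<lambda>(x, i). [bop (?a f (x, i)) (?a g (x, i))])"
    by (simp add: PB_def case_prod_beta')
  from PT_concat[OF PN_length[OF f] this] show ?thesis
  proof (rule PT_cong)
    fix x assume "x \<in> X"
    then have len: "length (f x) = length (g x)" by (rule len)
    have "concat (map (\<lambda>i. [bop (?a f (x, i)) (?a g (x, i))]) [0..<?N x]) =
      map (\<lambda>i. bop (?a f (x, i)) (?a g (x, i))) [0..<?N x]" by simp
    also have "\<dots> = map2 bop (f x) (g x)" using len by (auto intro!: nth_equalityI)
    finally show "concat (map (\<lambda>i. [bop (?a f (x, i)) (?a g (x, i))]) [0..<?N x]) = map2 bop (f x) (g x)" .
  qed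
qed

section \<open>Iterations on tables\<close>

context aggregate_program
begin

lemma card_base:
  assumes D: "D \<in> finite_structures sg"
  shows "card (bs D) = (\<Sum>p\<leftarrow>Pd. prod_card D (pred_args sg p))"
proof -
  have "(\<Sum>p\<leftarrow>ps. length (tuple_list D (pred_args sg p))) = (\<Sum>p\<leftarrow>ps. prod_card D (pred_args sg p))"
    if "set ps \<subseteq> set Pd" for ps
    using that by (induction ps) (auto simp: length_tuple_list[OF Pd_finite[OF D]])
  from this[OF subset_refl] length_tab[OF D, of "{}"] show ?thesis
    by (simp add: tab_def atom_list_def length_concat comp_def)
qed

lemma tab_empty: "D \<in> finite_structures sg \<Longrightarrow> tab D {} = replicate (card (bs D)) False"
  using length_tab[of D "{}"] by (simp add: tab_def map_replicate_const)

lemma tab_base: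
  assumes D: "D \<in> finite_structures sg"
  shows "tab D (bs D) = replicate (card (bs D)) True"
proof -
  have "tab D (bs D) = map (\<lambda>_. True) (atom_list D)"
    unfolding tab_def by (rule map_cong[OF refl]) (simp add: set_atom_list[OF D])
  then show ?thesis using length_tab[OF D, of "bs D"] by (simp add: map_replicate_const)
qed

context
  fixes K :: "'k set" and dm :: "'k \<Rightarrow> ('s, 'f, 'p, 'e) struct" and G0 :: "('k \<Rightarrow> bool list) list"
  assumes dm: "\<And>k. k \<in> K \<Longrightarrow> dm k \<in> finite_structures sg"
    and code: "PT K G0 (\<lambda>k. struct_code sg (dm k))"
begin

interpretation program_context sg Pd P X K dm G0
  by unfold_locales (use dm code in auto)

lemma PN_card_base: "PN K G0 (\<lambda>k. card (bs (dm k)))"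
proof -
  have "PN K G0 (\<lambda>k. \<Sum>p\<leftarrow>Pd. prod_card (dm k) (pred_args sg p))"
    by (intro PN_sum_list PN_prod_card Pd_sorts)
  then show ?thesis by (rule PN_cong) (simp add: card_base dm)
qed

lemma PT_tab_base: "PT K G0 (\<lambda>k. tab (dm k) (bs (dm k)))"
  by (rule PT_cong[OF PN_card_base[unfolded PN_def]]) (simp add: tab_base dm)

lemma PT_tab_empty: "PT K G0 (\<lambda>k. tab (dm k) {})"
proof -
  have "PT (below K (\<lambda>k. card (bs (dm k)))) (add_index G0) (\<lambda>(k, i). [False])"
    using PT_const[of _ _ "[False]"] by (simp add: case_prod_beta')
  from PT_concat[OF PN_card_base this] show ?thesis
  proof (rule PT_cong)
    fix k assume "k \<in> K"
    moreover have "concat (map (\<lambda>i. [False]) [0..<n]) = replicate n False" for n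
      by (induction n) (auto simp: replicate_append_same)
    ultimately show "concat (map (\<lambda>i. [False]) [0..<card (bs (dm k))]) = tab (dm k) {}"
      by (simp add: tab_empty dm)
  qed
qed

lemma PT_tab_Int:
  assumes "PT K G0 (\<lambda>k. tab (dm k) (J k))" "PT K G0 (\<lambda>k. tab (dm k) (J' k))"
  shows "PT K G0 (\<lambda>k. tab (dm k) (J k \<inter> J' k))"
  by (rule PT_cong[OF PT_map2[OF assms, of "(\<and>)"]])
    (auto simp: tab_def zip_map1 zip_map2 zip_same_conv_map)

lemma PT_tab_Un:
  assumes "PT K G0 (\<lambda>k. tab (dm k) (J k))" "PT K G0 (\<lambda>k. tab (dm k) (J' k))"
  shows "PT K G0 (\<lambda>k. tab (dm k) (J k \<union> J' k))"
  by (rule PT_cong[OF PT_map2[OF assms, of "(\<or>)"]])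
    (auto simp: tab_def zip_map1 zip_map2 zip_same_conv_map)

text \<open>The two tables are concatenated for the iteration; as their common length is known, they
  can be separated again. The step is stated for a new domain and new words because it takes place
  on pairs of an object and a round number, with the current tables visible. What is computable from
  the object alone is carried over by the second premise.\<close>

lemma PT_iterate_pair:
  fixes v :: "'k \<Rightarrow> nat \<Rightarrow> ('p, 'e) interp3"
  assumes N: "PN K G0 N"
    and init: "PT K G0 (\<lambda>k. tab (dm k) (fst (v k 0)))" "PT K G0 (\<lambda>k. tab (dm k) (snd (v k 0)))"
    and step: "\<And>K' G'. K' = below K N \<Longrightarrow>
      (\<And>f. PT K G0 f \<Longrightarrow> PT K' G' (\<lambda>z. f (fst z))) \<Longrightarrow>
      PT K' G' (\<lambda>z. tab (dm (fst z)) (fst (v (fst z) (snd z)))) \<Longrightarrow>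
      PT K' G' (\<lambda>z. tab (dm (fst z)) (snd (v (fst z) (snd z)))) \<Longrightarrow>
      PT K' G' (\<lambda>z. tab (dm (fst z)) (fst (v (fst z) (Suc (snd z))))) \<and>
      PT K' G' (\<lambda>z. tab (dm (fst z)) (snd (v (fst z) (Suc (snd z)))))"
  shows "PT K G0 (\<lambda>k. tab (dm k) (fst (v k (N k))))" "PT K G0 (\<lambda>k. tab (dm k) (snd (v k (N k))))"
proof -
  let ?y = "\<lambda>k i. tab (dm k) (fst (v k i)) @ tab (dm k) (snd (v k i))"
  let ?n = "\<lambda>k. card (bs (dm k))"
  let ?K = "below K N"
  let ?G = "map (\<lambda>g (x, i). g x) G0 @ [\<lambda>(x, i). replicate i True, \<lambda>(x, i). ?y x i]"
  note len = length_tab[OF dm]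
  have lift: "PT ?K ?G (\<lambda>z. f (fst z))" if "PT K G0 f" for f
    using PT_lift[OF that, of ?K ?G] by (auto simp: below_def case_prod_beta')
  have y: "PT ?K ?G (\<lambda>z. ?y (fst z) (snd z))"
    by (rule PT_proj) (simp add: case_prod_beta')
  have n: "PN ?K ?G (\<lambda>z. ?n (fst z))"
    using lift[OF PN_card_base[unfolded PN_def]] by (simp add: PN_def)
  have kK: "fst z \<in> K" if "z \<in> ?K" for z using that by (auto simp: below_def)
  have 1: "PT ?K ?G (\<lambda>z. tab (dm (fst z)) (fst (v (fst z) (snd z))))"
    by (rule PT_cong[OF PT_take[OF y n]]) (simp add: len[OF kK])
  have 2: "PT ?K ?G (\<lambda>z. tab (dm (fst z)) (snd (v (fst z) (snd z))))"
    by (rule PT_cong[OF PT_drop[OF y n]]) (simp add: len[OF kK])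
  have body: "PT ?K ?G (\<lambda>(k, i). ?y k (Suc i))"
    using PT_append[OF conjunct1[OF step[OF refl lift 1 2]] conjunct2[OF step[OF refl lift 1 2]]]
    by (simp add: case_prod_beta')
  have pn: "pbd K (sz G0) ?n" using PT_length[OF PN_card_base[unfolded PN_def]] by simp
  have "PT K G0 (\<lambda>k. ?y k (length (replicate (N k) True)))"
  proof (rule PT_iterate[of _ _ _ ?y "\<lambda>k. ?n k + ?n k", OF N[unfolded PN_def]])
    show "PT K G0 (\<lambda>k. ?y k 0)" by (rule PT_append[OF init])
    show "PT {(k, i). k \<in> K \<and> i < length (replicate (N k) True)} ?G (\<lambda>(k, i). ?y k (Suc i))"
      using body by (simp add: below_def)
    show "pbd K (sz G0) (\<lambda>k. ?n k + ?n k)" by (intro pbd_intros pn)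
  qed (simp add: len)
  then have fin: "PT K G0 (\<lambda>k. ?y k (N k))" by simp
  show "PT K G0 (\<lambda>k. tab (dm k) (fst (v k (N k))))"
    by (rule PT_cong[OF PT_take[OF fin PN_card_base]]) (simp add: len)
  show "PT K G0 (\<lambda>k. tab (dm k) (snd (v k (N k))))"
    by (rule PT_cong[OF PT_drop[OF fin PN_card_base]]) (simp add: len)
qed

end

abbreviation dwn :: "('s, 'f, 'p, 'e) struct \<Rightarrow> ('p, 'e) gatom set \<Rightarrow> ('p, 'e) gatom set" where
  "dwn D \<equiv> approximation_op.down (bs D) (\<Phi> D)"

abbreviation upw :: "('s, 'f, 'p, 'e) struct \<Rightarrow> ('p, 'e) gatom set \<Rightarrow> ('p, 'e) gatom set" where
  "upw D \<equiv> approximation_op.up (bs D) (\<Phi> D)"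

text \<open>The upper bound \<open>b\<close> does not change, but is carried along so that each
  round applies the operator to the current pair.\<close>

lemma PT_down:
  fixes dm :: "'k \<Rightarrow> ('s, 'f, 'p, 'e) struct"
  assumes dm: "\<And>k. k \<in> K \<Longrightarrow> dm k \<in> finite_structures sg"
    and code: "PT K G0 (\<lambda>k. struct_code sg (dm k))" and b: "PT K G0 (\<lambda>k. tab (dm k) (b k))"
  shows "PT K G0 (\<lambda>k. tab (dm k) (dwn (dm k) (b k)))"
proof -
  let ?F = "\<lambda>k x. fst (\<Phi> (dm k) (x, b k)) \<inter> b k"
  let ?v = "\<lambda>k i. ((?F k ^^ i) {}, b k)"
  have "PT K G0 (\<lambda>k. tab (dm k) (fst (?v k (card (bs (dm k))))))"
  proof (rule PT_iterate_pair(1)[of K dm G0 "\<lambda>k. card (bs (dm k))" ?v])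
    show "PN K G0 (\<lambda>k. card (bs (dm k)))" by (rule PN_card_base[OF dm code])
    show "PT K G0 (\<lambda>k. tab (dm k) (fst (?v k 0)))" using PT_tab_empty[OF dm code] by simp
    show "PT K G0 (\<lambda>k. tab (dm k) (snd (?v k 0)))" using b by simp
    fix K' G' assume K': "K' = below K (\<lambda>k. card (bs (dm k)))"
      and lift: "\<And>f. PT K G0 f \<Longrightarrow> PT K' G' (\<lambda>z. f (fst z))"
      and 1: "PT K' G' (\<lambda>z. tab (dm (fst z)) (fst (?v (fst z) (snd z))))"
      and 2: "PT K' G' (\<lambda>z. tab (dm (fst z)) (snd (?v (fst z) (snd z))))"
    have dm': "dm (fst z) \<in> finite_structures sg" if "z \<in> K'" for z
      using that K' dm by (auto simp: below_def)
    have "PT K' G' (\<lambda>z. tab (dm (fst z)) (fst (\<Phi> (dm (fst z)) (?v (fst z) (snd z))) \<inter> b (fst z)))"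
      by (rule PT_tab_Int[OF dm' lift[OF code]
            PT_consequence(1)[OF dm' lift[OF code], of "\<lambda>z. ?v (fst z) (snd z)", OF _ 1 2] lift[OF b]])
    then show "PT K' G' (\<lambda>z. tab (dm (fst z)) (fst (?v (fst z) (Suc (snd z))))) \<and>
      PT K' G' (\<lambda>z. tab (dm (fst z)) (snd (?v (fst z) (Suc (snd z)))))"
      using 2 by simp
  qed (use dm code in auto)
  then show ?thesis
    by (rule PT_cong) (simp add: approximation_op.down_def[OF approximation_op_consequence[OF dm]])
qed

lemma PT_up:
  fixes dm :: "'k \<Rightarrow> ('s, 'f, 'p, 'e) struct"
  assumes dm: "\<And>k. k \<in> K \<Longrightarrow> dm k \<in> finite_structures sg"
    and code: "PT K G0 (\<lambda>k. struct_code sg (dm k))" and a: "PT K G0 (\<lambda>k. tab (dm k) (a k))"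
  shows "PT K G0 (\<lambda>k. tab (dm k) (upw (dm k) (a k)))"
proof -
  let ?F = "\<lambda>k x. a k \<union> snd (\<Phi> (dm k) (a k, x))"
  let ?v = "\<lambda>k i. (a k, (?F k ^^ i) (a k))"
  have "PT K G0 (\<lambda>k. tab (dm k) (snd (?v k (card (bs (dm k))))))"
  proof (rule PT_iterate_pair(2)[of K dm G0 "\<lambda>k. card (bs (dm k))" ?v])
    show "PN K G0 (\<lambda>k. card (bs (dm k)))" by (rule PN_card_base[OF dm code])
    show "PT K G0 (\<lambda>k. tab (dm k) (fst (?v k 0)))" "PT K G0 (\<lambda>k. tab (dm k) (snd (?v k 0)))"
      using a by simp_all
    fix K' G' assume K': "K' = below K (\<lambda>k. card (bs (dm k)))"
      and lift: "\<And>f. PT K G0 f \<Longrightarrow> PT K' G' (\<lambda>z. f (fst z))"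
      and 1: "PT K' G' (\<lambda>z. tab (dm (fst z)) (fst (?v (fst z) (snd z))))"
      and 2: "PT K' G' (\<lambda>z. tab (dm (fst z)) (snd (?v (fst z) (snd z))))"
    have dm': "dm (fst z) \<in> finite_structures sg" if "z \<in> K'" for z
      using that K' dm by (auto simp: below_def)
    have "PT K' G' (\<lambda>z. tab (dm (fst z)) (a (fst z) \<union> snd (\<Phi> (dm (fst z)) (?v (fst z) (snd z)))))"
      by (rule PT_tab_Un[OF dm' lift[OF code] lift[OF a]
            PT_consequence(2)[OF dm' lift[OF code], of "\<lambda>z. ?v (fst z) (snd z)", OF _ 1 2]])
    then show "PT K' G' (\<lambda>z. tab (dm (fst z)) (fst (?v (fst z) (Suc (snd z))))) \<and>
      PT K' G' (\<lambda>z. tab (dm (fst z)) (snd (?v (fst z) (Suc (snd z)))))"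
      using 1 by simp
  qed (use dm code in auto)
  then show ?thesis
    by (rule PT_cong) (simp add: approximation_op.up_def[OF approximation_op_consequence[OF dm]])
qed

lemma PT_code: "PT (finite_structures sg) [struct_code sg] (struct_code sg)"
  by (rule PT_proj) simp

lemma PT_kripke_kleene:
  "PT (finite_structures sg) [struct_code sg] (\<lambda>D. tab D (fst (kripke_kleene (bs D) (\<Phi> D))))"
proof -
  let ?v = "\<lambda>D i. (\<Phi> D ^^ i) ({}, bs D)"
  have "PT (finite_structures sg) [struct_code sg] (\<lambda>D. tab D (fst (?v D (2 * card (bs D)))))"
  proof (rule PT_iterate_pair(1)[of _ "\<lambda>D. D" _ "\<lambda>D. 2 * card (bs D)" ?v])
    show "PN (finite_structures sg) [struct_code sg] (\<lambda>D. 2 * card (bs D))"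
      by (rule PN_mult[OF PN_const PN_card_base[OF _ PT_code]])
    show "PT (finite_structures sg) [struct_code sg] (\<lambda>D. tab D (fst (?v D 0)))"
      using PT_tab_empty[OF _ PT_code] by simp
    show "PT (finite_structures sg) [struct_code sg] (\<lambda>D. tab D (snd (?v D 0)))"
      using PT_tab_base[OF _ PT_code] by simp
    fix K' G' assume K': "K' = below (finite_structures sg) (\<lambda>D. 2 * card (bs D))"
      and lift: "\<And>f. PT (finite_structures sg) [struct_code sg] f \<Longrightarrow> PT K' G' (\<lambda>z. f (fst z))"
      and 1: "PT K' G' (\<lambda>z. tab (fst z) (fst (?v (fst z) (snd z))))"
      and 2: "PT K' G' (\<lambda>z. tab (fst z) (snd (?v (fst z) (snd z))))"
    have dm': "fst z \<in> finite_structures sg" if "z \<in> K'" for z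
      using that K' by (auto simp: below_def)
    from PT_consequence[OF dm' lift[OF PT_code], of "\<lambda>z. ?v (fst z) (snd z)", OF _ 1 2]
    show "PT K' G' (\<lambda>z. tab (fst z) (fst (?v (fst z) (Suc (snd z))))) \<and>
      PT K' G' (\<lambda>z. tab (fst z) (snd (?v (fst z) (Suc (snd z)))))" by simp
  qed (auto intro: PT_code)
  then show ?thesis
    by (rule PT_cong) (simp add: approximation_op.kripke_kleene_iterate[OF approximation_op_consequence])
qed

text \<open>Every round runs the two inner iterations, with bounds depending on the round. This is
  why \<open>PT_down\<close> and \<open>PT_up\<close> are stated for an arbitrary domain of
  objects.\<close>

lemma PT_well_founded:
  "PT (finite_structures sg) [struct_code sg] (\<lambda>D. tab D (fst (well_founded (bs D) (\<Phi> D))))"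
proof -
  let ?v = "\<lambda>D i. ((\<lambda>v. (dwn D (snd v), upw D (fst v))) ^^ i) ({}, bs D)"
  have "PT (finite_structures sg) [struct_code sg] (\<lambda>D. tab D (fst (?v D (2 * card (bs D)))))"
  proof (rule PT_iterate_pair(1)[of _ "\<lambda>D. D" _ "\<lambda>D. 2 * card (bs D)" ?v])
    show "PN (finite_structures sg) [struct_code sg] (\<lambda>D. 2 * card (bs D))"
      by (rule PN_mult[OF PN_const PN_card_base[OF _ PT_code]])
    show "PT (finite_structures sg) [struct_code sg] (\<lambda>D. tab D (fst (?v D 0)))"
      using PT_tab_empty[OF _ PT_code] by simp
    show "PT (finite_structures sg) [struct_code sg] (\<lambda>D. tab D (snd (?v D 0)))"
      using PT_tab_base[OF _ PT_code] by simp
    fix K' G' assume K': "K' = below (finite_structures sg) (\<lambda>D. 2 * card (bs D))"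
      and lift: "\<And>f. PT (finite_structures sg) [struct_code sg] f \<Longrightarrow> PT K' G' (\<lambda>z. f (fst z))"
      and 1: "PT K' G' (\<lambda>z. tab (fst z) (fst (?v (fst z) (snd z))))"
      and 2: "PT K' G' (\<lambda>z. tab (fst z) (snd (?v (fst z) (snd z))))"
    have dm': "fst z \<in> finite_structures sg" if "z \<in> K'" for z
      using that K' by (auto simp: below_def)
    from PT_down[OF dm' lift[OF PT_code] 2] PT_up[OF dm' lift[OF PT_code] 1]
    show "PT K' G' (\<lambda>z. tab (fst z) (fst (?v (fst z) (Suc (snd z))))) \<and>
      PT K' G' (\<lambda>z. tab (fst z) (snd (?v (fst z) (Suc (snd z)))))" by simp
  qed (auto intro: PT_code)
  then show ?thesis
  proof (rule PT_cong)
    fix D :: "('s, 'f, 'p, 'e) struct" assume "D \<in> finite_structures sg"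
    note op = approximation_op_consequence[OF this]
    have "approximation_op.stable (bs D) (\<Phi> D) = (\<lambda>v. (dwn D (snd v), upw D (fst v)))"
      by (simp add: fun_eq_iff approximation_op.stable_def[OF op])
    then show "tab D (fst (?v D (2 * card (bs D)))) = tab D (fst (well_founded (bs D) (\<Phi> D)))"
      by (simp add: approximation_op.well_founded_iterate[OF op])
  qed
qed

lemma PB_exact_stable:
  "PB {(D, I). D \<in> finite_structures sg \<and> I \<subseteq> bs D} [\<lambda>(D, I). struct_code sg D, \<lambda>(D, I). tab D I]
     (\<lambda>(D, I). exact_stable (bs D) (\<Phi> D) I)"
proof -
  let ?K = "{(D, I). D \<in> finite_structures sg \<and> I \<subseteq> bs D}"
  let ?G = "[\<lambda>(D, I). struct_code sg D, \<lambda>(D, I). tab D I]"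
  have dm: "fst z \<in> finite_structures sg" if "z \<in> ?K" for z using that by auto
  have code: "PT ?K ?G (\<lambda>z. struct_code sg (fst z))" by (rule PT_proj) (simp add: case_prod_beta')
  have I: "PT ?K ?G (\<lambda>z. tab (fst z) (snd z))" by (rule PT_proj) (simp add: case_prod_beta')
  have "PT ?K ?G (\<lambda>z. tab (fst z) (fst (\<Phi> (fst z) (snd z, snd z))))"
    using PT_consequence(1)[OF dm code, of "\<lambda>z. (snd z, snd z)"] I by simp
  from PB_conj[OF PB_eq_words[OF PT_down[OF dm code I] I] PB_eq_words[OF this I]]
  show ?thesis
  proof (rule PB_cong)
    fix z assume "z \<in> ?K"
    then obtain D I where z: "z = (D, I)" "D \<in> finite_structures sg" "I \<subseteq> bs D" by auto
    note op = approximation_op_consequence[OF z(2)]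
    have "dwn D I \<subseteq> bs D" using approximation_op.down_fixpoint(2)[OF op z(3)] z(3) by simp
    moreover have "fst (\<Phi> D (I, I)) \<subseteq> bs D" by (auto simp: consequence_derived[OF z(2)] derived_def)
    ultimately show "(tab (fst z) (dwn (fst z) (snd z)) = tab (fst z) (snd z) \<and>
        tab (fst z) (fst (\<Phi> (fst z) (snd z, snd z))) = tab (fst z) (snd z)) =
      (\<lambda>(D, I). exact_stable (bs D) (\<Phi> D) I) z"
      using tab_inj[OF z(2)] z(1,3) by (simp add: approximation_op.exact_stable_iff[OF op])
  qed
qed

end

section \<open>Recognizing codes of structures\<close>

lemma sdom_cong:
  assumes "sdom D = sdom D'"
  shows "rank D = rank D'" "elems D = elems D'" "prod_card D = prod_card D'" "tuples D = tuples D'"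
    "tuple_list D = tuple_list D'" "tuple_index D = tuple_index D'"
    "fun_offset sg D = fun_offset sg D'" "pred_offset sg D = pred_offset sg D'"
proof -
  show 1: "rank D = rank D'" "elems D = elems D'" "prod_card D = prod_card D'" "tuples D = tuples D'"
    "tuple_list D = tuple_list D'"
    by (simp_all add: fun_eq_iff rank_def elems_def prod_card_def tuples_def tuple_list_def assms)
  have "tuple_index D ss ds = tuple_index D' ss ds" for ss ds
  proof (induction ss arbitrary: ds)
    case (Cons s ss)
    then show ?case by (cases ds) (simp_all add: 1)
  qed simp
  then show "tuple_index D = tuple_index D'" by (simp add: fun_eq_iff)
  show "fun_offset sg D = fun_offset sg D'" "pred_offset sg D = pred_offset sg D'"
    by (simp_all add: fun_eq_iff fun_offset_def pred_offset_def 1)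
qed

text \<open>Between domains of equal size this is the order isomorphism, applied to each component.
  Codes are built from ranks and are preserved if functions and predicates are transported along
  it.\<close>

definition transfer_tuple :: "('s, 'f, 'p, 'e::linorder) struct \<Rightarrow> ('s, 'f, 'p, 'd::linorder) struct \<Rightarrow>
    's list \<Rightarrow> 'e list \<Rightarrow> 'd list" where
  "transfer_tuple D D' ss ds = map2 (\<lambda>s d. elems D' s ! rank D s d) ss ds"

locale same_cards = wf_sig sg
  for sg :: "('s, 'f, 'p, 'r) signature" +
  fixes D :: "('s, 'f, 'p, 'e::linorder) struct" and D' :: "('s, 'f, 'p, 'd::linorder) struct"
  assumes fin: "s \<in> set (sorts sg) \<Longrightarrow> finite (sdom D s)" "s \<in> set (sorts sg) \<Longrightarrow> finite (sdom D' s)"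
    and cards: "s \<in> set (sorts sg) \<Longrightarrow> card (sdom D' s) = card (sdom D s)"
begin

lemma prod_card_eq: "set ss \<subseteq> set (sorts sg) \<Longrightarrow> prod_card D' ss = prod_card D ss"
  unfolding prod_card_def using cards by (induction ss) auto

lemma fun_offset_eq: "fun_offset sg D' f = fun_offset sg D f"
proof -
  have "map (\<lambda>g. prod_card D' (fun_args sg g)) (takeWhile (\<lambda>g. g \<noteq> f) (funs sg)) =
    map (\<lambda>g. prod_card D (fun_args sg g)) (takeWhile (\<lambda>g. g \<noteq> f) (funs sg))"
    by (intro map_cong refl prod_card_eq fun_sorts(1)) (auto dest: set_takeWhileD)
  then show ?thesis by (simp only: fun_offset_def)
qed

lemma pred_offset_eq: "pred_offset sg D' p = pred_offset sg D p"
proof -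
  have "map (\<lambda>g. prod_card D' (fun_args sg g)) (funs sg) = map (\<lambda>g. prod_card D (fun_args sg g)) (funs sg)"
    by (intro map_cong refl prod_card_eq fun_sorts(1))
  moreover have "map (\<lambda>g. prod_card D' (pred_args sg g)) (takeWhile (\<lambda>g. g \<noteq> p) (preds sg)) =
    map (\<lambda>g. prod_card D (pred_args sg g)) (takeWhile (\<lambda>g. g \<noteq> p) (preds sg))"
    by (intro map_cong refl prod_card_eq pred_sorts) (auto dest: set_takeWhileD)
  ultimately show ?thesis by (simp only: pred_offset_def)
qed

lemma tuple_list_transfer:
  "set ss \<subseteq> set (sorts sg) \<Longrightarrow> tuple_list D' ss = map (transfer_tuple D D' ss) (tuple_list D ss)"
proof (induction ss)
  case (Cons s ss)
  have s: "s \<in> set (sorts sg)" using Cons.prems by simp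
  have e: "elems D' s = map (\<lambda>d. elems D' s ! rank D s d) (elems D s)"
    using elems(3)[OF fin(1)[OF s]] elems(3)[OF fin(2)[OF s]] cards[OF s] rank_nth[OF fin(1)[OF s]]
    by (intro nth_equalityI) simp_all
  have "tuple_list D' (s # ss) = concat (map (\<lambda>d. map ((#) (elems D' s ! rank D s d)) (tuple_list D' ss)) (elems D s))"
    using arg_cong[OF e, of "\<lambda>es. concat (map (\<lambda>d. map ((#) d) (tuple_list D' ss)) es)"]
    by (simp add: tuple_list_Cons comp_def)
  also have "\<dots> = map (transfer_tuple D D' (s # ss)) (tuple_list D (s # ss))"
    using Cons by (simp add: tuple_list_Cons map_concat comp_def transfer_tuple_def)
  finally show ?case .
qed (simp add: tuple_list_Nil transfer_tuple_def)

lemma tuple_index_transfer: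
  "set ss \<subseteq> set (sorts sg) \<Longrightarrow> ds \<in> tuples D ss \<Longrightarrow>
   tuple_index D' ss (transfer_tuple D D' ss ds) = tuple_index D ss ds"
proof (induction ss arbitrary: ds)
  case (Cons s ss)
  then obtain d ds' where ds: "ds = d # ds'" "d \<in> sdom D s" "ds' \<in> tuples D ss"
    by (auto simp: tuples_Cons)
  have s: "s \<in> set (sorts sg)" using Cons.prems by simp
  have "rank D' s (elems D' s ! rank D s d) = rank D s d"
    using rank_nth[OF fin(2)[OF s]] nth_rank(2)[OF fin(1)[OF s] ds(2)] cards[OF s] by simp
  then show ?case
    using Cons ds prod_card_eq[of ss] by (simp add: transfer_tuple_def)
qed (simp add: tuples_Nil transfer_tuple_def)

lemma struct_nats_transfer:
  assumes f: "\<And>f ds. f \<in> set (funs sg) \<Longrightarrow> ds \<in> tuples D (fun_args sg f) \<Longrightarrow>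
      rank D' (fun_res sg f) (fun_int D' f (transfer_tuple D D' (fun_args sg f) ds)) =
      rank D (fun_res sg f) (fun_int D f ds)"
    and p: "\<And>p ds. p \<in> set (preds sg) \<Longrightarrow> ds \<in> tuples D (pred_args sg p) \<Longrightarrow>
      pred_int D' p (transfer_tuple D D' (pred_args sg p) ds) = pred_int D p ds"
  shows "struct_nats sg D' = struct_nats sg D"
proof -
  have tl: "set (tuple_list D ss) = tuples D ss" if "set ss \<subseteq> set (sorts sg)" for ss
    by (rule set_tuple_list) (use that fin in blast)
  have "map (\<lambda>s. card (sdom D' s)) (sorts sg) = map (\<lambda>s. card (sdom D s)) (sorts sg)"
    using cards by simp
  moreover have "map (\<lambda>ds. rank D' (fun_res sg g) (fun_int D' g ds)) (tuple_list D' (fun_args sg g)) =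
      map (\<lambda>ds. rank D (fun_res sg g) (fun_int D g ds)) (tuple_list D (fun_args sg g))"
    if "g \<in> set (funs sg)" for g
    using f[OF that] tl[OF fun_sorts(1)[OF that]] by (simp add: tuple_list_transfer[OF fun_sorts(1)[OF that]])
  moreover have "map (\<lambda>ds. of_bool (pred_int D' q ds) :: nat) (tuple_list D' (pred_args sg q)) =
      map (\<lambda>ds. of_bool (pred_int D q ds)) (tuple_list D (pred_args sg q))"
    if "q \<in> set (preds sg)" for q
    using p[OF that] tl[OF pred_sorts[OF that]] by (simp add: tuple_list_transfer[OF pred_sorts[OF that]])
  ultimately show ?thesis unfolding struct_nats_def by (simp cong: map_cong)
qed

end

section \<open>Reading arbitrary words as structures\<close>

context wf_sig
begin

text \<open>Where the tables of functions and predicates begin depends on the cardinalities. Reading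
  the domains first avoids a circular definition of \<open>decode\<close>.\<close>

definition blank :: "bool list \<Rightarrow> ('s, 'f, 'p, nat) struct" where
  "blank w = \<lparr>sdom = (\<lambda>s. {0..<block w (pos (sorts sg) s)}), fun_int = (\<lambda>_ _. 0), pred_int = (\<lambda>_ _. False)\<rparr>"

text \<open>Any word is read as a structure over naturals, whose functions may leave the domain.\<close>

definition decode :: "bool list \<Rightarrow> ('s, 'f, 'p, nat) struct" where
  "decode w = \<lparr>sdom = sdom (blank w),
     fun_int = (\<lambda>f ds. block w (fun_offset sg (blank w) f + tuple_index (blank w) (fun_args sg f) ds)),
     pred_int = (\<lambda>p ds. block w (pred_offset sg (blank w) p + tuple_index (blank w) (pred_args sg p) ds) = 1)\<rparr>"

lemma decode_simps:
  "sdom (decode w) s = {0..<block w (pos (sorts sg) s)}"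
  "fun_int (decode w) f ds = block w (fun_offset sg (decode w) f + tuple_index (decode w) (fun_args sg f) ds)"
  "pred_int (decode w) p ds \<longleftrightarrow> block w (pred_offset sg (decode w) p + tuple_index (decode w) (pred_args sg p) ds) = 1"
proof -
  have e: "sdom (blank w) = sdom (decode w)" by (simp add: decode_def)
  show "sdom (decode w) s = {0..<block w (pos (sorts sg) s)}" by (simp add: decode_def blank_def)
  show "fun_int (decode w) f ds = block w (fun_offset sg (decode w) f + tuple_index (decode w) (fun_args sg f) ds)"
    "pred_int (decode w) p ds \<longleftrightarrow> block w (pred_offset sg (decode w) p + tuple_index (decode w) (pred_args sg p) ds) = 1"
    unfolding sdom_cong(6-8)[OF e[symmetric]] by (simp_all add: decode_def)
qed

text \<open>The rank is the minimum of \<open>v\<close> and the size of the domain, also for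
  \<open>v\<close> outside of it. The truncated subtractions put it in a form to which
  \<open>PN_diff\<close> applies.\<close>

lemma rank_decode: "rank (decode w) s v = v - (v - card (sdom (decode w) s))"
proof -
  have "{x \<in> {0..<n}. x < v} = {0..<min n v}" for n by auto
  then have "card {x \<in> {0..<n}. x < v} = min n v" for n by simp
  then show ?thesis by (simp add: rank_def decode_simps(1) min_def)
qed

sublocale dec: domain_context sg "UNIV :: bool list set" decode "[\<lambda>w. w]"
proof
  show "finite (sdom (decode w) s)" for w s by (simp add: decode_simps)
  show "PN UNIV [\<lambda>w. w] (\<lambda>w. card (sdom (decode w) s))" for s
    using PN_block[OF PT_proj PN_const, of "\<lambda>w. w" "[\<lambda>w. w]" UNIV "pos (sorts sg) s"]
    by (simp add: decode_simps)
qed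

definition var_list :: "'s list \<Rightarrow> 's var list" where
  "var_list ss = zip [0..<length ss] ss"

lemma var_list: "distinct (var_list ss)" "map snd (var_list ss) = ss"
  by (simp_all add: var_list_def distinct_zipI1)

lemma PT_word: "PT UNIV [\<lambda>w. w] (\<lambda>w. w)"
  by (rule PT_proj) simp

lemma PN_decoded_index:
  assumes "set ss \<subseteq> set (sorts sg)"
  shows "PN (dec.cX (var_list ss)) (dec.cG (var_list ss))
    (\<lambda>z. tuple_index (decode (fst z)) ss (map (snd z) (var_list ss)))"
  using dec.ctx_tuple_index[of "var_list ss" "var_list ss" snd "\<lambda>v z. snd z v"] dec.ctx_var assms
  by (simp add: var_list(2) flip: set_map)

lemma PN_decoded_fun:
  assumes f: "f \<in> set (funs sg)"
  shows "PN (dec.cX (var_list (fun_args sg f))) (dec.cG (var_list (fun_args sg f)))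
    (\<lambda>z. fun_int (decode (fst z)) f (map (snd z) (var_list (fun_args sg f))))"
  unfolding decode_simps(2)
  by (intro PN_block PN_add dec.ctx_base[OF PT_word] dec.ctx_base_PN[OF dec.PN_fun_offset[OF f]]
      PN_decoded_index fun_sorts(1) f)

lemma PB_decoded_pred:
  assumes p: "p \<in> set (preds sg)"
  shows "PB (dec.cX (var_list (pred_args sg p))) (dec.cG (var_list (pred_args sg p)))
    (\<lambda>z. pred_int (decode (fst z)) p (map (snd z) (var_list (pred_args sg p))))"
  unfolding decode_simps(3)
  by (intro PB_eq PN_const PN_block PN_add dec.ctx_base[OF PT_word] dec.ctx_base_PN[OF dec.PN_pred_offset[OF p]]
      PN_decoded_index pred_sorts p)

lemma PT_struct_code_decode: "PT UNIV [\<lambda>w. w] (\<lambda>w. struct_code sg (decode w))"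
proof -
  have un: "PT X G (\<lambda>x. unary_code [n x])" if "PN X G n" for X G and n :: "'x \<Rightarrow> nat"
    using PT_unary_code[of "[n]" X G] that by simp
  have 1: "PT UNIV [\<lambda>w. w] (\<lambda>w. unary_code (map (\<lambda>s. card (sdom (decode w) s)) (sorts sg)))"
    unfolding unary_code_map[of _ "sorts sg"] by (intro PT_concat_static un dec.PN_card)
  have 2: "PT UNIV [\<lambda>w. w] (\<lambda>w. concat (map (\<lambda>ds. unary_code [rank (decode w) (fun_res sg f) (fun_int (decode w) f ds)])
      (tuple_list (decode w) (fun_args sg f))))" if f: "f \<in> set (funs sg)" for f
    by (rule dec.PT_tuples[OF var_list fun_sorts(1)[OF f]], unfold rank_decode)
      (intro un PN_diff PN_decoded_fun f dec.ctx_base_PN[OF dec.PN_card] fun_sorts(2))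
  have 3: "PT UNIV [\<lambda>w. w] (\<lambda>w. concat (map (\<lambda>ds. unary_code [of_bool (pred_int (decode w) p ds)])
      (tuple_list (decode w) (pred_args sg p))))" if p: "p \<in> set (preds sg)" for p
  proof (rule dec.PT_tuples[OF var_list pred_sorts[OF p]])
    let ?zs = "var_list (pred_args sg p)"
    have "PT (dec.cX ?zs) (dec.cG ?zs) (\<lambda>z. if pred_int (decode (fst z)) p (map (snd z) ?zs)
        then unary_code [1] else unary_code [0])"
      by (rule PT_if'[OF PB_decoded_pred[OF p] PT_const PT_const])
    then show "PT (dec.cX ?zs) (dec.cG ?zs) (\<lambda>z. unary_code [of_bool (pred_int (decode (fst z)) p (map (snd z) ?zs))])"
      by (rule PT_cong) simp
  qed
  have cc: "unary_code (concat (map (\<lambda>a. map (h a) (L a)) as)) = concat (map (\<lambda>a. concat (map (\<lambda>x. unary_code [h a x]) (L a))) as)"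
    for h :: "'x \<Rightarrow> 'y \<Rightarrow> nat" and L as
    by (induction as) (simp_all add: unary_code_simps(1,3) unary_code_map[of "h _"])
  show ?thesis
    unfolding struct_code_def struct_nats_def unary_code_simps(3) cc
    by (intro PT_append 1 PT_concat_static 2 3)
qed

text \<open>Decoded domains are finite by construction. Only the closure of the domains under the
  functions can fail, and it is checked tuple by tuple.\<close>

lemma PB_decode_closed: "PB UNIV [\<lambda>w. w] (\<lambda>w. decode w \<in> finite_structures sg)"
proof -
  have "PB UNIV [\<lambda>w. w] (\<lambda>w. \<exists>ds\<in>tuples (decode w) (fun_args sg f).
      \<not> fun_int (decode w) f ds < card (sdom (decode w) (fun_res sg f)))" if f: "f \<in> set (funs sg)" for f
    by (rule dec.PB_tuples_ex[OF var_list fun_sorts(1)[OF f]])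
      (intro PB_not PB_less PN_decoded_fun f dec.ctx_base_PN[OF dec.PN_card] fun_sorts(2))
  from PB_ball[OF finite_set PB_not[OF this]] show ?thesis
    by (rule PB_cong) (auto simp: finite_structures_def decode_simps(1))
qed

text \<open>The decoded structure has domains of the same size as \<open>D\<close>, and matching
  ranks identify the two, so their codes coincide. Numbers after those of the structure are not
  read.\<close>

lemma decode_struct_code:
  fixes D :: "('s, 'f, 'p, 'e::linorder) struct"
  assumes D: "D \<in> finite_structures sg" and w: "w = unary_code (struct_nats sg D @ ns)"
  shows "decode w \<in> finite_structures sg" "struct_code sg (decode w) = struct_code sg D"
    "\<And>s. s \<in> set (sorts sg) \<Longrightarrow> card (sdom (decode w) s) = card (sdom D s)"
proof -
  show card: "card (sdom (decode w) s) = card (sdom D s)" if "s \<in> set (sorts sg)" for s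
    using block_card[OF D that, of ns] by (simp add: decode_simps(1) w)
  interpret same_cards sg D "decode w"
    by unfold_locales (use finite_sdom[OF D] card in \<open>auto simp: decode_simps(1)\<close>)
  have f: "fun_int (decode w) f (transfer_tuple D (decode w) (fun_args sg f) ds) = rank D (fun_res sg f) (fun_int D f ds)"
    "rank D (fun_res sg f) (fun_int D f ds) < card (sdom (decode w) (fun_res sg f))"
    if f: "f \<in> set (funs sg)" and ds: "ds \<in> tuples D (fun_args sg f)" for f ds
  proof -
    show "fun_int (decode w) f (transfer_tuple D (decode w) (fun_args sg f) ds) = rank D (fun_res sg f) (fun_int D f ds)"
      unfolding decode_simps(2) fun_offset_eq tuple_index_transfer[OF fun_sorts(1)[OF f] ds]
      using block_fun[OF D f ds, of ns] w by simp
    have "fun_int D f ds \<in> sdom D (fun_res sg f)" using D f ds by (simp add: finite_structures_def)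
    from nth_rank(2)[OF finite_sdom[OF D fun_sorts(2)[OF f]] this]
    show "rank D (fun_res sg f) (fun_int D f ds) < card (sdom (decode w) (fun_res sg f))"
      using card[OF fun_sorts(2)[OF f]] by simp
  qed
  have "struct_nats sg (decode w) = struct_nats sg D"
  proof (rule struct_nats_transfer)
    fix f ds assume fds: "f \<in> set (funs sg)" "ds \<in> tuples D (fun_args sg f)"
    show "rank (decode w) (fun_res sg f) (fun_int (decode w) f (transfer_tuple D (decode w) (fun_args sg f) ds)) =
      rank D (fun_res sg f) (fun_int D f ds)"
      using f[OF fds] unfolding rank_decode by simp
  next
    fix p ds assume p: "p \<in> set (preds sg)" and ds: "ds \<in> tuples D (pred_args sg p)"
    show "pred_int (decode w) p (transfer_tuple D (decode w) (pred_args sg p) ds) = pred_int D p ds"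
      unfolding decode_simps(3) pred_offset_eq tuple_index_transfer[OF pred_sorts[OF p] ds]
      using block_pred[OF D p ds, of ns] w by simp
  qed
  then show "struct_code sg (decode w) = struct_code sg D" by (simp add: struct_code_def)
  have "fun_int (decode w) f ds' \<in> sdom (decode w) (fun_res sg f)"
    if fs: "f \<in> set (funs sg)" and ds': "ds' \<in> tuples (decode w) (fun_args sg f)" for f ds'
  proof -
    have "set (tuple_list (decode w) (fun_args sg f)) = tuples (decode w) (fun_args sg f)"
      by (rule set_tuple_list) (simp add: decode_simps(1))
    moreover have "set (tuple_list D (fun_args sg f)) = tuples D (fun_args sg f)"
      by (rule set_tuple_list[OF finite_sdoms[OF D fun_sorts(1)[OF fs]]])
    ultimately obtain ds where "ds \<in> tuples D (fun_args sg f)" "ds' = transfer_tuple D (decode w) (fun_args sg f) ds"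
      using ds' tuple_list_transfer[OF fun_sorts(1)[OF fs]] by auto
    then show ?thesis using f[OF fs] by (simp add: decode_simps(1))
  qed
  then show "decode w \<in> finite_structures sg" by (simp add: finite_structures_def decode_simps(1))
qed

text \<open>The decoded structure is copied along ranks to sets of the right size in the type at
  hand.\<close>

lemma realize_decode:
  assumes D': "decode w \<in> finite_structures sg"
    and real: "\<And>s. s \<in> set (sorts sg) \<Longrightarrow> \<exists>S :: 'e::linorder set. finite S \<and> card S = card (sdom (decode w) s)"
  shows "\<exists>D :: ('s, 'f, 'p, 'e) struct. D \<in> finite_structures sg \<and> struct_code sg D = struct_code sg (decode w)"
proof -
  let ?D' = "decode w"
  obtain S :: "'s \<Rightarrow> 'e set" where S: "\<And>s. s \<in> set (sorts sg) \<Longrightarrow> finite (S s) \<and> card (S s) = card (sdom ?D' s)"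
    using real by metis
  \<comment> \<open>This auxiliary structure has the domains of \<open>D\<close>; it provides
    \<open>elems\<close> and ranks for defining the functions and predicates of
    \<open>D\<close>.\<close>
  define D0 :: "('s, 'f, 'p, 'e) struct" where
    "D0 = \<lparr>sdom = S, fun_int = (\<lambda>_ _. undefined), pred_int = (\<lambda>_ _. False)\<rparr>"
  define D :: "('s, 'f, 'p, 'e) struct" where
    "D = \<lparr>sdom = S,
       fun_int = (\<lambda>f ds. elems D0 (fun_res sg f) !
         rank ?D' (fun_res sg f) (fun_int ?D' f (transfer_tuple D0 ?D' (fun_args sg f) ds))),
       pred_int = (\<lambda>p ds. pred_int ?D' p (transfer_tuple D0 ?D' (pred_args sg p) ds))\<rparr>"
  have sd: "sdom D0 = sdom D" and sdS: "sdom D = S" by (simp_all add: D0_def D_def)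
  have tr: "transfer_tuple D0 ?D' = transfer_tuple D ?D'"
    unfolding transfer_tuple_def sdom_cong(1)[OF sd] by (rule refl)
  have fD: "fun_int D f ds = elems D (fun_res sg f) !
      rank ?D' (fun_res sg f) (fun_int ?D' f (transfer_tuple D ?D' (fun_args sg f) ds))" for f ds
    unfolding tr[symmetric] sdom_cong(2)[OF sd, symmetric] by (simp add: D_def)
  have pD: "pred_int D p ds = pred_int ?D' p (transfer_tuple D ?D' (pred_args sg p) ds)" for p ds
    unfolding tr[symmetric] by (simp add: D_def)
  interpret same_cards sg D ?D'
    by unfold_locales (use S sdS finite_sdom[OF D'] in auto)
  have r: "rank ?D' (fun_res sg f) (fun_int ?D' f (transfer_tuple D ?D' (fun_args sg f) ds)) < card (sdom D (fun_res sg f))"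
    if f: "f \<in> set (funs sg)" and ds: "ds \<in> tuples D (fun_args sg f)" for f ds
  proof -
    have "transfer_tuple D ?D' (fun_args sg f) ds \<in> set (tuple_list ?D' (fun_args sg f))"
      using ds set_tuple_list[of "fun_args sg f" D] fin(1) subsetD[OF fun_sorts(1)[OF f]]
      by (simp add: tuple_list_transfer[OF fun_sorts(1)[OF f]])
    also have "set (tuple_list ?D' (fun_args sg f)) = tuples ?D' (fun_args sg f)"
      by (rule set_tuple_list[OF finite_sdoms[OF D' fun_sorts(1)[OF f]]])
    finally have "fun_int ?D' f (transfer_tuple D ?D' (fun_args sg f) ds) \<in> sdom ?D' (fun_res sg f)"
      using D' f by (simp add: finite_structures_def)
    from nth_rank(2)[OF finite_sdom[OF D' fun_sorts(2)[OF f]] this] show ?thesis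
      using cards[OF fun_sorts(2)[OF f]] by simp
  qed
  have "struct_nats sg ?D' = struct_nats sg D"
  proof (rule struct_nats_transfer)
    fix f ds assume f: "f \<in> set (funs sg)" and ds: "ds \<in> tuples D (fun_args sg f)"
    show "rank ?D' (fun_res sg f) (fun_int ?D' f (transfer_tuple D ?D' (fun_args sg f) ds)) =
      rank D (fun_res sg f) (fun_int D f ds)"
      unfolding fD using rank_nth[OF fin(1)[OF fun_sorts(2)[OF f]] r[OF f ds]] by simp
  qed (simp add: pD)
  moreover have "fun_int D f ds \<in> sdom D (fun_res sg f)"
    if f: "f \<in> set (funs sg)" and ds: "ds \<in> tuples D (fun_args sg f)" for f ds
  proof -
    note fin_res = fin(1)[OF fun_sorts(2)[OF f]]
    have "fun_int D f ds \<in> set (elems D (fun_res sg f))"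
      unfolding fD using r[OF f ds] elems(3)[OF fin_res] by (intro nth_mem) simp
    then show ?thesis using elems(1)[OF fin_res] by simp
  qed
  then have "D \<in> finite_structures sg" using fin(1) by (simp add: finite_structures_def)
  ultimately show ?thesis by (auto simp: struct_code_def)
qed

lemma ex_set_card: "(\<exists>S :: 'e set. finite S \<and> card S = n) \<longleftrightarrow> (finite (UNIV :: 'e set) \<longrightarrow> n \<le> card (UNIV :: 'e set))"
proof (cases "finite (UNIV :: 'e set)")
  case True
  then show ?thesis using obtain_subset_with_card_n[of n "UNIV :: 'e set"] card_mono[of "UNIV :: 'e set"] by auto
next
  case False
  then show ?thesis using infinite_arbitrarily_large[OF False, of n] by auto
qed

text \<open>Over a finite type of elements there are no structures with larger domains, although
  words may describe them. The bound is a constant, so it can be tested.\<close>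

definition struct_word :: "'e::linorder itself \<Rightarrow> bool list \<Rightarrow> bool" where
  "struct_word _ w \<longleftrightarrow> decode w \<in> finite_structures sg \<and>
     (\<forall>s\<in>set (sorts sg). finite (UNIV :: 'e set) \<longrightarrow> card (sdom (decode w) s) \<le> card (UNIV :: 'e set))"

lemma PB_struct_word: "PB UNIV [\<lambda>w. w] (struct_word TYPE('e::linorder))"
proof -
  have "PB UNIV [\<lambda>w. w] (\<lambda>w. finite (UNIV :: 'e set) \<longrightarrow> card (sdom (decode w) s) \<le> card (UNIV :: 'e set))"
    if "s \<in> set (sorts sg)" for s
    using PB_le[OF dec.PN_card[OF that] PN_const, of "card (UNIV :: 'e set)"]
    by (cases "finite (UNIV :: 'e set)") (simp_all add: PB_const)
  from PB_conj[OF PB_decode_closed PB_ball[OF finite_set this]] show ?thesis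
    unfolding struct_word_def .
qed

text \<open>
  The structure used to evaluate \<open>R\<close> is only determined up to isomorphism, but \<open>R\<close> is computed
  from its code and hence does not depend on the choice.
\<close>

lemma PTIME_if_structure:
  fixes R :: "bool list \<Rightarrow> ('s, 'f, 'p, 'e::linorder) struct \<Rightarrow> bool"
  assumes g: "PT UNIV [\<lambda>v. v] g"
    and R: "PB {(v, D). D \<in> finite_structures sg} [\<lambda>(v, D). v, \<lambda>(v, D). struct_code sg D] (\<lambda>(v, D). R v D)"
    and gR: "\<And>v D. D \<in> finite_structures sg \<Longrightarrow> R v D \<Longrightarrow> \<exists>ns. g v = unary_code (struct_nats sg D @ ns)"
  shows "{v. \<exists>D\<in>finite_structures sg. R v D} \<in> PTIME"
proof (rule PTIME_if_PT, fold PB_def)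
  let ?ok = "\<lambda>v. struct_word TYPE('e) (g v)"
  define ch where "ch v = (SOME D :: ('s, 'f, 'p, 'e) struct. D \<in> finite_structures sg \<and>
    struct_code sg D = struct_code sg (decode (g v)))" for v
  have ch: "ch v \<in> finite_structures sg" "struct_code sg (ch v) = struct_code sg (decode (g v))" if "?ok v" for v
  proof -
    have "\<exists>D :: ('s, 'f, 'p, 'e) struct. D \<in> finite_structures sg \<and> struct_code sg D = struct_code sg (decode (g v))"
      by (rule realize_decode) (use that ex_set_card in \<open>auto simp: struct_word_def\<close>)
    from someI_ex[OF this] show "ch v \<in> finite_structures sg" "struct_code sg (ch v) = struct_code sg (decode (g v))"
      unfolding ch_def by auto
  qed
  have ok: "PB UNIV [\<lambda>v. v] ?ok"
    by (rule PB_comp[OF PB_struct_word]) (use g in auto)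
  have "PB {v \<in> UNIV. ?ok v} [\<lambda>v. v] (\<lambda>v. (\<lambda>(v, D). R v D) (v, ch v))"
  proof (rule PB_comp[OF R])
    fix h assume "h \<in> set [\<lambda>(v, D :: ('s, 'f, 'p, 'e) struct). v, \<lambda>(v, D). struct_code sg D]"
    then consider "h = (\<lambda>(v, D). v)" | "h = (\<lambda>(v, D). struct_code sg D)" by auto
    then show "PT {v \<in> UNIV. ?ok v} [\<lambda>v. v] (\<lambda>v. h (v, ch v))"
    proof cases
      case 1
      then show ?thesis using PT_proj[of "\<lambda>v. v" "[\<lambda>v. v]"] by simp
    next
      case 2
      have "PT UNIV [\<lambda>v. v] (\<lambda>v. struct_code sg (decode (g v)))"
        by (rule PT_comp[OF PT_struct_code_decode]) (use g in auto)
      then have "PT {v \<in> UNIV. ?ok v} [\<lambda>v. v] (\<lambda>v. struct_code sg (decode (g v)))" by (rule PT_mono) simp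
      then show ?thesis by (rule PT_cong) (simp add: 2 ch)
    qed
  qed (use ch in auto)
  from PB_conj_dep[OF ok this]
  show "PB UNIV [\<lambda>v. v] (\<lambda>v. v \<in> {v. \<exists>D\<in>finite_structures sg. R v D})"
  proof (rule PB_cong)
    fix v
    show "(?ok v \<and> (\<lambda>(v, D). R v D) (v, ch v)) = (v \<in> {v. \<exists>D\<in>finite_structures sg. R v D})"
    proof
      assume "v \<in> {v. \<exists>D\<in>finite_structures sg. R v D}"
      then obtain D where D: "D \<in> finite_structures sg" "R v D" by blast
      then obtain ns where "g v = unary_code (struct_nats sg D @ ns)" using gR by blast
      note dc = decode_struct_code[OF D(1) this]
      have ok: "?ok v"
        unfolding struct_word_def using dc(1,3) card_mono[of "UNIV :: 'e set"] by auto
      \<comment> \<open>The chosen structure may differ from \<open>D\<close>, but both have the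
        same code, and a computed predicate cannot distinguish them.\<close>
      have "[(\<lambda>(v, D). R v D) (v, ch v)] = [(\<lambda>(v, D). R v D) (v, D)]"
        by (rule PT_determines[OF R[unfolded PB_def]]) (use ch[OF ok] D dc(2) in auto)
      then show "?ok v \<and> (\<lambda>(v, D). R v D) (v, ch v)" using ok D by simp
    qed (use ch in auto)
  qed
qed

end

section \<open>The decision problems\<close>

context aggregate_program
begin

text \<open>The queried atom is not parsed: all ground atoms are tried, and their query codes are
  compared with the input. The structure is decoded from the whole word, whose remaining numbers do
  no harm.\<close>

lemma query_PTIME:
  assumes J: "PT (finite_structures sg) [struct_code sg] (\<lambda>D. tab D (J D))"
  shows "{query_code sg Pd D A | D A. D \<in> finite_structures sg \<and> A \<in> bs D \<and> A \<in> J D} \<in> PTIME"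
proof -
  let ?K = "{(v :: bool list, D :: ('s, 'f, 'p, 'e) struct). D \<in> finite_structures sg}"
  let ?G = "[\<lambda>(v, D). v, \<lambda>(v, D). struct_code sg D]"
  let ?R = "\<lambda>v D. \<exists>A\<in>bs D. v = query_code sg Pd D A \<and> A \<in> J D"
  have v: "PT ?K ?G fst" by (rule PT_proj) (simp add: case_prod_beta')
  have code: "PT ?K ?G (\<lambda>z. struct_code sg (snd z))" by (rule PT_proj) (simp add: case_prod_beta')
  interpret q: program_context sg Pd P X ?K snd ?G
    by unfold_locales (use code in auto)
  have J': "PT ?K ?G (\<lambda>z. tab (snd z) (J (snd z)))"
    by (rule PT_comp[OF J]) (use code in auto)
  have "PB ?K ?G (\<lambda>z. \<exists>ds\<in>tuples (snd z) (pred_args sg p). fst z = query_code sg Pd (snd z) (p, ds) \<and> (p, ds) \<in> J (snd z))"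
    if p: "p \<in> set Pd" for p
  proof (rule q.PB_tuples_ex[OF var_list Pd_sorts[OF p]])
    let ?zs = "var_list (pred_args sg p)"
    let ?ns = "(\<lambda>z. pos Pd p) # map (\<lambda>v z. rank (snd (fst z)) (snd v) (snd z v)) ?zs"
    have "PT (q.cX ?zs) (q.cG ?zs) (\<lambda>z. unary_code (map (\<lambda>n. n z) ?ns))"
      by (rule PT_unary_code) (auto intro: PN_const q.ctx_var)
    from PB_eq_words[OF q.ctx_base[OF v] PT_append[OF q.ctx_base[OF code] this]]
    have "PB (q.cX ?zs) (q.cG ?zs) (\<lambda>z. fst (fst z) = query_code sg Pd (snd (fst z)) (p, map (snd z) ?zs))"
    proof (rule PB_cong)
      fix z :: "(bool list \<times> ('s, 'f, 'p, 'e) struct) \<times> ('s var \<Rightarrow> 'e)"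
      have "map2 (rank (snd (fst z))) (map snd xs) (map (snd z) xs) =
        map (\<lambda>v. rank (snd (fst z)) (snd v) (snd z v)) xs" for xs
        by (induction xs) auto
      from this[of ?zs] have "map2 (rank (snd (fst z))) (pred_args sg p) (map (snd z) ?zs) =
        map (\<lambda>v. rank (snd (fst z)) (snd v) (snd z v)) ?zs" unfolding var_list(2) .
      then show "(fst (fst z) = struct_code sg (snd (fst z)) @ unary_code (map (\<lambda>n. n z) ?ns)) =
        (fst (fst z) = query_code sg Pd (snd (fst z)) (p, map (snd z) ?zs))"
        by (simp add: query_code_def gatom_nats_def struct_code_def unary_code_simps(3) pos_def comp_def)
    qed
    moreover have "PB (q.cX ?zs) (q.cG ?zs) (\<lambda>z. (p, map (eval_trm (snd (fst z)) (snd z)) (map Var ?zs)) \<in> J (snd (fst z)))"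
    proof (rule q.ctx_defined_atom[OF p _ _ _ J'])
      have "snd v \<in> set (pred_args sg p)" if "v \<in> set ?zs" for v
        using that var_list(2)[of "pred_args sg p"] by (metis image_eqI set_map)
      then show "\<forall>t\<in>set (map Var ?zs). wf_trm sg t" using Pd_sorts[OF p] by auto
      show "map (sort_of sg) (map Var ?zs) = pred_args sg p" using var_list(2) by (simp add: comp_def)
    qed auto
    then have "PB (q.cX ?zs) (q.cG ?zs) (\<lambda>z. (p, map (snd z) ?zs) \<in> J (snd (fst z)))" by (simp add: comp_def)
    ultimately show "PB (q.cX ?zs) (q.cG ?zs) (\<lambda>z. fst (fst z) = query_code sg Pd (snd (fst z)) (p, map (snd z) ?zs) \<and>
        (p, map (snd z) ?zs) \<in> J (snd (fst z)))"
      by (rule PB_conj)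
  qed
  from PB_bex[OF finite_set this] have "PB ?K ?G (\<lambda>(v, D). ?R v D)"
    by (rule PB_cong) (auto simp: base_def, blast+)
  from PTIME_if_structure[OF PT_word this]
  have "{v. \<exists>D\<in>finite_structures sg. ?R v D} \<in> PTIME" by (auto simp: query_code_def)
  moreover have "{v. \<exists>D\<in>finite_structures sg. ?R v D} =
      {query_code sg Pd D A | D A. D \<in> finite_structures sg \<and> A \<in> bs D \<and> A \<in> J D}" by auto
  ultimately show ?thesis by simp
qed

end

section \<open>Pairing of words and the verification of certificates\<close>

definition unpair :: "bool list \<Rightarrow> bool list" where
  "unpair v = concat (map (\<lambda>i. if \<forall>j<Suc i. 2 * j < length v \<and> v ! (2 * j)
     then [2 * i + 1 < length v \<and> v ! (2 * i + 1)] else []) [0..<length v])"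

lemma PT_unpair: "PT UNIV [\<lambda>v. v] unpair"
proof -
  let ?Y = "below (UNIV :: bool list set) length" and ?H = "add_index [\<lambda>v. v]"
  have v: "PT UNIV [\<lambda>v. v] (\<lambda>v. v)" by (rule PT_proj) simp
  have vi: "PT ?Y ?H fst" using PT_index[OF v, of length] by (simp add: case_prod_beta')
  have i: "PN ?Y ?H snd" using PN_the_index[of UNIV length "[\<lambda>v. v]"] by (simp add: case_prod_beta')
  let ?N = "\<lambda>z :: bool list \<times> nat. Suc (snd z)"
  have N: "PN ?Y ?H ?N" using PN_add[OF PN_const[of _ _ 1] i] by simp
  let ?Z = "below ?Y ?N" and ?I = "add_index ?H"
  have vj: "PT ?Z ?I (\<lambda>y. fst (fst y))" using PT_index[OF vi, of ?N] by (simp add: case_prod_beta')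
  have j: "PN ?Z ?I snd" using PN_the_index[of ?Y ?N ?H] by (simp add: case_prod_beta')
  have "PB ?Z ?I (\<lambda>y. 2 * snd y < length (fst (fst y)) \<and> fst (fst y) ! (2 * snd y))"
    by (intro PB_nth vj PN_mult PN_const j)
  then have "PB ?Z ?I (\<lambda>(z, j). 2 * j < length (fst z) \<and> fst z ! (2 * j))" by (simp add: case_prod_beta')
  from PB_all[OF N this]
  have "PT ?Y ?H (\<lambda>z. if \<forall>j<Suc (snd z). 2 * j < length (fst z) \<and> fst z ! (2 * j)
     then [2 * snd z + 1 < length (fst z) \<and> fst z ! (2 * snd z + 1)] else [])"
    by (rule PT_if'[OF _ PB_nth[OF vi, unfolded PB_def] PT_Nil]) (intro PN_add PN_mult PN_const i)
  then have "PT ?Y ?H (\<lambda>(v, i). if \<forall>j<Suc i. 2 * j < length v \<and> v ! (2 * j)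
     then [2 * i + 1 < length v \<and> v ! (2 * i + 1)] else [])" by (simp add: case_prod_beta')
  from PT_concat[OF PN_length[OF v] this] show ?thesis
    by (rule PT_cong) (simp add: unpair_def)
qed

lemma pair_code_nth:
  "length (pair_code w u) = 2 * length w + 1 + length u"
  "i < length w \<Longrightarrow> pair_code w u ! (2 * i)" "i < length w \<Longrightarrow> pair_code w u ! (2 * i + 1) = w ! i"
  "\<not> pair_code w u ! (2 * length w)" "drop (2 * length w + 1) (pair_code w u) = u"
proof -
  have C: "pair_code (b # w) u = True # b # pair_code w u" for b w by (simp add: pair_code_def)
  have N: "pair_code [] u = False # u" by (simp add: pair_code_def)
  show "length (pair_code w u) = 2 * length w + 1 + length u" by (induction w) (simp_all add: C N)
  show "i < length w \<Longrightarrow> pair_code w u ! (2 * i)"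
  proof (induction w arbitrary: i)
    case (Cons b w)
    then show ?case by (cases i) (auto simp: C)
  qed simp
  show "i < length w \<Longrightarrow> pair_code w u ! (2 * i + 1) = w ! i"
  proof (induction w arbitrary: i)
    case (Cons b w)
    then show ?case by (cases i) (auto simp: C)
  qed simp
  show "\<not> pair_code w u ! (2 * length w)" by (induction w) (simp_all add: C N)
  show "drop (2 * length w + 1) (pair_code w u) = u" by (induction w) (simp_all add: C N)
qed

text \<open>Position \<open>2 * i\<close> marks whether bit \<open>i\<close> of the first word
  follows. The separator is the first unset mark, and requiring all marks up to \<open>i\<close> to
  be set excludes whatever comes after it.\<close>

lemma unpair_pair_code: "unpair (pair_code w u) = w"
proof -
  let ?v = "pair_code w u" and ?n = "length w"
  let ?f = "\<lambda>i. if \<forall>j<Suc i. 2 * j < length ?v \<and> ?v ! (2 * j)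
     then [2 * i + 1 < length ?v \<and> ?v ! (2 * i + 1)] else []"
  have lt: "?f i = [w ! i]" if "i < ?n" for i
    using that pair_code_nth(1)[of w u] pair_code_nth(2,3)[of _ w u] by auto
  have ge: "?f i = []" if "i \<ge> ?n" for i
    using that pair_code_nth(4)[of w u] by (auto intro!: exI[of _ ?n])
  have "[0..<length ?v] = [0..<?n] @ [?n..<length ?v]"
    using pair_code_nth(1)[of w u] upt_add_eq_append[of 0 ?n "length ?v - ?n"] by (simp add: mult_2 add.assoc)
  then have "unpair ?v = concat (map ?f [0..<?n]) @ concat (map ?f [?n..<length ?v])"
    unfolding unpair_def by (simp only: map_append concat_append)
  also have "map ?f [0..<?n] = map (\<lambda>i. [w ! i]) [0..<?n]" by (rule map_cong) (use lt in auto)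
  also have "map ?f [?n..<length ?v] = map (\<lambda>i. []) [?n..<length ?v]" by (rule map_cong) (use ge in auto)
  also have "concat (map (\<lambda>i. [w ! i]) [0..<?n]) = w"
    using concat_map_singleton[of "\<lambda>i. w ! i" "[0..<?n]"] by (simp add: map_nth)
  also have "concat (map (\<lambda>i. []) [?n..<length ?v]) = []" by simp
  finally show ?thesis by simp
qed

lemma PT_pair_code:
  assumes f: "PT X G f" and g: "PT X G g"
  shows "PT X G (\<lambda>x. pair_code (f x) (g x))"
proof -
  let ?N = "\<lambda>x. length (f x)"
  let ?Y = "below X ?N" and ?H = "add_index G"
  have fi: "PT ?Y ?H (\<lambda>z. f (fst z))" using PT_index[OF f, of ?N] by (simp add: case_prod_beta')
  have i: "PN ?Y ?H snd" using PN_the_index[of X ?N G] by (simp add: case_prod_beta')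
  have "PT ?Y ?H (\<lambda>z. [True] @ [snd z < length (f (fst z)) \<and> f (fst z) ! snd z])"
    by (intro PT_append PT_single PB_nth[OF fi i, unfolded PB_def])
  then have "PT ?Y ?H (\<lambda>(x, i). [True, i < length (f x) \<and> f x ! i])" by (simp add: case_prod_beta')
  from PT_append[OF PT_concat[OF PN_length[OF f] this] PT_append[OF PT_single[of _ _ False] g]]
  show ?thesis
  proof (rule PT_cong)
    fix x
    have "map (\<lambda>i. [True, i < length w \<and> w ! i]) [0..<length w] = map (\<lambda>b. [True, b]) w" for w
      by (rule nth_equalityI) simp_all
    then show "concat (map (\<lambda>i. [True, i < length (f x) \<and> f x ! i]) [0..<?N x]) @ [False] @ g x =
      pair_code (f x) (g x)" by (simp add: pair_code_def)
  qed
qed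

context aggregate_program
begin

definition stable_pairs :: "bool list set" where
  "stable_pairs = {pair_code (struct_code sg D) (tab D I) | D I.
     D \<in> finite_structures sg \<and> exact_stable (bs D) (\<Phi> D) I}"

text \<open>The check that the word is a pair whose second part has the length of a table comes
  before the fixpoint test, which is promised a table. The interpretation is then recovered from its
  table, and uniquely so.\<close>

lemma stable_pairs_PTIME: "stable_pairs \<in> PTIME"
proof -
  let ?K = "{(v :: bool list, D :: ('s, 'f, 'p, 'e) struct). D \<in> finite_structures sg}"
  let ?G = "[\<lambda>(v, D). v, \<lambda>(v, D). struct_code sg D]"
  let ?R = "\<lambda>v D. \<exists>I. v = pair_code (struct_code sg D) (tab D I) \<and> exact_stable (bs D) (\<Phi> D) I"
  have v: "PT ?K ?G fst" by (rule PT_proj) (simp add: case_prod_beta')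
  have code: "PT ?K ?G (\<lambda>z. struct_code sg (snd z))" by (rule PT_proj) (simp add: case_prod_beta')
  have dm: "snd z \<in> finite_structures sg" if "z \<in> ?K" for z using that by auto
  \<comment> \<open>The certificate begins after two symbols per bit of the structure code and one
    separator.\<close>
  let ?u = "\<lambda>z :: bool list \<times> ('s, 'f, 'p, 'e) struct. drop (2 * length (struct_code sg (snd z)) + 1) (fst z)"
  let ?c = "\<lambda>z. length (?u z) = card (bs (snd z)) \<and> fst z = pair_code (struct_code sg (snd z)) (?u z)"
  have u: "PT ?K ?G ?u"
    by (intro PT_drop v PN_add PN_mult PN_const PN_length code)
  have c: "PB ?K ?G ?c"
    by (intro PB_conj PB_eq PB_eq_words PN_length u v PT_pair_code code PN_card_base[OF dm code])
  define I where "I z = (SOME J. J \<subseteq> bs (snd z) \<and> tab (snd z) J = ?u z)" for z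
  have I: "I z \<subseteq> bs (snd z)" "tab (snd z) (I z) = ?u z" if "z \<in> ?K" "?c z" for z
  proof -
    have "\<exists>J\<subseteq>bs (snd z). tab (snd z) J = ?u z" by (rule tab_surj[OF dm[OF that(1)]]) (use that(2) in blast)
    from someI_ex[OF this] show "I z \<subseteq> bs (snd z)" "tab (snd z) (I z) = ?u z" unfolding I_def by auto
  qed
  have "PB {z \<in> ?K. ?c z} ?G (\<lambda>z. (\<lambda>(D, I). exact_stable (bs D) (\<Phi> D) I) (snd z, I z))"
  proof (rule PB_comp[OF PB_exact_stable])
    fix h :: "('s, 'f, 'p, 'e) struct \<times> ('p, 'e) gatom set \<Rightarrow> bool list"
    assume "h \<in> set [\<lambda>(D, I). struct_code sg D, \<lambda>(D, I). tab D I]"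
    then consider "h = (\<lambda>(D, I). struct_code sg D)" | "h = (\<lambda>(D, I). tab D I)" by auto
    then show "PT {z \<in> ?K. ?c z} ?G (\<lambda>z. h (snd z, I z))"
    proof cases
      case 1
      show ?thesis unfolding 1 prod.case by (rule PT_mono[OF code]) blast
    next
      case 2
      show ?thesis unfolding 2 prod.case by (rule PT_mono_cong[OF u]) (use I(2) in auto)
    qed
  qed (use I(1) in auto)
  from PB_conj_dep[OF c this] have R: "PB ?K ?G (\<lambda>(v, D). ?R v D)"
  proof (rule PB_cong)
    fix z assume z: "z \<in> ?K"
    obtain v D where vD: "z = (v, D)" "D \<in> finite_structures sg" using z by auto
    show "(?c z \<and> (\<lambda>(D, I). exact_stable (bs D) (\<Phi> D) I) (snd z, I z)) = (\<lambda>(v, D). ?R v D) z"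
    proof
      assume *: "?c z \<and> (\<lambda>(D, I). exact_stable (bs D) (\<Phi> D) I) (snd z, I z)"
      then show "(\<lambda>(v, D). ?R v D) z" using I(2)[OF z] vD(1) by (auto intro!: exI[of _ "I z"])
    next
      assume "(\<lambda>(v, D). ?R v D) z"
      then obtain J where J: "v = pair_code (struct_code sg D) (tab D J)" "exact_stable (bs D) (\<Phi> D) J"
        using vD(1) by auto
      have u: "?u z = tab D J" using J(1) pair_code_nth(5) vD(1) by simp
      then have c: "?c z" using length_tab[OF vD(2)] J(1) vD(1) by simp
      have "J \<subseteq> bs D" using J(2) by (simp add: exact_stable_def)
      then have "I z = J" using I[OF z c] u vD tab_inj[OF vD(2)] by simp
      then show "?c z \<and> (\<lambda>(D, I). exact_stable (bs D) (\<Phi> D) I) (snd z, I z)" using c J vD by simp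
    qed
  qed
  have "{v. \<exists>D\<in>finite_structures sg. ?R v D} \<in> PTIME"
  proof (rule PTIME_if_structure[OF PT_unpair R])
    fix v and D :: "('s, 'f, 'p, 'e) struct"
    assume "?R v D"
    then have "unpair v = struct_code sg D" using unpair_pair_code by auto
    then show "\<exists>ns. unpair v = unary_code (struct_nats sg D @ ns)"
      by (intro exI[of _ "[]"]) (simp add: struct_code_def)
  qed
  moreover have "{v. \<exists>D\<in>finite_structures sg. ?R v D} = stable_pairs" by (auto simp: stable_pairs_def)
  ultimately show ?thesis by simp
qed

text \<open>A certificate has one bit per ground atom. The number of ground atoms is computable in
  unary from the code, hence polynomial in its length.\<close>

lemma exact_stable_NPTIME:
  "{struct_code sg D | D. D \<in> finite_structures sg \<and> (\<exists>I. exact_stable (bs D) (\<Phi> D) I)} \<in> NPTIME"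
proof -
  have "PN (finite_structures sg) [struct_code sg] (\<lambda>D. card (bs D))"
    by (rule PN_card_base[OF _ PT_code])
  then obtain p where p: "\<And>D. D \<in> finite_structures sg \<Longrightarrow> card (bs D) \<le> Polynomial.poly p (length (struct_code sg D))"
    using PT_length[of "finite_structures sg" "[struct_code sg]"] unfolding PN_def pbd_def
    by (fastforce simp: sz_def)
  have "w \<in> {struct_code sg D | D. D \<in> finite_structures sg \<and> (\<exists>I. exact_stable (bs D) (\<Phi> D) I)} \<longleftrightarrow>
      (\<exists>u. length u \<le> Polynomial.poly p (length w) \<and> pair_code w u \<in> stable_pairs)" for w
  proof
    assume "w \<in> {struct_code sg D | D. D \<in> finite_structures sg \<and> (\<exists>I. exact_stable (bs D) (\<Phi> D) I)}"
    then obtain D I where "w = struct_code sg D" "D \<in> finite_structures sg" "exact_stable (bs D) (\<Phi> D) I" by blast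
    then show "\<exists>u. length u \<le> Polynomial.poly p (length w) \<and> pair_code w u \<in> stable_pairs"
      using p[of D] length_tab[of D I] by (intro exI[of _ "tab D I"]) (auto simp: stable_pairs_def)
  next
    assume "\<exists>u. length u \<le> Polynomial.poly p (length w) \<and> pair_code w u \<in> stable_pairs"
    then obtain u D I where e: "pair_code w u = pair_code (struct_code sg D) (tab D I)" and
      D: "D \<in> finite_structures sg" "exact_stable (bs D) (\<Phi> D) I" unfolding stable_pairs_def by blast
    from arg_cong[OF e, of unpair] have "w = struct_code sg D" by (simp add: unpair_pair_code)
    with D show "w \<in> {struct_code sg D | D. D \<in> finite_structures sg \<and> (\<exists>I. exact_stable (bs D) (\<Phi> D) I)}" by blast
  qed
  then show ?thesis unfolding NPTIME_def using stable_pairs_PTIME by blast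
qed

end

theorem theorem8:
  fixes sg :: "('s, 'f, 'p, 'r) signature"
    and Pd :: "'p list"
    and P :: "('s, 'f, 'p, 'r) rl set"
    and X :: "('s, 'f, 'p, 'e::linorder) struct \<Rightarrow> ('s, 'f, 'p, 'e, 'r) struct3"
  assumes "wf_signature sg"
    and "wf_defined sg Pd"
    and "finite P" and "\<forall>\<rho> \<in> P. wf_rule sg Pd \<rho>"
    and "\<forall>D \<in> finite_structures sg. tv_extension sg D (X D)"
    and "\<forall>r \<in> set (aggs sg). agg_polytime sg X fst r \<and> agg_polytime sg X snd r"
  shows
    "{query_code sg Pd D A | D A. D \<in> finite_structures sg \<and> A \<in> base sg Pd D \<and>
        A \<in> fst (kripke_kleene (base sg Pd D) (consequence_op sg Pd P (X D)))} \<in> PTIME \<and>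
     {query_code sg Pd D A | D A. D \<in> finite_structures sg \<and> A \<in> base sg Pd D \<and>
        A \<in> fst (well_founded (base sg Pd D) (consequence_op sg Pd P (X D)))} \<in> PTIME \<and>
     {struct_code sg D | D. D \<in> finite_structures sg \<and>
        (\<exists>I. exact_stable (base sg Pd D) (consequence_op sg Pd P (X D)) I)} \<in> NPTIME"
proof -
  interpret aggregate_program sg Pd P X
    by unfold_locales (use assms in auto)
  show ?thesis
    using query_PTIME[OF PT_kripke_kleene] query_PTIME[OF PT_well_founded] exact_stable_NPTIME by blast
qed

end
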